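(* Let $G$ be a finite subgroup of a group $X$. Equip $A=\mathbb{C}X$ and $B=\mathbb{C}G$ with the calculi determined by a right representation $V$ of $X$ and a cocycle $\omega:X\to V$ as described in the context (with $V=W\oplus W^\perp$, $W=\mathrm{span}\{\omega(g):g\in G\}$, and projections $\pi:V\to W$, $\pi^\perp:V\to W^\perp$). Let $E=\mathbb{C}X$ be the $B$-$A$ bimodule with actions given by multiplication. Then the right bimodule connection $(E,\nabla_E,\sigma_E)$ given by $\nabla_E(x)=1\otimes\mathrm{d}x$ and $\sigma_E(\mathrm{d}g\otimes x)=1\otimes\mathrm{d}g.x$ gives a differential fibre bundle. The fibre calculi are $N_q\cong(W^\perp)^{\wedge q}.\mathbb{C}X$, on which the differential $\mathrm{d}:N_q\to N_{q+1}$ is given by $$\mathrm{d}(\xi.x)=(-1)^{|\xi|}\,\xi\wedge\pi^\perp(\omega(x)\triangleleft x^{-1}).x$$ for $\xi\in(W^\perp)^{\wedge q}$ and $x\in X$. The differential $\nabla_q:H^q(N)\to\Omega^1_{\mathbb{C}G}\otimes_{\mathbb{C}G}H^q(N)$ is given by $$\nabla_q([\xi.x])=\pi(\omega(x)\triangleleft x^{-1})\otimes[\xi.x].$$ The fibre bundle $E$ gives rise to a spectral sequence converging to $H(\mathbb{C}X,E,\nabla_E)\cong H_{\mathrm{dR}}(\mathbb{C}X)$ with second page position $(p,q)$ given by $H^p(\mathbb{C}G,H^q(N),\nabla_q)$.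
   Context: Calculi. A differential calculus on an algebra $A$ is a graded algebra $\Omega_A=\bigoplus_{n\ge0}\Omega^n_A$ with product $\wedge$, $\Omega^0_A=A$, and linear $\mathrm{d}:\Omega^n_A\to\Omega^{n+1}_A$ with $\mathrm{d}^2=0$, $\mathrm{d}(\xi\wedge\eta)=\mathrm{d}\xi\wedge\eta+(-1)^{|\xi|}\xi\wedge\mathrm{d}\eta$, $\Omega^1_A=\mathrm{span}\{a'\mathrm{d}a\}$, generated in degrees $0,1$. $H_{\mathrm{dR}}(A)$ is the cohomology of $(\Omega_A,\mathrm{d})$. Group algebra calculi. Given a right $\mathbb{C}X$-module $V$ with action $\triangleleft$ and a map $\omega:X\to V$ with $\omega(xy)=\omega(x)\triangleleft y+\omega(y)$ and $V=\mathrm{span}\,\omega(X)$, one has the calculus $\Omega^1_{\mathbb{C}X}=\mathbb{C}X.V$ (free left module on $V$), with right action $v.x=x.(v\triangleleft x)$ and $\mathrm{d}x=x\,\omega(x)$. Higher forms: maximal prolongation together with $\mathrm{d}V=0$, so that $\Omega^n_{\mathbb{C}X}=\mathbb{C}X.V^{\wedge n}=V^{\wedge n}.\mathbb{C}X$ with $V^{\wedge n}$ the exterior power. $W=\mathrm{span}\{\omega(g):g\in G\}$ is a right $G$-representation with complement $W^\perp$ (orthogonal for a $G$-invariant inner product on $V$), also a $G$-representation; $\pi,\pi^\perp$ are the projections for $V=W\oplus W^\perp$. On $\mathbb{C}G$ take the calculus given by $W$ and $\omega|_G$, with $\Omega^n_{\mathbb{C}G}=\mathbb{C}G.W^{\wedge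 n}$, $\mathrm{d}W=0$. Bimodule connections. A right bimodule connection on a $B$-$A$ bimodule $E$ is a linear $\nabla_E:E\to E\otimes_A\Omega^1_A$ with $\nabla_E(ea)=\nabla_E(e)a+e\otimes\mathrm{d}a$ and a bimodule map $\sigma_E:\Omega^1_B\otimes_BE\to E\otimes_A\Omega^1_A$ with $\nabla_E(be)=\sigma_E(\mathrm{d}b\otimes e)+b\nabla_E(e)$. It is extendable if $\sigma_E$ extends to $\Omega^n_B\otimes_BE\to E\otimes_A\Omega^n_A$ for all $n$ (with $\sigma_E(b\otimes e)=be\otimes1$) by $\sigma_E(\xi\wedge\eta\otimes e)=(\sigma_E\wedge\mathrm{id})(\xi\otimes\sigma_E(\eta\otimes e))$, where $(\sigma_E\wedge\mathrm{id})(\xi\otimes e\otimes\eta)=\sigma_E(\xi\otimes e)\wedge\eta$. Put $\nabla_E^{[n]}(e\otimes\eta)=e\otimes\mathrm{d}\eta+\nabla_E(e)\wedge\eta$; the curvature is $\nabla_E^{[1]}\nabla_E$. In the zero-curvature case $H^n(A,E,\nabla_E)$ is the cohomology of $C^n=E\otimes_A\Omega^n_A$ with differential $\nabla_E^{[n]}$. Fibre bundles. $F^mC^n=\mathrm{image}(\sigma_E\wedge\mathrm{id}:\Omega^m_B\otimes_BE\otimes_A\Omega^{n-m}_A\to C^n)$ ($0$ for $m>n$), $M_{p,q}=F^pC^{p+q}/F^{p+1}C^{p+q}$, $N_q=M_{0,q}$, with $\mathrm{d}:N_q\to N_{q+1}$ induced by $\nabla_E^{[q]}$, and $H^q(N)$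 the cohomology. $g:\Omega^p_B\otimes_BN_q\to M_{p,q}$ is $g(\xi\otimes[e\otimes\eta])=[\sigma_E(\xi\otimes e)\wedge\eta]$. $E$ is a differential fibre bundle if the connection is extendable with zero curvature, $\Omega^p_B$ is flat as a right $B$-module for all $p\ge1$, and $g$ is an isomorphism for all $p,q\ge0$. Then the left connection $\nabla_q:H^q(N)\to\Omega^1_B\otimes_BH^q(N)$ is $\nabla_q([[e\otimes\xi]])=\eta\otimes[[f\otimes\kappa]]$ where $\nabla_E^{[q]}(e\otimes\xi)=\sigma_E(\eta\otimes f)\wedge\kappa$ (summation implicit; precisely, $\nabla_q([[e\otimes\xi]])$ corresponds to the class of $\nabla_E^{[q]}(e\otimes\xi)$ in the cohomology at $M_{1,q}$ under the isomorphism $\Omega^1_B\otimes_BH^q(N)\cong H^{1+q}(M_{1,q})$ induced by $g$), and $H^p(B,H^q(N),\nabla_q)$ is the cohomology of $\Omega^p_B\otimes_BH^q(N)$ with differential $\omega\otimes x\mapsto\mathrm{d}\omega\otimes x+(-1)^p\omega\wedge\nabla_q(x)$. The spectral sequence is that of the filtration $F^mC$; converging means that entries stabilise with $H^k(A,E,\nabla_E)\cong\bigoplus_{p+q=k}E^{p,q}_\infty$. *)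

theory Defs
  imports Complex_Main "HOL-Algebra.Module" "HOL-Algebra.AbelCoset" "HOL-Library.Poly_Mapping"
begin

section \<open>Complex vector spaces, quotients, tensor products\<close>

definition complex_ring :: "complex ring" where
  "complex_ring = \<lparr>carrier = UNIV, mult = (*), one = 1, zero = 0, add = (+)\<rparr>"

abbreviation cvs :: "(complex, 'v, 'z) module_scheme \<Rightarrow> bool" where
  "cvs V \<equiv> Module.module complex_ring V"

abbreviation csubspace :: "'v set \<Rightarrow> (complex, 'v, 'z) module_scheme \<Rightarrow> bool" where
  "csubspace S V \<equiv> submodule S complex_ring V"

definition cspan :: "(complex, 'v, 'z) module_scheme \<Rightarrow> 'v set \<Rightarrow> 'v set" where
  "cspan V S = \<Inter>{H. csubspace H V \<and> S \<subseteq> H}"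

definition linear_maps ::
  "(complex, 'v, 'y) module_scheme \<Rightarrow> (complex, 'w, 'z) module_scheme \<Rightarrow> ('v \<Rightarrow> 'w) set" where
  "linear_maps V W = {f. f \<in> carrier V \<rightarrow> carrier W \<and>
     (\<forall>u\<in>carrier V. \<forall>v\<in>carrier V. f (u \<oplus>\<^bsub>V\<^esub> v) = f u \<oplus>\<^bsub>W\<^esub> f v) \<and>
     (\<forall>c. \<forall>v\<in>carrier V. f (c \<odot>\<^bsub>V\<^esub> v) = c \<odot>\<^bsub>W\<^esub> f v)}"

definition linear_iso ::
  "(complex, 'v, 'y) module_scheme \<Rightarrow> (complex, 'w, 'z) module_scheme \<Rightarrow> ('v \<Rightarrow> 'w) \<Rightarrow> bool" where
  "linear_iso V W f \<longleftrightarrow> f \<in> linear_maps V W \<and> bij_betw f (carrier V) (carrier W)"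

definition isomorphic ::
  "(complex, 'v, 'y) module_scheme \<Rightarrow> (complex, 'w, 'z) module_scheme \<Rightarrow> bool" where
  "isomorphic V W \<longleftrightarrow> (\<exists>f. linear_iso V W f)"

definition calgebra :: "(complex, 'a, 'z) module_scheme \<Rightarrow> bool" where
  "calgebra A \<longleftrightarrow> cvs A \<and> ring A \<and>
     (\<forall>c. \<forall>x\<in>carrier A. \<forall>y\<in>carrier A.
        (c \<odot>\<^bsub>A\<^esub> x) \<otimes>\<^bsub>A\<^esub> y = c \<odot>\<^bsub>A\<^esub> (x \<otimes>\<^bsub>A\<^esub> y) \<and> x \<otimes>\<^bsub>A\<^esub> (c \<odot>\<^bsub>A\<^esub> y) = c \<odot>\<^bsub>A\<^esub> (x \<otimes>\<^bsub>A\<^esub> y))"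

text \<open>The value of a map on a coset on which it is constant.\<close>

definition on_coset :: "('v \<Rightarrow> 'w) \<Rightarrow> 'v set \<Rightarrow> 'w" where
  "on_coset f U = the_elem (f ` U)"

text \<open>Quotients of vector spaces by a subspace, with cosets as elements.  The ring operations
  of the record are irrelevant for vector spaces.\<close>

definition quot :: "(complex, 'v, 'z) module_scheme \<Rightarrow> 'v set \<Rightarrow> (complex, 'v set) module" where
  "quot V S = \<lparr>carrier = a_rcosets\<^bsub>V\<^esub> S, mult = undefined, one = undefined,
     zero = S, add = (\<lambda>P Q. P <+>\<^bsub>V\<^esub> Q),
     smult = (\<lambda>c. on_coset (\<lambda>v. S +>\<^bsub>V\<^esub> (c \<odot>\<^bsub>V\<^esub> v)))\<rparr>"

definition free_cvs :: "'s set \<Rightarrow> (complex, 's \<Rightarrow>\<^sub>0 complex) module" where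
  "free_cvs S = \<lparr>carrier = {f. Poly_Mapping.keys f \<subseteq> S}, mult = undefined, one = undefined,
     zero = 0, add = (+), smult = (\<lambda>c. Poly_Mapping.map ((*) c))\<rparr>"

abbreviation gen :: "'s \<Rightarrow> 's \<Rightarrow>\<^sub>0 complex" where
  "gen s \<equiv> Poly_Mapping.single s 1"

definition lin_ext :: "(complex, 'w, 'z) module_scheme \<Rightarrow> ('s \<Rightarrow> 'w) \<Rightarrow> ('s \<Rightarrow>\<^sub>0 complex) \<Rightarrow> 'w" where
  "lin_ext W h f = (\<Oplus>\<^bsub>W\<^esub> s \<in> Poly_Mapping.keys f. Poly_Mapping.lookup f s \<odot>\<^bsub>W\<^esub> h s)"

text \<open>Modules over complex algebras.  A right module is a \<open>bimod\<close> record whose left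
  action is ignored.\<close>

record ('b, 'm) lmod = "(complex, 'm) module" +
  lact :: "'b \<Rightarrow> 'm \<Rightarrow> 'm"

record ('b, 'a, 'm) bimod = "('b, 'm) lmod" +
  ract :: "'m \<Rightarrow> 'a \<Rightarrow> 'm"

definition left_module :: "(complex, 'b) module \<Rightarrow> ('b, 'm, 'z) lmod_scheme \<Rightarrow> bool" where
  "left_module B M \<longleftrightarrow> cvs M \<and>
     (\<forall>b\<in>carrier B. lact M b \<in> linear_maps M M) \<and>
     (\<forall>m\<in>carrier M. (\<lambda>b. lact M b m) \<in> linear_maps B M) \<and>
     (\<forall>b\<in>carrier B. \<forall>b'\<in>carrier B. \<forall>m\<in>carrier M. lact M (b \<otimes>\<^bsub>B\<^esub> b') m = lact M b (lact M b' m)) \<and>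
     (\<forall>m\<in>carrier M. lact M \<one>\<^bsub>B\<^esub> m = m)"

definition bimodule ::
  "(complex, 'b) module \<Rightarrow> (complex, 'a) module \<Rightarrow> ('b, 'a, 'm, 'z) bimod_scheme \<Rightarrow> bool" where
  "bimodule B A M \<longleftrightarrow> left_module B M \<and>
     (\<forall>a\<in>carrier A. (\<lambda>m. ract M m a) \<in> linear_maps M M) \<and>
     (\<forall>m\<in>carrier M. ract M m \<in> linear_maps A M) \<and>
     (\<forall>a\<in>carrier A. \<forall>a'\<in>carrier A. \<forall>m\<in>carrier M. ract M m (a \<otimes>\<^bsub>A\<^esub> a') = ract M (ract M m a) a') \<and>
     (\<forall>m\<in>carrier M. ract M m \<one>\<^bsub>A\<^esub> = m) \<and>
     (\<forall>b\<in>carrier B. \<forall>a\<in>carrier A. \<forall>m\<in>carrier M. lact M b (ract M m a) = ract M (lact M b m) a)"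

definition left_module_maps ::
  "(complex, 'b) module \<Rightarrow> ('b, 'm, 'y) lmod_scheme \<Rightarrow> ('b, 'n, 'z) lmod_scheme \<Rightarrow> ('m \<Rightarrow> 'n) set" where
  "left_module_maps B M N =
     {f \<in> linear_maps M N. \<forall>b\<in>carrier B. \<forall>m\<in>carrier M. f (lact M b m) = lact N b (f m)}"

definition bimodule_maps ::
  "(complex, 'b) module \<Rightarrow> (complex, 'a) module \<Rightarrow>
   ('b, 'a, 'm, 'y) bimod_scheme \<Rightarrow> ('b, 'a, 'n, 'z) bimod_scheme \<Rightarrow> ('m \<Rightarrow> 'n) set" where
  "bimodule_maps B A M N =
     {f \<in> left_module_maps B M N. \<forall>a\<in>carrier A. \<forall>m\<in>carrier M. f (ract M m a) = ract N (f m) a}"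

definition bimodule_iso ::
  "(complex, 'b) module \<Rightarrow> (complex, 'a) module \<Rightarrow>
   ('b, 'a, 'm, 'y) bimod_scheme \<Rightarrow> ('b, 'a, 'n, 'z) bimod_scheme \<Rightarrow> ('m \<Rightarrow> 'n) \<Rightarrow> bool" where
  "bimodule_iso B A M N f \<longleftrightarrow> f \<in> bimodule_maps B A M N \<and> bij_betw f (carrier M) (carrier N)"

definition lquot :: "('b, 'm, 'z) lmod_scheme \<Rightarrow> 'm set \<Rightarrow> ('b, 'm set) lmod" where
  "lquot M S = module.extend (quot M S)
     (lmod.fields (\<lambda>b. on_coset (\<lambda>m. S +>\<^bsub>M\<^esub> lact M b m)))"

definition bquot :: "('b, 'a, 'm, 'z) bimod_scheme \<Rightarrow> 'm set \<Rightarrow> ('b, 'a, 'm set) bimod" where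
  "bquot M S = lmod.extend (lquot M S)
     (bimod.fields (\<lambda>U a. on_coset (\<lambda>m. S +>\<^bsub>M\<^esub> ract M m a) U))"

text \<open>The tensor product \<open>E \<otimes>\<^sub>A F\<close>.\<close>

definition tensor_rels ::
  "(complex, 'a) module \<Rightarrow> ('b, 'a, 'e, 'y) bimod_scheme \<Rightarrow> ('a, 'f, 'z) lmod_scheme \<Rightarrow>
   ('e \<times> 'f \<Rightarrow>\<^sub>0 complex) set" where
  "tensor_rels A E F =
     {gen (e \<oplus>\<^bsub>E\<^esub> e', f) - gen (e, f) - gen (e', f) | e e' f.
        e \<in> carrier E \<and> e' \<in> carrier E \<and> f \<in> carrier F} \<union>
     {gen (e, f \<oplus>\<^bsub>F\<^esub> f') - gen (e, f) - gen (e, f') | e f f'.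
        e \<in> carrier E \<and> f \<in> carrier F \<and> f' \<in> carrier F} \<union>
     {gen (c \<odot>\<^bsub>E\<^esub> e, f) - Poly_Mapping.single (e, f) c | c e f. e \<in> carrier E \<and> f \<in> carrier F} \<union>
     {gen (e, c \<odot>\<^bsub>F\<^esub> f) - Poly_Mapping.single (e, f) c | c e f. e \<in> carrier E \<and> f \<in> carrier F} \<union>
     {gen (ract E e a, f) - gen (e, lact F a f) | e a f.
        e \<in> carrier E \<and> a \<in> carrier A \<and> f \<in> carrier F}"

definition tensor_sub ::
  "(complex, 'a) module \<Rightarrow> ('b, 'a, 'e, 'y) bimod_scheme \<Rightarrow> ('a, 'f, 'z) lmod_scheme \<Rightarrow>
   ('e \<times> 'f \<Rightarrow>\<^sub>0 complex) set" where
  "tensor_sub A E F = cspan (free_cvs (carrier E \<times> carrier F)) (tensor_rels A E F)"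

definition tensor ::
  "(complex, 'a) module \<Rightarrow> ('b, 'a, 'e, 'y) bimod_scheme \<Rightarrow> ('a, 'f, 'z) lmod_scheme \<Rightarrow>
   (complex, ('e \<times> 'f \<Rightarrow>\<^sub>0 complex) set) module" where
  "tensor A E F = quot (free_cvs (carrier E \<times> carrier F)) (tensor_sub A E F)"

definition tens ::
  "(complex, 'a) module \<Rightarrow> ('b, 'a, 'e, 'y) bimod_scheme \<Rightarrow> ('a, 'f, 'z) lmod_scheme \<Rightarrow>
   'e \<Rightarrow> 'f \<Rightarrow> ('e \<times> 'f \<Rightarrow>\<^sub>0 complex) set" where
  "tens A E F e f = tensor_sub A E F +>\<^bsub>free_cvs (carrier E \<times> carrier F)\<^esub> gen (e, f)"

text \<open>The linear map on a tensor product induced by a balanced bilinear map \<open>h\<close>.\<close>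

definition tensor_lift ::
  "(complex, 'w, 'z) module_scheme \<Rightarrow> ('e \<Rightarrow> 'f \<Rightarrow> 'w) \<Rightarrow> ('e \<times> 'f \<Rightarrow>\<^sub>0 complex) set \<Rightarrow> 'w" where
  "tensor_lift W h = on_coset (lin_ext W (\<lambda>(e, f). h e f))"

definition btensor ::
  "(complex, 'a) module \<Rightarrow> ('b, 'a, 'e, 'y) bimod_scheme \<Rightarrow> ('a, 'c, 'f, 'z) bimod_scheme \<Rightarrow>
   ('b, 'c, ('e \<times> 'f \<Rightarrow>\<^sub>0 complex) set) bimod" where
  "btensor A E F = lmod.extend
     (module.extend (tensor A E F)
       (lmod.fields (\<lambda>b. tensor_lift (tensor A E F) (\<lambda>e f. tens A E F (lact E b e) f))))
     (bimod.fields (\<lambda>t c. tensor_lift (tensor A E F) (\<lambda>e f. tens A E F e (ract F f c)) t))"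

text \<open>Flatness of a right \<open>B\<close>-module \<open>P\<close>.  The test modules range over the two types
  given by the first argument; the notion is the usual one when these types are arbitrary.\<close>

definition flat_right ::
  "('m \<times> 'n) itself \<Rightarrow> (complex, 'b) module \<Rightarrow> ('c, 'b, 'p, 'z) bimod_scheme \<Rightarrow> bool" where
  "flat_right ty B P \<longleftrightarrow> (\<forall>(M :: ('b, 'm) lmod) (N :: ('b, 'n) lmod) f.
     left_module B M \<and> left_module B N \<and> f \<in> left_module_maps B M N \<and> inj_on f (carrier M) \<longrightarrow>
     inj_on (tensor_lift (tensor B P N) (\<lambda>p m. tens B P N p (f m))) (carrier (tensor B P M)))"

section \<open>Cochain complexes in non-negative degrees\<close>

definition cocycles ::
  "(nat \<Rightarrow> (complex, 'c, 'z) module_scheme) \<Rightarrow> (nat \<Rightarrow> 'c \<Rightarrow> 'c) \<Rightarrow> nat \<Rightarrow> 'c set" where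
  "cocycles C d n = {x \<in> carrier (C n). d n x = \<zero>\<^bsub>C (Suc n)\<^esub>}"

definition coboundaries ::
  "(nat \<Rightarrow> (complex, 'c, 'z) module_scheme) \<Rightarrow> (nat \<Rightarrow> 'c \<Rightarrow> 'c) \<Rightarrow> nat \<Rightarrow> 'c set" where
  "coboundaries C d n = (case n of 0 \<Rightarrow> {\<zero>\<^bsub>C 0\<^esub>} | Suc m \<Rightarrow> d m ` carrier (C m))"

definition cohomology ::
  "(nat \<Rightarrow> (complex, 'c, 'z) module_scheme) \<Rightarrow> (nat \<Rightarrow> 'c \<Rightarrow> 'c) \<Rightarrow> nat \<Rightarrow> (complex, 'c set) module" where
  "cohomology C d n = quot ((C n)\<lparr>carrier := cocycles C d n\<rparr>) (coboundaries C d n)"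

definition lcohomology ::
  "(nat \<Rightarrow> ('b, 'c, 'z) lmod_scheme) \<Rightarrow> (nat \<Rightarrow> 'c \<Rightarrow> 'c) \<Rightarrow> nat \<Rightarrow> ('b, 'c set) lmod" where
  "lcohomology C d n = lquot ((C n)\<lparr>carrier := cocycles C d n\<rparr>) (coboundaries C d n)"

definition coh_class ::
  "(nat \<Rightarrow> (complex, 'c, 'z) module_scheme) \<Rightarrow> (nat \<Rightarrow> 'c \<Rightarrow> 'c) \<Rightarrow> nat \<Rightarrow> 'c \<Rightarrow> 'c set" where
  "coh_class C d n x = coboundaries C d n +>\<^bsub>C n\<^esub> x"

section \<open>Differential calculi\<close>

text \<open>The record is the whole graded algebra \<open>\<Omega>\<close>, with \<open>forms \<Omega> n\<close> its part of degree \<open>n\<close>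
  and \<open>emb \<Omega>\<close> the identification of \<open>A\<close> with the degree-zero part.\<close>

record ('a, 'w) calculus = "(complex, 'w) module" +
  forms :: "nat \<Rightarrow> 'w set"
  emb :: "'a \<Rightarrow> 'w"
  diff :: "'w \<Rightarrow> 'w"

definition differential_calculus :: "(complex, 'a) module \<Rightarrow> ('a, 'w) calculus \<Rightarrow> bool" where
  "differential_calculus A \<Omega> \<longleftrightarrow> calgebra A \<and> calgebra \<Omega> \<and>
     (\<forall>n. csubspace (forms \<Omega> n) \<Omega>) \<and>
     (\<forall>w\<in>carrier \<Omega>. \<exists>!f. (\<forall>n. f n \<in> forms \<Omega> n) \<and> finite {n. f n \<noteq> \<zero>\<^bsub>\<Omega>\<^esub>} \<and>
        w = (\<Oplus>\<^bsub>\<Omega>\<^esub> n \<in> {n. f n \<noteq> \<zero>\<^bsub>\<Omega>\<^esub>}. f n)) \<and>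
     (\<forall>m n. \<forall>\<xi>\<in>forms \<Omega> m. \<forall>\<eta>\<in>forms \<Omega> n. \<xi> \<otimes>\<^bsub>\<Omega>\<^esub> \<eta> \<in> forms \<Omega> (m + n)) \<and>
     emb \<Omega> \<in> linear_maps A \<Omega> \<and> bij_betw (emb \<Omega>) (carrier A) (forms \<Omega> 0) \<and>
     emb \<Omega> \<one>\<^bsub>A\<^esub> = \<one>\<^bsub>\<Omega>\<^esub> \<and>
     (\<forall>a\<in>carrier A. \<forall>b\<in>carrier A. emb \<Omega> (a \<otimes>\<^bsub>A\<^esub> b) = emb \<Omega> a \<otimes>\<^bsub>\<Omega>\<^esub> emb \<Omega> b) \<and>
     diff \<Omega> \<in> linear_maps \<Omega> \<Omega> \<and>
     (\<forall>n. \<forall>\<xi>\<in>forms \<Omega> n. diff \<Omega> \<xi> \<in> forms \<Omega> (Suc n)) \<and>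
     (\<forall>\<xi>\<in>carrier \<Omega>. diff \<Omega> (diff \<Omega> \<xi>) = \<zero>\<^bsub>\<Omega>\<^esub>) \<and>
     (\<forall>n. \<forall>\<xi>\<in>forms \<Omega> n. \<forall>\<eta>\<in>carrier \<Omega>. diff \<Omega> (\<xi> \<otimes>\<^bsub>\<Omega>\<^esub> \<eta>) =
        (diff \<Omega> \<xi> \<otimes>\<^bsub>\<Omega>\<^esub> \<eta>) \<oplus>\<^bsub>\<Omega>\<^esub> ((-1) ^ n \<odot>\<^bsub>\<Omega>\<^esub> (\<xi> \<otimes>\<^bsub>\<Omega>\<^esub> diff \<Omega> \<eta>))) \<and>
     forms \<Omega> 1 = cspan \<Omega> {emb \<Omega> a' \<otimes>\<^bsub>\<Omega>\<^esub> diff \<Omega> (emb \<Omega> a) | a a'. a \<in> carrier A \<and> a' \<in> carrier A} \<and>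
     (\<forall>S. csubspace S \<Omega> \<and> forms \<Omega> 0 \<union> forms \<Omega> 1 \<subseteq> S \<and>
        (\<forall>\<xi>\<in>S. \<forall>\<eta>\<in>S. \<xi> \<otimes>\<^bsub>\<Omega>\<^esub> \<eta> \<in> S) \<longrightarrow> carrier \<Omega> \<subseteq> S)"

definition form_bimod :: "('a, 'w) calculus \<Rightarrow> nat \<Rightarrow> ('a, 'a, 'w) bimod" where
  "form_bimod \<Omega> n = \<lparr>carrier = forms \<Omega> n, mult = undefined, one = undefined,
     zero = \<zero>\<^bsub>\<Omega>\<^esub>, add = add \<Omega>, smult = smult \<Omega>,
     lact = (\<lambda>a \<xi>. emb \<Omega> a \<otimes>\<^bsub>\<Omega>\<^esub> \<xi>), ract = (\<lambda>\<xi> a. \<xi> \<otimes>\<^bsub>\<Omega>\<^esub> emb \<Omega> a)\<rparr>"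

definition deRham :: "('a, 'w) calculus \<Rightarrow> nat \<Rightarrow> (complex, 'w set) module" where
  "deRham \<Omega> = cohomology (form_bimod \<Omega>) (\<lambda>n. diff \<Omega>)"

section \<open>Left connections\<close>

text \<open>\<open>lforms_wedge B \<Omega> F k \<omega>\<close> is \<open>\<eta> \<otimes> x \<mapsto> (\<omega> \<and> \<eta>) \<otimes> x\<close> into \<open>\<Omega>\<^sup>k \<otimes>\<^sub>B F\<close>.\<close>

definition lforms ::
  "(complex, 'b) module \<Rightarrow> ('b, 'u) calculus \<Rightarrow> ('b, 'f) lmod \<Rightarrow> nat \<Rightarrow>
   (complex, ('u \<times> 'f \<Rightarrow>\<^sub>0 complex) set) module" where
  "lforms B \<Omega> F p = tensor B (form_bimod \<Omega> p) F"

definition lforms_wedge ::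
  "(complex, 'b) module \<Rightarrow> ('b, 'u) calculus \<Rightarrow> ('b, 'f) lmod \<Rightarrow> nat \<Rightarrow> 'u \<Rightarrow>
   ('u \<times> 'f \<Rightarrow>\<^sub>0 complex) set \<Rightarrow> ('u \<times> 'f \<Rightarrow>\<^sub>0 complex) set" where
  "lforms_wedge B \<Omega> F k \<omega> =
     tensor_lift (lforms B \<Omega> F k) (\<lambda>\<eta> x. tens B (form_bimod \<Omega> k) F (\<omega> \<otimes>\<^bsub>\<Omega>\<^esub> \<eta>) x)"

definition left_connection ::
  "(complex, 'b) module \<Rightarrow> ('b, 'u) calculus \<Rightarrow> ('b, 'f) lmod \<Rightarrow>
   ('f \<Rightarrow> ('u \<times> 'f \<Rightarrow>\<^sub>0 complex) set) \<Rightarrow> bool" where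
  "left_connection B \<Omega> F nab \<longleftrightarrow> nab \<in> linear_maps F (lforms B \<Omega> F 1) \<and>
     (\<forall>b\<in>carrier B. \<forall>x\<in>carrier F. nab (lact F b x) =
        tens B (form_bimod \<Omega> 1) F (diff \<Omega> (emb \<Omega> b)) x
        \<oplus>\<^bsub>lforms B \<Omega> F 1\<^esub> lforms_wedge B \<Omega> F 1 (emb \<Omega> b) (nab x))"

definition lforms_diff ::
  "(complex, 'b) module \<Rightarrow> ('b, 'u) calculus \<Rightarrow> ('b, 'f) lmod \<Rightarrow>
   ('f \<Rightarrow> ('u \<times> 'f \<Rightarrow>\<^sub>0 complex) set) \<Rightarrow> nat \<Rightarrow>
   ('u \<times> 'f \<Rightarrow>\<^sub>0 complex) set \<Rightarrow> ('u \<times> 'f \<Rightarrow>\<^sub>0 complex) set" where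
  "lforms_diff B \<Omega> F nab p = tensor_lift (lforms B \<Omega> F (Suc p))
     (\<lambda>\<omega> x. tens B (form_bimod \<Omega> (Suc p)) F (diff \<Omega> \<omega>) x
        \<oplus>\<^bsub>lforms B \<Omega> F (Suc p)\<^esub>
        ((-1) ^ p \<odot>\<^bsub>lforms B \<Omega> F (Suc p)\<^esub> lforms_wedge B \<Omega> F (Suc p) \<omega> (nab x)))"

definition left_connection_cohomology ::
  "(complex, 'b) module \<Rightarrow> ('b, 'u) calculus \<Rightarrow> ('b, 'f) lmod \<Rightarrow>
   ('f \<Rightarrow> ('u \<times> 'f \<Rightarrow>\<^sub>0 complex) set) \<Rightarrow> nat \<Rightarrow> (complex, ('u \<times> 'f \<Rightarrow>\<^sub>0 complex) set set) module" where
  "left_connection_cohomology B \<Omega> F nab = cohomology (lforms B \<Omega> F) (lforms_diff B \<Omega> F nab)"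

section \<open>Right bimodule connections\<close>

record ('b, 'u, 'a, 'w, 'e) bundle_data =
  base_alg :: "(complex, 'b) module"
  base_calc :: "('b, 'u) calculus"
  tot_alg :: "(complex, 'a) module"
  tot_calc :: "('a, 'w) calculus"
  bim :: "('b, 'a, 'e) bimod"
  conn :: "'e \<Rightarrow> ('e \<times> 'w \<Rightarrow>\<^sub>0 complex) set"
  braid :: "('u \<times> 'e \<Rightarrow>\<^sub>0 complex) set \<Rightarrow> ('e \<times> 'w \<Rightarrow>\<^sub>0 complex) set"

definition cochains :: "('b, 'u, 'a, 'w, 'e) bundle_data \<Rightarrow> nat \<Rightarrow> ('b, 'a, ('e \<times> 'w \<Rightarrow>\<^sub>0 complex) set) bimod" where
  "cochains D n = btensor (tot_alg D) (bim D) (form_bimod (tot_calc D) n)"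

definition ctens :: "('b, 'u, 'a, 'w, 'e) bundle_data \<Rightarrow> nat \<Rightarrow> 'e \<Rightarrow> 'w \<Rightarrow> ('e \<times> 'w \<Rightarrow>\<^sub>0 complex) set" where
  "ctens D n = tens (tot_alg D) (bim D) (form_bimod (tot_calc D) n)"

definition btens :: "('b, 'u, 'a, 'w, 'e) bundle_data \<Rightarrow> nat \<Rightarrow> 'u \<Rightarrow> 'e \<Rightarrow> ('u \<times> 'e \<Rightarrow>\<^sub>0 complex) set" where
  "btens D n = tens (base_alg D) (form_bimod (base_calc D) n) (bim D)"

text \<open>\<open>(e \<otimes> \<eta>') \<and> \<eta> = e \<otimes> (\<eta>' \<and> \<eta>)\<close>, where \<open>n\<close> is the total degree.\<close>

definition cwedge ::
  "('b, 'u, 'a, 'w, 'e) bundle_data \<Rightarrow> nat \<Rightarrow> ('e \<times> 'w \<Rightarrow>\<^sub>0 complex) set \<Rightarrow> 'w \<Rightarrow> ('e \<times> 'w \<Rightarrow>\<^sub>0 complex) set" where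
  "cwedge D n t \<eta> = tensor_lift (cochains D n) (\<lambda>e \<eta>'. ctens D n e (\<eta>' \<otimes>\<^bsub>tot_calc D\<^esub> \<eta>)) t"

definition bimodule_connection :: "('b, 'u, 'a, 'w, 'e) bundle_data \<Rightarrow> bool" where
  "bimodule_connection D \<longleftrightarrow>
     differential_calculus (base_alg D) (base_calc D) \<and>
     differential_calculus (tot_alg D) (tot_calc D) \<and>
     bimodule (base_alg D) (tot_alg D) (bim D) \<and>
     conn D \<in> linear_maps (bim D) (cochains D 1) \<and>
     (\<forall>e\<in>carrier (bim D). \<forall>a\<in>carrier (tot_alg D). conn D (ract (bim D) e a) =
        ract (cochains D 1) (conn D e) a \<oplus>\<^bsub>cochains D 1\<^esub> ctens D 1 e (diff (tot_calc D) (emb (tot_calc D) a))) \<and>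
     braid D \<in> bimodule_maps (base_alg D) (tot_alg D)
        (btensor (base_alg D) (form_bimod (base_calc D) 1) (bim D)) (cochains D 1) \<and>
     (\<forall>b\<in>carrier (base_alg D). \<forall>e\<in>carrier (bim D). conn D (lact (bim D) b e) =
        braid D (btens D 1 (diff (base_calc D) (emb (base_calc D) b)) e)
        \<oplus>\<^bsub>cochains D 1\<^esub> lact (cochains D 1) b (conn D e))"

text \<open>\<open>braid_wedge D s m n \<xi> (e \<otimes> \<eta>) = s m (\<xi> \<otimes> e) \<and> \<eta>\<close> for \<open>\<xi>\<close> of degree \<open>m\<close> and
  \<open>\<eta>\<close> of degree \<open>n\<close>.\<close>

definition braid_wedge ::
  "('b, 'u, 'a, 'w, 'e) bundle_data \<Rightarrow>
   (nat \<Rightarrow> ('u \<times> 'e \<Rightarrow>\<^sub>0 complex) set \<Rightarrow> ('e \<times> 'w \<Rightarrow>\<^sub>0 complex) set) \<Rightarrow> nat \<Rightarrow> nat \<Rightarrow>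
   'u \<Rightarrow> ('e \<times> 'w \<Rightarrow>\<^sub>0 complex) set \<Rightarrow> ('e \<times> 'w \<Rightarrow>\<^sub>0 complex) set" where
  "braid_wedge D s m n \<xi> =
     tensor_lift (cochains D (m + n)) (\<lambda>e \<eta>. cwedge D (m + n) (s m (btens D m \<xi> e)) \<eta>)"

definition extends_braid ::
  "('b, 'u, 'a, 'w, 'e) bundle_data \<Rightarrow>
   (nat \<Rightarrow> ('u \<times> 'e \<Rightarrow>\<^sub>0 complex) set \<Rightarrow> ('e \<times> 'w \<Rightarrow>\<^sub>0 complex) set) \<Rightarrow> bool" where
  "extends_braid D s \<longleftrightarrow>
     (\<forall>n. s n \<in> bimodule_maps (base_alg D) (tot_alg D)
        (btensor (base_alg D) (form_bimod (base_calc D) n) (bim D)) (cochains D n)) \<and>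
     (\<forall>b\<in>carrier (base_alg D). \<forall>e\<in>carrier (bim D).
        s 0 (btens D 0 (emb (base_calc D) b) e) = ctens D 0 (lact (bim D) b e) \<one>\<^bsub>tot_calc D\<^esub>) \<and>
     (\<forall>t\<in>carrier (tensor (base_alg D) (form_bimod (base_calc D) 1) (bim D)). s 1 t = braid D t) \<and>
     (\<forall>m n. \<forall>\<xi>\<in>forms (base_calc D) m. \<forall>\<eta>\<in>forms (base_calc D) n. \<forall>e\<in>carrier (bim D).
        s (m + n) (btens D (m + n) (\<xi> \<otimes>\<^bsub>base_calc D\<^esub> \<eta>) e) =
        braid_wedge D s m n \<xi> (s n (btens D n \<eta> e)))"

definition extendable :: "('b, 'u, 'a, 'w, 'e) bundle_data \<Rightarrow> bool" where
  "extendable D \<longleftrightarrow> (\<exists>s. extends_braid D s)"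

text \<open>The extension is unique, the calculus on \<open>B\<close> being generated in degrees 0 and 1.\<close>

definition braids ::
  "('b, 'u, 'a, 'w, 'e) bundle_data \<Rightarrow> nat \<Rightarrow> ('u \<times> 'e \<Rightarrow>\<^sub>0 complex) set \<Rightarrow> ('e \<times> 'w \<Rightarrow>\<^sub>0 complex) set" where
  "braids D = (SOME s. extends_braid D s)"

definition connC ::
  "('b, 'u, 'a, 'w, 'e) bundle_data \<Rightarrow> nat \<Rightarrow> ('e \<times> 'w \<Rightarrow>\<^sub>0 complex) set \<Rightarrow> ('e \<times> 'w \<Rightarrow>\<^sub>0 complex) set" where
  "connC D n = tensor_lift (cochains D (Suc n))
     (\<lambda>e \<eta>. ctens D (Suc n) e (diff (tot_calc D) \<eta>)
        \<oplus>\<^bsub>cochains D (Suc n)\<^esub> cwedge D (Suc n) (conn D e) \<eta>)"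

definition zero_curvature :: "('b, 'u, 'a, 'w, 'e) bundle_data \<Rightarrow> bool" where
  "zero_curvature D \<longleftrightarrow> (\<forall>e\<in>carrier (bim D). connC D 1 (conn D e) = \<zero>\<^bsub>cochains D 2\<^esub>)"

definition bundle_cohomology ::
  "('b, 'u, 'a, 'w, 'e) bundle_data \<Rightarrow> nat \<Rightarrow> (complex, ('e \<times> 'w \<Rightarrow>\<^sub>0 complex) set set) module" where
  "bundle_cohomology D = cohomology (cochains D) (connC D)"

section \<open>Differential fibre bundles\<close>

definition filt :: "('b, 'u, 'a, 'w, 'e) bundle_data \<Rightarrow> nat \<Rightarrow> nat \<Rightarrow> ('e \<times> 'w \<Rightarrow>\<^sub>0 complex) set set" where
  "filt D m n = (if m \<le> n
     then tensor_lift (cochains D n) (braid_wedge D (braids D) m (n - m))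
        ` carrier (tensor (base_alg D) (form_bimod (base_calc D) m) (cochains D (n - m)))
     else {\<zero>\<^bsub>cochains D n\<^esub>})"

definition filt_class ::
  "('b, 'u, 'a, 'w, 'e) bundle_data \<Rightarrow> nat \<Rightarrow> nat \<Rightarrow> ('e \<times> 'w \<Rightarrow>\<^sub>0 complex) set \<Rightarrow>
   ('e \<times> 'w \<Rightarrow>\<^sub>0 complex) set set" where
  "filt_class D p q z = filt D (Suc p) (p + q) +>\<^bsub>cochains D (p + q)\<^esub> z"

definition fibre_quot :: "('b, 'u, 'a, 'w, 'e) bundle_data \<Rightarrow> nat \<Rightarrow> nat \<Rightarrow>
   ('b, 'a, ('e \<times> 'w \<Rightarrow>\<^sub>0 complex) set set) bimod" where
  "fibre_quot D p q = bquot ((cochains D (p + q))\<lparr>carrier := filt D p (p + q)\<rparr>) (filt D (Suc p) (p + q))"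

definition fibre_quot_diff ::
  "('b, 'u, 'a, 'w, 'e) bundle_data \<Rightarrow> nat \<Rightarrow> nat \<Rightarrow> ('e \<times> 'w \<Rightarrow>\<^sub>0 complex) set set \<Rightarrow>
   ('e \<times> 'w \<Rightarrow>\<^sub>0 complex) set set" where
  "fibre_quot_diff D p q = on_coset (\<lambda>z. filt_class D p (Suc q) (connC D (p + q) z))"

abbreviation fibre :: "('b, 'u, 'a, 'w, 'e) bundle_data \<Rightarrow> nat \<Rightarrow>
   ('b, 'a, ('e \<times> 'w \<Rightarrow>\<^sub>0 complex) set set) bimod" where
  "fibre D q \<equiv> fibre_quot D 0 q"

abbreviation fibre_diff ::
  "('b, 'u, 'a, 'w, 'e) bundle_data \<Rightarrow> nat \<Rightarrow> ('e \<times> 'w \<Rightarrow>\<^sub>0 complex) set set \<Rightarrow>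
   ('e \<times> 'w \<Rightarrow>\<^sub>0 complex) set set" where
  "fibre_diff D q \<equiv> fibre_quot_diff D 0 q"

definition HN :: "('b, 'u, 'a, 'w, 'e) bundle_data \<Rightarrow> nat \<Rightarrow>
   ('b, ('e \<times> 'w \<Rightarrow>\<^sub>0 complex) set set set) lmod" where
  "HN D = lcohomology (fibre D) (fibre_diff D)"

definition HN_class :: "('b, 'u, 'a, 'w, 'e) bundle_data \<Rightarrow> nat \<Rightarrow> ('e \<times> 'w \<Rightarrow>\<^sub>0 complex) set set \<Rightarrow>
   ('e \<times> 'w \<Rightarrow>\<^sub>0 complex) set set set" where
  "HN_class D = coh_class (fibre D) (fibre_diff D)"

definition g_map ::
  "('b, 'u, 'a, 'w, 'e) bundle_data \<Rightarrow> nat \<Rightarrow> nat \<Rightarrow>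
   ('u \<times> ('e \<times> 'w \<Rightarrow>\<^sub>0 complex) set set \<Rightarrow>\<^sub>0 complex) set \<Rightarrow> ('e \<times> 'w \<Rightarrow>\<^sub>0 complex) set set" where
  "g_map D p q = tensor_lift (fibre_quot D p q)
     (\<lambda>\<xi>. on_coset (\<lambda>z. filt_class D p q (braid_wedge D (braids D) p q \<xi> z)))"

definition differential_fibre_bundle ::
  "('m \<times> 'n) itself \<Rightarrow> ('b, 'u, 'a, 'w, 'e) bundle_data \<Rightarrow> bool" where
  "differential_fibre_bundle ty D \<longleftrightarrow>
     bimodule_connection D \<and> extendable D \<and> zero_curvature D \<and>
     (\<forall>p\<ge>1. flat_right ty (base_alg D) (form_bimod (base_calc D) p)) \<and>
     (\<forall>p q. linear_iso (tensor (base_alg D) (form_bimod (base_calc D) p) (fibre D q)) (fibre_quot D p q) (g_map D p q))"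

text \<open>The isomorphism \<open>\<Omega>\<^sup>1 \<otimes>\<^sub>B H\<^sup>q(N) \<rightarrow> H(M\<^sub>1\<^sub>,\<^sub>q)\<close> induced by \<open>g\<close>, and the connection
  \<open>\<nabla>\<^sub>q\<close> on \<open>H\<^sup>q(N)\<close> which it defines.  Elements of \<open>H\<^sup>q(N)\<close> are sets of cosets in \<open>C\<^sup>q\<close>,
  so the union of such an element is the set of all its representatives in \<open>C\<^sup>q\<close>.\<close>

definition g_coh ::
  "('b, 'u, 'a, 'w, 'e) bundle_data \<Rightarrow> nat \<Rightarrow>
   ('u \<times> ('e \<times> 'w \<Rightarrow>\<^sub>0 complex) set set set \<Rightarrow>\<^sub>0 complex) set \<Rightarrow> ('e \<times> 'w \<Rightarrow>\<^sub>0 complex) set set set" where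
  "g_coh D q = tensor_lift (cohomology (fibre_quot D 1) (fibre_quot_diff D 1) q)
     (\<lambda>\<xi>. on_coset (\<lambda>u. coh_class (fibre_quot D 1) (fibre_quot_diff D 1) q
        (g_map D 1 q (tens (base_alg D) (form_bimod (base_calc D) 1) (fibre D q) \<xi> u))))"

definition fibre_conn ::
  "('b, 'u, 'a, 'w, 'e) bundle_data \<Rightarrow> nat \<Rightarrow> ('e \<times> 'w \<Rightarrow>\<^sub>0 complex) set set set \<Rightarrow>
   ('u \<times> ('e \<times> 'w \<Rightarrow>\<^sub>0 complex) set set set \<Rightarrow>\<^sub>0 complex) set" where
  "fibre_conn D q h = on_coset
     (\<lambda>z. inv_into (carrier (lforms (base_alg D) (base_calc D) (HN D q) 1)) (g_coh D q)
        (coh_class (fibre_quot D 1) (fibre_quot_diff D 1) q (filt_class D 1 q (connC D q z)))) (\<Union>h)"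

section \<open>The spectral sequence of the filtration\<close>

text \<open>Bidegrees are integers and pages start with page 1: a spectral sequence is given by its
  pages \<open>E r p q\<close> and differentials \<open>d r p q\<close> from bidegree \<open>(p, q)\<close> to \<open>(p + r, q - r + 1)\<close>.\<close>

definition spectral_sequence ::
  "(nat \<Rightarrow> int \<Rightarrow> int \<Rightarrow> (complex, 'c) module) \<Rightarrow> (nat \<Rightarrow> int \<Rightarrow> int \<Rightarrow> 'c \<Rightarrow> 'c) \<Rightarrow> bool" where
  "spectral_sequence E d \<longleftrightarrow> (\<forall>r\<ge>1. \<forall>p q.
     cvs (E r p q) \<and>
     d r p q \<in> linear_maps (E r p q) (E r (p + int r) (q - int r + 1)) \<and>
     (\<forall>x\<in>carrier (E r p q). d r (p + int r) (q - int r + 1) (d r p q x)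
        = \<zero>\<^bsub>E r (p + int r + int r) (q - int r + 1 - int r + 1)\<^esub>) \<and>
     isomorphic (E (Suc r) p q)
       (quot ((E r p q)\<lparr>carrier := {x \<in> carrier (E r p q). d r p q x = \<zero>\<^bsub>E r (p + int r) (q - int r + 1)\<^esub>}\<rparr>)
          (d r (p - int r) (q + int r - 1) ` carrier (E r (p - int r) (q + int r - 1)))))"

definition direct_sum :: "'i set \<Rightarrow> ('i \<Rightarrow> (complex, 'c) module) \<Rightarrow> (complex, 'i \<Rightarrow> 'c) module" where
  "direct_sum I E = \<lparr>carrier = {f \<in> (\<Pi>\<^sub>E i\<in>I. carrier (E i)). finite {i \<in> I. f i \<noteq> \<zero>\<^bsub>E i\<^esub>}},
     mult = undefined, one = undefined, zero = (\<lambda>i\<in>I. \<zero>\<^bsub>E i\<^esub>),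
     add = (\<lambda>f g. \<lambda>i\<in>I. f i \<oplus>\<^bsub>E i\<^esub> g i), smult = (\<lambda>c f. \<lambda>i\<in>I. c \<odot>\<^bsub>E i\<^esub> f i)\<rparr>"

text \<open>An entry stabilises once the differentials leaving and entering it vanish.\<close>

definition converges_to ::
  "(nat \<Rightarrow> int \<Rightarrow> int \<Rightarrow> (complex, 'c) module) \<Rightarrow> (nat \<Rightarrow> int \<Rightarrow> int \<Rightarrow> 'c \<Rightarrow> 'c) \<Rightarrow>
   (nat \<Rightarrow> (complex, 'h) module) \<Rightarrow> bool" where
  "converges_to E d H \<longleftrightarrow> (\<exists>Einf :: int \<times> int \<Rightarrow> (complex, 'c) module.
     (\<forall>p q. \<exists>r\<^sub>0\<ge>1. \<forall>r\<ge>r\<^sub>0.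
        (\<forall>x\<in>carrier (E r p q). d r p q x = \<zero>\<^bsub>E r (p + int r) (q - int r + 1)\<^esub>) \<and>
        (\<forall>x\<in>carrier (E r (p - int r) (q + int r - 1)). d r (p - int r) (q + int r - 1) x = \<zero>\<^bsub>E r p q\<^esub>) \<and>
        isomorphic (E r p q) (Einf (p, q))) \<and>
     (\<forall>k. isomorphic (H k) (direct_sum {(p, q). p + q = int k} Einf)))"

text \<open>The pages of the filtration: \<open>Z\<^sub>r / (Z\<^sub>r\<^sub>-\<^sub>1 + \<nabla> Z\<^sub>r\<^sub>-\<^sub>1)\<close> in the appropriate bidegrees.
  Since \<open>nat\<close> is truncating, the filtration is extended by the whole complex to negative
  filtration degrees.\<close>

definition Zpage :: "('b, 'u, 'a, 'w, 'e) bundle_data \<Rightarrow> nat \<Rightarrow> int \<Rightarrow> nat \<Rightarrow>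
   ('e \<times> 'w \<Rightarrow>\<^sub>0 complex) set set" where
  "Zpage D r p n = {z \<in> filt D (nat p) n. connC D n z \<in> filt D (nat (p + int r)) (Suc n)}"

definition Bpage :: "('b, 'u, 'a, 'w, 'e) bundle_data \<Rightarrow> nat \<Rightarrow> int \<Rightarrow> nat \<Rightarrow>
   ('e \<times> 'w \<Rightarrow>\<^sub>0 complex) set set" where
  "Bpage D r p n = Zpage D (r - 1) (p + 1) n <+>\<^bsub>cochains D n\<^esub>
     (case n of 0 \<Rightarrow> {\<zero>\<^bsub>cochains D 0\<^esub>} | Suc m \<Rightarrow> connC D m ` Zpage D (r - 1) (p - int r + 1) m)"

definition page :: "('b, 'u, 'a, 'w, 'e) bundle_data \<Rightarrow> nat \<Rightarrow> int \<Rightarrow> int \<Rightarrow>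
   (complex, ('e \<times> 'w \<Rightarrow>\<^sub>0 complex) set set) module" where
  "page D r p q = (if p + q < 0 then quot ((cochains D 0)\<lparr>carrier := {\<zero>\<^bsub>cochains D 0\<^esub>}\<rparr>) {\<zero>\<^bsub>cochains D 0\<^esub>}
     else quot ((cochains D (nat (p + q)))\<lparr>carrier := Zpage D r p (nat (p + q))\<rparr>) (Bpage D r p (nat (p + q))))"

definition page_diff :: "('b, 'u, 'a, 'w, 'e) bundle_data \<Rightarrow> nat \<Rightarrow> int \<Rightarrow> int \<Rightarrow>
   ('e \<times> 'w \<Rightarrow>\<^sub>0 complex) set set \<Rightarrow> ('e \<times> 'w \<Rightarrow>\<^sub>0 complex) set set" where
  "page_diff D r p q U = (if p + q < 0 then \<zero>\<^bsub>page D r (p + int r) (q - int r + 1)\<^esub>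
     else on_coset (\<lambda>z. Bpage D r (p + int r) (Suc (nat (p + q)))
        +>\<^bsub>cochains D (Suc (nat (p + q)))\<^esub> connC D (nat (p + q)) z) U)"

section \<open>Exterior algebras\<close>

text \<open>The exterior algebra is the free algebra on the vectors, with words as basis, modulo the
  linear and alternating relations; \<open>wedge_list V vs\<close> is the wedge product of the vectors \<open>vs\<close>.\<close>

definition ext_rels :: "(complex, 'v) module \<Rightarrow> ('v list \<Rightarrow>\<^sub>0 complex) set" where
  "ext_rels V =
     {gen (us @ [u \<oplus>\<^bsub>V\<^esub> v] @ vs) - gen (us @ [u] @ vs) - gen (us @ [v] @ vs) | us u v vs.
        us \<in> lists (carrier V) \<and> u \<in> carrier V \<and> v \<in> carrier V \<and> vs \<in> lists (carrier V)} \<union>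
     {gen (us @ [c \<odot>\<^bsub>V\<^esub> u] @ vs) - Poly_Mapping.single (us @ [u] @ vs) c | c us u vs.
        us \<in> lists (carrier V) \<and> u \<in> carrier V \<and> vs \<in> lists (carrier V)} \<union>
     {gen (us @ [u, u] @ vs) | us u vs.
        us \<in> lists (carrier V) \<and> u \<in> carrier V \<and> vs \<in> lists (carrier V)}"

definition ext_ideal :: "(complex, 'v) module \<Rightarrow> ('v list \<Rightarrow>\<^sub>0 complex) set" where
  "ext_ideal V = cspan (free_cvs (lists (carrier V))) (ext_rels V)"

definition wedge_list :: "(complex, 'v) module \<Rightarrow> 'v list \<Rightarrow> ('v list \<Rightarrow>\<^sub>0 complex) set" where
  "wedge_list V vs = ext_ideal V +>\<^bsub>free_cvs (lists (carrier V))\<^esub> gen vs"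

definition ext_alg :: "(complex, 'v) module \<Rightarrow> (complex, ('v list \<Rightarrow>\<^sub>0 complex) set) module" where
  "ext_alg V = (let Q = quot (free_cvs (lists (carrier V))) (ext_ideal V) in
     Q\<lparr>mult := (\<lambda>S. on_coset (\<lambda>t. on_coset
          (lin_ext Q (\<lambda>us. lin_ext Q (\<lambda>vs. wedge_list V (us @ vs)) t)) S)),
       one := wedge_list V []\<rparr>)"

text \<open>The subspace \<open>U\<^sup>\<and>\<^sup>n\<close> of the exterior algebra of \<open>V\<close>, for a subspace \<open>U\<close> of \<open>V\<close>.\<close>

definition ext_power :: "(complex, 'v) module \<Rightarrow> 'v set \<Rightarrow> nat \<Rightarrow> ('v list \<Rightarrow>\<^sub>0 complex) set set" where
  "ext_power V U n = cspan (ext_alg V) {wedge_list V vs | vs. vs \<in> lists U \<and> length vs = n}"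

definition ext_act ::
  "(complex, 'v) module \<Rightarrow> ('v \<Rightarrow> 'x \<Rightarrow> 'v) \<Rightarrow> ('v list \<Rightarrow>\<^sub>0 complex) set \<Rightarrow> 'x \<Rightarrow> ('v list \<Rightarrow>\<^sub>0 complex) set" where
  "ext_act V act \<xi> x = on_coset (lin_ext (ext_alg V) (\<lambda>vs. wedge_list V (map (\<lambda>v. act v x) vs))) \<xi>"

section \<open>Group algebras and their calculi\<close>

definition group_alg :: "('x, 'z) monoid_scheme \<Rightarrow> (complex, 'x \<Rightarrow>\<^sub>0 complex) module" where
  "group_alg X = \<lparr>carrier = {a. Poly_Mapping.keys a \<subseteq> carrier X},
     mult = (\<lambda>a b. \<Sum>x\<in>Poly_Mapping.keys a. \<Sum>y\<in>Poly_Mapping.keys b.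
        Poly_Mapping.single (x \<otimes>\<^bsub>X\<^esub> y) (Poly_Mapping.lookup a x * Poly_Mapping.lookup b y)),
     one = gen \<one>\<^bsub>X\<^esub>, zero = 0, add = (+), smult = (\<lambda>c. Poly_Mapping.map ((*) c))\<rparr>"

definition right_representation ::
  "('x, 'z) monoid_scheme \<Rightarrow> (complex, 'v) module \<Rightarrow> ('v \<Rightarrow> 'x \<Rightarrow> 'v) \<Rightarrow> bool" where
  "right_representation X V act \<longleftrightarrow> cvs V \<and>
     (\<forall>x\<in>carrier X. (\<lambda>v. act v x) \<in> linear_maps V V) \<and>
     (\<forall>x\<in>carrier X. \<forall>y\<in>carrier X. \<forall>v\<in>carrier V. act v (x \<otimes>\<^bsub>X\<^esub> y) = act (act v x) y) \<and>
     (\<forall>v\<in>carrier V. act v \<one>\<^bsub>X\<^esub> = v)"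

definition cocycle ::
  "('x, 'z) monoid_scheme \<Rightarrow> (complex, 'v) module \<Rightarrow> ('v \<Rightarrow> 'x \<Rightarrow> 'v) \<Rightarrow> ('x \<Rightarrow> 'v) \<Rightarrow> bool" where
  "cocycle X V act \<omega> \<longleftrightarrow> \<omega> \<in> carrier X \<rightarrow> carrier V \<and>
     (\<forall>x\<in>carrier X. \<forall>y\<in>carrier X. \<omega> (x \<otimes>\<^bsub>X\<^esub> y) = act (\<omega> x) y \<oplus>\<^bsub>V\<^esub> \<omega> y)"

definition invariant_inner_product ::
  "'x set \<Rightarrow> (complex, 'v) module \<Rightarrow> ('v \<Rightarrow> 'x \<Rightarrow> 'v) \<Rightarrow> ('v \<Rightarrow> 'v \<Rightarrow> complex) \<Rightarrow> bool" where
  "invariant_inner_product G V act ip \<longleftrightarrow>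
     (\<forall>u\<in>carrier V. \<forall>u'\<in>carrier V. \<forall>v\<in>carrier V. ip (u \<oplus>\<^bsub>V\<^esub> u') v = ip u v + ip u' v) \<and>
     (\<forall>c. \<forall>u\<in>carrier V. \<forall>v\<in>carrier V. ip (c \<odot>\<^bsub>V\<^esub> u) v = c * ip u v) \<and>
     (\<forall>u\<in>carrier V. \<forall>v\<in>carrier V. ip v u = cnj (ip u v)) \<and>
     (\<forall>u\<in>carrier V. u \<noteq> \<zero>\<^bsub>V\<^esub> \<longrightarrow> Re (ip u u) > 0) \<and>
     (\<forall>g\<in>G. \<forall>u\<in>carrier V. \<forall>v\<in>carrier V. ip (act u g) (act v g) = ip u v)"

text \<open>The projection onto \<open>S\<close> along the complement \<open>T\<close>.\<close>

definition projection :: "(complex, 'v) module \<Rightarrow> 'v set \<Rightarrow> 'v set \<Rightarrow> 'v \<Rightarrow> 'v" where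
  "projection V S T v = (THE s. s \<in> S \<and> (\<exists>t\<in>T. v = s \<oplus>\<^bsub>V\<^esub> t))"

text \<open>\<open>left_mono V x \<xi>\<close> is the form \<open>x.\<xi>\<close>, for \<open>\<xi>\<close> in the exterior algebra of \<open>V\<close>.\<close>

definition left_mono :: "(complex, 'v) module \<Rightarrow> 'x \<Rightarrow> ('v list \<Rightarrow>\<^sub>0 complex) set \<Rightarrow>
   'x \<Rightarrow> ('v list \<Rightarrow>\<^sub>0 complex) set" where
  "left_mono V x \<xi> = (\<lambda>y. if y = x then \<xi> else \<zero>\<^bsub>ext_alg V\<^esub>)"

text \<open>The calculus \<open>\<complex>X.V\<^sup>\<and>\<close>: an element is a finitely supported function \<open>f\<close>, standing for
  the sum of the \<open>x.(f x)\<close>.  The product is determined by \<open>\<xi>.x = x.(\<xi> \<triangleleft> x)\<close>, that is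
  \<open>(x.\<xi>) \<and> (y.\<eta>) = xy.((\<xi> \<triangleleft> y) \<and> \<eta>)\<close>, and \<open>d\<close> by \<open>dx = x.\<omega>(x)\<close> and \<open>dV = 0\<close>,
  that is \<open>d(x.\<xi>) = x.(\<omega>(x) \<and> \<xi>)\<close>.\<close>

definition group_calculus ::
  "('x, 'z) monoid_scheme \<Rightarrow> (complex, 'v) module \<Rightarrow> ('v \<Rightarrow> 'x \<Rightarrow> 'v) \<Rightarrow> ('x \<Rightarrow> 'v) \<Rightarrow>
   ('x \<Rightarrow>\<^sub>0 complex, 'x \<Rightarrow> ('v list \<Rightarrow>\<^sub>0 complex) set) calculus" where
  "group_calculus X V act \<omega> = (let L = ext_alg V; supp = (\<lambda>f. {x. f x \<noteq> \<zero>\<^bsub>L\<^esub>});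
      car = (\<lambda>S. {f. (\<forall>x. f x \<in> S) \<and> finite (supp f) \<and> supp f \<subseteq> carrier X}) in
     \<lparr>carrier = car (carrier L),
      mult = (\<lambda>f g z. \<Oplus>\<^bsub>L\<^esub> p \<in> {(x, y). x \<in> supp f \<and> y \<in> supp g \<and> x \<otimes>\<^bsub>X\<^esub> y = z}.
         ext_act V act (f (fst p)) (snd p) \<otimes>\<^bsub>L\<^esub> g (snd p)),
      one = left_mono V \<one>\<^bsub>X\<^esub> \<one>\<^bsub>L\<^esub>,
      zero = (\<lambda>x. \<zero>\<^bsub>L\<^esub>),
      add = (\<lambda>f g x. f x \<oplus>\<^bsub>L\<^esub> g x),
      smult = (\<lambda>c f x. c \<odot>\<^bsub>L\<^esub> f x),
      forms = (\<lambda>n. car (ext_power V (carrier V) n)),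
      emb = (\<lambda>a x. Poly_Mapping.lookup a x \<odot>\<^bsub>L\<^esub> \<one>\<^bsub>L\<^esub>),
      diff = (\<lambda>f x. if x \<in> carrier X then wedge_list V [\<omega> x] \<otimes>\<^bsub>L\<^esub> f x else \<zero>\<^bsub>L\<^esub>)\<rparr>)"

text \<open>The form \<open>\<xi>.x\<close>.\<close>

definition right_mono ::
  "('x, 'z) monoid_scheme \<Rightarrow> (complex, 'v) module \<Rightarrow> ('v \<Rightarrow> 'x \<Rightarrow> 'v) \<Rightarrow> ('x \<Rightarrow> 'v) \<Rightarrow>
   ('v list \<Rightarrow>\<^sub>0 complex) set \<Rightarrow> 'x \<Rightarrow> 'x \<Rightarrow> ('v list \<Rightarrow>\<^sub>0 complex) set" where
  "right_mono X V act \<omega> \<xi> x = left_mono V \<one>\<^bsub>X\<^esub> \<xi>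
     \<otimes>\<^bsub>group_calculus X V act \<omega>\<^esub> emb (group_calculus X V act \<omega>) (gen x)"

text \<open>\<open>U\<^sup>\<and>\<^sup>n.\<complex>X\<close> for a subspace \<open>U\<close> of \<open>V\<close>, with the \<open>\<complex>X\<close>-bimodule operations of the
  \<open>n\<close>-forms (of which only the left action of elements preserving \<open>U\<close> is meaningful).\<close>

definition power_forms ::
  "('x, 'z) monoid_scheme \<Rightarrow> (complex, 'v) module \<Rightarrow> ('v \<Rightarrow> 'x \<Rightarrow> 'v) \<Rightarrow> ('x \<Rightarrow> 'v) \<Rightarrow> 'v set \<Rightarrow> nat \<Rightarrow>
   ('x \<Rightarrow>\<^sub>0 complex, 'x \<Rightarrow>\<^sub>0 complex, 'x \<Rightarrow> ('v list \<Rightarrow>\<^sub>0 complex) set) bimod" where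
  "power_forms X V act \<omega> U n = (form_bimod (group_calculus X V act \<omega>) n)
     \<lparr>carrier := cspan (group_calculus X V act \<omega>)
        {right_mono X V act \<omega> \<xi> x | \<xi> x. \<xi> \<in> ext_power V U n \<and> x \<in> carrier X}\<rparr>"

definition mult_bimod :: "(complex, 'a) module \<Rightarrow> ('a, 'a, 'a) bimod" where
  "mult_bimod A = \<lparr>carrier = carrier A, mult = undefined, one = undefined,
     zero = \<zero>\<^bsub>A\<^esub>, add = add A, smult = smult A, lact = mult A, ract = mult A\<rparr>"

end

theory Submission imports Defs
begin

abbreviation car where "car == carrier"
abbreviation lin where "lin == linear_maps"
abbreviation fb where "fb == form_bimod"
abbreviation wg where "wg == wedge_list"
abbreviation (input) iff_in (infixr \<open><->\<close> 25) where "A <-> B == A = B"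
abbreviation lookup where "lookup == Poly_Mapping.lookup"
abbreviation keys where "keys == Poly_Mapping.keys"
abbreviation single where "single == Poly_Mapping.single"
abbreviation add_in (\<open>_ +[_] _\<close> [65, 0, 66] 65) where "x +[V] y == x \<oplus>\<^bsub>V\<^esub> y"
abbreviation smult_in (\<open>_ *[_] _\<close> [76, 0, 75] 75) where "c *[V] x == c \<odot>\<^bsub>V\<^esub> x"
abbreviation mult_in (\<open>_ **[_] _\<close> [70, 0, 71] 70) where "x **[V] y == x \<otimes>\<^bsub>V\<^esub> y"
abbreviation zero_in (\<open>0[_]\<close>) where "0[V] == \<zero>\<^bsub>V\<^esub>"
abbreviation one_in (\<open>1[_]\<close>) where "1[V] == \<one>\<^bsub>V\<^esub>"
abbreviation inv_in (\<open>inv[_] _\<close> [0, 81] 80) where "inv[V] x == inv\<^bsub>V\<^esub> x"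

text \<open>Through \<open>\<xi> \<mapsto> 1 \<otimes> \<xi>\<close> the complex \<open>E \<otimes>\<^sub>A \<Omega>\<^sub>A\<close> becomes \<open>\<Omega>\<^sub>A\<close> itself, and \<open>F\<^sup>m\<close> becomes \<open>\<Omega>\<^sub>B\<^sup>m \<and> \<Omega>\<^sub>A\<close>.
 A basis of \<open>\<Lambda>\<^sup>pW\<close> is a basis of the right module \<open>\<Omega>\<^sub>B\<^sup>p\<close>, which gives flatness. For such a basis \<open>(e\<^sub>i)\<close>,
 contracting with its dual basis shows that \<open>\<Sum>\<^sub>i e\<^sub>i \<and> u\<^sub>i\<close> lies in \<open>F\<^sup>p\<^sup>+\<^sup>1\<close> only if \<open>\<Lambda>(\<pi>\<^sup>\<bottom>)u\<^sub>i = 0\<close> for all \<open>i\<close>;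
 hence \<open>N\<^sub>q = \<Lambda>\<^sup>q(W\<^sup>\<bottom>).A\<close>, and the maps \<open>\<Omega>\<^sub>B\<^sup>p \<otimes>\<^sub>B N\<^sub>q \<rightarrow> M\<^sub>p\<^sub>,\<^sub>q\<close> are injective. They intertwine the
 differentials up to the sign \<open>(-1)\<^sup>p\<close>, so flatness identifies the first page with \<open>\<Omega>\<^sub>B\<^sup>p \<otimes>\<^sub>B H\<^sup>q(N)\<close>. The filtration is
 finite in each degree, which gives convergence.\<close>

section \<open>Complex vector spaces\<close>

text \<open>The obstacle is the twist \<open>\<xi>.x = x.(\<xi> \<lhd> x)\<close>: forms are stored
  as sums of \<open>x.\<xi>\<close>, while the right module structure and the fibre forms need the
  coefficients on the other side. The maps \<open>R z\<close>, with
  \<open>f = \<Sum> (R z f).z\<close>, change sides. In these coefficients multiplication by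
  \<open>1.\<xi>\<close> from the left is the plain wedge product, so the filtration can be tested
  in the exterior algebra of \<open>V\<close>. There \<open>V\<close> may have infinite dimension;
  finite bases come from \<open>W\<close>, spanned by the finite image of \<open>G\<close> under
  \<open>\<omega>\<close>, and contraction avoids a basis of \<Lambda>V adapted to the splitting.
  The basis forms \<open>1.\<xi>\<close> are closed because \<open>\<omega> 1 = 0\<close>, which
  makes coordinates compatible with d. The bundle and its spectral sequence are treated in the
  locale \<open>split_bundle\<close>, where groups no longer occur. The connection and the braiding
  are prescribed on generators only, and the extension of the braiding is an arbitrary choice, so
  all of them must be shown to be determined before anything can be computed.\<close>

lemma complex_ring_simps [simp]:
 "car complex_ring = UNIV" "mult complex_ring = (*)" "one complex_ring = 1"
 "zero complex_ring = 0" "add complex_ring = (+)"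
 by (simp_all add: complex_ring_def)

lemma cring_complex_ring: "cring complex_ring"
proof (rule cringI)
 show "abelian_group complex_ring"
 proof (rule abelian_groupI)
  show "EX y:car complex_ring. y +[complex_ring] x = 0[complex_ring]" for x
   by (rule bexI[of _ "- x"]) auto
 qed auto
qed (auto intro!: comm_monoidI simp: algebra_simps)

text \<open>The law \<open>0 \<odot> x = \<zero>\<close> stands in for additive inverses: with
  distributivity it makes \<open>(-1) \<odot> x\<close> the inverse of \<open>x\<close>.\<close>

lemma cvsI:
 fixes V (structure)
 assumes zero: "\<zero> : car V"
  and add: "!!x y. x:car V ==> y:car V ==> x \<oplus> y:car V"
  and assoc: "!!x y z. x:car V ==> y:car V ==> z:car V ==> x \<oplus> y \<oplus> z = x \<oplus> (y \<oplus> z)"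
  and comm: "!!x y. x:car V ==> y:car V ==> x \<oplus> y = y \<oplus> x"
  and l_zero: "!!x. x:car V ==> \<zero> \<oplus> x = x"
  and smult: "!!c x. x:car V ==> c \<odot> x:car V"
  and l_distr: "!!c d x. x:car V ==> (c + d) \<odot> x = c \<odot> x \<oplus> d \<odot> x"
  and r_distr: "!!c x y. x:car V ==> y:car V ==> c \<odot> (x \<oplus> y) = c \<odot> x \<oplus> c \<odot> y"
  and smult_assoc: "!!c d x. x:car V ==> (c * d) \<odot> x = c \<odot> (d \<odot> x)"
  and smult_one: "!!x. x:car V ==> 1 \<odot> x = x"
  and smult_zero: "!!x. x:car V ==> 0 \<odot> x = \<zero>"
 shows "cvs V"
proof (rule moduleI)
 show "abelian_group V"
 proof (rule abelian_groupI)
  fix x assume x: "x:car V"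
  have "(-1) \<odot> x \<oplus> 1 \<odot> x = \<zero>"
   using x l_distr[of x "-1" 1] by (simp add: smult_zero)
  thus "EX y:car V. y \<oplus> x = \<zero>" using x smult smult_one by auto
 qed (use assms in auto)
qed (use assms cring_complex_ring in auto)

context
 fixes V (structure)
 assumes V: "cvs V"
begin

interpretation M: Module.module complex_ring V by (rule V)

lemma cvs_abelian: "abelian_group V" by (rule M.abelian_group_axioms)
lemma zero_cl: "\<zero> : car V" by simp
lemma add_cl: "x:car V ==> y:car V ==> x \<oplus> y:car V" by simp
lemma smult_cl: "x:car V ==> c \<odot> x:car V" by simp
lemma cvs_l_zero: "x:car V ==> \<zero> \<oplus> x = x" by simp
lemma cvs_r_zero: "x:car V ==> x \<oplus> \<zero> = x" by simp
lemma cvs_add_assoc: "x:car V ==> y:car V ==> z:car V ==> x \<oplus> y \<oplus> z = x \<oplus> (y \<oplus> z)"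
 by (rule M.a_assoc)
lemma cvs_add_comm: "x:car V ==> y:car V ==> x \<oplus> y = y \<oplus> x"
 by (rule M.a_comm)
lemma cvs_smult_add: "x:car V ==> y:car V ==> c \<odot> (x \<oplus> y) = c \<odot> x \<oplus> c \<odot> y"
 using M.smult_r_distr by simp
lemma cvs_add_smult: "x:car V ==> (c + d) \<odot> x = c \<odot> x \<oplus> d \<odot> x"
 using M.smult_l_distr by simp
lemma cvs_smult_smult: "x:car V ==> c \<odot> (d \<odot> x) = (c * d) \<odot> x"
 using M.smult_assoc1 by simp
lemma cvs_smult_one: "x:car V ==> 1 \<odot> x = x" using M.smult_one by simp
lemma cvs_zero_smult: "x:car V ==> 0 \<odot> x = \<zero>" using M.smult_l_null by simp
lemma cvs_smult_zero: "c \<odot> \<zero> = \<zero>" using M.smult_r_null by simp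
lemma cvs_finsum_closed: "f:I \<rightarrow> car V ==> (\<Oplus>i\<in>I. f i):car V"
 by (rule M.finsum_closed)

lemma cvs_minus: "x:car V ==> \<ominus> x = (-1) \<odot> x"
proof -
 assume x: "x:car V"
 have "x \<oplus> (-1) \<odot> x = \<zero>"
  using x cvs_add_smult[of x 1 "-1"] by (simp add: cvs_zero_smult cvs_smult_one)
 thus ?thesis using x M.minus_equality[of "(-1) \<odot> x" x]
  by (simp add: M.a_comm)
qed

lemma cvs_add_diff: "x:car V ==> y:car V ==> x \<oplus> y \<oplus> (-1) \<odot> x = y"
 by (metis M.a_comm M.add.inv_closed M.a_assoc M.l_zero M.r_neg cvs_minus)

lemma cvs_diff_add: "x:car V ==> y:car V ==> x \<oplus> (y \<oplus> (-1) \<odot> x) = y"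
 using cvs_add_diff[of x y] smult_cl[of x "-1"] by (simp add: M.a_assoc)

lemma cvs_add_left_imp_diff:
 "x:car V ==> y:car V ==> z = x \<oplus> y ==> y = z \<oplus> (-1) \<odot> x"
 using cvs_add_diff by simp

lemma cvs_diff_self: "x:car V ==> x \<oplus> (-1) \<odot> x = \<zero>"
 by (simp add: cvs_minus[symmetric] M.r_neg)

lemma cvs_diff_eq_zero:
 "x:car V ==> y:car V ==> x \<oplus> (-1) \<odot> y = \<zero> <-> x = y"
 by (metis M.a_comm M.add.inv_closed M.minus_equality M.minus_minus cvs_diff_self cvs_minus)

lemma csubspaceI:
 assumes "S <= car V" "\<zero> : S" "!!x y. x:S ==> y:S ==> x \<oplus> y:S"
  "!!c x. x:S ==> c \<odot> x:S"
 shows "csubspace S V"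
proof (rule M.submoduleI)
 fix a assume "a:S"
 thus "\<ominus> a:S" using assms(1,4) by (metis cvs_minus subsetD)
qed (use assms in auto)

lemma subD:
 assumes "csubspace S V"
 shows "S <= car V" "\<zero> : S" "!!x y. x:S ==> y:S ==> x \<oplus> y:S"
  "!!c x. x:S ==> c \<odot> x:S" "!!x. x:S ==> x:car V"
proof -
 note E = M.submoduleE[OF assms]
 show "S <= car V" "!!x y. x:S ==> y:S ==> x \<oplus> y:S"
  "!!c x. x:S ==> c \<odot> x:S" "!!x. x:S ==> x:car V" using E by auto
 obtain x where "x:S" using E(2) by auto
 hence "0 \<odot> x:S" "x:car V" using E by auto
 thus "\<zero> : S" by (simp add: cvs_zero_smult)
qed

lemma csubspace_carrier: "csubspace (car V) V" by (rule M.carrier_is_submodule)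

lemma csubspace_zero: "csubspace {\<zero>} V"
 by (rule csubspaceI) (auto simp: cvs_smult_zero)

lemma sub_cvs: "csubspace S V ==> cvs (V(|carrier := S|))"
 by (rule submodule.submodule_is_module) (auto intro: V)

lemma csubspace_sum_closed:
 assumes S: "csubspace S V" and "!!i. i:I ==> f i:S"
 shows "(\<Oplus>i\<in>I. f i):S"
 using assms(2)
proof (induction I rule: infinite_finite_induct)
 case (insert i I)
 thus ?case using subD[OF S] by (simp add: Pi_def)
qed (use subD(2)[OF S] in auto)

lemma csubspace_add_cancel:
 assumes S: "csubspace S V" and "x:S" "y:car V"
 shows "x \<oplus> y:S <-> y:S" "y \<oplus> x:S <-> y:S"
proof -
 have "y = (x \<oplus> y) \<oplus> (-1) \<odot> x"
  using assms subD(5)[OF S] by (simp add: cvs_add_diff)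
 thus *: "x \<oplus> y:S <-> y:S"
  using subD[OF S] assms by metis
 show "y \<oplus> x:S <-> y:S" using * assms subD(5)[OF S]
  by (simp add: cvs_add_comm)
qed

lemma csubspace_Inter:
 assumes "!!H. H : \<H> ==> csubspace H V" "\<H> ~= {}"
 shows "csubspace (\<Inter>\<H>) V"
proof (rule csubspaceI)
 obtain H where H: "H : \<H>" using assms(2) by auto
 show "\<Inter>\<H> <= car V" using H subD(1)[OF assms(1)[OF H]] by auto
qed (use subD(2-4)[OF assms(1)] in auto)

lemma cspan_sub: "S <= car V ==> csubspace (cspan V S) V"
 unfolding cspan_def by (rule csubspace_Inter) (use csubspace_carrier in auto)

lemma cspan_minimal: "csubspace H V ==> S <= H ==> cspan V S <= H"
 by (auto simp: cspan_def)

lemma cspan_superset: "S <= cspan V S"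
 by (auto simp: cspan_def)

lemma cspan_base: "s:S ==> s:cspan V S"
 using cspan_superset by auto

lemma cspan_mono: "S <= T ==> cspan V S <= cspan V T"
 by (auto simp: cspan_def)

lemma cspan_induct [consumes 3, case_names zero base add smult]:
 assumes x: "x:cspan V S" and S: "S <= car V"
  and "P \<zero>" "!!s. s:S ==> P s"
  and "!!x y. x:cspan V S ==> y:cspan V S ==> P x ==> P y ==> P (x \<oplus> y)"
  and "!!c x. x:cspan V S ==> P x ==> P (c \<odot> x)"
 shows "P x"
proof -
 note D = subD[OF cspan_sub[OF S]]
 have "csubspace {x:cspan V S. P x} V"
  by (rule csubspaceI) (use D assms(3-) in auto)
 moreover have "S <= {x:cspan V S. P x}"
  using cspan_superset assms(4) by auto
 ultimately have "cspan V S <= {x:cspan V S. P x}" by (rule cspan_minimal)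
 thus ?thesis using x by auto
qed

lemma cspan_singleton: "x:car V ==> cspan V {x} = range (%c. c \<odot> x)"
proof
 assume x: "x:car V"
 have "csubspace (range (%c. c \<odot> x)) V"
 proof (rule csubspaceI)
  show "\<zero> : range (%c. c \<odot> x)" using cvs_zero_smult[OF x] by (metis rangeI)
 qed (use x in "auto simp: cvs_smult_smult cvs_add_smult[symmetric]")
 thus "cspan V {x} <= range (%c. c \<odot> x)"
  using cspan_minimal x cvs_smult_one[OF x] by (metis empty_subsetI insert_subset rangeI)
 show "range (%c. c \<odot> x) <= cspan V {x}"
  using subD(4)[OF cspan_sub, of "{x}"] cspan_base[of x "{x}"] x by auto
qed

lemma csubspace_add:
 assumes S: "csubspace S V" and T: "csubspace T V"
 shows "csubspace (S <+>\<^bsub>V\<^esub> T) V"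
proof (rule csubspaceI)
 note DS = subD[OF S] and DT = subD[OF T]
 have mem: "z:S <+>\<^bsub>V\<^esub> T <-> (EX s:S. EX t:T. z = s \<oplus> t)" for z
  by (auto simp: set_add_def set_mult_def)
 show "S <+>\<^bsub>V\<^esub> T <= car V" using DS DT by (auto simp: mem)
 show "\<zero> : S <+>\<^bsub>V\<^esub> T" unfolding mem using DS(2) DT(2) by (metis M.l_zero M.zero_closed)
 show "x \<oplus> y:S <+>\<^bsub>V\<^esub> T" if x: "x:S <+>\<^bsub>V\<^esub> T" and y: "y:S <+>\<^bsub>V\<^esub> T" for x y
 proof -
  obtain s t s' t' where *: "s:S" "t:T" "x = s \<oplus> t" "s':S" "t':T" "y = s' \<oplus> t'"
   using x y by (auto simp: mem)
  hence "x \<oplus> y = (s \<oplus> s') \<oplus> (t \<oplus> t')"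
   using DS(5) DT(5) by (simp add: M.a_ac)
  thus ?thesis unfolding mem using * DS(3) DT(3) by blast
 qed
 show "c \<odot> x:S <+>\<^bsub>V\<^esub> T" if x: "x:S <+>\<^bsub>V\<^esub> T" for c x
  using x DS(4,5) DT(4,5) unfolding mem by (metis cvs_smult_add)
qed

text \<open>By Zorn's lemma there is a maximal subspace that contains \<open>T0\<close> and meets
  \<open>S\<close> only in 0; it is a complement of \<open>S\<close>. Being able to prescribe
  \<open>T0\<close> is what produces functionals vanishing on a given subspace.\<close>

lemma complement_extension:
 assumes S: "csubspace S V" and T0: "csubspace T0 V" and ST0: "S \<inter> T0 = {\<zero>}"
 shows "EX T. csubspace T V & T0 <= T & S \<inter> T = {\<zero>} &
  (ALL x:car V. EX s:S. EX t:T. x = s \<oplus> t)"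
proof -
 define \<T> where "\<T> = {T. csubspace T V & T0 <= T & S \<inter> T = {\<zero>}}"
 have "EX T:\<T>. ALL T':\<T>. T <= T' --> T' = T"
 proof (rule subset_Zorn_nonempty)
  show "\<T> ~= {}" using T0 ST0 by (auto simp: \<T>_def)
  fix \<C> assume ne: "\<C> ~= {}" and chain: "subset.chain \<T> \<C>"
  have sub: "csubspace T V" "T0 <= T" "S \<inter> T = {\<zero>}" if "T : \<C>" for T
   using chain that by (auto simp: \<T>_def subset.chain_def)
  have "csubspace (\<Union>\<C>) V"
  proof (rule csubspaceI)
   fix x y assume "x : \<Union>\<C>" "y : \<Union>\<C>"
   then obtain T1 T2 where "T1 : \<C>" "T2 : \<C>" "x:T1" "y:T2" by auto
   moreover have "T1 <= T2 \<or> T2 <= T1"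
    using chain calculation unfolding subset.chain_def by blast
   ultimately obtain T where "T : \<C>" "x:T" "y:T" by auto
   thus "x \<oplus> y : \<Union>\<C>" using subD(3)[OF sub(1)] by blast
  next
   show "\<zero> : \<Union>\<C>" using ne subD(2)[OF sub(1)] by auto
  next
   show "\<Union>\<C> <= car V" using subD(1)[OF sub(1)] by auto
  qed (use subD(4)[OF sub(1)] in auto)
  moreover have "T0 <= \<Union>\<C>" using ne sub(2) by auto
  moreover have "S \<inter> \<Union>\<C> = {\<zero>}"
  proof -
   have "S \<inter> \<Union>\<C> = (\<Union>T\<in>\<C>. S \<inter> T)" by auto
   also have "... = (\<Union>T\<in>\<C>. {\<zero>})" using sub(3) by simp
   finally show ?thesis using ne by auto
  qed
  ultimately show "\<Union>\<C> : \<T>" by (simp add: \<T>_def)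
 qed
 then obtain T where T: "csubspace T V" "T0 <= T" "S \<inter> T = {\<zero>}"
  and max: "!!T'. csubspace T' V ==> S \<inter> T' = {\<zero>} ==> T <= T' ==> T' = T"
  unfolding \<T>_def by (auto dest: order_trans)
 note DS = subD[OF S] and DT = subD[OF T(1)]
 \<comment> \<open>If \<open>x\<close> is outside S + T, adjoin it to \<open>T\<close>: by
   maximality the larger space contains a nonzero element \<open>s = t + c x\<close> of
   \<open>S\<close>, and \<open>c \<noteq> 0\<close> allows solving for \<open>x\<close>.\<close>
 have "EX s:S. EX t:T. x = s \<oplus> t" if x: "x:car V" for x
 proof (rule ccontr)
  assume no: "\<not> ?thesis"
  define T' where "T' = T <+>\<^bsub>V\<^esub> cspan V {x}"
  have mem: "z:T' <-> (EX t:T. EX c. z = t \<oplus> c \<odot> x)" for z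
   using x by (auto simp: T'_def set_add_def set_mult_def cspan_singleton)
  have T': "csubspace T' V"
   unfolding T'_def using x by (intro csubspace_add T cspan_sub) auto
  have TT': "T <= T'"
  proof
   fix t assume t: "t:T"
   hence "t = t \<oplus> 0 \<odot> x" using x DT(5) by (simp add: cvs_zero_smult)
   thus "t:T'" unfolding mem using t by blast
  qed
  have "x:T'"
   unfolding mem using DT(2) x by (metis M.l_zero cvs_smult_one)
  moreover have "x \<notin> T" using no DS(2) x by (metis M.l_zero)
  ultimately have "S \<inter> T' ~= {\<zero>}" using max[OF T' _ TT'] by auto
  moreover have "\<zero> : S \<inter> T'" using DS(2) DT(2) TT' by auto
  ultimately obtain s where s: "s:S" "s:T'" "s ~= \<zero>" by auto
  then obtain t c where t: "t:T" "s = t \<oplus> c \<odot> x" by (auto simp: mem)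
  have "c ~= 0"
  proof
   assume "c = 0"
   hence "s = t" using t DT(5) x by (simp add: cvs_zero_smult)
   thus False using s t T(3) by auto
  qed
  have "c \<odot> x = s \<oplus> (-1) \<odot> t"
   using t x DT(5) by (intro cvs_add_left_imp_diff) auto
  hence "(inverse c * c) \<odot> x = inverse c \<odot> (s \<oplus> (-1) \<odot> t)"
   using x by (simp add: cvs_smult_smult[symmetric])
  hence "x = inverse c \<odot> s \<oplus> inverse c \<odot> ((-1) \<odot> t)"
   using \<open>c ~= 0\<close> x s t DS(5) DT(5) by (simp add: cvs_smult_one cvs_smult_add)
  thus False using no s t DS(4) DT(4) by blast
 qed
 thus ?thesis using T by blast
qed

end

lemmas cvs_abelian_monoid = abelian_group.axioms(1)[OF cvs_abelian]
lemmas cvs_finsum_cong = abelian_monoid.finsum_cong'[OF cvs_abelian_monoid refl]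
lemmas cvs_finsum_zero = abelian_monoid.finsum_zero[OF cvs_abelian_monoid]
lemmas cvs_finsum_reindex = abelian_monoid.finsum_reindex[OF cvs_abelian_monoid]

text \<open>Many records below differ only in fields that are irrelevant for linear algebra
  (quotients, bimodules, forms of one degree). Linear statements are transported along equality of
  the four fields that matter.\<close>

lemma cvs_cong:
 fixes V :: "(complex, 'v, 'y) module_scheme" and W :: "(complex, 'v, 'z) module_scheme"
 assumes "cvs V" "car W = car V" "zero W = zero V" "add W = add V" "smult W = smult V"
 shows "cvs W"
 using assms(2-) by (intro cvsI)
  (auto simp: zero_cl[OF assms(1)] add_cl[OF assms(1)] smult_cl[OF assms(1)]
   cvs_l_zero[OF assms(1)] cvs_add_assoc[OF assms(1)] cvs_add_smult[OF assms(1)]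
   cvs_smult_add[OF assms(1)] cvs_smult_smult[OF assms(1)] cvs_smult_one[OF assms(1)]
   cvs_zero_smult[OF assms(1)] intro: cvs_add_comm[OF assms(1)])

lemma csubspace_cong:
 fixes V :: "(complex, 'v, 'y) module_scheme" and W :: "(complex, 'v, 'z) module_scheme"
 assumes V: "cvs V" and "car W = car V" "zero W = zero V" "add W = add V" "smult W = smult V"
 shows "csubspace S W <-> csubspace S V"
proof -
 have W: "cvs W" using assms by (rule cvs_cong)
 show ?thesis
 proof
  assume "csubspace S W"
  note D = subD[OF W this, unfolded assms(2-)]
  show "csubspace S V" by (rule csubspaceI[OF V]) (use D in auto)
 next
  assume "csubspace S V"
  note D = subD[OF V this]
  show "csubspace S W" by (rule csubspaceI[OF W]) (use D in "auto simp: assms(2-)")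
 qed
qed

lemma cspan_cong:
 fixes V :: "(complex, 'v, 'y) module_scheme" and W :: "(complex, 'v, 'z) module_scheme"
 assumes "cvs V" "car W = car V" "zero W = zero V" "add W = add V" "smult W = smult V"
 shows "cspan W S = cspan V S"
 by (simp add: cspan_def csubspace_cong[OF assms])

lemma csubspace_of_subspace:
 assumes V: "cvs V" and S: "csubspace S V" "T <= S"
 shows "csubspace T (V(|carrier := S|)) <-> csubspace T V"
proof
 assume "csubspace T (V(|carrier := S|))"
 note D = subD[OF sub_cvs[OF V S(1)] this]
 show "csubspace T V"
  by (rule csubspaceI[OF V]) (use D subD[OF V S(1)] in auto)
next
 assume "csubspace T V"
 note D = subD[OF V this]
 show "csubspace T (V(|carrier := S|))"
  by (rule csubspaceI[OF sub_cvs[OF V S(1)]]) (use D S(2) in auto)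
qed

lemma cspan_of_subspace:
 assumes V: "cvs V" and S: "csubspace S V" "T <= S"
 shows "cspan (V(|carrier := S|)) T = cspan V T"
proof
 note VS = sub_cvs[OF V S(1)]
 have T: "T <= car V" using S subD(1)[OF V S(1)] by auto
 have "cspan V T <= S" using cspan_minimal[OF V S] .
 thus "cspan (V(|carrier := S|)) T <= cspan V T"
  using cspan_minimal[OF VS _ cspan_superset[OF V]] csubspace_of_subspace[OF V S(1)] cspan_sub[OF V T] by blast
 have sp: "csubspace (cspan (V(|carrier := S|)) T) (V(|carrier := S|))"
  using cspan_sub[OF VS] S(2) by simp
 have "cspan (V(|carrier := S|)) T <= S" using subD(1)[OF VS sp] by simp
 thus "cspan V T <= cspan (V(|carrier := S|)) T"
  using cspan_minimal[OF V _ cspan_superset[OF VS]] csubspace_of_subspace[OF V S(1)] sp by blast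
qed

section \<open>Linear maps\<close>

lemma linI:
 assumes "!!x. x:car V ==> f x:car W"
  "!!x y. x:car V ==> y:car V ==> f (x +[V] y) = f x +[W] f y"
  "!!c x. x:car V ==> f (c *[V] x) = c *[W] f x"
 shows "f:lin V W"
 using assms by (auto simp: linear_maps_def)

lemma linD:
 assumes "f:lin V W"
 shows lin_cl: "x:car V ==> f x:car W"
  and linear_add: "x:car V ==> y:car V ==> f (x +[V] y) = f x +[W] f y"
  and linear_smult: "x:car V ==> f (c *[V] x) = c *[W] f x"
 using assms by (auto simp: linear_maps_def)

lemma lin_zero:
 assumes "cvs V" "cvs W" "f:lin V W"
 shows "f 0[V] = 0[W]"
 using linear_smult[OF assms(3), of "0[V]" 0] zero_cl[OF assms(1)] lin_cl[OF assms(3)]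
 by (simp add: cvs_zero_smult[OF assms(1)] cvs_zero_smult[OF assms(2)])

lemma lin_finsum:
 assumes V: "cvs V" and W: "cvs W" and f: "f:lin V W" and "!!i. i:I ==> g i:car V"
 shows "f (finsum V (%i. g i) I) = (finsum W (%i. f (g i)) I)"
proof -
 interpret V: abelian_group V by (rule cvs_abelian[OF V])
 interpret W: abelian_group W by (rule cvs_abelian[OF W])
 show ?thesis using assms(4)
 proof (induction I rule: infinite_finite_induct)
  case (insert i I)
  thus ?case using lin_cl[OF f] by (simp add: Pi_def linear_add[OF f])
 qed (auto simp: lin_zero[OF V W f])
qed

lemma lin_comp:
 "f:lin U V ==> g:lin V W ==> (%x. g (f x)):lin U W"
 by (auto simp: linear_maps_def Pi_iff)

lemma linear_id: "(%x. x):lin V V"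
 by (auto simp: linear_maps_def)

lemma linear_zero_map: "cvs W ==> (%x. 0[W]):lin V W"
 by (auto simp: linear_maps_def zero_cl cvs_l_zero cvs_smult_zero)

lemma linear_plus:
 assumes W: "cvs W" and f: "f:lin V W" and g: "g:lin V W"
 shows "(%x. f x +[W] g x):lin V W"
proof -
 interpret W: abelian_group W by (rule cvs_abelian[OF W])
 show ?thesis
  by (rule linI)
   (simp_all add: linD[OF f] linD[OF g] W.a_ac cvs_smult_add[OF W])
qed

lemma linear_scale:
 assumes W: "cvs W" and f: "f:lin V W"
 shows "(%x. c *[W] f x):lin V W"
 by (rule linI) (simp_all add: linD[OF f] smult_cl[OF W] cvs_smult_add[OF W]
   cvs_smult_smult[OF W] mult.commute)

lemma linear_restrict:
 "f:lin V W ==> S <= car V ==> f:lin (V(|carrier := S|)) W"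
 by (rule linI) (auto simp: linD subset_iff)

lemma linear_corestrict:
 "f:lin V W ==> f ` car V <= S ==> f:lin V (W(|carrier := S|))"
 by (auto simp: linear_maps_def)

lemma linear_cong:
 "f:lin V W ==> cvs V ==> (!!x. x:car V ==> g x = f x) ==> g:lin V W"
 by (rule linI) (simp_all add: linD add_cl smult_cl)

lemma lin_eq_cspan:
 assumes V: "cvs V" and W: "cvs W" and f: "f:lin V W" and g: "g:lin V W"
  and S: "S <= car V" "!!s. s:S ==> f s = g s" and x: "x:cspan V S"
 shows "f x = g x"
proof -
 note cl = subD(5)[OF V cspan_sub[OF V S(1)]]
 from V x S(1) show ?thesis
  by (induction rule: cspan_induct)
   (simp_all add: lin_zero[OF V W f] lin_zero[OF V W g] S cl linD[OF f] linD[OF g])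
qed

lemma lin_vimage:
 assumes V: "cvs V" and W: "cvs W" and f: "f:lin V W" and T: "csubspace T W"
 shows "csubspace {x:car V. f x:T} V"
 by (rule csubspaceI[OF V])
  (auto simp: zero_cl[OF V] add_cl[OF V] smult_cl[OF V]
   lin_zero[OF V W f] linD[OF f] subD[OF W T])

lemma linear_kernel_subspace:
 assumes V: "cvs V" and W: "cvs W" and f: "f:lin V W"
 shows "csubspace {x:car V. f x = 0[W]} V"
 using lin_vimage[OF assms csubspace_zero[OF W]] by simp

lemma linear_image_subspace:
 assumes V: "cvs V" and W: "cvs W" and f: "f:lin V W" and S: "csubspace S V"
 shows "csubspace (f ` S) W"
proof (rule csubspaceI[OF W])
 note D = subD[OF V S]
 show "f ` S <= car W" using D lin_cl[OF f] by auto
 show "0[W]:f ` S" using D(2) lin_zero[OF V W f] by force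
 show "x +[W] y:f ` S" if "x:f ` S" "y:f ` S" for x y
  using that D linear_add[OF f] by (auto simp: image_iff) metis
 show "c *[W] x:f ` S" if "x:f ` S" for c x
  using that D linear_smult[OF f] by (auto simp: image_iff) metis
qed

lemma linear_image_cspan:
 assumes V: "cvs V" and W: "cvs W" and f: "f:lin V W" and S: "S <= car V"
 shows "f ` cspan V S = cspan W (f ` S)"
proof
 have fS: "f ` S <= car W" using S lin_cl[OF f] by auto
 have "cspan V S <= {x:car V. f x:cspan W (f ` S)}"
  using S by (intro cspan_minimal[OF V] lin_vimage[OF V W f] cspan_sub[OF W] fS)
   (auto intro: cspan_base[OF W])
 thus "f ` cspan V S <= cspan W (f ` S)" by auto
 show "cspan W (f ` S) <= f ` cspan V S"
  by (intro cspan_minimal[OF W] linear_image_subspace[OF V W f] cspan_sub[OF V] S)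
   (auto intro: cspan_base[OF V])
qed

lemma linear_injI:
 assumes V: "cvs V" and W: "cvs W" and f: "f:lin V W"
  and ker: "!!x. x:car V ==> f x = 0[W] ==> x = 0[V]"
 shows "inj_on f (car V)"
proof (rule inj_onI)
 fix x y assume xy: "x:car V" "y:car V" "f x = f y"
 hence "f (x +[V] (-1) *[V] y) = 0[W]"
  by (simp add: linD[OF f] smult_cl[OF V] cvs_diff_self[OF W])
 hence "x +[V] (-1) *[V] y = 0[V]"
  using xy by (intro ker) (auto intro: add_cl[OF V] smult_cl[OF V])
 thus "x = y" using xy by (simp add: cvs_diff_eq_zero[OF V])
qed

lemma linear_inv:
 assumes V: "cvs V" and f: "f:lin V W" "bij_betw f (car V) (car W)"
 shows "inv_into (car V) f:lin W V"
proof -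
 let ?g = "inv_into (car V) f"
 have g: "f (?g y) = y" "?g y:car V" if "y:car W" for y
  using that f(2) by (auto simp: bij_betw_def f_inv_into_f inv_into_into)
 have gf: "?g (f x) = x" if "x:car V" for x
  using that f(2) by (simp add: bij_betw_def)
 show ?thesis
 proof (rule linI)
  fix x y assume "x:car W" "y:car W"
  thus "?g (x +[W] y) = ?g x +[V] ?g y"
   using gf[of "?g x +[V] ?g y"] g by (simp add: linD[OF f(1)] add_cl[OF V])
 next
  fix c x assume "x:car W"
  thus "?g (c *[W] x) = c *[V] ?g x"
   using gf[of "c *[V] ?g x"] g by (simp add: linD[OF f(1)] smult_cl[OF V])
 qed (use g in auto)
qed

lemma isomorphic_sym: "cvs V ==> isomorphic V W ==> isomorphic W V"
 unfolding isomorphic_def linear_iso_def using linear_inv bij_betw_inv_into by blast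

lemma isomorphic_trans: "isomorphic U V ==> isomorphic V W ==> isomorphic U W"
 unfolding isomorphic_def linear_iso_def
 using lin_comp bij_betw_trans unfolding comp_def by blast

lemma isomorphic_refl: "isomorphic V V"
 unfolding isomorphic_def linear_iso_def
 by (rule exI[of _ "%x. x"]) (simp add: linear_id bij_betw_def)

text \<open>The scalars as a vector space, the target of linear functionals;
  \<open>complex_ring\<close> has no scalar multiplication.\<close>

definition complex_vs :: "(complex, complex) module" where
 "complex_vs = (|carrier = UNIV, mult = (*), one = 1, zero = 0, add = (+), smult = (*)|)"

lemma complex_vs_simps [simp]:
 "car complex_vs = UNIV" "zero complex_vs = 0" "add complex_vs = (+)" "smult complex_vs = (*)"
 by (simp_all add: complex_vs_def)

lemma cvs_complex_vs: "cvs complex_vs"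
 by (rule cvsI) (auto simp: algebra_simps)

lemma finsum_complex_vs: "(finsum complex_vs (%i. f i) I) = (\<Sum>i\<in>I. f i)"
proof -
 interpret abelian_group complex_vs by (rule cvs_abelian[OF cvs_complex_vs])
 show ?thesis by (induction I rule: infinite_finite_induct) (auto simp: Pi_def)
qed

lemma func_simps:
 assumes "f:lin V complex_vs"
 shows "x:car V ==> y:car V ==> f (x +[V] y) = f x + f y"
  "x:car V ==> f (c *[V] x) = c * f x"
 using linD[OF assms] by auto

lemma functional_finsum:
 assumes "cvs V" "f:lin V complex_vs" "!!i. i:I ==> g i:car V"
 shows "f (finsum V (%i. g i) I) = (\<Sum>i\<in>I. f (g i))"
 using lin_finsum[OF assms(1) cvs_complex_vs assms(2,3)] by (simp add: finsum_complex_vs)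

text \<open>Stated for a definite description given from outside, so that it serves both
  \<open>projection\<close> and the auxiliary projection onto a line in
  \<open>separating_functional\<close>. Trivial intersection gives uniqueness of the decomposition,
  and uniqueness gives linearity.\<close>

lemma complementary_projection:
 assumes V: "cvs V" and S: "csubspace S V" and T: "csubspace T V"
  and int: "S \<inter> T <= {0[V]}" and p_def: "!!v. p v = (THE s. s:S & (EX t:T. v = s +[V] t))"
  and sum: "!!v. v:car V ==> EX s:S. EX t:T. v = s +[V] t"
 shows "p:lin V V" "v:car V ==> p v:S"
  "s:S ==> t:T ==> p (s +[V] t) = s"
proof -
 interpret AG: abelian_group V by (rule cvs_abelian[OF V])
 note SD = subD[OF V S] and TD = subD[OF V T]
 have uniq: "s = s'" if "s:S" "s':S" "t:T" "t':T" and e: "s +[V] t = s' +[V] t'" for s s' t t'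
 proof -
  note c = SD(5)[OF that(1)] SD(5)[OF that(2)] TD(5)[OF that(3)] TD(5)[OF that(4)]
  note m = smult_cl[OF V c(2), of "-1"] smult_cl[OF V c(3), of "-1"]
  have "s = (s' +[V] t') +[V] (-1) *[V] t"
   using e c by (intro cvs_add_left_imp_diff[OF V]) (auto simp: AG.a_comm)
  also have "... = (t' +[V] (-1) *[V] t) +[V] s'" using c m by (simp add: AG.a_ac)
  finally have "s +[V] (-1) *[V] s' = t' +[V] (-1) *[V] t"
   using c m cvs_add_left_imp_diff[OF V c(2) add_cl[OF V c(4) m(2)], of s]
   by (simp add: AG.a_comm)
  hence "s +[V] (-1) *[V] s':S \<inter> T"
   using SD(3)[OF that(1) SD(4)[OF that(2)]] TD(3)[OF that(4) TD(4)[OF that(3)]] by (metis IntI)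
  thus "s = s'" using int cvs_diff_eq_zero[OF V c(1,2)] by auto
 qed
 have p: "p (s +[V] t) = s" if "s:S" "t:T" for s t
  unfolding p_def using that uniq by (intro the_equality) blast+
 show "s:S ==> t:T ==> p (s +[V] t) = s" by (rule p)
 show m: "v:car V ==> p v:S" for v using sum[of v] p by auto
 show "p:lin V V"
 proof (rule linI)
  show "p v:car V" if "v:car V" for v using m[OF that] SD(5) by auto
  fix u assume "u:car V"
  then obtain s t where u: "s:S" "t:T" "u = s +[V] t" using sum by blast
  show "p (c *[V] u) = c *[V] p u" for c
   using p[OF SD(4)[OF u(1)] TD(4)[OF u(2)]] u SD(5) TD(5) by (simp add: p cvs_smult_add[OF V])
  fix v assume "v:car V"
  then obtain s' t' where v: "s':S" "t':T" "v = s' +[V] t'" using sum by blast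
  have "u +[V] v = (s +[V] s') +[V] (t +[V] t')"
   using u v SD(5)[OF u(1)] TD(5)[OF u(2)] SD(5)[OF v(1)] TD(5)[OF v(2)] by (simp add: AG.a_ac)
  thus "p (u +[V] v) = p u +[V] p v"
   using p[OF SD(3)[OF u(1) v(1)] TD(3)[OF u(2) v(2)]] u v by (simp add: p)
 qed
qed

text \<open>Take the coefficient of \<open>x\<close> in the projection onto the line through
  \<open>x\<close>, along a complement of this line that contains \<open>S\<close>.\<close>

lemma separating_functional:
 assumes V: "cvs V" and S: "csubspace S V" and x: "x:car V" "x \<notin> S"
 shows "EX phi:lin V complex_vs. phi x = 1 & (ALL s:S. phi s = 0)"
proof -
 have int: "cspan V {x} \<inter> T = {0[V]}" if T: "csubspace T V" and xT: "x \<notin> T" for T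
 proof -
  have "c *[V] x = 0[V]" if "c *[V] x:T" for c
  proof (cases "c = 0")
   case False
   have "inverse c *[V] (c *[V] x):T" using that subD(4)[OF V T] by blast
   thus ?thesis using False x xT by (simp add: cvs_smult_smult[OF V] cvs_smult_one[OF V])
  qed (simp add: cvs_zero_smult[OF V] x)
  moreover have "0[V]:cspan V {x}" "0[V]:T"
   using x subD(2)[OF V] cspan_sub[OF V, of "{x}"] T by auto
  ultimately show ?thesis by (auto simp: cspan_singleton[OF V x(1)])
 qed
 have sp: "csubspace (cspan V {x}) V" using x by (intro cspan_sub[OF V]) auto
 obtain T where T: "csubspace T V" "S <= T" "cspan V {x} \<inter> T = {0[V]}"
  and dec: "ALL y:car V. EX s:cspan V {x}. EX t:T. y = s +[V] t"
  using complement_extension[OF V sp S int[OF S x(2)]] by blast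
 note DT = subD[OF V T(1)]
 have xT: "x \<notin> T"
 proof
  assume "x:T"
  hence "x = 0[V]" using T(3) cspan_base[OF V, of x "{x}"] by auto
  thus False using subD(2)[OF V S] x(2) by simp
 qed
 define p where "p v = (THE s. s:cspan V {x} & (EX t:T. v = s +[V] t))" for v
 have p: "p:lin V V" "!!y. y:car V ==> p y:cspan V {x}" "!!s t. s:cspan V {x} ==> t:T ==> p (s +[V] t) = s"
  using complementary_projection[OF V sp T(1) _ p_def] T(3) dec by auto
 hence "ALL y:car V. EX c. p y = c *[V] x" using cspan_singleton[OF V x(1)] by fast
 then obtain phi where phi: "!!y. y:car V ==> p y = phi y *[V] x" by metis
 \<comment> \<open>Since \<open>x\<close> lies outside \<open>T\<close>, a multiple of
   \<open>x\<close> determines its coefficient; the properties of \<open>phi\<close> are then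
   checked after multiplying \<open>x\<close> by both sides.\<close>
 have inj: "c = c'" if "c *[V] x = c' *[V] x" for c c'
 proof (rule ccontr)
  assume ne: "c ~= c'"
  have "(c - c') *[V] x = c *[V] x +[V] (-1) *[V] (c' *[V] x)"
   using x by (simp add: cvs_smult_smult[OF V] cvs_add_smult[OF V, symmetric])
  hence "(c - c') *[V] x:T" using that DT(2) smult_cl[OF V x(1)] by (simp add: cvs_diff_self[OF V])
  hence "inverse (c - c') *[V] ((c - c') *[V] x):T" using DT by blast
  thus False using ne x xT by (simp add: cvs_smult_smult[OF V] cvs_smult_one[OF V])
 qed
 have "phi:lin V complex_vs"
 proof (rule linI)
  fix y z assume y: "y:car V" and z: "z:car V"
  show "phi (y +[V] z) = phi y +[complex_vs] phi z"
   using phi[OF add_cl[OF V y z]] x by (intro inj) (simp add: linD[OF p(1)] y z phi cvs_add_smult[OF V])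
 next
  fix c y assume y: "y:car V"
  show "phi (c *[V] y) = c *[complex_vs] phi y"
   using phi[OF smult_cl[OF V y]] x by (intro inj) (simp add: linD[OF p(1)] y phi cvs_smult_smult[OF V])
 qed auto
 moreover have "phi x = 1"
  using p(3)[OF cspan_base[OF V, of x "{x}"] DT(2)] phi x by (intro inj) (simp add: cvs_smult_one[OF V] cvs_r_zero[OF V])
 moreover have "phi s = 0" if "s:S" for s
  using p(3)[OF subD(2)[OF V sp], of s] phi[of s] that T(2) DT(5) x
  by (intro inj) (simp add: cvs_zero_smult[OF V] cvs_l_zero[OF V] subset_iff)
 ultimately show ?thesis by blast
qed

text \<open>Functionals separate points, since one of them is 1 on the nonzero difference. Used
  below for finite sums in an abstract space: both sides become sums of complex numbers, where
  reindexing and dropping zero terms are easy.\<close>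

lemma cvs_eqI:
 assumes V: "cvs V" and xy: "x:car V" "y:car V"
  and eq: "!!phi. phi:lin V complex_vs ==> phi x = phi y"
 shows "x = y"
proof (rule ccontr)
 assume "x ~= y"
 hence "x +[V] (-1) *[V] y \<notin> {0[V]}" using xy by (simp add: cvs_diff_eq_zero[OF V])
 then obtain phi where phi: "phi:lin V complex_vs" "phi (x +[V] (-1) *[V] y) = 1"
  using separating_functional[OF V csubspace_zero[OF V]] xy
  by (metis add_cl[OF V] smult_cl[OF V])
 thus False using eq[OF phi(1)] xy
  by (simp add: func_simps[OF phi(1)] smult_cl[OF V])
qed

section \<open>Quotients\<close>

lemma mem_coset_iff: "y:S +>\<^bsub>V\<^esub> x <-> (EX s:S. y = s +[V] x)"
 by (auto simp: a_r_coset_def')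

lemma coset_carrier_update [simp]: "S +>\<^bsub>V(|carrier := Z|)\<^esub> x = S +>\<^bsub>V\<^esub> x"
 by (simp add: a_r_coset_def')

lemma quot_simps [simp]:
 "car (quot V S) = (%x. S +>\<^bsub>V\<^esub> x) ` car V"
 "zero (quot V S) = S" "add (quot V S) = (%P Q. P <+>\<^bsub>V\<^esub> Q)"
 by (auto simp: quot_def A_RCOSETS_def')

lemma on_coset_eqI:
 assumes "x:U" "!!y. y:U ==> f y = z"
 shows "on_coset f U = z"
proof -
 have "f ` U = {z}" using assms by auto
 thus ?thesis by (simp add: on_coset_def)
qed

context
 fixes V (structure) and S
 assumes V: "cvs V" and S: "csubspace S V"
begin

lemma mem_own_coset: "x:car V ==> x:S +> x"
 using subD(2)[OF V S] cvs_l_zero[OF V] by (force simp: mem_coset_iff)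

lemma coset_mem_iff: "x:car V ==> y:car V ==> y:S +> x <-> y \<oplus> (-1) \<odot> x:S"
proof -
 assume xy: "x:car V" "y:car V"
 interpret abelian_group V by (rule cvs_abelian[OF V])
 have m: "(-1) \<odot> x:car V" using xy by (simp add: smult_cl[OF V])
 show ?thesis
 proof
  assume "y:S +> x"
  then obtain s where "s:S" "y = s \<oplus> x" by (auto simp: mem_coset_iff)
  thus "y \<oplus> (-1) \<odot> x:S"
   using cvs_add_diff[OF V, of x s] xy subD(5)[OF V S] by (simp add: a_comm)
 next
  assume "y \<oplus> (-1) \<odot> x:S"
  moreover have "y = (y \<oplus> (-1) \<odot> x) \<oplus> x"
   using cvs_diff_add[OF V, of x y] xy m by (simp add: a_comm)
  ultimately show "y:S +> x" by (auto simp: mem_coset_iff)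
 qed
qed

lemma coset_eq_iff:
 assumes "x:car V" "y:car V"
 shows "S +> x = S +> y <-> x \<oplus> (-1) \<odot> y:S"
proof
 assume "S +> x = S +> y"
 hence "x:S +> y" using mem_own_coset assms by auto
 thus "x \<oplus> (-1) \<odot> y:S" using coset_mem_iff assms by simp
next
 interpret abelian_group V by (rule cvs_abelian[OF V])
 note D = subD[OF V S]
 assume "x \<oplus> (-1) \<odot> y:S"
 hence "x:S +> y" using coset_mem_iff assms by simp
 then obtain s where s: "s:S" "x = s \<oplus> y" by (auto simp: mem_coset_iff)
 show "S +> x = S +> y"
 proof (rule Set.set_eqI)
  fix z
  show "z:S +> x <-> z:S +> y"
  proof
   assume "z:S +> x"
   then obtain t where "t:S" "z = t \<oplus> x" by (auto simp: mem_coset_iff)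
   hence "z = (t \<oplus> s) \<oplus> y" using s assms D(5) by (simp add: a_assoc)
   thus "z:S +> y" using D(3) \<open>t:S\<close> s(1) by (auto simp: mem_coset_iff)
  next
   assume "z:S +> y"
   then obtain t where t: "t:S" "z = t \<oplus> y" by (auto simp: mem_coset_iff)
   have c: "(-1) \<odot> s:S" using s D(4) by auto
   have "(t \<oplus> (-1) \<odot> s) \<oplus> (s \<oplus> y) = t \<oplus> ((s \<oplus> y) \<oplus> (-1) \<odot> s)"
    using s(1) t(1) c assms D(5) by (simp add: a_ac)
   also have "... = z" using s(1) t assms D(5) by (simp add: cvs_add_diff[OF V])
   finally have "z = (t \<oplus> (-1) \<odot> s) \<oplus> x" using s by simp
   thus "z:S +> x" using D(3) c t(1) by (auto simp: mem_coset_iff)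
  qed
 qed
qed

lemma coset_eqI:
 assumes "s:S" "y:car V" "x = s \<oplus> y"
 shows "S +> x = S +> y"
proof -
 interpret abelian_group V by (rule cvs_abelian[OF V])
 have "s:car V" using assms subD(5)[OF V S] by auto
 moreover have "x \<oplus> (-1) \<odot> y = s"
  using assms calculation cvs_add_diff[OF V, of y s] by (simp add: a_comm)
 ultimately show ?thesis using assms by (subst coset_eq_iff) auto
qed

lemma coset_eqE:
 assumes "S +> x = S +> y" "x:car V" "y:car V"
 obtains s where "s:S" "x = s \<oplus> y"
 using mem_own_coset[of x] assms by (auto simp: mem_coset_iff)

lemma coset_zero: "S +> \<zero> = S"
 using subD(1)[OF V S] cvs_r_zero[OF V] by (force simp: a_r_coset_def')

lemma coset_eq_zero_iff: "x:car V ==> S +> x = S <-> x:S"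
proof -
 assume x: "x:car V"
 have "S +> x = S +> \<zero> <-> x:S"
  using x by (subst coset_eq_iff) (simp_all add: zero_cl[OF V] cvs_smult_zero[OF V] cvs_r_zero[OF V])
 thus ?thesis by (simp add: coset_zero)
qed

lemma coset_add:
 assumes "x:car V" "y:car V"
 shows "(S +> x) <+> (S +> y) = S +> (x \<oplus> y)"
proof -
 interpret abelian_group V by (rule cvs_abelian[OF V])
 note D = subD[OF V S]
 have "z:(S +> x) <+> (S +> y) <-> (EX u:S +> x. EX v:S +> y. z = u \<oplus> v)" for z
  by (auto simp: set_add_def set_mult_def)
 hence mem: "z:(S +> x) <+> (S +> y) <-> (EX s:S. EX t:S. z = (s \<oplus> x) \<oplus> (t \<oplus> y))" for z
  unfolding Bex_def mem_coset_iff by blast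
 have eq: "(s \<oplus> x) \<oplus> (t \<oplus> y) = (s \<oplus> t) \<oplus> (x \<oplus> y)" if "s:S" "t:S" for s t
  using that assms D(5) by (simp add: a_ac)
 show ?thesis
 proof (rule Set.set_eqI)
  fix z
  have "z:S +> (x \<oplus> y) <-> (EX s:S. EX t:S. z = (s \<oplus> t) \<oplus> (x \<oplus> y))"
   unfolding mem_coset_iff using D(2,3,5) by (metis r_zero)
  thus "z:(S +> x) <+> (S +> y) <-> z:S +> (x \<oplus> y)"
   unfolding mem using eq by auto
 qed
qed

lemma on_coset_eq:
 assumes "x:car V" "!!s. s:S ==> f (s \<oplus> x) = f x"
 shows "on_coset f (S +> x) = f x"
 by (rule on_coset_eqI[OF mem_own_coset[OF assms(1)]]) (use assms(2) in "auto simp: mem_coset_iff")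

lemma quot_smult:
 assumes "x:car V"
 shows "c *[quot V S] (S +> x) = S +> (c \<odot> x)"
proof -
 note D = subD[OF V S]
 have "on_coset (%v. S +> (c \<odot> v)) (S +> x) = S +> (c \<odot> x)"
 proof (rule on_coset_eq[OF assms])
  fix s assume s: "s:S"
  show "S +> c \<odot> (s \<oplus> x) = S +> c \<odot> x"
   by (rule coset_eqI[of "c \<odot> s"])
    (use s assms D in "auto simp: cvs_smult_add[OF V] smult_cl[OF V]")
 qed
 thus ?thesis by (simp add: quot_def)
qed

lemma cvs_quot: "cvs (quot V S)"
proof -
 interpret abelian_group V by (rule cvs_abelian[OF V])
 show ?thesis
 proof (rule cvsI)
  show "0[quot V S]:car (quot V S)"
   using zero_cl[OF V] coset_zero by (auto intro!: image_eqI)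
 next
  fix P Q assume "P:car (quot V S)" "Q:car (quot V S)"
  thus "P +[quot V S] Q = Q +[quot V S] P"
   by (auto simp: coset_add a_comm)
 next
  fix P assume "P:car (quot V S)"
  then obtain x where "x:car V" "P = S +> x" by auto
  thus "0[quot V S] +[quot V S] P = P"
   using coset_add[of "\<zero>" x] by (simp add: coset_zero)
 qed (auto simp: coset_add quot_smult smult_cl[OF V] a_assoc
   cvs_smult_add[OF V] cvs_add_smult[OF V] cvs_smult_smult[OF V] cvs_smult_one[OF V]
   cvs_zero_smult[OF V] coset_zero)
qed

lemma quot_class_linear: "(%x. S +> x):lin V (quot V S)"
 by (rule linI) (auto simp: coset_add quot_smult)

text \<open>The universal property of the quotient; maps out of tensor products and exterior
  algebras are built on it.\<close>

lemma on_coset_linear: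
 assumes W: "cvs W" and f: "f:lin V W" and 0: "!!s. s:S ==> f s = 0[W]"
 shows "on_coset f:lin (quot V S) W" "!!x. x:car V ==> on_coset f (S +> x) = f x"
proof -
 show *: "on_coset f (S +> x) = f x" if "x:car V" for x
  by (rule on_coset_eq[OF that])
   (use that subD(5)[OF V S] in "simp add: linear_add[OF f] 0 cvs_l_zero[OF W] lin_cl[OF f]")
 show "on_coset f:lin (quot V S) W"
  by (rule linI)
   (auto simp: * coset_add quot_smult linD[OF f] add_cl[OF V] smult_cl[OF V])
qed

end

lemma lquot_simps [simp]:
 "car (lquot M S) = car (quot M S)" "zero (lquot M S) = zero (quot M S)"
 "add (lquot M S) = add (quot M S)" "smult (lquot M S) = smult (quot M S)"
 by (simp_all add: lquot_def module.defs lmod.defs)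

lemma bquot_simps [simp]:
 "car (bquot M S) = car (quot M S)" "zero (bquot M S) = zero (quot M S)"
 "add (bquot M S) = add (quot M S)" "smult (bquot M S) = smult (quot M S)"
 "lact (bquot M S) = lact (lquot M S)"
 by (simp_all add: bquot_def lquot_def module.defs lmod.defs bimod.defs)

lemma on_coset_endo:
 assumes V: "cvs V" and S: "csubspace S V" and f: "f:lin V V" "f ` S <= S" and x: "x:car V"
 shows "on_coset (%m. S +>\<^bsub>V\<^esub> f m) (S +>\<^bsub>V\<^esub> x) = S +>\<^bsub>V\<^esub> f x"
 by (rule on_coset_eq[OF V S x], rule coset_eqI[OF V S])
  (use f x subD(5)[OF V S] in "auto simp: linD[OF f(1)]")

lemma lact_lquot:
 assumes "cvs M" "csubspace S M" "lact M b:lin M M" "lact M b ` S <= S" "x:car M"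
 shows "lact (lquot M S) b (S +>\<^bsub>M\<^esub> x) = S +>\<^bsub>M\<^esub> lact M b x"
 using on_coset_endo[OF assms] by (simp add: lquot_def module.defs lmod.defs)

lemma ract_bquot:
 assumes "cvs M" "csubspace S M" "(%m. ract M m a):lin M M" "(%m. ract M m a) ` S <= S" "x:car M"
 shows "ract (bquot M S) (S +>\<^bsub>M\<^esub> x) a = S +>\<^bsub>M\<^esub> ract M x a"
 using on_coset_endo[OF assms] by (simp add: bquot_def lquot_def module.defs lmod.defs bimod.defs)

lemma cvs_bquot: "cvs M ==> csubspace S M ==> cvs (bquot M S)"
 by (rule cvs_cong[OF cvs_quot]) auto

lemma linear_maps_cong_structure:
 assumes "car V' = car V" "add V' = add V" "smult V' = smult V"
  "car W' = car W" "add W' = add W" "smult W' = smult W"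
 shows "lin V' W' = lin V W"
 by (simp add: linear_maps_def assms)

lemma linear_finsum_maps:
 assumes V: "cvs V" and W: "cvs W" and f: "!!i. i:I ==> f i:lin V W"
 shows "(%x. \<Oplus>\<^bsub>W\<^esub>i\<in>I. f i x):lin V W"
proof -
 interpret W: abelian_group W by (rule cvs_abelian[OF W])
 show ?thesis
  using f
 proof (induction I rule: infinite_finite_induct)
  case (insert i I)
  hence *: "(%x. f i x +[W] (finsum W (%i. f i x) I)):lin V W" by (intro linear_plus[OF W]) auto
  show ?case
  proof (rule linear_cong[OF * V])
   fix x assume "x:car V"
   thus "(finsum W (%i. f i x) (insert i I)) = f i x +[W] (finsum W (%i. f i x) I)"
    using insert lin_cl by (subst W.finsum_insert) fastforce+
  qed
 qed (auto intro: linear_zero_map[OF W])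
qed

text \<open>A minimal spanning subset: each of its elements is separated from the span of the others.\<close>

lemma finite_basis:
 assumes V: "cvs V" and S: "finite S" "S <= car V" "car V = cspan V S"
 shows "EX I co. finite I & I <= S & (ALL i:I. co i:lin V complex_vs) &
  (ALL i:I. ALL k:I. co i k = (if k = i then 1 else 0)) &
  (ALL x:car V. x = (finsum V (%i. co i x *[V] i) I))"
proof -
 define P where "P I <-> I <= S & cspan V I = car V" for I
 have "P S" using S by (simp add: P_def)
 then obtain I where "P I" and least: "!!J. P J ==> card I <= card J"
  using ex_has_least_nat[of P S card] by blast
 hence I: "I <= S" "cspan V I = car V"
  and min: "!!J. J <= S ==> cspan V J = car V ==> card I <= card J"
  by (auto simp: P_def)
 have fin: "finite I" and IV: "I <= car V" using I S finite_subset by auto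
 have sp: "csubspace (cspan V (I - {i})) V" for i
  using IV by (intro cspan_sub[OF V]) auto
 have "EX phi:lin V complex_vs. phi i = 1 & (ALL s:cspan V (I - {i}). phi s = 0)" if i: "i:I" for i
 proof (rule separating_functional[OF V sp])
  show "i:car V" using i IV by auto
  show "i \<notin> cspan V (I - {i})"
  proof
   assume "i:cspan V (I - {i})"
   hence "I <= cspan V (I - {i})" using cspan_superset[OF V, of "I - {i}"] by auto
   hence "cspan V I <= cspan V (I - {i})" by (rule cspan_minimal[OF V sp])
   hence "cspan V (I - {i}) = car V" using I subD(1)[OF V sp[of i]] by blast
   hence "card I <= card (I - {i})" using min I by (meson Diff_subset subset_trans)
   thus False using i fin by (metis card_Diff1_less leD)
  qed
 qed
 then obtain co where co: "!!i. i:I ==> co i:lin V complex_vs" "!!i. i:I ==> co i i = 1"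
  "!!i s. i:I ==> s:cspan V (I - {i}) ==> co i s = 0"
  by metis
 have delta: "co i k = (if k = i then 1 else 0)" if "i:I" "k:I" for i k
  using that co(2,3) by (auto intro!: co(3) cspan_base[OF V])
 have cl: "(%i. co i x *[V] i):I \<rightarrow> car V" for x
  using IV by (auto intro: smult_cl[OF V])
 have cl': "i:I ==> i:car V" for i using IV by auto
 have sum_cl: "(finsum V (%i. co i x *[V] i) I):car V" for x
  by (intro cvs_finsum_closed[OF V] cl)
 have phisum: "phi (finsum V (%i. co i x *[V] i) I) = (\<Sum>i\<in>I. co i x * phi i)"
  if "phi:lin V complex_vs" for phi x
  using cl cl' by (subst functional_finsum[OF V that])
   (auto simp: func_simps[OF that] intro!: sum.cong)
 have lin: "(%x. \<Oplus>\<^bsub>V\<^esub>i\<in>I. co i x *[V] i):lin V V"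
  using IV by (intro linear_finsum_maps[OF V V] linI)
   (auto simp: smult_cl[OF V] linD[OF co(1)] cvs_add_smult[OF V] cvs_smult_smult[OF V] subset_iff)
 \<comment> \<open>Both sides are linear in \<open>x\<close>, so they may be compared on the
   spanning set \<open>I\<close>, where the coordinates are Kronecker deltas.\<close>
 have "x = (finsum V (%i. co i x *[V] i) I)" if "x:car V" for x
 proof (rule lin_eq_cspan[OF V V linear_id lin IV])
  show "x:cspan V I" using that I by simp
  fix k assume k: "k:I"
  show "k = (finsum V (%i. co i k *[V] i) I)"
  proof (rule cvs_eqI[OF V])
   fix phi assume phi: "phi:lin V complex_vs"
   have "phi (finsum V (%i. co i k *[V] i) I) = (\<Sum>i\<in>I. co i k * phi i)" by (rule phisum[OF phi])
   also have "... = (\<Sum>i\<in>I. if i = k then phi i else 0)"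
    using k by (intro sum.cong) (auto simp: delta)
   finally show "phi k = phi (finsum V (%i. co i k *[V] i) I)" using fin k by simp
  qed (use k IV cl in "auto intro: cvs_finsum_closed[OF V]")
 qed
 thus ?thesis using fin I(1) co(1) delta by (intro exI[of _ I] exI[of _ co]) auto
qed

section \<open>Free vector spaces\<close>

lemma free_cvs_simps [simp]:
 "car (free_cvs S) = {f. keys f <= S}" "zero (free_cvs S) = 0"
 "add (free_cvs S) = (+)" "smult (free_cvs S) = (%c. Poly_Mapping.map ((*) c))"
 by (simp_all add: free_cvs_def)

lemma lookup_scale [simp]: "lookup (Poly_Mapping.map ((*) c) f) s = (c::complex) * lookup f s"
 by (simp add: Poly_Mapping.map.rep_eq when_def)

lemma keys_scale: "keys (Poly_Mapping.map ((*) (c::complex)) f) <= keys f"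
 by (auto simp: in_keys_iff)

lemma cvs_free_cvs: "cvs (free_cvs S)"
proof (rule cvsI)
 show "x +[free_cvs S] y:car (free_cvs S)" if "x:car (free_cvs S)" "y:car (free_cvs S)" for x y
  using that keys_add[of x y] by auto
 show "c *[free_cvs S] x:car (free_cvs S)" if "x:car (free_cvs S)" for c x
  using that keys_scale by fastforce
qed (auto simp: algebra_simps lookup_add intro!: poly_mapping_eqI)

lemma gen_closed: "s:S ==> gen s:car (free_cvs S)"
 by simp

lemma single_eq_scale_gen: "single s c = Poly_Mapping.map ((*) c) (gen s)"
 by (rule poly_mapping_eqI) (simp add: lookup_single when_def)

lemma carrier_free_cvs_span: "car (free_cvs S) = cspan (free_cvs S) (gen ` S)"
proof
 have sub: "gen ` S <= car (free_cvs S)" by auto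
 note sp = subD[OF cvs_free_cvs cspan_sub[OF cvs_free_cvs sub]]
 show "cspan (free_cvs S) (gen ` S) <= car (free_cvs S)" by (rule sp(1))
 show "car (free_cvs S) <= cspan (free_cvs S) (gen ` S)"
 proof
  fix f assume "f:car (free_cvs S)"
  \<comment> \<open>The induction runs over a finite set containing the support rather than over the
    support itself, so that a vanishing coefficient of \<open>s\<close> needs no separate
    case.\<close>
  moreover have "f:cspan (free_cvs S) (gen ` S)"
   if "finite F" "keys f <= F" "F <= S" for F and f :: "'a \<Rightarrow>\<^sub>0 complex"
   using that
  proof (induction F arbitrary: f rule: finite_induct)
   case empty
   thus ?case using sp(2) by simp
  next
   case (insert s F)
   let ?c = "lookup f s"
   have "f - single s ?c:cspan (free_cvs S) (gen ` S)"
    using insert.prems by (intro insert.IH)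
     (auto simp: in_keys_iff lookup_minus lookup_single when_def subset_iff split: if_splits)
   moreover have "gen s:cspan (free_cvs S) (gen ` S)"
    using insert.prems by (intro cspan_base[OF cvs_free_cvs]) auto
   hence "single s ?c:cspan (free_cvs S) (gen ` S)"
    using sp(4)[of "gen s" ?c] unfolding single_eq_scale_gen[of s ?c] by simp
   ultimately have "(f - single s ?c) + single s ?c:cspan (free_cvs S) (gen ` S)"
    using sp(3) by force
   thus ?case by simp
  qed
  from this[OF _ order_refl] calculation show "f:cspan (free_cvs S) (gen ` S)" by simp
 qed
qed

context
 fixes W :: "(complex, 'w, 'z) module_scheme" and h :: "'s => 'w" and S
 assumes W: "cvs W" and h_Pi: "h:S \<rightarrow> car W"
begin

private lemma h: "s:S ==> h s:car W" using h_Pi by auto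

lemma lin_ext_closed: "keys f <= S ==> lin_ext W h f:car W"
 unfolding lin_ext_def by (rule cvs_finsum_closed[OF W]) (use h in "auto intro: smult_cl[OF W]")

text \<open>The sum may run over any finite set \<open>F\<close> containing the support; this puts
  two elements and their sum over a common index set.\<close>

lemma functional_lin_ext:
 assumes phi: "phi:lin W complex_vs" and f: "keys f <= F" "F <= S" "finite F"
 shows "phi (lin_ext W h f) = (\<Sum>s\<in>F. lookup f s * phi (h s))"
proof -
 have "phi (lin_ext W h f) = (\<Sum>s\<in>keys f. phi (lookup f s *[W] h s))"
  unfolding lin_ext_def using f h by (intro functional_finsum[OF W phi] smult_cl[OF W]) auto
 also have "... = (\<Sum>s\<in>keys f. lookup f s * phi (h s))"
  using f h by (intro sum.cong) (auto simp: func_simps[OF phi] subset_iff)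
 also have "... = (\<Sum>s\<in>F. lookup f s * phi (h s))"
  using f by (intro sum.mono_neutral_left) (auto simp: in_keys_iff)
 finally show ?thesis .
qed

lemma lin_ext_linear: "lin_ext W h:lin (free_cvs S) W"
proof (rule linI)
 fix f g assume "f:car (free_cvs S)" "g:car (free_cvs S)"
 hence fg: "keys f <= S" "keys g <= S" by auto
 let ?F = "keys f \<union> keys g"
 show "lin_ext W h (f +[free_cvs S] g) = lin_ext W h f +[W] lin_ext W h g"
 proof (rule cvs_eqI[OF W])
  show cl: "lin_ext W h (f +[free_cvs S] g):car W"
   by (rule lin_ext_closed) (use fg keys_add[of f g] in auto)
  show "lin_ext W h f +[W] lin_ext W h g:car W"
   using fg by (intro add_cl[OF W] lin_ext_closed)
  fix phi assume phi: "phi:lin W complex_vs"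
  have F: "?F <= S" "finite ?F" "keys (f + g) <= ?F" "keys f <= ?F" "keys g <= ?F"
   using fg keys_add[of f g] by auto
  show "phi (lin_ext W h (f +[free_cvs S] g)) = phi (lin_ext W h f +[W] lin_ext W h g)"
   using fg by (simp add: func_simps[OF phi] lin_ext_closed functional_lin_ext[OF phi F(3,1,2)]
    functional_lin_ext[OF phi F(4,1,2)] functional_lin_ext[OF phi F(5,1,2)] lookup_add distrib_right sum.distrib)
 qed
next
 fix c f assume "f:car (free_cvs S)"
 hence f: "keys f <= S" by auto
 have cf: "keys (Poly_Mapping.map ((*) c) f) <= keys f" by (rule keys_scale)
 show "lin_ext W h (c *[free_cvs S] f) = c *[W] lin_ext W h f"
 proof (rule cvs_eqI[OF W])
  show "lin_ext W h (c *[free_cvs S] f):car W" by (rule lin_ext_closed) (use f cf in auto)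
  show "c *[W] lin_ext W h f:car W" by (intro smult_cl[OF W] lin_ext_closed f)
  fix phi assume phi: "phi:lin W complex_vs"
  show "phi (lin_ext W h (c *[free_cvs S] f)) = phi (c *[W] lin_ext W h f)"
   using f by (simp add: func_simps[OF phi] lin_ext_closed functional_lin_ext[OF phi cf f]
    functional_lin_ext[OF phi order_refl f] sum_distrib_left mult.assoc)
 qed
qed (use lin_ext_closed in auto)

lemma lin_ext_single: "s:S ==> lin_ext W h (single s c) = c *[W] h s"
proof (cases "c = 0")
 case True
 assume "s:S"
 thus ?thesis using True lin_zero[OF cvs_free_cvs W lin_ext_linear] h
  by (simp add: cvs_zero_smult[OF W])
next
 case False
 interpret abelian_group W by (rule cvs_abelian[OF W])
 assume "s:S"
 thus ?thesis using False h
  by (simp add: lin_ext_def smult_cl[OF W] Pi_def)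
qed

lemma lin_ext_gen: "s:S ==> lin_ext W h (gen s) = h s"
 using lin_ext_single[of s 1] h by (simp add: cvs_smult_one[OF W])

lemma lin_ext_diff:
 "keys f <= S ==> keys g <= S ==>
  lin_ext W h (f - g) = lin_ext W h f +[W] (-1) *[W] lin_ext W h g"
proof -
 assume fg: "keys f <= S" "keys g <= S"
 have eq: "f - g = f + Poly_Mapping.map ((*) (-1)) g"
  by (rule poly_mapping_eqI) (simp add: lookup_minus lookup_add)
 have "Poly_Mapping.map ((*) (-1)) g:car (free_cvs S)"
  using keys_scale[of "-1" g] fg by auto
 hence "lin_ext W h (f - g) = lin_ext W h f +[W] lin_ext W h (Poly_Mapping.map ((*) (-1)) g)"
  unfolding eq using linear_add[OF lin_ext_linear, of f "Poly_Mapping.map ((*) (-1)) g"] fg by simp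
 thus ?thesis using linear_smult[OF lin_ext_linear, of g "-1"] fg by simp
qed

end

lemma keys_diff_subset: "keys f <= S ==> keys g <= S ==> keys (f - g) <= S"
 using keys_diff[of f g] by auto

section \<open>Tensor products\<close>

definition balanced ::
 "(complex, 'a) module => ('b, 'a, 'e, 'y) bimod_scheme => ('a, 'f, 'z) lmod_scheme =>
 (complex, 'w, 'u) module_scheme => ('e => 'f => 'w) => bool" where
 "balanced A E F W h <->
  (ALL e:car E. h e:lin F W) & (ALL f:car F. (%e. h e f):lin E W) &
  (ALL e:car E. ALL a:car A. ALL f:car F. h (ract E e a) f = h e (lact F a f))"

text \<open>What makes the tensor relations lie in the free space: vector spaces whose two inner
  actions stay in their carriers. The condition is weak on purpose, since the factors are variously
  forms, cochains, quotients and cohomology.\<close>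

definition tensorable ::
 "(complex, 'a) module => ('b, 'a, 'e, 'y) bimod_scheme => ('a, 'f, 'z) lmod_scheme => bool" where
 "tensorable A E F <-> cvs E & cvs F &
  (ALL e:car E. ALL a:car A. ract E e a:car E) &
  (ALL f:car F. ALL a:car A. lact F a f:car F)"

lemma balancedI:
 assumes "!!e f. e:car E ==> f:car F ==> h e f:car W"
  "!!e f f'. e:car E ==> f:car F ==> f':car F ==> h e (f +[F] f') = h e f +[W] h e f'"
  "!!c e f. e:car E ==> f:car F ==> h e (c *[F] f) = c *[W] h e f"
  "!!e e' f. e:car E ==> e':car E ==> f:car F ==> h (e +[E] e') f = h e f +[W] h e' f"
  "!!c e f. e:car E ==> f:car F ==> h (c *[E] e) f = c *[W] h e f"
  "!!e a f. e:car E ==> a:car A ==> f:car F ==> h (ract E e a) f = h e (lact F a f)"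
 shows "balanced A E F W h"
 unfolding balanced_def using assms by (auto intro!: linI)

lemma balancedD:
 assumes "balanced A E F W h"
 shows "!!e f. e:car E ==> f:car F ==> h e f:car W"
  "!!e f f'. e:car E ==> f:car F ==> f':car F ==> h e (f +[F] f') = h e f +[W] h e f'"
  "!!c e f. e:car E ==> f:car F ==> h e (c *[F] f) = c *[W] h e f"
  "!!e e' f. e:car E ==> e':car E ==> f:car F ==> h (e +[E] e') f = h e f +[W] h e' f"
  "!!c e f. e:car E ==> f:car F ==> h (c *[E] e) f = c *[W] h e f"
  "!!e a f. e:car E ==> a:car A ==> f:car F ==> h (ract E e a) f = h e (lact F a f)"
  "!!e. e:car E ==> h e:lin F W"
  "!!f. f:car F ==> (%e. h e f):lin E W"
 using assms by (auto simp: balanced_def linear_maps_def Pi_iff)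

context
 fixes A :: "(complex, 'a) module" and E :: "('b, 'a, 'e, 'y) bimod_scheme" and F :: "('a, 'f, 'z) lmod_scheme"
 assumes AEF: "tensorable A E F"
begin

lemma tensorableD:
 "cvs E" "cvs F" "!!e a. e:car E ==> a:car A ==> ract E e a:car E"
 "!!f a. f:car F ==> a:car A ==> lact F a f:car F"
 using AEF by (auto simp: tensorable_def)

lemma tensor_rels_subset: "tensor_rels A E F <= car (free_cvs (car E \<times> car F))"
proof
 have k: "keys (single (e, f) c) <= car E \<times> car F"
  if "e:car E" "f:car F" for e f and c :: complex using that by auto
 fix r assume "r:tensor_rels A E F"
 thus "r:car (free_cvs (car E \<times> car F))"
  unfolding tensor_rels_def free_cvs_simps mem_Collect_eq
  by (elim UnE CollectE exE conjE; hypsubst; intro keys_diff_subset k)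
   (auto intro: add_cl[OF tensorableD(1)] add_cl[OF tensorableD(2)]
    smult_cl[OF tensorableD(1)] smult_cl[OF tensorableD(2)] tensorableD(3,4))
qed

lemma tensor_sub_subspace: "csubspace (tensor_sub A E F) (free_cvs (car E \<times> car F))"
 unfolding tensor_sub_def by (rule cspan_sub[OF cvs_free_cvs tensor_rels_subset])

lemma cvs_tensor: "cvs (tensor A E F)"
 unfolding tensor_def by (rule cvs_quot[OF cvs_free_cvs tensor_sub_subspace])

lemma tens_closed: "e:car E ==> f:car F ==> tens A E F e f:car (tensor A E F)"
 unfolding tensor_def tens_def by auto

lemma lin_ext_tensor_rels:
 assumes W: "cvs W" and h: "balanced A E F W h" and s: "s:tensor_sub A E F"
 shows "lin_ext W (%(e, f). h e f) s = 0[W]"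
proof -
 let ?V = "free_cvs (car E \<times> car F)"
 let ?h = "%(e, f). h e f"
 note H = balancedD[OF h]
 have cl: "?h:car E \<times> car F \<rightarrow> car W" using H(1) by auto
 note L = lin_ext_linear[OF W cl] and g = lin_ext_gen[OF W cl]
  and d = lin_ext_diff[OF W cl] and si = lin_ext_single[OF W cl]
 note C = add_cl[OF tensorableD(1)] add_cl[OF tensorableD(2)]
  smult_cl[OF tensorableD(1)] smult_cl[OF tensorableD(2)] tensorableD(3,4)
 interpret W: abelian_group W by (rule cvs_abelian[OF W])
 have base: "lin_ext W ?h r = 0[W]" if "r:tensor_rels A E F" for r
 proof -
  have 1: "lin_ext W ?h (gen p - gen q - gen q') = ?h p +[W] (-1) *[W] ?h q +[W] (-1) *[W] ?h q'"
   if "p:car E \<times> car F" "q:car E \<times> car F" "q':car E \<times> car F" for p q q'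
  proof -
   have k: "keys (gen p :: _ \<Rightarrow>\<^sub>0 complex) <= car E \<times> car F"
    "keys (gen q :: _ \<Rightarrow>\<^sub>0 complex) <= car E \<times> car F"
    "keys (gen q' :: _ \<Rightarrow>\<^sub>0 complex) <= car E \<times> car F" using that by auto
   show ?thesis using d[OF keys_diff_subset[OF k(1,2)] k(3)] d[OF k(1,2)] g that by simp
  qed
  have 2: "lin_ext W ?h (gen p - single q c) = ?h p +[W] (-1) *[W] (c *[W] ?h q)"
   if "p:car E \<times> car F" "q:car E \<times> car F" for p q c
  proof -
   have k: "keys (gen p :: _ \<Rightarrow>\<^sub>0 complex) <= car E \<times> car F"
    "keys (single q c) <= car E \<times> car F" using that by auto
   show ?thesis using d[OF k] g[OF that(1)] si[OF that(2)] by simp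
  qed
  have 3: "x +[W] y +[W] (-1) *[W] x +[W] (-1) *[W] y = 0[W]" if "x:car W" "y:car W" for x y
   using that by (simp add: cvs_add_diff[OF W] cvs_diff_self[OF W])
  show ?thesis
   using that unfolding tensor_rels_def
  proof (elim UnE CollectE exE conjE)
   fix e e' f assume "r = gen (e +[E] e', f) - gen (e, f) - gen (e', f)" "e:car E" "e':car E" "f:car F"
   thus ?thesis using C by (simp add: 1 H(1,4) 3)
  next
   fix e f f' assume "r = gen (e, f +[F] f') - gen (e, f) - gen (e, f')" "e:car E" "f:car F" "f':car F"
   thus ?thesis using C by (simp add: 1 H(1,2) 3)
  next
   fix c e f assume "r = gen (c *[E] e, f) - single (e, f) c" "e:car E" "f:car F"
   thus ?thesis using C by (simp add: 2 H(1,5) smult_cl[OF W] cvs_diff_self[OF W])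
  next
   fix c e f assume "r = gen (e, c *[F] f) - single (e, f) c" "e:car E" "f:car F"
   thus ?thesis using C by (simp add: 2 H(1,3) smult_cl[OF W] cvs_diff_self[OF W])
  next
   fix e a f assume r: "r = gen (ract E e a, f) - gen (e, lact F a f)" "e:car E" "a:car A" "f:car F"
   thus ?thesis using C 2[of "(ract E e a, f)" "(e, lact F a f)" 1]
    by (simp add: H(1,6) cvs_smult_one[OF W] cvs_diff_self[OF W])
  qed
 qed
 show ?thesis
  by (rule lin_eq_cspan[OF cvs_free_cvs W L linear_zero_map[OF W] tensor_rels_subset])
   (use base s in "auto simp: tensor_sub_def")
qed

lemma
 assumes W: "cvs W" and h: "balanced A E F W h"
 shows tensor_lift_linear: "tensor_lift W h:lin (tensor A E F) W"
  and tensor_lift_tens: "e:car E ==> f:car F ==> tensor_lift W h (tens A E F e f) = h e f"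
proof -
 have cl: "(%(e, f). h e f):car E \<times> car F \<rightarrow> car W"
  using balancedD(1)[OF h] by auto
 note O = on_coset_linear[OF cvs_free_cvs tensor_sub_subspace W lin_ext_linear[OF W cl] lin_ext_tensor_rels[OF W h]]
 show "tensor_lift W h:lin (tensor A E F) W"
  unfolding tensor_lift_def tensor_def by (rule O(1))
 show "tensor_lift W h (tens A E F e f) = h e f" if "e:car E" "f:car F"
  unfolding tensor_lift_def tens_def using that by (subst O(2)) (simp_all add: lin_ext_gen[OF W cl])
qed

lemma tens_balanced: "balanced A E F (tensor A E F) (tens A E F)"
proof -
 let ?V = "free_cvs (car E \<times> car F)" and ?S = "tensor_sub A E F"
 note V = cvs_free_cvs[of "car E \<times> car F"] and S = tensor_sub_subspace
 note C = add_cl[OF tensorableD(1)] add_cl[OF tensorableD(2)]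
  smult_cl[OF tensorableD(1)] smult_cl[OF tensorableD(2)] tensorableD(3,4)
 have rel: "r:tensor_rels A E F ==> r:?S" for r
  unfolding tensor_sub_def by (rule cspan_base[OF V])
 have T: "tens A E F e f = ?S +>\<^bsub>?V\<^esub> gen (e, f)" for e f by (simp add: tens_def)
 have ad: "(?S +>\<^bsub>?V\<^esub> gen p) <+>\<^bsub>?V\<^esub> (?S +>\<^bsub>?V\<^esub> gen q) = ?S +>\<^bsub>?V\<^esub> (gen p + gen q)"
  if "p:car E \<times> car F" "q:car E \<times> car F" for p q
  using coset_add[OF V S, of "gen p" "gen q"] that by simp
 have sm: "c *[quot ?V ?S] (?S +>\<^bsub>?V\<^esub> gen p) = ?S +>\<^bsub>?V\<^esub> (single p c)"
  if "p:car E \<times> car F" for p c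
  using quot_smult[OF V S, of "gen p" c] that unfolding single_eq_scale_gen[of p c] by simp
 have eq: "?S +>\<^bsub>?V\<^esub> x = ?S +>\<^bsub>?V\<^esub> y"
  if "x:car ?V" "y:car ?V" "x - y:tensor_rels A E F" for x y
  by (rule coset_eqI[OF V S rel[OF that(3)] that(2)]) simp
 show ?thesis
 proof (rule balancedI)
  fix e f f' assume *: "e:car E" "f:car F" "f':car F"
  have "gen (e, f +[F] f') - (gen (e, f) + gen (e, f')):tensor_rels A E F"
   unfolding diff_diff_add[symmetric] tensor_rels_def using * by blast
  thus "tens A E F e (f +[F] f') = tens A E F e f +[tensor A E F] tens A E F e f'"
   using * C unfolding T tensor_def quot_simps
   by (subst ad) (simp, simp, rule eq, insert add_cl[OF V], auto)
 next
  fix e e' f assume *: "e:car E" "e':car E" "f:car F"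
  have "gen (e +[E] e', f) - (gen (e, f) + gen (e', f)):tensor_rels A E F"
   unfolding diff_diff_add[symmetric] tensor_rels_def using * by blast
  thus "tens A E F (e +[E] e') f = tens A E F e f +[tensor A E F] tens A E F e' f"
   using * C unfolding T tensor_def quot_simps
   by (subst ad) (simp, simp, rule eq, insert add_cl[OF V], auto)
 next
  fix c e f assume *: "e:car E" "f:car F"
  have "gen (e, c *[F] f) - single (e, f) c:tensor_rels A E F"
   unfolding tensor_rels_def using * by blast
  thus "tens A E F e (c *[F] f) = c *[tensor A E F] tens A E F e f"
   using * C unfolding T tensor_def by (subst sm) (simp, intro eq, auto)
 next
  fix c e f assume *: "e:car E" "f:car F"
  have "gen (c *[E] e, f) - single (e, f) c:tensor_rels A E F"
   unfolding tensor_rels_def using * by blast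
  thus "tens A E F (c *[E] e) f = c *[tensor A E F] tens A E F e f"
   using * C unfolding T tensor_def by (subst sm) (simp, intro eq, auto)
 next
  fix e a f assume *: "e:car E" "a:car A" "f:car F"
  have "gen (ract E e a, f) - gen (e, lact F a f):tensor_rels A E F"
   unfolding tensor_rels_def using * by blast
  thus "tens A E F (ract E e a) f = tens A E F e (lact F a f)"
   using * C unfolding T by (intro eq) auto
 qed (rule tens_closed)
qed

lemma carrier_tensor_span:
 "car (tensor A E F) = cspan (tensor A E F) {tens A E F e f | e f. e:car E & f:car F}"
proof -
 let ?V = "free_cvs (car E \<times> car F)" and ?S = "tensor_sub A E F"
 have "car (tensor A E F) = (%x. ?S +>\<^bsub>?V\<^esub> x) ` cspan ?V (gen ` (car E \<times> car F))"
  unfolding tensor_def quot_simps carrier_free_cvs_span ..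
 also have "... = cspan (tensor A E F) ((%x. ?S +>\<^bsub>?V\<^esub> x) ` gen ` (car E \<times> car F))"
  unfolding tensor_def
  by (rule linear_image_cspan[OF cvs_free_cvs cvs_quot[OF cvs_free_cvs tensor_sub_subspace]
    quot_class_linear[OF cvs_free_cvs tensor_sub_subspace]]) auto
 also have "(%x. ?S +>\<^bsub>?V\<^esub> x) ` gen ` (car E \<times> car F) = {tens A E F e f | e f. e:car E & f:car F}"
  by (auto simp: tens_def)
 finally show ?thesis .
qed

lemma tensor_linear_eqI:
 assumes "cvs W" "k:lin (tensor A E F) W" "l:lin (tensor A E F) W"
  and "!!e f. e:car E ==> f:car F ==> k (tens A E F e f) = l (tens A E F e f)"
  and "t:car (tensor A E F)"
 shows "k t = l t"
 by (rule lin_eq_cspan[OF cvs_tensor assms(1-3)])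
  (use assms(4,5) tens_closed carrier_tensor_span in auto)

text \<open>Turns the image of a map on a tensor product, as it occurs in the definition of
  \<open>filt\<close>, into a span of explicit products.\<close>

lemma tensor_linear_image:
 assumes W: "cvs W" and k: "k:lin (tensor A E F) W"
 shows "k ` car (tensor A E F) = cspan W {k (tens A E F e f) | e f. e:car E & f:car F}"
proof -
 have "k ` car (tensor A E F) = cspan W (k ` {tens A E F e f | e f. e:car E & f:car F})"
  by (subst carrier_tensor_span, rule linear_image_cspan[OF cvs_tensor W k]) (use tens_closed in auto)
 also have "k ` {tens A E F e f | e f. e:car E & f:car F} = {k (tens A E F e f) | e f. e:car E & f:car F}"
  by auto
 finally show ?thesis .
qed

end

lemma btensor_simps [simp]:
 "car (btensor A E F) = car (tensor A E F)" "zero (btensor A E F) = zero (tensor A E F)"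
 "add (btensor A E F) = add (tensor A E F)" "smult (btensor A E F) = smult (tensor A E F)"
 "lact (btensor A E F) = (%b. tensor_lift (tensor A E F) (%e f. tens A E F (lact E b e) f))"
 "ract (btensor A E F) = (%t c. tensor_lift (tensor A E F) (%e f. tens A E F e (ract F f c)) t)"
 by (simp_all add: btensor_def module.defs lmod.defs bimod.defs)

subsection \<open>Free right modules\<close>

text \<open>A finite free right module, presented by a basis and its dual basis \<open>co\<close> of
  right linear coordinate functions. The basis elements serve as their own indices.\<close>

definition right_basis ::
 "(complex, 'b) module => ('c, 'b, 'p, 'z) bimod_scheme => 'p set => ('p => 'p => 'b) => bool" where
 "right_basis B P I co <-> finite I & I <= car P & (ALL i:I. co i:lin P B) &
  (ALL i:I. ALL p:car P. ALL b:car B. co i (ract P p b) = co i p **[B] b) &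
  (ALL i:I. ALL k:I. co i k = (if k = i then 1[B] else 0[B])) &
  (ALL p:car P. p = (finsum P (%i. ract P i (co i p)) I))"

lemma left_moduleD:
 assumes "left_module B M"
 shows "cvs M" "!!b. b:car B ==> lact M b:lin M M"
  "!!m. m:car M ==> (%b. lact M b m):lin B M"
  "!!b b' m. b:car B ==> b':car B ==> m:car M ==> lact M (b **[B] b') m = lact M b (lact M b' m)"
  "!!m. m:car M ==> lact M 1[B] m = m"
  "!!b m. b:car B ==> m:car M ==> lact M b m:car M"
 using assms by (auto simp: left_module_def linear_maps_def Pi_iff)

context
 fixes B :: "(complex, 'b) module" and P :: "('c, 'b, 'p, 'z) bimod_scheme" and I co
 assumes B: "cvs B" and P: "cvs P" "ALL p:car P. ALL b:car B. ract P p b:car P"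
  and basis: "right_basis B P I co"
begin

lemma right_basisD:
 "finite I" "!!i. i:I ==> i:car P" "!!i. i:I ==> co i:lin P B"
 "!!i p b. i:I ==> p:car P ==> b:car B ==> co i (ract P p b) = co i p **[B] b"
 "!!i k. i:I ==> k:I ==> co i k = (if k = i then 1[B] else 0[B])"
 "!!p. p:car P ==> p = (finsum P (%i. ract P i (co i p)) I)"
 "!!i p. i:I ==> p:car P ==> co i p:car B"
 using basis unfolding right_basis_def by (blast dest: lin_cl)+

lemma right_basis_tensorable: "left_module B N ==> tensorable B P N"
 using P left_moduleD by (fastforce simp: tensorable_def)

lemma coord_balanced:
 assumes N: "left_module B N" and i: "i:I"
 shows "balanced B P N N (%p n. lact N (co i p) n)"
proof -
 note L = left_moduleD[OF N] and co = right_basisD(3)[OF i]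
 note lin1 = linD[OF L(2)] and lin2 = linD[OF L(3)]
 show ?thesis
  by (rule balancedI) (use i in "simp_all add: L(6) right_basisD(4,7) lin1 lin2 linD[OF co] L(4)")
qed

text \<open>The component of index \<open>i\<close> of the isomorphism from
  \<open>P \<otimes>\<^sub>B N\<close> to a power of \<open>N\<close>, with one copy of
  \<open>N\<close> for each basis element of \<open>P\<close>.\<close>

definition "tensor_coord N i = tensor_lift N (%p n. lact N (co i p) n)"

context
 fixes N :: "('b, 'n, 'u) lmod_scheme"
 assumes N: "left_module B N"
begin

private lemma PN: "tensorable B P N" by (rule right_basis_tensorable[OF N])

lemma tensor_coord_linear: "i:I ==> tensor_coord N i:lin (tensor B P N) N"
 unfolding tensor_coord_def by (rule tensor_lift_linear[OF PN left_moduleD(1)[OF N] coord_balanced[OF N]])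

lemma tensor_coord_tens:
 "i:I ==> p:car P ==> n:car N ==> tensor_coord N i (tens B P N p n) = lact N (co i p) n"
 unfolding tensor_coord_def by (rule tensor_lift_tens[OF PN left_moduleD(1)[OF N] coord_balanced[OF N]])

lemma tensor_coord_basis:
 "i:I ==> k:I ==> n:car N ==>
  tensor_coord N i (tens B P N k n) = (if k = i then n else 0[N])"
 using lin_zero[OF B left_moduleD(1)[OF N] left_moduleD(3)[OF N]]
 by (simp add: tensor_coord_tens right_basisD left_moduleD(5)[OF N])

lemma tensor_coord_sum:
 assumes i: "i:I" and n: "!!k. k:I ==> n k:car N"
 shows "tensor_coord N i (finsum (tensor B P N) (%k. tens B P N k (n k)) I) = n i"
proof -
 note NN = left_moduleD(1)[OF N]
 have cl: "tens B P N k (n k):car (tensor B P N)" if "k:I" for k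
  using that n right_basisD(2) by (auto intro: tens_closed[OF PN])
 have "tensor_coord N i (finsum (tensor B P N) (%k. tens B P N k (n k)) I) = (finsum N (%k. tensor_coord N i (tens B P N k (n k))) I)"
  by (rule lin_finsum[OF cvs_tensor[OF PN] NN tensor_coord_linear[OF i] cl])
 also have "... = n i"
 proof (rule cvs_eqI[OF NN])
  have cl': "tensor_coord N i (tens B P N k (n k)):car N" if "k:I" for k
   using that cl lin_cl[OF tensor_coord_linear[OF i]] by auto
  show "(finsum N (%k. tensor_coord N i (tens B P N k (n k))) I):car N"
   by (rule cvs_finsum_closed[OF NN]) (use cl' in auto)
  show "n i:car N" using n i by auto
  fix phi assume phi: "phi:lin N complex_vs"
  have "phi (finsum N (%k. tensor_coord N i (tens B P N k (n k))) I) = (\<Sum>k\<in>I. phi (tensor_coord N i (tens B P N k (n k))))"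
   by (rule functional_finsum[OF NN phi cl'])
  also have "... = (\<Sum>k\<in>I. if k = i then phi (n k) else 0)"
   using i n lin_zero[OF NN cvs_complex_vs phi] by (intro sum.cong) (auto simp: tensor_coord_basis)
  finally show "phi (finsum N (%k. tensor_coord N i (tens B P N k (n k))) I) = phi (n i)"
   using i right_basisD(1) by simp
 qed
 finally show ?thesis .
qed

text \<open>On \<open>p \<otimes> n\<close> expand \<open>p\<close> in the basis and move the
  coordinates, which lie in \<open>B\<close>, across the tensor sign. Both sides are linear, so pure
  tensors suffice.\<close>

lemma tensor_expand:
 assumes t: "t:car (tensor B P N)"
 shows "t = (finsum (tensor B P N) (%i. tens B P N i (tensor_coord N i t)) I)"
proof -
 let ?T = "tensor B P N"
 note T = cvs_tensor[OF PN] and bal = balancedD[OF tens_balanced[OF PN]] and NN = left_moduleD(1)[OF N]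
 have lin: "(%t. \<Oplus>\<^bsub>?T\<^esub>i\<in>I. tens B P N i (tensor_coord N i t)):lin ?T ?T"
  by (rule linear_finsum_maps[OF T T])
   (rule lin_comp[OF tensor_coord_linear bal(7)], auto intro: right_basisD(2))
 show ?thesis
 proof (rule tensor_linear_eqI[OF PN T linear_id lin _ t])
  fix p n assume pn: "p:car P" "n:car N"
  have cl: "ract P i (co i p):car P" if "i:I" for i
   using that pn P right_basisD(2,7) by auto
  have "tens B P N p n = tens B P N (finsum P (%i. ract P i (co i p)) I) n"
   using right_basisD(6)[OF pn(1)] by simp
  also have "... = (finsum ?T (%i. tens B P N (ract P i (co i p)) n) I)"
   using lin_finsum[where I = I, OF P(1) T bal(8)[OF pn(2)] cl] by simp
  also have "... = (finsum ?T (%i. tens B P N i (tensor_coord N i (tens B P N p n))) I)"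
  proof -
   interpret abelian_group ?T by (rule cvs_abelian[OF T])
   show ?thesis
    using pn right_basisD(2,7) by (intro finsum_cong')
     (auto simp: tensor_coord_tens bal(6) intro!: bal(1) left_moduleD(6)[OF N])
  qed
  finally show "tens B P N p n = (finsum ?T (%i. tens B P N i (tensor_coord N i (tens B P N p n))) I)" .
 qed
qed

lemma tensor_zeroD:
 assumes "!!k. k:I ==> n k:car N" "(finsum (tensor B P N) (%k. tens B P N k (n k)) I) = 0[tensor B P N]" "i:I"
 shows "n i = 0[N]"
 using tensor_coord_sum[of i n] assms
  lin_zero[OF cvs_tensor[OF PN] left_moduleD(1)[OF N] tensor_coord_linear] by simp

end

lemma tensor_map_balanced:
 assumes M: "left_module B M" and N: "left_module B N" and f: "f:left_module_maps B M N"
 shows "balanced B P M (tensor B P N) (%p m. tens B P N p (f m))"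
proof -
 note bal = balancedD[OF tens_balanced[OF right_basis_tensorable[OF N]]]
 have lin: "f:lin M N" and act: "!!b m. b:car B ==> m:car M ==> f (lact M b m) = lact N b (f m)"
  using f by (auto simp: left_module_maps_def)
 show ?thesis
  by (rule balancedI) (simp_all add: bal(1-6) act linD[OF lin])
qed

end

text \<open>In coordinates the induced map applies \<open>f\<close> to every component, so it is
  injective together with \<open>f\<close>.\<close>

lemma right_basis_flat:
 fixes B :: "(complex, 'b) module" and P :: "('c, 'b, 'p, 'z) bimod_scheme" and ty :: "('m \<times> 'n) itself"
 assumes B: "cvs B" and P: "cvs P" "ALL p:car P. ALL b:car B. ract P p b:car P"
  and basis: "right_basis B P I co"
 shows "flat_right ty B P"
 unfolding flat_right_def
proof (intro allI impI, elim conjE)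
 fix M :: "('b, 'm) lmod" and N :: "('b, 'n) lmod" and f
 assume M: "left_module B M" and N: "left_module B N" and f: "f:left_module_maps B M N" "inj_on f (car M)"
 note D = right_basisD[OF B P basis] and MM = left_moduleD[OF M] and NN = left_moduleD[OF N]
 note tM = right_basis_tensorable[OF B P basis M] and tN = right_basis_tensorable[OF B P basis N]
 let ?F = "tensor_lift (tensor B P N) (%p m. tens B P N p (f m))"
 note bal = tensor_map_balanced[OF B P basis M N f(1)]
 have lin: "f:lin M N" using f by (auto simp: left_module_maps_def)
 note F = tensor_lift_linear[OF tM cvs_tensor[OF tN] bal] and Ft = tensor_lift_tens[OF tM cvs_tensor[OF tN] bal]
 show "inj_on ?F (car (tensor B P M))"
 proof (rule linear_injI[OF cvs_tensor[OF tM] cvs_tensor[OF tN] F])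
  fix t assume t: "t:car (tensor B P M)" "?F t = 0[tensor B P N]"
  define m where "m i = tensor_coord co M i t" for i
  have m: "m i:car M" if "i:I" for i
   unfolding m_def using lin_cl[OF tensor_coord_linear[OF B P basis M that]] t by auto
  have te: "t = (finsum (tensor B P M) (%i. tens B P M i (m i)) I)"
   unfolding m_def by (rule tensor_expand[OF B P basis M t(1)])
  have "?F t = (finsum (tensor B P N) (%i. ?F (tens B P M i (m i))) I)"
   by (subst te, rule lin_finsum[OF cvs_tensor[OF tM] cvs_tensor[OF tN] F])
    (use m D(2) in "auto intro: tens_closed[OF tM]")
  also have "... = (finsum (tensor B P N) (%i. tens B P N i (f (m i))) I)"
  proof -
   interpret abelian_group "tensor B P N" by (rule cvs_abelian[OF cvs_tensor[OF tN]])
   show ?thesis using m D(2) by (intro finsum_cong') (auto simp: Ft intro!: tens_closed[OF tN] lin_cl[OF lin])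
  qed
  finally have z: "(finsum (tensor B P N) (%i. tens B P N i (f (m i))) I) = 0[tensor B P N]" using t by simp
  have "f (m i) = 0[N]" if "i:I" for i
   by (rule tensor_zeroD[OF B P basis N _ z that]) (rule lin_cl[OF lin m])
  hence m0: "m i = 0[M]" if "i:I" for i
   using that f(2) m lin_zero[OF MM(1) NN(1) lin] zero_cl[OF MM(1)] by (metis inj_onD)
  interpret abelian_group "tensor B P M" by (rule cvs_abelian[OF cvs_tensor[OF tM]])
  have "(finsum (tensor B P M) (%i. tens B P M i (m i)) I) = (finsum (tensor B P M) (%i. 0[tensor B P M]) I)"
   using m0 D(2) lin_zero[OF MM(1) cvs_tensor[OF tM] balancedD(7)[OF tens_balanced[OF tM]]]
   by (intro finsum_cong') auto
  thus "t = 0[tensor B P M]" using te by simp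
 qed
qed

section \<open>Isomorphisms of quotients, linear sections, direct sums\<close>

lemma cvs_finsum_single:
 assumes V: "cvs V" and "finite I" "i:I" "f i:car V" "!!k. k:I ==> k ~= i ==> f k = 0[V]"
 shows "(finsum V (%k. f k) I) = f i"
proof (rule cvs_eqI[OF V])
 have cl: "f k:car V" if "k:I" for k using assms that zero_cl[OF V] by (cases "k = i") auto
 thus "(finsum V (%k. f k) I):car V" by (intro cvs_finsum_closed[OF V]) auto
 fix phi assume phi: "phi:lin V complex_vs"
 have "phi (finsum V (%k. f k) I) = (\<Sum>k\<in>I. phi (f k))" by (rule functional_finsum[OF V phi cl])
 also have "... = (\<Sum>k\<in>I. if k = i then phi (f k) else 0)"
  using assms lin_zero[OF V cvs_complex_vs phi] by (intro sum.cong) auto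
 finally show "phi (finsum V (%k. f k) I) = phi (f i)" using assms by simp
qed (rule assms)

lemma isomorphic_trivial:
 assumes "cvs V" "cvs W" "car V = {0[V]}" "car W = {0[W]}"
 shows "isomorphic V W"
 unfolding isomorphic_def linear_iso_def
 by (rule exI[of _ "%_. 0[W]"]) (use assms in "auto simp: linear_zero_map bij_betw_def")

text \<open>The first isomorphism theorem. That \<open>K\<close> is a subspace follows from its
  being the kernel.\<close>

lemma isomorphic_quot:
 assumes V: "cvs V" and W: "cvs W" and f: "f:lin V W" "f ` car V = car W"
  and K: "K <= car V" "!!x. x:car V ==> f x = 0[W] <-> x:K"
 shows "isomorphic (quot V K) W"
proof -
 have "K = {x:car V. f x = 0[W]}" using K by auto
 hence S: "csubspace K V" using linear_kernel_subspace[OF V W f(1)] by simp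
 have f0: "f s = 0[W]" if "s:K" for s using that K by auto
 note O = on_coset_linear[OF V S W f(1) f0]
 have "inj_on (on_coset f) (car (quot V K))"
 proof (rule linear_injI[OF cvs_quot[OF V S] W O(1)])
  fix u assume u: "u:car (quot V K)" "on_coset f u = 0[W]"
  then obtain x where x: "x:car V" "u = K +>\<^bsub>V\<^esub> x" by auto
  hence "x:K" using u K(2) O(2) by simp
  thus "u = 0[quot V K]" using coset_eq_zero_iff[OF V S x(1)] x(2) by simp
 qed
 moreover have "on_coset f ` car (quot V K) = car W"
  unfolding f(2)[symmetric] quot_simps image_image by (rule image_cong) (simp_all add: O(2))
 ultimately show ?thesis
  unfolding isomorphic_def linear_iso_def bij_betw_def using O(1) by blast
qed

text \<open>A complement of \<open>S\<close> maps isomorphically onto the quotient, and the inverse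
  is the section. It will split the filtration of the cohomology in the proof of
  convergence.\<close>

lemma linear_section:
 assumes V: "cvs V" and S: "csubspace S V"
 obtains s where "s:lin (quot V S) V" "!!u. u:car (quot V S) ==> S +>\<^bsub>V\<^esub> s u = u"
proof -
 obtain T where T: "csubspace T V" "S \<inter> T = {0[V]}"
  and dec: "!!x. x:car V ==> EX s:S. EX t:T. x = s +[V] t"
  using complement_extension[OF V S csubspace_zero[OF V]] subD(2)[OF V S] by auto
 note DT = subD[OF V T(1)] and VT = sub_cvs[OF V T(1)]
 let ?c = "%x. S +>\<^bsub>V\<^esub> x" and ?V = "V(|carrier := T|)"
 have lin: "?c:lin ?V (quot V S)"
  by (rule linear_restrict[OF quot_class_linear[OF V S] DT(1)])
 have "inj_on ?c (car ?V)"
 proof (rule linear_injI[OF VT cvs_quot[OF V S] lin])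
  fix x assume "x:car ?V" "?c x = 0[quot V S]"
  thus "x = 0[?V]" using T(2) DT(5) by (auto simp: coset_eq_zero_iff[OF V S])
 qed
 moreover have "?c ` car ?V = car (quot V S)"
 proof
  show "car (quot V S) <= ?c ` car ?V"
  proof
   fix u assume "u:car (quot V S)"
   then obtain x where x: "x:car V" "u = ?c x" by auto
   then obtain s t where st: "s:S" "t:T" "x = s +[V] t" using dec by blast
   hence "?c x = ?c t" using DT(5) by (intro coset_eqI[OF V S]) auto
   thus "u:?c ` car ?V" using x st by auto
  qed
 qed (use DT(5) in auto)
 ultimately have bij: "bij_betw ?c (car ?V) (car (quot V S))" by (simp add: bij_betw_def)
 let ?s = "inv_into T ?c"
 have "?s:lin (quot V S) ?V" using linear_inv[OF VT lin bij] by simp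
 hence "?s:lin (quot V S) V"
  using DT(5) by (auto simp: linear_maps_def Pi_iff)
 moreover have "?c (?s u) = u" if "u:car (quot V S)" for u
  using bij that by (auto simp: bij_betw_def f_inv_into_f)
 ultimately show ?thesis using that by blast
qed

lemma cvs_direct_sum:
 assumes E: "!!i. i:I ==> cvs (E i)"
 shows "cvs (direct_sum I E)"
proof -
 note Z = zero_cl[OF E] and A = add_cl[OF E] and M = smult_cl[OF E]
 have car: "f:car (direct_sum I E) <-> f:(\<Pi>\<^sub>E i\<in>I. car (E i)) & finite {i:I. f i ~= 0[E i]}" for f
  by (auto simp: direct_sum_def)
 have cl: "f i:car (E i)" if "f:car (direct_sum I E)" "i:I" for f i using that by (auto simp: car)
 have ext: "f i = undefined" if "f:car (direct_sum I E)" "i \<notin> I" for f i using that by (auto simp: car PiE_def extensional_def)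
 show ?thesis
 proof (rule cvsI)
  fix f g assume fg: "f:car (direct_sum I E)" "g:car (direct_sum I E)"
  have "{i:I. f i +[E i] g i ~= 0[E i]} <= {i:I. f i ~= 0[E i]} \<union> {i:I. g i ~= 0[E i]}"
   using cvs_l_zero[OF E Z] by auto
  moreover have "finite ({i:I. f i ~= 0[E i]} \<union> {i:I. g i ~= 0[E i]})" using fg by (auto simp: car)
  ultimately have "finite {i:I. f i +[E i] g i ~= 0[E i]}" by (rule finite_subset)
  thus "f +[direct_sum I E] g:car (direct_sum I E)"
   using fg cl A by (auto simp: car) (auto simp: direct_sum_def cong: conj_cong)
  show "f +[direct_sum I E] g = g +[direct_sum I E] f"
   using fg cl cvs_add_comm[OF E] by (auto simp: direct_sum_def intro!: restrict_ext)
 next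
  fix c f assume f: "f:car (direct_sum I E)"
  have "{i:I. c *[E i] f i ~= 0[E i]} <= {i:I. f i ~= 0[E i]}"
   using cvs_smult_zero[OF E] by auto
  hence "finite {i:I. c *[E i] f i ~= 0[E i]}" using f by (auto simp: car elim: finite_subset)
  thus "c *[direct_sum I E] f:car (direct_sum I E)"
   using f cl M by (auto simp: car) (auto simp: direct_sum_def cong: conj_cong)
 next
  show "0[direct_sum I E]:car (direct_sum I E)"
   using Z by (auto simp: car) (auto simp: direct_sum_def)
 qed (use cl ext in "auto simp: direct_sum_def fun_eq_iff restrict_def A M cvs_add_assoc[OF E] cvs_l_zero[OF E]
   cvs_add_smult[OF E] cvs_smult_add[OF E] cvs_smult_smult[OF E] cvs_smult_one[OF E] cvs_zero_smult[OF E]")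
qed

section \<open>The spectral sequence of a filtered complex\<close>

text \<open>What the spectral sequence uses of the bundle: a decreasing filtration by subcomplexes
  that starts with everything and is zero in degree \<open>n\<close> beyond step \<open>n\<close>.
  This finiteness makes every entry stabilise.\<close>

locale filtered_complex =
 fixes D :: "('b, 'u, 'a, 'w, 'e) bundle_data"
 assumes cochains_cvs: "cvs (cochains D n)"
  and connC_linear: "connC D n:lin (cochains D n) (cochains D (Suc n))"
  and connC_square: "x:car (cochains D n) ==> connC D (Suc n) (connC D n x) = 0[cochains D (Suc (Suc n))]"
  and filt_subspace: "csubspace (filt D p n) (cochains D n)"
  and filt_0: "filt D 0 n = car (cochains D n)"
  and filt_Suc: "filt D (Suc p) n <= filt D p n"
  and filt_above: "n < p ==> filt D p n = {0[cochains D n]}"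
  and connC_filt: "x:filt D p n ==> connC D n x:filt D p (Suc n)"
begin

abbreviation "C n == cochains D n"
abbreviation "d n == connC D n"
abbreviation "Z r p n == Zpage D r p n"
abbreviation "Bd r p n == Bpage D r p n"
abbreviation "Fi p n == filt D (nat p) n"

lemmas FD = subD[OF cochains_cvs filt_subspace]
lemmas dD = linD[OF connC_linear]
lemma d_zero: "d n 0[C n] = 0[C (Suc n)]"
 by (rule lin_zero[OF cochains_cvs cochains_cvs connC_linear])

lemma filt_mono: "p <= p' ==> filt D p' n <= filt D p n"
 by (induction p' rule: dec_induct) (use filt_Suc in auto)

lemma Fi_mono: "p <= p' ==> x:Fi p' n ==> x:Fi p n"
 using filt_mono[of "nat p" "nat p'"] by (auto intro: nat_mono)

lemma Z_iff: "z:Z r p n <-> z:Fi p n & d n z:Fi (p + int r) (Suc n)"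
 by (simp add: Zpage_def)

lemma Z_mono: "p <= p' ==> p + int r <= p' + int r' ==> z:Z r' p' n ==> z:Z r p n"
 unfolding Z_iff using Fi_mono by blast

lemma Z_subspace: "csubspace (Z r p n) (C n)"
 by (rule csubspaceI[OF cochains_cvs]) (auto simp: Z_iff FD d_zero dD)

lemmas ZD = subD[OF cochains_cvs Z_subspace]

lemma cycle_in_Z: "z:Fi p n ==> d n z = 0[C (Suc n)] ==> z:Z r p n"
 by (simp add: Z_iff FD)

text \<open>A boundary is a cycle, so it survives to every page: \<open>r'\<close> is unrelated to
  \<open>r\<close>.\<close>

lemma d_in_Z: "y:Z r p n ==> d n y:Z r' (p + int r) (Suc n)"
 using ZD(5) by (intro cycle_in_Z) (auto simp: Z_iff connC_square)

text \<open>The second summand of \<open>Bpage\<close>, the elements hit by the differential of the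
  preceding page. In degree 0 there is nothing to come from.\<close>

definition "bdry r p n = (case n of 0 => {0[C 0]} | Suc m => d m ` Z (r - 1) (p - int r + 1) m)"

lemma Bd_eq: "Bd r p n = Z (r - 1) (p + 1) n <+>\<^bsub>C n\<^esub> bdry r p n"
 by (auto simp: Bpage_def bdry_def split: nat.splits)

lemma bdry_subspace: "csubspace (bdry r p n) (C n)"
 by (cases n) (auto simp: bdry_def csubspace_zero cochains_cvs
   intro: linear_image_subspace[OF cochains_cvs cochains_cvs connC_linear Z_subspace])

lemma Bd_subspace: "csubspace (Bd r p n) (C n)"
 unfolding Bd_eq by (rule csubspace_add[OF cochains_cvs Z_subspace bdry_subspace])

lemmas BdD = subD[OF cochains_cvs Bd_subspace]

lemma mem_set_add: "x:S <+>\<^bsub>V\<^esub> T <-> (EX s:S. EX t:T. x = s +[V] t)"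
 by (auto simp: set_add_def set_mult_def)

lemma Bd_iff: "x:Bd r p n <-> (EX u:Z (r - 1) (p + 1) n. EX v:bdry r p n. x = u +[C n] v)"
 unfolding Bd_eq mem_set_add ..

lemma in_BdI1: "u:Z (r - 1) (p + 1) n ==> u:Bd r p n"
 unfolding Bd_iff using subD(2)[OF cochains_cvs bdry_subspace] cvs_r_zero[OF cochains_cvs] ZD(5) by metis

lemma in_BdI2: "v:bdry r p n ==> v:Bd r p n"
 unfolding Bd_iff using subD(5)[OF cochains_cvs bdry_subspace] cvs_l_zero[OF cochains_cvs] ZD(2) by metis

lemma bdry_cycle: "v:bdry r p n ==> d n v = 0[C (Suc n)]"
 using connC_square ZD(5) by (cases n) (auto simp: bdry_def d_zero)

lemma bdry_filt: "r >= 1 ==> v:bdry r p n ==> v:Fi p n"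
 by (cases n) (auto simp: bdry_def FD Z_iff)

lemma Bd_sub_Z: "r >= 1 ==> Bd r p n <= Z r p n"
proof
 fix x assume r: "r >= 1" and "x:Bd r p n"
 then obtain u v where "u:Z (r - 1) (p + 1) n" "v:bdry r p n" "x = u +[C n] v" by (auto simp: Bd_iff)
 moreover have "u:Z r p n" using Z_mono[of p "p + 1" r "r - 1" u n] r calculation(1) by auto
 moreover have "v:Z r p n" using calculation r by (intro cycle_in_Z bdry_filt bdry_cycle) auto
 ultimately show "x:Z r p n" using ZD(3) by auto
qed

abbreviation "ZV r p n == (C n)(|carrier := Z r p n|)"

text \<open>The page by filtration and total degree. The integer bidegrees of \<open>page\<close>
  matter only in the case \<open>p + q < 0\<close>, which is kept apart from here on.\<close>

definition "Pg r p n = quot (ZV r p n) (Bd r p n)"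
definition "pcl r p n z = Bd r p n +>\<^bsub>C n\<^esub> z"

lemma ZV_cvs: "cvs (ZV r p n)"
 by (rule sub_cvs[OF cochains_cvs Z_subspace])

lemma Bd_ZV: "r >= 1 ==> csubspace (Bd r p n) (ZV r p n)"
 using csubspace_of_subspace[OF cochains_cvs Z_subspace Bd_sub_Z] Bd_subspace by auto

lemma cvs_Pg: "r >= 1 ==> cvs (Pg r p n)"
 unfolding Pg_def by (rule cvs_quot[OF ZV_cvs Bd_ZV])

lemma carrier_Pg: "car (Pg r p n) = pcl r p n ` Z r p n"
 by (simp add: Pg_def pcl_def)

lemma zero_Pg: "0[Pg r p n] = Bd r p n"
 by (simp add: Pg_def)

lemma pcl_linear: "r >= 1 ==> pcl r p n:lin (ZV r p n) (Pg r p n)"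
 using quot_class_linear[OF ZV_cvs Bd_ZV] by (simp add: Pg_def pcl_def[abs_def])

lemma pcl_closed: "z:Z r p n ==> pcl r p n z:car (Pg r p n)"
 by (simp add: carrier_Pg)

lemma pcl_add: "r >= 1 ==> x:Z r p n ==> y:Z r p n ==>
  pcl r p n (x +[C n] y) = pcl r p n x +[Pg r p n] pcl r p n y"
 using linear_add[OF pcl_linear] by simp

lemma pcl_smult: "r >= 1 ==> x:Z r p n ==> pcl r p n (c *[C n] x) = c *[Pg r p n] pcl r p n x"
 using linear_smult[OF pcl_linear] by simp

lemma pcl_zero_iff: "r >= 1 ==> z:Z r p n ==> pcl r p n z = 0[Pg r p n] <-> z:Bd r p n"
 using coset_eq_zero_iff[OF ZV_cvs Bd_ZV] by (simp add: zero_Pg pcl_def)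

lemma pcl_eqI: "r >= 1 ==> z:Z r p n ==> s:Bd r p n ==> pcl r p n (s +[C n] z) = pcl r p n z"
 using coset_eqI[where x = "s +[C n] z" and y = z, OF ZV_cvs Bd_ZV] by (simp add: pcl_def)

lemma page_eq_Pg: "p + q >= 0 ==> page D r p q = Pg r p (nat (p + q))"
 by (simp add: page_def Pg_def)

lemma page_negative:
 assumes "p + q < 0"
 shows "cvs (page D r p q)" "car (page D r p q) = {0[page D r p q]}"
proof -
 let ?V = "(C 0)(|carrier := {0[C 0]}|)"
 have V: "cvs ?V" by (rule sub_cvs[OF cochains_cvs csubspace_zero[OF cochains_cvs]])
 have S: "csubspace {0[C 0]} ?V" using csubspace_carrier[OF V] by simp
 show "cvs (page D r p q)" using assms cvs_quot[OF V S] by (simp add: page_def)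
 show "car (page D r p q) = {0[page D r p q]}"
  using assms coset_zero[OF V S] by (simp add: page_def)
qed

lemma cvs_page: "r >= 1 ==> cvs (page D r p q)"
 using page_negative(1) cvs_Pg page_eq_Pg by (metis not_less)

text \<open>The value is independent of the representative: of the two summands of
  \<open>Bpage\<close>, one consists of cycles and the other is mapped into the boundaries of the
  target.\<close>

lemma page_diff_class:
 assumes r: "r >= 1" and pq: "p + q >= 0" and z: "z:Z r p (nat (p + q))"
 shows "page_diff D r p q (pcl r p (nat (p + q)) z) = pcl r (p + int r) (Suc (nat (p + q))) (d (nat (p + q)) z)"
proof -
 let ?n = "nat (p + q)"
 have "on_coset (%z. Bd r (p + int r) (Suc ?n) +>\<^bsub>C (Suc ?n)\<^esub> d ?n z) (Bd r p ?n +>\<^bsub>ZV r p ?n\<^esub> z)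
  = Bd r (p + int r) (Suc ?n) +>\<^bsub>C (Suc ?n)\<^esub> d ?n z"
 proof (rule on_coset_eq[OF ZV_cvs Bd_ZV[OF r]])
  fix s assume "s:Bd r p ?n"
  then obtain u v where uv: "u:Z (r - 1) (p + 1) ?n" "v:bdry r p ?n" "s = u +[C ?n] v" by (auto simp: Bd_iff)
  have v: "v:car (C ?n)" using uv(2) subD(5)[OF cochains_cvs bdry_subspace] by auto
  have "d ?n s = d ?n u +[C (Suc ?n)] 0[C (Suc ?n)]"
   using uv v ZD(5) by (simp add: dD bdry_cycle)
  hence ds: "d ?n s = d ?n u" using uv(1) ZD(5) dD(1) by (simp add: cvs_r_zero[OF cochains_cvs])
  \<comment> \<open>\<open>u\<close> has filtration \<open>p + 1 = (p + r) - r + 1\<close>, the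
    index that occurs in \<open>bdry\<close> at filtration \<open>p + r\<close>.\<close>
  have "d ?n u:bdry r (p + int r) (Suc ?n)" using uv(1) by (auto simp: bdry_def)
  hence "d ?n s:Bd r (p + int r) (Suc ?n)" unfolding ds by (rule in_BdI2)
  moreover have "s:car (C ?n)" using uv v ZD(5) add_cl[OF cochains_cvs] by auto
  ultimately show "Bd r (p + int r) (Suc ?n) +>\<^bsub>C (Suc ?n)\<^esub> d ?n (s +[ZV r p ?n] z) = Bd r (p + int r) (Suc ?n) +>\<^bsub>C (Suc ?n)\<^esub> d ?n z"
   using z ZD(5) dD by (intro coset_eqI[OF cochains_cvs Bd_subspace, of "d ?n s"]) auto
 qed (use z in simp)
 thus ?thesis using pq by (simp add: page_diff_def pcl_def)
qed

lemma page_target: "p + q >= 0 ==> page D r (p + int r) (q - int r + 1) = Pg r (p + int r) (Suc (nat (p + q)))"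
proof -
 assume pq: "p + q >= 0"
 hence "nat ((p + int r) + (q - int r + 1)) = Suc (nat (p + q))" "(p + int r) + (q - int r + 1) >= 0" by auto
 thus ?thesis using page_eq_Pg[of "p + int r" "q - int r + 1" r] by metis
qed

lemma page_diff_linear:
 assumes r: "r >= 1"
 shows "page_diff D r p q:lin (page D r p q) (page D r (p + int r) (q - int r + 1))"
proof (cases "p + q < 0")
 case True
 thus ?thesis using linear_zero_map[OF cvs_page[OF r]] by (auto simp: page_diff_def[abs_def])
next
 case False
 hence pq: "p + q >= 0" by simp
 note dz = d_in_Z[of _ r p "nat (p + q)" r]
 show ?thesis
  unfolding page_target[OF pq] page_eq_Pg[OF pq]
  by (rule linI)
   (auto simp: carrier_Pg page_diff_class[OF r pq] pcl_add[OF r, symmetric] pcl_smult[OF r, symmetric] ZD dD dz)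
qed

lemma page_diff_square:
 assumes r: "r >= 1" and x: "x:car (page D r p q)"
 shows "page_diff D r (p + int r) (q - int r + 1) (page_diff D r p q x)
    = 0[page D r (p + int r + int r) (q - int r + 1 - int r + 1)]"
proof (cases "p + q < 0")
 case True
 thus ?thesis using lin_zero[OF cvs_page[OF r] cvs_page[OF r] page_diff_linear[OF r]]
  by (simp add: page_diff_def[of D r p q])
next
 case False
 hence pq: "p + q >= 0" and pq': "(p + int r) + (q - int r + 1) >= 0" by auto
 have n: "nat ((p + int r) + (q - int r + 1)) = Suc (nat (p + q))" using pq by simp
 obtain z where z: "z:Z r p (nat (p + q))" "x = pcl r p (nat (p + q)) z"
  using x by (auto simp: page_eq_Pg[OF pq] carrier_Pg)
 have dz: "d (nat (p + q)) z:Z r (p + int r) (Suc (nat (p + q)))" using z d_in_Z by blast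
 have "pcl r (p + int r + int r) (Suc (Suc (nat (p + q)))) 0[C (Suc (Suc (nat (p + q))))]
   = 0[Pg r (p + int r + int r) (Suc (Suc (nat (p + q))))]"
  using pcl_zero_iff[OF r ZD(2)] BdD(2) by blast
 thus ?thesis
  unfolding page_target[OF pq', unfolded n] z(2) page_diff_class[OF r pq z(1)]
   page_diff_class[OF r pq', unfolded n, OF dz] connC_square[OF ZD(5)[OF z(1)]] .
qed

text \<open>Send an element of \<open>Z (Suc r)\<close> to its class in the homology of page
  \<open>r\<close>. This is onto, because a representative can be corrected by an element of higher
  filtration, and the kernel is \<open>Bpage\<close> of the next page.\<close>

lemma page_step:
 assumes r: "r >= 1"
 shows "isomorphic (page D (Suc r) p q)
   (quot ((page D r p q)(|carrier := {x:car (page D r p q). page_diff D r p q x = 0[page D r (p + int r) (q - int r + 1)]}|))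
     (page_diff D r (p - int r) (q + int r - 1) ` car (page D r (p - int r) (q + int r - 1))))"
  (is "isomorphic _ (quot (_(|carrier := ?K|)) ?I)")
proof -
 let ?E = "page D r p q"
 have E: "cvs ?E" by (rule cvs_page[OF r])
 have K: "csubspace ?K ?E"
  by (rule linear_kernel_subspace[OF E cvs_page[OF r] page_diff_linear[OF r]])
 note KV = sub_cvs[OF E K]
 have lin': "page_diff D r (p - int r) (q + int r - 1):lin (page D r (p - int r) (q + int r - 1)) ?E"
  using page_diff_linear[OF r, of "p - int r" "q + int r - 1"] by simp
 have "csubspace ?I ?E"
  using linear_image_subspace[OF cvs_page[OF r] E lin' csubspace_carrier[OF cvs_page[OF r]]] .
 moreover have IK: "?I <= ?K"
  using page_diff_square[OF r, of _ "p - int r" "q + int r - 1"] lin_cl[OF lin'] by auto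
 ultimately have I: "csubspace ?I (?E(|carrier := ?K|))"
  using csubspace_of_subspace[OF E K IK] by blast
 show ?thesis
 proof (cases "p + q < 0")
  case True
  have "?K <= {0[?E]}" using page_negative(2)[OF True] by auto
  moreover have "0[?E]:?K" by (rule subD(2)[OF E K])
  moreover have "0[?E]:?I" using subD(2)[OF KV I] by simp
  ultimately have "?K = {0[?E]}" "?I = {0[?E]}" using IK by blast+
  thus ?thesis
   using page_negative[OF True] cvs_quot[OF KV I] coset_zero[OF KV I] by (intro isomorphic_trivial) auto
 next
  case False
  hence pq: "p + q >= 0" by simp
  define n where "n = nat (p + q)"
  note EP = page_eq_Pg[OF pq, folded n_def]
  note dcl = page_diff_class[OF r pq, folded n_def]
  have r': "Suc r >= 1" by simp
  have sub: "z:Z r p n" if "z:Z (Suc r) p n" for z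
   using Z_mono[of p p r "Suc r" z n] that by simp
  have tgt: "page D r (p + int r) (q - int r + 1) = Pg r (p + int r) (Suc n)"
   using page_target[OF pq] by (simp add: n_def)
  have Kmem: "pcl r p n z:?K <-> d n z:Bd r (p + int r) (Suc n)" if "z:Z r p n" for z
   using that d_in_Z[OF that] unfolding tgt by (auto simp: dcl EP pcl_closed pcl_zero_iff[OF r])
  \<comment> \<open>The image of the incoming differential consists of the classes of
    \<open>d y\<close> with \<open>y\<close> of filtration \<open>p - r = p - (r + 1) + 1\<close>,
    hence of the boundaries that belong to the next page.\<close>
  have I_iff: "pcl r p n z:?I <-> (EX s:Bd r p n. EX v:bdry (Suc r) p n. z = s +[C n] v)" if z: "z:Z r p n" for z
  proof (cases n)
   case 0
   hence "p - int r + (q + int r - 1) < 0" using pq by (simp add: n_def)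
   hence "?I = {0[?E]}"
    using page_negative(2)[of "p - int r" "q + int r - 1" r] by (simp add: page_diff_def)
   thus ?thesis using z 0 EP ZD(5) BdD(5) by (auto simp: pcl_zero_iff[OF r] bdry_def cvs_r_zero[OF cochains_cvs])
  next
   case (Suc m)
   hence pq': "p - int r + (q + int r - 1) >= 0" and m: "nat (p - int r + (q + int r - 1)) = m"
    by (auto simp: n_def)
   have I_eq: "?I = (%y. pcl r p n (d m y)) ` Z r (p - int r) m"
    unfolding page_eq_Pg[OF pq', of r, unfolded m] carrier_Pg image_image
    by (rule image_cong) (simp_all add: page_diff_class[OF r pq', unfolded m] Suc)
   have dZ: "d m y:Z r p n" if "y:Z r (p - int r) m" for y
    using d_in_Z[OF that, of r] Suc by simp
   have eqv: "pcl r p n z = pcl r p n (d m y) <-> (EX s:Bd r p n. z = s +[C n] d m y)" if y: "y:Z r (p - int r) m" for y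
   proof
    assume "pcl r p n z = pcl r p n (d m y)"
    thus "EX s:Bd r p n. z = s +[C n] d m y"
     using coset_eqE[OF ZV_cvs Bd_ZV[OF r], of p n z "d m y"] z dZ[OF y] by (auto simp: pcl_def)
   qed (use pcl_eqI[OF r] dZ[OF y] in auto)
   have "pcl r p n z:?I <-> (EX y:Z r (p - int r) m. pcl r p n z = pcl r p n (d m y))"
    unfolding I_eq image_iff ..
   also have "... <-> (EX y:Z r (p - int r) m. EX s:Bd r p n. z = s +[C n] d m y)" using eqv by blast
   also have "... <-> (EX s:Bd r p n. EX v:bdry (Suc r) p n. z = s +[C n] v)"
    using Suc by (auto simp: bdry_def)
   finally show ?thesis .
  qed
  let ?f = "%z. ?I +>\<^bsub>?E\<^esub> pcl r p n z"
  have d1: "d n z:Bd r (p + int r) (Suc n)" if "z:Z (Suc r) p n" for z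
  proof (rule in_BdI1)
   have "d n z:Z (r - 1) (p + int (Suc r)) (Suc n)" by (rule d_in_Z[OF that])
   thus "d n z:Z (r - 1) (p + int r + 1) (Suc n)" by (simp add: algebra_simps)
  qed
  have pK: "pcl r p n z:?K" if "z:Z (Suc r) p n" for z
   using Kmem[OF sub[OF that]] d1[OF that] by blast
  have "pcl r p n:lin (ZV (Suc r) p n) ?E"
   using linear_restrict[OF pcl_linear[OF r], of "Z (Suc r) p n" p n] sub by (auto simp: EP)
  hence "pcl r p n:lin (ZV (Suc r) p n) (?E(|carrier := ?K|))"
   by (rule linear_corestrict) (use pK in auto)
  from lin_comp[OF this quot_class_linear[OF KV I]]
  have f: "?f:lin (ZV (Suc r) p n) (quot (?E(|carrier := ?K|)) ?I)" by simp
  have "isomorphic (quot (ZV (Suc r) p n) (Bd (Suc r) p n)) (quot (?E(|carrier := ?K|)) ?I)"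
  proof (rule isomorphic_quot[OF ZV_cvs cvs_quot[OF KV I] f])
   show "Bd (Suc r) p n <= car (ZV (Suc r) p n)" using Bd_sub_Z[OF r'] by simp
   show "?f ` car (ZV (Suc r) p n) = car (quot (?E(|carrier := ?K|)) ?I)"
   proof
    show "car (quot (?E(|carrier := ?K|)) ?I) <= ?f ` car (ZV (Suc r) p n)"
    proof
     fix U assume "U:car (quot (?E(|carrier := ?K|)) ?I)"
     then obtain e where e: "e:?K" "U = ?I +>\<^bsub>?E\<^esub> e" by auto
     then obtain z where z: "z:Z r p n" "e = pcl r p n z" by (auto simp: EP carrier_Pg)
     hence "d n z:Bd r (p + int r) (Suc n)" using e Kmem by simp
     then obtain u v where uv: "u:Z (r - 1) (p + int r + 1) (Suc n)" "v:bdry r (p + int r) (Suc n)"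
      "d n z = u +[C (Suc n)] v" by (auto simp: Bd_iff)
     then obtain y where y: "y:Z (r - 1) (p + 1) n" "v = d n y" by (auto simp: bdry_def)
     note cl = ZD(5)[OF z(1)] ZD(5)[OF uv(1)] ZD(5)[OF y(1)] dD(1)[OF ZD(5)[OF y(1)]]
      smult_cl[OF cochains_cvs] add_cl[OF cochains_cvs]
     \<comment> \<open>Here \<open>d z = u + d y\<close> with \<open>u\<close> of filtration
       \<open>p + r + 1\<close>. Subtracting \<open>y\<close>, which is zero on page
       \<open>r\<close>, leaves \<open>u\<close> as the differential, so the corrected element lives
       on the next page.\<close>
     let ?z' = "z +[C n] (-1) *[C n] y"
     have y': "(-1) *[C n] y:Bd r p n" using y in_BdI1 BdD(4) by blast
     have "d n ?z' = (u +[C (Suc n)] v) +[C (Suc n)] (-1) *[C (Suc n)] v"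
      using cl uv y by (simp add: dD)
     also have "... = u"
      using cl y cvs_add_comm[OF cochains_cvs, of u "Suc n" v] by (simp add: cvs_add_diff[OF cochains_cvs])
     finally have du: "d n ?z' = u" .
     have zr: "?z':Z r p n" using z(1) y' Bd_sub_Z[OF r, of p n] ZD(3) by blast
     hence "?z':Z (Suc r) p n" using uv(1) by (simp add: Z_iff du algebra_simps)
     moreover have "pcl r p n ?z' = e"
      using pcl_eqI[OF r z(1) y'] cl z cvs_add_comm[OF cochains_cvs, of z n "(-1) *[C n] y"] by simp
     ultimately show "U:?f ` car (ZV (Suc r) p n)" using e by auto
    qed
    show "?f ` car (ZV (Suc r) p n) <= car (quot (?E(|carrier := ?K|)) ?I)"
     using lin_cl[OF f] by blast
   qed
   fix z assume "z:car (ZV (Suc r) p n)"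
   hence z: "z:Z (Suc r) p n" "z:Z r p n" using sub by auto
   have "?f z = 0[quot (?E(|carrier := ?K|)) ?I] <-> pcl r p n z:?I"
    using coset_eq_zero_iff[OF KV I] pK[OF z(1)] by simp
   also have "... <-> z:Bd (Suc r) p n"
    unfolding I_iff[OF z(2)]
   proof
    assume "EX s:Bd r p n. EX v:bdry (Suc r) p n. z = s +[C n] v"
    then obtain u w v where *: "u:Z (r - 1) (p + 1) n" "w:bdry r p n" "v:bdry (Suc r) p n"
     "z = (u +[C n] w) +[C n] v" by (auto simp: Bd_iff)
    have "w:bdry (Suc r) p n"
     using *(2) r Z_mono[of "p - int r" "p - int r + 1" r "r - 1"] by (cases n) (auto simp: bdry_def)
    hence wv: "w +[C n] v:bdry (Suc r) p n" using *(3) subD(3)[OF cochains_cvs bdry_subspace] by auto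
    have cl: "w:car (C n)" "v:car (C n)" "w +[C n] v:car (C n)" "u:car (C n)"
     using *(1-3) wv subD(5)[OF cochains_cvs bdry_subspace] ZD(5) by auto
    have zz: "z = u +[C n] (w +[C n] v)" using * cl by (simp add: cvs_add_assoc[OF cochains_cvs])
    \<comment> \<open>The boundary parts are cycles, so \<open>u\<close> has the same differential
      as \<open>z\<close>. Thus \<open>u\<close>, of filtration \<open>p + 1\<close>, has a
      differential of filtration \<open>p + 1 + r\<close> and lies in the first summand of the next
      \<open>Bpage\<close>.\<close>
    have "d n z = d n u +[C (Suc n)] 0[C (Suc n)]"
     using cl wv unfolding zz by (simp add: dD bdry_cycle)
    hence "d n u = d n z" using cl dD(1) by (simp add: cvs_r_zero[OF cochains_cvs])
    hence "u:Z r (p + 1) n" using *(1) z(1) by (simp add: Z_iff algebra_simps)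
    thus "z:Bd (Suc r) p n" unfolding Bd_iff using wv zz by auto
   next
    assume "z:Bd (Suc r) p n"
    then obtain u v where "u:Z r (p + 1) n" "v:bdry (Suc r) p n" "z = u +[C n] v" by (auto simp: Bd_iff)
    moreover have "u:Bd r p n" using calculation(1) Z_mono[of "p + 1" "p + 1" "r - 1" r] by (intro in_BdI1) auto
    ultimately show "EX s:Bd r p n. EX v:bdry (Suc r) p n. z = s +[C n] v" by auto
   qed
   finally show "?f z = 0[quot (?E(|carrier := ?K|)) ?I] <-> z:Bd (Suc r) p n" .
  qed
  thus ?thesis using page_eq_Pg[OF pq, of "Suc r"] by (simp add: Pg_def n_def)
 qed
qed

lemma spectral_sequence_pages: "spectral_sequence (page D) (page_diff D)"
 unfolding spectral_sequence_def
 using cvs_page page_diff_linear page_diff_square page_step by blast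

text \<open>For \<open>p < 0\<close> the filtration does not change from \<open>p\<close> to
  \<open>p + 1\<close>, so \<open>Z r p = Z (r - 1) (p + 1)\<close>, the first summand of
  \<open>Bpage\<close>. For \<open>q < 0\<close> the filtration degree exceeds the total degree and
  \<open>Z\<close> is zero.\<close>

lemma page_vanishes:
 assumes r: "r >= 1" and "p < 0 \<or> q < 0"
 shows "car (page D r p q) = {0[page D r p q]}"
proof (cases "p + q < 0")
 case False
 hence pq: "p + q >= 0" by simp
 have "Z r p (nat (p + q)) <= Bd r p (nat (p + q))"
 proof (cases "p < 0")
  case True
  hence "Z r p n = Z (r - 1) (p + 1) n" for n using r by (auto simp: Z_iff)
  thus ?thesis using in_BdI1 by auto
 next
  case False
  hence "Fi p (nat (p + q)) = {0[C (nat (p + q))]}" using assms pq by (intro filt_above) auto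
  thus ?thesis using BdD(2) by (auto simp: Z_iff)
 qed
 hence "pcl r p (nat (p + q)) z = 0[Pg r p (nat (p + q))]" if "z:Z r p (nat (p + q))" for z
  using that pcl_zero_iff[OF r] by auto
 hence "car (Pg r p (nat (p + q))) <= {0[Pg r p (nat (p + q))]}" unfolding carrier_Pg by auto
 thus ?thesis using zero_cl[OF cvs_Pg[OF r]] unfolding page_eq_Pg[OF pq] by blast
qed (rule page_negative)


section \<open>Stabilisation of the pages and convergence\<close>

abbreviation "cob n == coboundaries (cochains D) (connC D) n"
abbreviation "cyc n == cocycles (cochains D) (connC D) n"

lemma cyc_iff: "x:cyc n <-> x:car (C n) & d n x = 0[C (Suc n)]"
 by (simp add: cocycles_def)

lemma cyc_subspace: "csubspace (cyc n) (C n)"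
 unfolding cocycles_def by (rule linear_kernel_subspace[OF cochains_cvs cochains_cvs connC_linear])

lemma cob_subspace: "csubspace (cob n) (C n)"
 by (cases n) (auto simp: coboundaries_def csubspace_zero cochains_cvs
   intro: linear_image_subspace[OF cochains_cvs cochains_cvs connC_linear csubspace_carrier[OF cochains_cvs]])

lemma cob_sub_cyc: "cob n <= cyc n"
 by (cases n) (auto simp: coboundaries_def cyc_iff connC_square d_zero zero_cl[OF cochains_cvs] dD)

lemma cyc_cvs: "cvs ((C n)(|carrier := cyc n|))"
 by (rule sub_cvs[OF cochains_cvs cyc_subspace])

lemma cob_cyc_subspace: "csubspace (cob n) ((C n)(|carrier := cyc n|))"
 using csubspace_of_subspace[OF cochains_cvs cyc_subspace cob_sub_cyc] cob_subspace by auto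

lemma bundle_cohomology_eq: "bundle_cohomology D n = quot ((C n)(|carrier := cyc n|)) (cob n)"
 by (simp add: bundle_cohomology_def cohomology_def)

lemma Z_stable: "int n + 1 < p + int r ==> Z r p n = {z:Fi p n. d n z = 0[C (Suc n)]}"
 using filt_above[of "Suc n" "nat (p + int r)"] by (auto simp: Z_iff)

text \<open>For such \<open>r\<close> there is no condition left on the filtration of a primitive,
  as the filtration at indices up to 0 is the whole complex.\<close>

lemma bdry_stable:
 assumes "p - int r + 1 <= 0" "r >= 1"
 shows "bdry r p n = cob n \<inter> Fi p n"
proof (cases n)
 case 0
 thus ?thesis using FD(2) by (auto simp: bdry_def coboundaries_def)
next
 case (Suc m)
 have "Z (r - 1) (p - int r + 1) m = {y:car (C m). d m y:Fi p (Suc m)}"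
  using assms by (auto simp: Z_iff filt_0)
 thus ?thesis by (auto simp: Suc bdry_def coboundaries_def)
qed

text \<open>A page from which on the entry at \<open>(p, q)\<close> is final: \<open>p + r\<close>
  exceeds every filtration degree occurring in total degree \<open>p + q + 1\<close>, and
  \<open>p - r + 1\<close> is not positive. The 3 leaves room for the strict inequalities in
  \<open>stage_bounds\<close>.\<close>

definition "stage p q = nat (\<bar>p\<bar> + \<bar>q\<bar> + 3)"

lemma stage_bounds:
 assumes "r >= stage p q"
 shows "r >= 1" "p + q >= 0 ==> int (nat (p + q)) + 1 < p + int r" "p - int r + 1 <= 0"
  "p + q >= 0 ==> int (nat (p + q)) + 1 < (p + 1) + int (r - 1)"
 using assms unfolding stage_def by (auto simp: of_nat_diff)

text \<open>From \<open>stage\<close> on the subspaces that define the entry no longer change, so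
  the entries are equal and not only isomorphic.\<close>

lemma page_stable: "r >= stage p q ==> page D r p q = page D (stage p q) p q"
proof (cases "p + q < 0")
 case True
 thus ?thesis by (simp add: page_def)
next
 case False
 assume r: "r >= stage p q"
 show ?thesis
  using False stage_bounds[OF r] stage_bounds[OF order_refl, of p q]
  by (simp add: page_eq_Pg Pg_def Bd_eq Z_stable bdry_stable)
qed

lemma page_diff_stable:
 assumes r: "r >= stage p q"
 shows "x:car (page D r p q) ==> page_diff D r p q x = 0[page D r (p + int r) (q - int r + 1)]"
  and "x:car (page D r (p - int r) (q + int r - 1)) ==>
   page_diff D r (p - int r) (q + int r - 1) x = 0[page D r p q]"
proof -
 note b = stage_bounds[OF r]
 show "page_diff D r p q x = 0[page D r (p + int r) (q - int r + 1)]" if x: "x:car (page D r p q)"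
 proof (cases "p + q < 0")
  case False
  hence pq: "p + q >= 0" by simp
  obtain z where z: "z:Z r p (nat (p + q))" "x = pcl r p (nat (p + q)) z"
   using x by (auto simp: page_eq_Pg[OF pq] carrier_Pg)
  have "d (nat (p + q)) z = 0[C (Suc (nat (p + q)))]" using z(1) Z_stable[OF b(2)[OF pq]] by auto
  thus ?thesis
   unfolding page_target[OF pq] z(2) page_diff_class[OF b(1) pq z(1)] using pcl_zero_iff[OF b(1) ZD(2)] BdD(2) by simp
 qed (simp add: page_diff_def)
 show "page_diff D r (p - int r) (q + int r - 1) x = 0[page D r p q]"
  if x: "x:car (page D r (p - int r) (q + int r - 1))"
 proof (cases "p - int r + (q + int r - 1) < 0")
  case False
  hence pq: "p - int r + (q + int r - 1) >= 0" and pq': "p + q >= 0" by auto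
  define m where "m = nat (p - int r + (q + int r - 1))"
  have n: "nat (p + q) = Suc m" using pq by (simp add: m_def)
  obtain y where y: "y:Z r (p - int r) m" "x = pcl r (p - int r) m y"
   using x by (auto simp: page_eq_Pg[OF pq] carrier_Pg m_def)
  have "d m y:cob (Suc m) \<inter> Fi p (Suc m)" using y(1) ZD(5)[OF y(1)] by (auto simp: Z_iff coboundaries_def)
  hence "d m y:Bd r p (Suc m)" using in_BdI2 bdry_stable[OF b(3,1)] by auto
  moreover have "d m y:Z r p (Suc m)" using d_in_Z[OF y(1), of r] by simp
  ultimately show ?thesis
   using page_diff_class[OF b(1) pq, folded m_def, OF y(1)] pcl_zero_iff[OF b(1)]
   by (simp add: y(2) page_eq_Pg[OF pq'] n)
 qed (simp add: page_diff_def)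
qed

definition "Einf = (%(p, q). page D (stage p q) p q)"

lemma cvs_Einf: "cvs (Einf pq)"
 by (cases pq) (simp add: Einf_def cvs_page[OF stage_bounds(1)[OF order_refl]])

text \<open>Linear sections of the entries on an antidiagonal give, by adding up representatives, a
  map from the direct sum to the cohomology. It is injective by inspecting the components in
  increasing filtration, and onto by descending induction on the filtration.\<close>

lemma cohomology_Einf: "isomorphic (bundle_cohomology D k) (direct_sum {(p, q). p + q = int k} Einf)"
proof -
 let ?I = "{(p, q). p + q = int k}" and ?H = "bundle_cohomology D k"
 let ?g = "%p. stage (int p) (int k - int p)"
 let ?E = "%p. Pg (?g p) (int p) k"
 let ?D = "direct_sum ?I Einf"
 have H: "cvs ?H" unfolding bundle_cohomology_eq by (rule cvs_quot[OF cyc_cvs cob_cyc_subspace])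
 have DS: "cvs ?D" by (rule cvs_direct_sum[OF cvs_Einf])
 have Einf_p: "Einf (int p, int k - int p) = ?E p" for p
  by (simp add: Einf_def page_eq_Pg)
 have Einf_0: "car (Einf (p, q)) = {0[Einf (p, q)]}" if "p < 0 \<or> q < 0" for p q
  using page_vanishes[OF stage_bounds(1)[OF order_refl, of p q]] that by (auto simp: Einf_def)
 have r1: "?g p >= 1" for p using stage_bounds(1) by blast
 note b = stage_bounds[OF order_refl, of "int p" "int k - int p" for p]
 have Zst: "Z (?g p) (int p) k = filt D p k \<inter> cyc k" for p
  using Z_stable[of k "int p" "?g p"] b(2)[of p] FD(5) by (auto simp: cyc_iff)
 have Bst: "x:Bd (?g p) (int p) k <->
   (EX u:filt D (Suc p) k \<inter> cyc k. EX v:cob k \<inter> filt D p k. x = u +[C k] v)" for p x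
  using Z_stable[of k "int p + 1" "?g p - 1"] b(4)[of p] FD(5) bdry_stable[OF b(3)[of p] r1]
  by (auto simp: Bd_iff cyc_iff nat_add_distrib)
 have "EX s. s:lin (?E p) ((C k)(|carrier := filt D p k \<inter> cyc k|)) &
   (ALL u:car (?E p). pcl (?g p) (int p) k (s u) = u)" for p
  using linear_section[OF ZV_cvs Bd_ZV[OF r1[of p]], of "int p" k] unfolding Pg_def pcl_def Zst[of p]
  by (metis coset_carrier_update)
 then obtain s where s: "!!p. s p:lin (?E p) ((C k)(|carrier := filt D p k \<inter> cyc k|))"
  and ps: "!!p u. u:car (?E p) ==> pcl (?g p) (int p) k (s p u) = u"
  by metis
 have sub: "csubspace (filt D p k \<inter> cyc k) (C k)" for p
  using Z_subspace[of "?g p" "int p" k] unfolding Zst .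
 have s': "s p:lin (?E p) (C k)" and s_in: "u:car (?E p) ==> s p u:filt D p k \<inter> cyc k" for p u
  using s[of p] subD(5)[OF cochains_cvs sub] by (auto simp: linear_maps_def Pi_iff)
 have s0: "s p 0[?E p] = 0[C k]" for p
  by (rule lin_zero[OF cvs_Pg[OF r1] cochains_cvs s'])
 have ev: "(%f. f (int p, int k - int p)):lin ?D (?E p)" for p
  unfolding Einf_p[symmetric] by (rule linI) (auto simp: direct_sum_def)
 have sev: "(%f. s p (f (int p, int k - int p))):lin ?D ((C k)(|carrier := cyc k|))" for p
  using lin_comp[OF ev s'] s_in lin_cl[OF ev] by (intro linear_corestrict) auto
 define T where "T f = (finsum ((C k)(|carrier := cyc k|)) (%p. s p (f (int p, int k - int p))) {..k})" for f
 have T: "T:lin ?D ((C k)(|carrier := cyc k|))"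
  unfolding T_def by (rule linear_finsum_maps[OF DS cyc_cvs sev])
 let ?\<Theta> = "%f. cob k +>\<^bsub>C k\<^esub> T f"
 have \<Theta>: "?\<Theta> : lin ?D ?H"
  using lin_comp[OF T quot_class_linear[OF cyc_cvs cob_cyc_subspace]] by (simp add: bundle_cohomology_eq)
 have "inj_on ?\<Theta> (car ?D)"
 proof (rule linear_injI[OF DS H \<Theta>])
  fix f assume f: "f:car ?D" "?\<Theta> f = 0[?H]"
  have Tcyc: "T f:car ((C k)(|carrier := cyc k|))" by (rule lin_cl[OF T f(1)])
  hence Tcob: "T f:cob k"
   using f(2) coset_eq_zero_iff[OF cyc_cvs cob_cyc_subspace, of "T f" k] by (simp add: bundle_cohomology_eq)
  have fE: "f (int p, int k - int p):car (?E p)" for p by (rule lin_cl[OF ev f(1)])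
  have s_f: "s p (f (int p, int k - int p)):filt D p k \<inter> cyc k" for p by (rule s_in[OF fE])
  \<comment> \<open>Components below \<open>p\<close> vanish by induction, and those above
    \<open>p\<close> have filtration at least \<open>p + 1\<close>. So component \<open>p\<close>
    agrees modulo higher filtration with the coboundary \<open>T f\<close>, and its class is
    zero.\<close>
  have "f (int p, int k - int p) = 0[?E p]" if "p <= k" for p
   using that
  proof (induction p rule: less_induct)
   case (less p)
   let ?x = "s p (f (int p, int k - int p))"
   let ?y = "\<Oplus>\<^bsub>(C k)(|carrier := cyc k|)\<^esub>j\<in>{..k} - {p}. s j (f (int j, int k - int j))"
   interpret K: abelian_group "(C k)(|carrier := cyc k|)" by (rule cvs_abelian[OF cyc_cvs])
   have "T f = (finsum ((C k)(|carrier := cyc k|)) (%j. s j (f (int j, int k - int j))) (insert p ({..k} - {p})))"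
    unfolding T_def using less.prems by (simp add: insert_absorb)
   also have "... = ?x +[C k] ?y" using s_f by (subst K.finsum_insert) auto
   finally have Tf: "T f = ?x +[C k] ?y" .
   have "?y:filt D (Suc p) k \<inter> cyc k"
   proof (rule csubspace_sum_closed[OF cyc_cvs])
    show "csubspace (filt D (Suc p) k \<inter> cyc k) ((C k)(|carrier := cyc k|))"
     using csubspace_of_subspace[OF cochains_cvs cyc_subspace, of "filt D (Suc p) k \<inter> cyc k"] sub by auto
    fix j assume j: "j:{..k} - {p}"
    show "s j (f (int j, int k - int j)):filt D (Suc p) k \<inter> cyc k"
    proof (cases "j < p")
     case True
     hence "f (int j, int k - int j) = 0[?E j]" using less j by auto
     thus ?thesis using s0 subD(2)[OF cochains_cvs sub] by simp
    next
     case False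
     thus ?thesis using s_f[of j] filt_mono[of "Suc p" j k] j by auto
    qed
   qed
   note y = this
   have "0[C k]:cob k \<inter> filt D p k" using FD(2) subD(2)[OF cochains_cvs cob_subspace] by auto
   moreover have "?y:car (C k)" using y FD(5) by blast
   hence "?y = ?y +[C k] 0[C k]" by (simp add: cvs_r_zero[OF cochains_cvs])
   ultimately have yB: "?y:Bd (?g p) (int p) k" unfolding Bst using y by blast
   have xF: "?x:filt D p k" "?y:filt D p k" using s_f[of p] y filt_Suc by auto
   hence "T f:cob k \<inter> filt D p k" using Tcob FD(3) unfolding Tf by auto
   moreover have "T f = 0[C k] +[C k] T f" using Tcyc by (simp add: cvs_l_zero[OF cochains_cvs] cyc_iff)
   moreover have "0[C k]:filt D (Suc p) k \<inter> cyc k" by (rule subD(2)[OF cochains_cvs sub])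
   ultimately have "T f:Bd (?g p) (int p) k" unfolding Bst by blast
   hence "?x:Bd (?g p) (int p) k"
    using csubspace_add_cancel(2)[OF cochains_cvs Bd_subspace yB] xF FD(5) unfolding Tf by blast
   hence "pcl (?g p) (int p) k ?x = 0[?E p]"
    using pcl_zero_iff[OF r1] s_f[of p] by (simp add: Zst)
   thus ?case using ps[OF fE] by simp
  qed
  hence "f (p, q) = 0[Einf (p, q)]" if "p + q = int k" for p q
  proof (cases "p < 0 \<or> q < 0")
   case True
   have "f (p, q):car (Einf (p, q))" using f(1) that by (auto simp: direct_sum_def)
   thus ?thesis using Einf_0[OF True] by auto
  next
   case False
   hence "p = int (nat p)" "q = int k - int (nat p)" "nat p <= k" using that by auto
   thus ?thesis using \<open>!!p. p <= k ==> f (int p, int k - int p) = 0[?E p]\<close>[of "nat p"] Einf_p[of "nat p"] by metis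
  qed
  thus "f = 0[?D]" using f(1) by (auto simp: direct_sum_def fun_eq_iff PiE_def extensional_def restrict_def)
 qed
 moreover have "?\<Theta> ` car ?D = car ?H"
 proof
  note im = subD[OF H linear_image_subspace[OF DS H \<Theta> csubspace_carrier[OF DS]]]
  \<comment> \<open>A family concentrated in one bidegree shows that the image contains the class of
    every value of a section.\<close>
  have del: "cob k +>\<^bsub>C k\<^esub> s j u:?\<Theta> ` car ?D" if j: "j <= k" and u: "u:car (?E j)" for j u
  proof -
   define f where "f = (\<lambda>i\<in>?I. if i = (int j, int k - int j) then u else 0[Einf i])"
   have "{i:?I. f i ~= 0[Einf i]} <= {(int j, int k - int j)}" by (auto simp: f_def)
   hence fin: "finite {i:?I. f i ~= 0[Einf i]}" by (rule finite_subset) simp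
   have "f i:car (Einf i)" if "i:?I" for i
    using that u Einf_p[of j] zero_cl[OF cvs_Einf, of i] by (cases "i = (int j, int k - int j)") (auto simp: f_def)
   hence f: "f:car ?D" using fin by (auto simp: direct_sum_def f_def)
   have fj: "f (int j, int k - int j) = u" by (simp add: f_def)
   have "T f = s j (f (int j, int k - int j))" unfolding T_def
   proof (rule cvs_finsum_single[OF cyc_cvs])
    show "s p (f (int p, int k - int p)) = 0[(C k)(|carrier := cyc k|)]" if "p ~= j" for p
     using that s0[of p] Einf_p[of p] by (simp add: f_def)
    show "s j (f (int j, int k - int j)):car ((C k)(|carrier := cyc k|))" using s_in[OF u] fj by simp
   qed (use j in auto)
   hence "?\<Theta> f = cob k +>\<^bsub>C k\<^esub> s j u" unfolding fj by (rule arg_cong)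
   thus ?thesis using imageI[OF f, of "?\<Theta>"] by simp
  qed
  \<comment> \<open>Start at filtration \<open>k + 1\<close>, where only 0 is left, and go down:
    \<open>z\<close> and the section of its class differ by a coboundary and a cocycle of filtration
    \<open>j + 1\<close>.\<close>
  have "z:filt D j k \<inter> cyc k ==> cob k +>\<^bsub>C k\<^esub> z:?\<Theta> ` car ?D" if "j <= Suc k" for j z
   using that
  proof (induction j arbitrary: z rule: inc_induct)
   case base
   hence "z = 0[C k]" using filt_above[of k "Suc k"] by auto
   thus ?case using im(2) coset_zero[OF cochains_cvs cob_subspace] by (simp add: bundle_cohomology_eq)
  next
   case (step j)
   let ?u = "pcl (stage (int j) (int k - int j)) (int j) k z"
   have z: "z:Z (stage (int j) (int k - int j)) (int j) k" using step.prems by (simp add: Zst)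
   hence u: "?u:car (?E j)" by (rule pcl_closed)
   have "Bd (stage (int j) (int k - int j)) (int j) k +>\<^bsub>ZV (stage (int j) (int k - int j)) (int j) k\<^esub> z
     = Bd (stage (int j) (int k - int j)) (int j) k +>\<^bsub>ZV (stage (int j) (int k - int j)) (int j) k\<^esub> s j ?u"
    using ps[OF u] by (simp add: pcl_def)
   then obtain y where y: "y:Bd (stage (int j) (int k - int j)) (int j) k" "z = y +[C k] s j ?u"
    using coset_eqE[where x = z and y = "s j ?u", OF ZV_cvs Bd_ZV[OF r1[of j], of "int j" k]] z s_in[OF u] Zst[of j] by auto
   then obtain z' v where zv: "z':filt D (Suc j) k \<inter> cyc k" "v:cob k" "y = z' +[C k] v" unfolding Bst by auto
   have cyc: "z':cyc k" "v:cyc k" "s j ?u:cyc k" using zv s_in[OF u] cob_sub_cyc by auto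
   have cl: "z':car (C k)" "v:car (C k)" "s j ?u:car (C k)" using cyc by (auto simp: cyc_iff)
   interpret K: abelian_group "C k" by (rule cvs_abelian[OF cochains_cvs])
   have "z = v +[C k] (z' +[C k] s j ?u)" using y zv cl by (simp add: K.a_ac)
   hence "cob k +>\<^bsub>C k\<^esub> z = cob k +>\<^bsub>C k\<^esub> (z' +[C k] s j ?u)"
    using zv cl by (intro coset_eqI[OF cochains_cvs cob_subspace]) auto
   also have "... = (cob k +>\<^bsub>C k\<^esub> z') +[?H] (cob k +>\<^bsub>C k\<^esub> s j ?u)"
    using linear_add[OF quot_class_linear[OF cyc_cvs cob_cyc_subspace], of z' k "s j ?u"] cyc
    by (simp add: bundle_cohomology_eq)
   finally show ?case using im(3) step.IH[OF zv(1)] del[OF _ u] step.hyps by auto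
  qed
  from this[of 0] show "car ?H <= ?\<Theta> ` car ?D"
   by (auto simp: bundle_cohomology_eq filt_0 cyc_iff)
 qed (use lin_cl[OF \<Theta>] in blast)
 ultimately have "isomorphic ?D ?H"
  unfolding isomorphic_def linear_iso_def bij_betw_def using \<Theta> by blast
 thus ?thesis by (rule isomorphic_sym[OF DS])
qed

lemma pages_converge: "converges_to (page D) (page_diff D) (bundle_cohomology D)"
 unfolding converges_to_def
proof (intro exI[of _ Einf] conjI allI)
 fix p q
 show "EX r\<^sub>0>=1. ALL r>=r\<^sub>0.
   (ALL x:car (page D r p q). page_diff D r p q x = 0[page D r (p + int r) (q - int r + 1)]) &
   (ALL x:car (page D r (p - int r) (q + int r - 1)). page_diff D r (p - int r) (q + int r - 1) x = 0[page D r p q]) &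
   isomorphic (page D r p q) (Einf (p, q))"
 proof (intro exI[of _ "stage p q"] conjI allI impI ballI)
  show "1 <= stage p q" by (rule stage_bounds(1)[OF order_refl])
  fix r assume r: "stage p q <= r"
  show "isomorphic (page D r p q) (Einf (p, q))"
   unfolding Einf_def prod.case page_stable[OF r] by (rule isomorphic_refl)
 qed (rule page_diff_stable; assumption)+
qed (rule cohomology_Einf)

end

section \<open>Actions on tensor products, and isomorphic complexes\<close>

lemma btensor_lact:
 assumes T: "tensorable A E F" and lin: "lact E b:lin E E"
  and comm: "!!e a. e:car E ==> a:car A ==> lact E b (ract E e a) = ract E (lact E b e) a"
 shows "lact (btensor A E F) b:lin (tensor A E F) (tensor A E F)"
  and "e:car E ==> f:car F ==> lact (btensor A E F) b (tens A E F e f) = tens A E F (lact E b e) f"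
proof -
 note bal = balancedD[OF tens_balanced[OF T]]
 have h: "balanced A E F (tensor A E F) (%e f. tens A E F (lact E b e) f)"
  by (rule balancedI) (simp_all add: bal(1-6) linD[OF lin] comm)
 show "lact (btensor A E F) b:lin (tensor A E F) (tensor A E F)"
  using tensor_lift_linear[OF T cvs_tensor[OF T] h] by simp
 show "e:car E ==> f:car F ==> lact (btensor A E F) b (tens A E F e f) = tens A E F (lact E b e) f"
  using tensor_lift_tens[OF T cvs_tensor[OF T] h] by simp
qed

lemma btensor_ract:
 assumes T: "tensorable A E F" and lin: "(%f. ract F f c):lin F F"
  and comm: "!!f a. f:car F ==> a:car A ==> lact F a (ract F f c) = ract F (lact F a f) c"
 shows "(%t. ract (btensor A E F) t c):lin (tensor A E F) (tensor A E F)"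
  and "e:car E ==> f:car F ==> ract (btensor A E F) (tens A E F e f) c = tens A E F e (ract F f c)"
proof -
 note bal = balancedD[OF tens_balanced[OF T]]
 have h: "balanced A E F (tensor A E F) (%e f. tens A E F e (ract F f c))"
  by (rule balancedI) (simp_all add: bal(1-6) linD[OF lin] comm)
 show "(%t. ract (btensor A E F) t c):lin (tensor A E F) (tensor A E F)"
  using tensor_lift_linear[OF T cvs_tensor[OF T] h] by simp
 show "e:car E ==> f:car F ==> ract (btensor A E F) (tens A E F e f) c = tens A E F e (ract F f c)"
  using tensor_lift_tens[OF T cvs_tensor[OF T] h] by simp
qed

text \<open>The maps \<open>d'\<close> inherit linearity and the vanishing of their square from
  \<open>d\<close> through the bijections \<open>f n\<close>, so the intertwining relation is all
  that is asked of them.\<close>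

lemma cohomology_iso:
 assumes C: "!!n. cvs (C n)" "!!n. d n:lin (C n) (C (Suc n))"
   "!!n x. x:car (C n) ==> d (Suc n) (d n x) = 0[C (Suc (Suc n))]"
  and C': "!!n. cvs (C' n)"
  and f: "!!n. f n:lin (C n) (C' n)" "!!n. bij_betw (f n) (car (C n)) (car (C' n))"
   "!!n x. x:car (C n) ==> d' n (f n x) = f (Suc n) (d n x)"
 shows "isomorphic (cohomology C d n) (cohomology C' d' n)"
proof -
 have surj: "EX x:car (C n). y = f n x" if "y:car (C' n)" for n y
  using f(2)[of n] that by (auto simp: bij_betw_def)
 have inj: "x = y" if "f n x = f n y" "x:car (C n)" "y:car (C n)" for n x y
  using f(2)[of n] that by (auto simp: bij_betw_def inj_on_def)
 have f0: "f n 0[C n] = 0[C' n]" for n by (rule lin_zero[OF C(1) C' f(1)])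
 have f0': "f n x = 0[C' n] <-> x = 0[C n]" if "x:car (C n)" for n x
  using f0 inj that zero_cl[OF C(1)] by metis
 note dcl = lin_cl[OF C(2)] and fcl = lin_cl[OF f(1)]
 have d': "d' n:lin (C' n) (C' (Suc n))" for n
 proof (rule linI)
  fix x y assume "x:car (C' n)" "y:car (C' n)"
  then obtain a b where "a:car (C n)" "x = f n a" "b:car (C n)" "y = f n b" using surj by metis
  thus "d' n (x +[C' n] y) = d' n x +[C' (Suc n)] d' n y"
   using f(3)[of "a +[C n] b" n] by (simp add: linear_add[OF f(1)] linear_add[OF C(2)] f(3) add_cl[OF C(1)] dcl)
 next
  fix c x assume "x:car (C' n)"
  then obtain a where "a:car (C n)" "x = f n a" using surj by metis
  thus "d' n (c *[C' n] x) = c *[C' (Suc n)] d' n x"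
   using f(3)[of "c *[C n] a" n] by (simp add: linear_smult[OF f(1)] linear_smult[OF C(2)] f(3) smult_cl[OF C(1)] dcl)
 next
  fix x assume "x:car (C' n)"
  then obtain a where "a:car (C n)" "x = f n a" using surj by metis
  thus "d' n x:car (C' (Suc n))" by (simp add: f(3) fcl dcl)
 qed
 let ?Z = "cocycles C d n" and ?Z' = "cocycles C' d' n" and ?B = "coboundaries C d n" and ?B' = "coboundaries C' d' n"
 have Z: "csubspace ?Z (C n)" unfolding cocycles_def by (rule linear_kernel_subspace[OF C(1) C(1) C(2)])
 have Z': "csubspace ?Z' (C' n)" unfolding cocycles_def by (rule linear_kernel_subspace[OF C' C' d'])
 have BZ: "?B <= ?Z"
  by (cases n) (auto simp: coboundaries_def cocycles_def C(3) dcl zero_cl[OF C(1)] lin_zero[OF C(1) C(1) C(2)])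
 have B'im: "?B' = f n ` ?B"
 proof (cases n)
  case (Suc m)
  have "car (C' m) = f m ` car (C m)" using f(2)[of m] by (simp add: bij_betw_def)
  thus ?thesis by (simp add: coboundaries_def Suc image_image f(3))
 qed (simp add: coboundaries_def f0)
 have fZ: "f n x:?Z' <-> x:?Z" if "x:car (C n)" for x
  using that by (simp add: cocycles_def fcl f(3) f0' dcl)
 have "csubspace ?B (C n)"
  by (cases n) (auto simp: coboundaries_def csubspace_zero C
   intro: linear_image_subspace[OF C(1) C(1) C(2) csubspace_carrier[OF C(1)]])
 hence "csubspace ?B' (C' n)" unfolding B'im by (rule linear_image_subspace[OF C(1) C' f(1)])
 moreover have B'Z: "?B' <= ?Z'"
  unfolding B'im using BZ fZ by (auto simp: cocycles_def)
 ultimately have B': "csubspace ?B' ((C' n)(|carrier := ?Z'|))" using csubspace_of_subspace[OF C' Z' B'Z] by blast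
 note VZ = sub_cvs[OF C(1) Z] and VZ' = sub_cvs[OF C' Z']
 have "f n:lin ((C n)(|carrier := ?Z|)) ((C' n)(|carrier := ?Z'|))"
 proof (rule linear_corestrict)
  show "f n:lin ((C n)(|carrier := ?Z|)) (C' n)" by (rule linear_restrict[OF f(1) subD(1)[OF C(1) Z]])
  show "f n ` car ((C n)(|carrier := ?Z|)) <= ?Z'" using fZ by (auto simp: cocycles_def)
 qed
 note lin = lin_comp[OF this quot_class_linear[OF VZ' B']]
 show ?thesis
  unfolding cohomology_def
 proof (rule isomorphic_quot[OF VZ cvs_quot[OF VZ' B'] lin])
  have im: "f n ` ?Z = ?Z'"
   using fZ surj by (auto simp: cocycles_def image_iff) metis
  show "(%x. ?B' +>\<^bsub>(C' n)(|carrier := ?Z'|)\<^esub> f n x) ` car ((C n)(|carrier := ?Z|))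
    = car (quot ((C' n)(|carrier := ?Z'|)) ?B')"
   by (auto simp: im[symmetric])
  show "?B <= car ((C n)(|carrier := ?Z|))" using BZ by simp
  fix x assume "x:car ((C n)(|carrier := ?Z|))"
  hence x: "x:?Z" "x:car (C n)" by (auto simp: cocycles_def)
  have "f n x:?B' <-> x:?B"
   unfolding B'im using inj x BZ by (auto simp: cocycles_def image_iff)
  thus "(?B' +>\<^bsub>(C' n)(|carrier := ?Z'|)\<^esub> f n x = 0[quot ((C' n)(|carrier := ?Z'|)) ?B']) <-> x:?B"
   using coset_eq_zero_iff[OF VZ' B'] fZ[OF x(2)] x by simp
 qed
qed

section \<open>Differential calculi\<close>

lemma form_bimod_simps [simp]:
 "car (fb K n) = forms K n" "zero (fb K n) = zero K" "add (fb K n) = add K"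
 "smult (fb K n) = smult K" "lact (fb K n) = (%a xi. emb K a **[K] xi)"
 "ract (fb K n) = (%xi a. xi **[K] emb K a)"
 by (simp_all add: form_bimod_def)

lemma mult_bimod_simps [simp]:
 "car (mult_bimod A) = car A" "zero (mult_bimod A) = zero A" "add (mult_bimod A) = add A"
 "smult (mult_bimod A) = smult A" "lact (mult_bimod A) = mult A" "ract (mult_bimod A) = mult A"
 by (simp_all add: mult_bimod_def)

lemma calgebraD:
 assumes "calgebra A"
 shows "cvs A" "1[A]:car A"
  "!!x y. x:car A ==> y:car A ==> x **[A] y:car A"
  "!!x y z. x:car A ==> y:car A ==> z:car A ==> x **[A] y **[A] z = x **[A] (y **[A] z)"
  "!!x. x:car A ==> 1[A] **[A] x = x" "!!x. x:car A ==> x **[A] 1[A] = x"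
  "!!x y z. x:car A ==> y:car A ==> z:car A ==> (x +[A] y) **[A] z = x **[A] z +[A] y **[A] z"
  "!!x y z. x:car A ==> y:car A ==> z:car A ==> z **[A] (x +[A] y) = z **[A] x +[A] z **[A] y"
  "!!c x y. x:car A ==> y:car A ==> (c *[A] x) **[A] y = c *[A] (x **[A] y)"
  "!!c x y. x:car A ==> y:car A ==> x **[A] (c *[A] y) = c *[A] (x **[A] y)"
proof -
 interpret ring A using assms by (simp add: calgebra_def)
 show "1[A]:car A"
  "!!x y. x:car A ==> y:car A ==> x **[A] y:car A"
  "!!x y z. x:car A ==> y:car A ==> z:car A ==> x **[A] y **[A] z = x **[A] (y **[A] z)"
  "!!x. x:car A ==> 1[A] **[A] x = x" "!!x. x:car A ==> x **[A] 1[A] = x"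
  "!!x y z. x:car A ==> y:car A ==> z:car A ==> (x +[A] y) **[A] z = x **[A] z +[A] y **[A] z"
  "!!x y z. x:car A ==> y:car A ==> z:car A ==> z **[A] (x +[A] y) = z **[A] x +[A] z **[A] y"
  by (simp_all add: m_assoc l_distr r_distr)
qed (use assms in "auto simp: calgebra_def")

lemma calgebra_mult_linear:
 assumes "calgebra A" "x:car A"
 shows "(%y. x **[A] y):lin A A" "(%y. y **[A] x):lin A A"
 using assms by (auto intro!: linI simp: calgebraD[OF assms(1)])

locale diff_calculus =
 fixes A :: "(complex, 'a) module" and K :: "('a, 'w) calculus"
 assumes dc: "differential_calculus A K"
begin

lemma algA: "calgebra A" and alg: "calgebra K"
 and forms_subspace: "csubspace (forms K n) K"
 and forms_mult: "xi:forms K m ==> eta:forms K n ==> xi **[K] eta:forms K (m + n)"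
 and emb_linear: "emb K:lin A K" and emb_bij: "bij_betw (emb K) (car A) (forms K 0)"
 and emb_one: "emb K 1[A] = 1[K]"
 and emb_mult: "a:car A ==> b:car A ==> emb K (a **[A] b) = emb K a **[K] emb K b"
 and diff_linear: "diff K:lin K K"
 and diff_forms: "xi:forms K n ==> diff K xi:forms K (Suc n)"
 and diff_diff: "xi:car K ==> diff K (diff K xi) = 0[K]"
 and leibniz: "xi:forms K n ==> eta:car K ==> diff K (xi **[K] eta) =
    (diff K xi **[K] eta) +[K] ((-1) ^ n *[K] (xi **[K] diff K eta))"
proof -
 note d0 = dc[unfolded differential_calculus_def]
 note d1 = conjunct2[OF d0]
 note d2 = conjunct2[OF d1]
 note d3 = conjunct2[OF d2]
 note d4 = conjunct2[OF d3]
 note d5 = conjunct2[OF d4]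
 note d6 = conjunct2[OF d5]
 note d7 = conjunct2[OF d6]
 note d8 = conjunct2[OF d7]
 note d9 = conjunct2[OF d8]
 note d10 = conjunct2[OF d9]
 note d11 = conjunct2[OF d10]
 note d12 = conjunct2[OF d11]
 show "calgebra A" "calgebra K" "csubspace (forms K n) K"
  "emb K:lin A K" "bij_betw (emb K) (car A) (forms K 0)" "emb K 1[A] = 1[K]"
  "diff K:lin K K"
  by (rule conjunct1[OF d0] conjunct1[OF d1] spec[OF conjunct1[OF d2]] conjunct1[OF d5] conjunct1[OF d6]
   conjunct1[OF d7] conjunct1[OF d9])+
 show "xi:forms K m ==> eta:forms K n ==> xi **[K] eta:forms K (m + n)" using conjunct1[OF d4] by blast
 show "a:car A ==> b:car A ==> emb K (a **[A] b) = emb K a **[K] emb K b" using conjunct1[OF d8] by blast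
 show "xi:forms K n ==> diff K xi:forms K (Suc n)" using conjunct1[OF d10] by blast
 show "xi:car K ==> diff K (diff K xi) = 0[K]" using conjunct1[OF d11] by blast
 show "xi:forms K n ==> eta:car K ==> diff K (xi **[K] eta) =
    (diff K xi **[K] eta) +[K] ((-1) ^ n *[K] (xi **[K] diff K eta))" using conjunct1[OF d12] by blast
qed

lemmas V = calgebraD(1)[OF alg] and VA = calgebraD(1)[OF algA]
lemmas alg_simps = calgebraD(3-10)[OF alg]
lemmas FD = subD[OF V forms_subspace]
lemmas embD = linD[OF emb_linear] and diffD = linD[OF diff_linear]

lemma emb_forms: "a:car A ==> emb K a:forms K 0"
 using emb_bij by (auto simp: bij_betw_def)

lemma emb_surj: "xi:forms K 0 ==> EX a:car A. xi = emb K a"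
 using emb_bij by (auto simp: bij_betw_def)

lemma forms_lmult: "a:car A ==> xi:forms K n ==> emb K a **[K] xi:forms K n"
 using forms_mult[OF emb_forms] by force

lemma forms_rmult: "a:car A ==> xi:forms K n ==> xi **[K] emb K a:forms K n"
 using forms_mult[OF _ emb_forms] by force

lemma cvs_forms: "cvs (fb K n)"
 by (rule cvs_cong[OF sub_cvs[OF V forms_subspace]]) simp_all

lemma cspan_form_bimod: "S <= forms K n ==> cspan (fb K n) S = cspan K S"
 using cspan_cong[OF sub_cvs[OF V forms_subspace], where W = "fb K n"]
  cspan_of_subspace[OF V forms_subspace] by simp

lemma finsum_form_bimod:
 assumes "!!i. i:I ==> f i:forms K n"
 shows "(finsum (fb K n) (%i. f i) I) = (finsum K (%i. f i) I)"
proof -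
 have "(%x. x):lin (fb K n) K" using FD(5) by (auto simp: linear_maps_def)
 from lin_finsum[OF cvs_forms V this, of I f] show ?thesis using assms by simp
qed

lemma linear_form_restrict: "f:lin K W ==> f:lin (fb K n) W"
 using FD(5) by (auto simp: linear_maps_def Pi_iff)

lemma diff_mult_emb: "a:car A ==> eta:car K ==>
  diff K (emb K a **[K] eta) = (diff K (emb K a) **[K] eta) +[K] (emb K a **[K] diff K eta)"
 using leibniz[OF emb_forms] by (simp add: cvs_smult_one[OF V] alg_simps embD diffD)

lemma diff_zero: "diff K 0[K] = 0[K]"
 by (rule lin_zero[OF V V diff_linear])

lemma tensorable_left:
 assumes "left_module A N"
 shows "tensorable A (fb K n) N"
 using assms cvs_forms forms_rmult left_moduleD[OF assms] by (auto simp: tensorable_def)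

end

text \<open>The filtration of the cochains carried over to forms (\<open>filt_eq\<close>). The value
  for \<open>p > n\<close> copies the convention of \<open>filt\<close>.\<close>

definition ideal_filt :: "('a, 'w) calculus => ('b, 'u) calculus => ('u => 'w) => nat => nat => 'w set" where
 "ideal_filt KA KB inc p n = (if p <= n
  then cspan KA {inc xi **[KA] eta | xi eta. xi:forms KB p & eta:forms KA (n - p)} else {0[KA]})"

section \<open>Bundles from an inclusion of calculi\<close>

text \<open>These assumptions are what the bundle and its spectral sequence are built from; groups
  do not occur. The essential ones are a finite right basis of closed forms on the base and
  \<open>basis_independent\<close>: a combination of basis forms lies one filtration step higher
  only if its coefficients have filtration 1.\<close>

locale split_bundle =
 A: diff_calculus A KA + B: diff_calculus B KB
 for A B :: "(complex, 'a) module" and KA :: "('a, 'w) calculus" and KB :: "('a, 'u) calculus" +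
 fixes inc :: "'u => 'w" and I :: "nat => 'u set" and co :: "nat => 'u => 'u => 'a" and nab and sig
 assumes B_sub: "car B <= car A" and B_eq: "mult B = mult A" "one B = one A" "zero B = zero A"
   "add B = add A" "smult B = smult A"
  and inc_linear: "inc:lin KB KA"
  and inc_mult: "xi:car KB ==> xi':car KB ==> inc (xi **[KB] xi') = inc xi **[KA] inc xi'"
  and inc_forms: "xi:forms KB n ==> inc xi:forms KA n"
  and inc_emb: "b:car B ==> inc (emb KB b) = emb KA b"
  and inc_diff: "xi:car KB ==> inc (diff KB xi) = diff KA (inc xi)"
  and forms_gen: "forms KB (Suc n) <= cspan KB {xi **[KB] xi' | xi xi'. xi:forms KB n & xi':forms KB 1}"
  and basis: "right_basis B (fb KB p) (I p) (co p)"
  and basis_closed: "e:I p ==> diff KB e = 0[KB]"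
  and basis_independent: "(!!e. e:I p ==> eta e:forms KA q) ==>
   (finsum KA (%e. inc e **[KA] eta e) (I p)):ideal_filt KA KB inc (Suc p) (p + q) ==> e:I p ==>
   eta e:ideal_filt KA KB inc 1 q"
  and nab_linear: "nab:lin (mult_bimod A) (tensor A (mult_bimod A) (fb KA 1))"
  and nab_eq: "a:car A ==> nab a = tens A (mult_bimod A) (fb KA 1) 1[A] (diff KA (emb KA a))"
  and sig_linear: "sig:lin (tensor B (fb KB 1) (mult_bimod A)) (tensor A (mult_bimod A) (fb KA 1))"
  and sig_eq: "xi:forms KB 1 ==> a:car A ==>
   sig (tens B (fb KB 1) (mult_bimod A) xi a) =
   tens A (mult_bimod A) (fb KA 1) 1[A] (inc xi **[KA] emb KA a)"
begin

abbreviation mulA (infixl \<open>*.\<close> 70) where "x *. y == x **[KA] y"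
abbreviation addA (infixl \<open>+.\<close> 65) where "x +. y == x +[KA] y"
abbreviation smulA (infixr \<open>.*\<close> 72) where "c .* y == c *[KA] y"
abbreviation dA where "dA == diff KA"
abbreviation E where "E == mult_bimod A"
abbreviation Fl where "Fl == ideal_filt KA KB inc"

definition D where
 "D = (|base_alg = B, base_calc = KB, tot_alg = A, tot_calc = KA, bim = E, conn = nab, braid = sig|)"

lemma D_simps [simp]: "base_alg D = B" "base_calc D = KB" "tot_alg D = A" "tot_calc D = KA" "bim D = E"
 "conn D = nab" "braid D = sig"
 by (simp_all add: D_def)

definition J where "J n = tens A E (fb KA n) 1[A]"

lemma BA: "b:car B ==> b:car A" using B_sub by auto

lemmas incD = linD[OF inc_linear]

lemma cvs_E: "cvs E" by (rule cvs_cong[OF A.VA]) simp_all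

lemma tens_able: "tensorable A E (fb KA n)"
 using cvs_E A.cvs_forms A.forms_lmult calgebraD(3)[OF A.algA] by (auto simp: tensorable_def)

lemmas tens_bal = balancedD[OF tens_balanced[OF tens_able], simplified]

lemma cochains_simps [simp]:
 "car (cochains D n) = car (tensor A E (fb KA n))"
 "zero (cochains D n) = zero (tensor A E (fb KA n))"
 "add (cochains D n) = add (tensor A E (fb KA n))"
 "smult (cochains D n) = smult (tensor A E (fb KA n))"
 by (simp_all add: cochains_def)

lemma cvs_C: "cvs (cochains D n)"
 by (rule cvs_cong[OF cvs_tensor[OF tens_able]]) simp_all

lemma tens_eq_J: "a:car A ==> eta:forms KA n ==> tens A E (fb KA n) a eta = J n (emb KA a *. eta)"
 using tens_bal(6)[of "1[A]" a eta n] by (simp add: J_def calgebraD[OF A.algA])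

lemma ctens_eq_J: "a:car A ==> eta:forms KA n ==> ctens D n a eta = J n (emb KA a *. eta)"
 by (simp add: ctens_def tens_eq_J)

lemma J_linear: "J n:lin (fb KA n) (cochains D n)"
 using balancedD(7)[OF tens_balanced[OF tens_able], of "1[A]"] calgebraD(2)[OF A.algA]
 by (simp add: J_def linear_maps_def)

lemmas JD = linD[OF J_linear, simplified]

lemma J_zero: "J n 0[KA] = 0[cochains D n]"
 using lin_zero[OF A.cvs_forms cvs_C J_linear, of n] by simp

text \<open>The inverse is multiplication,
  \<open>a \<otimes> \<eta> \<mapsto> a \<eta>\<close>.\<close>

lemma J_bij: "bij_betw (J n) (forms KA n) (car (cochains D n))"
proof -
 let ?h = "%a eta. emb KA a *. eta" and ?T = "tensor A E (fb KA n)"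
 have h: "balanced A E (fb KA n) (fb KA n) ?h"
  by (rule balancedI) (simp_all add: A.forms_lmult A.alg_simps A.embD A.FD(5) A.emb_mult)
 let ?P = "tensor_lift (fb KA n) ?h"
 note P = tensor_lift_linear[OF tens_able A.cvs_forms h] and Pt = tensor_lift_tens[OF tens_able A.cvs_forms h, simplified]
 have PJ: "?P (J n eta) = eta" if "eta:forms KA n" for eta
  using that Pt[of "1[A]" eta] by (simp add: J_def calgebraD[OF A.algA] A.emb_one calgebraD[OF A.alg] A.FD(5))
 have J': "J n:lin (fb KA n) ?T" using J_linear by (simp add: linear_maps_def)
 have JP: "J n (?P t) = t" if "t:car ?T" for t
  by (rule tensor_linear_eqI[OF tens_able cvs_tensor[OF tens_able] lin_comp[OF P J'] linear_id _ that])
   (subst Pt, simp_all add: tens_eq_J)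
 show ?thesis
  by (rule bij_betwI[where g = ?P]) (use PJ JP lin_cl[OF P] JD(1) in auto)
qed

lemma J_cases: assumes "z:car (cochains D n)" obtains eta where "eta:forms KA n" "z = J n eta"
 using assms J_bij[of n] by (auto simp: bij_betw_def)

lemma J_inj: "J n eta = J n eta' ==> eta:forms KA n ==> eta':forms KA n ==> eta = eta'"
 using J_bij[of n] by (auto simp: bij_betw_def inj_on_def)

lemma lact_J: "b:car A ==> eta:forms KA n ==> lact (cochains D n) b (J n eta) = J n (emb KA b *. eta)"
 and lact_linear: "b:car A ==> lact (cochains D n) b:lin (cochains D n) (cochains D n)"
proof -
 assume b: "b:car A"
 have 1: "lact E b:lin E E" using b by (auto intro!: linI simp: calgebraD[OF A.algA])
 have 2: "lact E b (ract E e a) = ract E (lact E b e) a" if "e:car E" "a:car A" for e a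
  using that b by (simp add: calgebraD[OF A.algA])
 note L = btensor_lact[OF tens_able 1 2]
 show "lact (cochains D n) b:lin (cochains D n) (cochains D n)"
  using L(1)[of n] unfolding linear_maps_def cochains_simps by (simp add: cochains_def)
 show "eta:forms KA n ==> lact (cochains D n) b (J n eta) = J n (emb KA b *. eta)"
  using L(2)[of "1[A]" eta n] b by (simp add: cochains_def J_def calgebraD[OF A.algA] tens_eq_J[unfolded J_def])
qed

lemma ract_J: "b:car A ==> eta:forms KA n ==> ract (cochains D n) (J n eta) b = J n (eta *. emb KA b)"
 and ract_linear: "b:car A ==> (%t. ract (cochains D n) t b):lin (cochains D n) (cochains D n)"
proof -
 assume b: "b:car A"
 have 1: "(%f. ract (fb KA n) f b):lin (fb KA n) (fb KA n)"
  using b by (auto intro!: linI simp: A.forms_rmult A.alg_simps A.FD(5) A.embD)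
 have 2: "lact (fb KA n) a (ract (fb KA n) f b) = ract (fb KA n) (lact (fb KA n) a f) b"
  if "f:car (fb KA n)" "a:car A" for f a
  using that b by (simp add: A.alg_simps A.FD(5) A.embD)
 note L = btensor_ract[OF tens_able 1 2]
 show "(%t. ract (cochains D n) t b):lin (cochains D n) (cochains D n)"
  using L(1) unfolding linear_maps_def cochains_simps by (simp add: cochains_def)
 show "eta:forms KA n ==> ract (cochains D n) (J n eta) b = J n (eta *. emb KA b)"
  using L(2)[of "1[A]" eta] by (simp add: cochains_def J_def calgebraD[OF A.algA])
qed

text \<open>The operations on cochains are defined by lifting formulas in \<open>a\<close> and
  \<open>\<eta>\<close>. When a formula depends only on the product \<open>a \<eta>\<close>, the
  lifted map is the corresponding map of forms conjugated by \<open>J\<close>; this eliminates the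
  tensor products over \<open>A\<close> from the definitions.\<close>

lemma lift_J:
 assumes phi: "phi:lin (fb KA m) (fb KA n)"
  and h: "!!a eta. a:car A ==> eta:forms KA m ==> h a eta = J n (phi (emb KA a *. eta))"
 shows "tensor_lift (cochains D n) h:lin (cochains D m) (cochains D n)"
  and "zeta:forms KA m ==> tensor_lift (cochains D n) h (J m zeta) = J n (phi zeta)"
proof -
 note phiD = linD[OF phi, simplified]
 note c = h A.forms_lmult A.alg_simps A.embD A.FD(5) A.emb_mult A.FD(3,4) JD phiD calgebraD(3)[OF A.algA]
 have b: "balanced A E (fb KA m) (cochains D n) h"
  by (rule balancedI) (simp_all add: c add_cl[OF A.VA] smult_cl[OF A.VA])
 show "tensor_lift (cochains D n) h:lin (cochains D m) (cochains D n)"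
  using tensor_lift_linear[OF tens_able cvs_C b] by (simp add: linear_maps_def)
 show "tensor_lift (cochains D n) h (J m zeta) = J n (phi zeta)" if "zeta:forms KA m"
  using tensor_lift_tens[OF tens_able cvs_C b, of "1[A]" zeta] that
  by (simp add: J_def[of m] calgebraD(2)[OF A.algA] h A.emb_one calgebraD(5)[OF A.alg] A.FD(5))
qed

lemma rmult_linear: "eta:forms KA k ==> (%zeta. zeta *. eta):lin (fb KA m) (fb KA (m + k))"
 and lmult_linear: "eta:forms KA k ==> (%zeta. eta *. zeta):lin (fb KA m) (fb KA (k + m))"
 and dA_linear: "dA:lin (fb KA m) (fb KA (Suc m))"
 by (auto intro!: linI simp: A.forms_mult A.alg_simps A.FD(5) A.diffD A.diff_forms)

lemma cwedge_J:
 assumes zeta: "zeta:forms KA m" and eta: "eta:forms KA k"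
 shows "cwedge D (m + k) (J m zeta) eta = J (m + k) (zeta *. eta)"
 unfolding cwedge_def
 by (rule lift_J(2)[OF rmult_linear[OF eta] _ zeta])
  (use eta in "simp add: ctens_eq_J A.forms_mult A.alg_simps A.FD(5) A.embD")

lemma braid_wedge_J:
 assumes xi: "xi:forms KB m" and s: "!!a. a:car A ==> s m (btens D m xi a) = J m (inc xi *. emb KA a)"
  and zeta: "zeta:forms KA k"
 shows "braid_wedge D s m k xi (J k zeta) = J (m + k) (inc xi *. zeta)"
 unfolding braid_wedge_def
 by (rule lift_J(2)[OF lmult_linear[OF inc_forms[OF xi]] _ zeta])
  (use inc_forms[OF xi] in "simp add: s cwedge_J A.forms_rmult A.alg_simps A.FD(5) A.embD")

lemma inc_closed: "xi:forms KB n ==> inc xi:car KA"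
 by (rule A.FD(5)[OF inc_forms])

lemma btens_able: "tensorable B (fb KB n) E"
 using cvs_E B.cvs_forms B.forms_rmult calgebraD(3)[OF A.algA] BA by (auto simp: tensorable_def)

lemmas btens_bal = balancedD[OF tens_balanced[OF btens_able], simplified]

text \<open>The extended braiding in closed form,
  \<open>\<xi> \<otimes> a \<mapsto> 1 \<otimes> \<xi> a\<close>. Its compatibility with products is
  associativity in the calculus on \<open>A\<close>.\<close>

definition "s0 n = tensor_lift (cochains D n) (%xi a. J n (inc xi *. emb KA a))"

lemma s0_balanced: "balanced B (fb KB n) E (cochains D n) (%xi a. J n (inc xi *. emb KA a))"
 by (rule balancedI)
  (simp_all add: A.forms_rmult A.alg_simps A.embD A.FD(5) A.emb_mult JD A.FD(3,4) inc_forms inc_closed incD B.FD(5) inc_mult BA inc_emb B.embD)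

lemma s0_linear: "s0 n:lin (tensor B (fb KB n) E) (cochains D n)"
 unfolding s0_def by (rule tensor_lift_linear[OF btens_able cvs_C s0_balanced])

lemma s0_tens: "xi:forms KB n ==> a:car A ==> s0 n (btens D n xi a) = J n (inc xi *. emb KA a)"
 using tensor_lift_tens[OF btens_able cvs_C s0_balanced, where e = xi and f = a] by (simp add: s0_def btens_def)

lemma bT_lact:
 assumes b: "b:car B"
 shows "lact (btensor B (fb KB n) E) b:lin (tensor B (fb KB n) E) (tensor B (fb KB n) E)"
  and "xi:forms KB n ==> a:car A ==> lact (btensor B (fb KB n) E) b (tens B (fb KB n) E xi a)
   = tens B (fb KB n) E (emb KB b **[KB] xi) a"
proof -
 have 1: "lact (fb KB n) b:lin (fb KB n) (fb KB n)"
  using b by (auto intro!: linI simp: B.forms_lmult B.alg_simps B.FD(5) B.embD)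
 have 2: "lact (fb KB n) b (ract (fb KB n) e a) = ract (fb KB n) (lact (fb KB n) b e) a"
  if "e:car (fb KB n)" "a:car B" for e a
  using that b by (simp add: B.alg_simps B.FD(5) B.embD)
 show "lact (btensor B (fb KB n) E) b:lin (tensor B (fb KB n) E) (tensor B (fb KB n) E)"
  by (rule btensor_lact(1)[OF btens_able 1 2])
 show "xi:forms KB n ==> a:car A ==> lact (btensor B (fb KB n) E) b (tens B (fb KB n) E xi a)
   = tens B (fb KB n) E (emb KB b **[KB] xi) a"
  using btensor_lact(2)[OF btens_able 1 2, where e = xi and f = a] by simp
qed

lemma bT_ract:
 assumes c: "c:car A"
 shows "(%t. ract (btensor B (fb KB n) E) t c):lin (tensor B (fb KB n) E) (tensor B (fb KB n) E)"
  and "xi:forms KB n ==> a:car A ==> ract (btensor B (fb KB n) E) (tens B (fb KB n) E xi a) c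
   = tens B (fb KB n) E xi (a **[A] c)"
proof -
 have 1: "(%f. ract E f c):lin E E" using c by (auto intro!: linI simp: calgebraD[OF A.algA])
 have 2: "lact E b (ract E e c) = ract E (lact E b e) c" if "e:car E" "b:car B" for e b
  using that c BA by (simp add: calgebraD[OF A.algA])
 show "(%t. ract (btensor B (fb KB n) E) t c):lin (tensor B (fb KB n) E) (tensor B (fb KB n) E)"
  by (rule btensor_ract(1)[OF btens_able 1 2])
 show "xi:forms KB n ==> a:car A ==> ract (btensor B (fb KB n) E) (tens B (fb KB n) E xi a) c
   = tens B (fb KB n) E xi (a **[A] c)"
  using btensor_ract(2)[OF btens_able 1 2, where e = xi and f = a] by simp
qed

lemma s0_bimodule: "s0 n:bimodule_maps B A (btensor B (fb KB n) E) (cochains D n)"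
proof -
 let ?T = "tensor B (fb KB n) E"
 note st = s0_tens[unfolded btens_def D_simps]
 have L: "s0 n (lact (btensor B (fb KB n) E) b t) = lact (cochains D n) b (s0 n t)"
  if b: "b:car B" and t: "t:car ?T" for b t
  by (rule tensor_linear_eqI[OF btens_able cvs_C lin_comp[OF bT_lact(1)[OF b] s0_linear]
    lin_comp[OF s0_linear lact_linear[OF BA[OF b]]] _ t])
   (use b in "simp del: btensor_simps add: bT_lact(2) st B.forms_lmult lact_J BA A.forms_rmult inc_forms inc_closed inc_mult inc_emb
    B.embD B.FD(5) A.alg_simps A.embD A.FD(5)")
 have R: "s0 n (ract (btensor B (fb KB n) E) t c) = ract (cochains D n) (s0 n t) c"
  if c: "c:car A" and t: "t:car ?T" for c t
  by (rule tensor_linear_eqI[OF btens_able cvs_C lin_comp[OF bT_ract(1)[OF c] s0_linear]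
    lin_comp[OF s0_linear ract_linear[OF c]] _ t])
   (use c in "simp del: btensor_simps add: bT_ract(2) st ract_J A.forms_rmult inc_forms inc_closed A.emb_mult
    A.alg_simps A.embD A.FD(5) calgebraD(3)[OF A.algA]")
 have "s0 n:lin (btensor B (fb KB n) E) (cochains D n)"
  using s0_linear by (simp add: linear_maps_def)
 thus ?thesis
  using L R by (simp add: bimodule_maps_def left_module_maps_def del: btensor_simps(5,6))
qed

lemma sig_eq_s0: "t:car (tensor B (fb KB 1) E) ==> sig t = s0 1 t"
proof -
 have "sig:lin (tensor B (fb KB 1) E) (cochains D 1)" using sig_linear by (simp add: linear_maps_def)
 from tensor_linear_eqI[OF btens_able cvs_C this s0_linear]
 show "t:car (tensor B (fb KB 1) E) ==> sig t = s0 1 t"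
  using s0_tens[of _ 1, unfolded btens_def D_simps] sig_eq by (simp add: J_def)
qed

lemma s0_extends: "extends_braid D s0"
 unfolding extends_braid_def D_simps
proof (intro conjI allI ballI)
 show "s0 n:bimodule_maps B A (btensor B (fb KB n) E) (cochains D n)" for n by (rule s0_bimodule)
 show "s0 1 t = sig t" if "t:car (tensor B (fb KB 1) E)" for t using sig_eq_s0[OF that] by simp
 fix b e assume "b:car B" "e:car E"
 thus "s0 0 (btens D 0 (emb KB b) e) = ctens D 0 (lact E b e) 1[KA]"
  using A.emb_forms[OF calgebraD(2)[OF A.algA]]
  by (simp add: s0_tens B.emb_forms ctens_eq_J BA calgebraD(3)[OF A.algA] A.emb_one inc_emb A.emb_mult
   calgebraD(6)[OF A.alg] A.alg_simps A.embD)
next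
 fix m n xi eta e assume *: "xi:forms KB m" "eta:forms KB n" "e:car E"
 thus "s0 (m + n) (btens D (m + n) (xi **[KB] eta) e) = braid_wedge D s0 m n xi (s0 n (btens D n eta e))"
  by (simp add: s0_tens B.forms_mult braid_wedge_J A.forms_rmult inc_forms inc_closed inc_mult B.FD(5) A.alg_simps A.FD(5) A.embD)
qed

text \<open>\<open>braids\<close> is an arbitrary choice, so it can be computed only if every
  extension agrees with the explicit one. Degrees 0 and 1 are prescribed, and products of
  \<open>n\<close>-forms with 1-forms span degree \<open>n + 1\<close>.\<close>

lemma extends_unique:
 assumes s: "extends_braid D s" and xi: "xi:forms KB n" and a: "a:car A"
 shows "s n (btens D n xi a) = J n (inc xi *. emb KA a)"
proof -
 have lin: "s n:lin (tensor B (fb KB n) E) (cochains D n)" for n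
  using s by (auto simp: extends_braid_def bimodule_maps_def left_module_maps_def linear_maps_def)
 have 1: "s 1 (btens D 1 eta e) = J 1 (inc eta *. emb KA e)" if "eta:forms KB 1" "e:car A" for eta e
 proof -
  have "btens D 1 eta e:car (tensor B (fb KB 1) E)"
   using that by (simp add: btens_def btens_bal(1))
  hence "s 1 (btens D 1 eta e) = sig (btens D 1 eta e)" using s by (simp add: extends_braid_def)
  thus ?thesis using that sig_eq by (simp add: btens_def J_def)
 qed
 have "ALL a:car A. s n (btens D n xi a) = J n (inc xi *. emb KA a)"
  using xi
 proof (induction n arbitrary: xi)
  case 0
  then obtain b where b: "b:car B" "xi = emb KB b" using B.emb_surj by blast
  thus ?case
   using s A.emb_forms[OF calgebraD(2)[OF A.algA]]
   by (simp add: extends_braid_def ctens_eq_J BA calgebraD(3)[OF A.algA] A.emb_one inc_emb A.emb_mult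
    calgebraD(6)[OF A.alg] A.alg_simps A.embD)
 next
  case (Suc n)
  show ?case
  proof
   fix a assume a: "a:car A"
   have sub: "{xi **[KB] xi' | xi xi'. xi:forms KB n & xi':forms KB 1} <= forms KB (Suc n)"
    using B.forms_mult[of _ n _ 1] by auto
   have "xi:cspan (fb KB (Suc n)) {xi **[KB] xi' | xi xi'. xi:forms KB n & xi':forms KB 1}"
    using Suc.prems forms_gen B.cspan_form_bimod[OF sub] by auto
   moreover have "(%xi. s (Suc n) (btens D (Suc n) xi a)):lin (fb KB (Suc n)) (cochains D (Suc n))"
    using lin_comp[OF balancedD(8)[OF tens_balanced[OF btens_able]] lin[of "Suc n"]] a by (simp add: btens_def)
   moreover have "(%xi. J (Suc n) (inc xi *. emb KA a)):lin (fb KB (Suc n)) (cochains D (Suc n))"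
    using balancedD(8)[OF s0_balanced] a by simp
   ultimately show "s (Suc n) (btens D (Suc n) xi a) = J (Suc n) (inc xi *. emb KA a)"
   proof (rule lin_eq_cspan[OF B.cvs_forms cvs_C, rotated -1])
    show "{xi **[KB] xi' | xi xi'. xi:forms KB n & xi':forms KB 1} <= car (fb KB (Suc n))"
     using sub by simp
    fix x assume "x:{xi **[KB] xi' | xi xi'. xi:forms KB n & xi':forms KB 1}"
    then obtain xi1 xi2 where x: "x = xi1 **[KB] xi2" "xi1:forms KB n" "xi2:forms KB 1" by auto
    have "s (n + 1) (btens D (n + 1) x a) = braid_wedge D s n 1 xi1 (s 1 (btens D 1 xi2 a))"
     using s a unfolding x(1) extends_braid_def D_simps mult_bimod_simps(1) using x(2,3) by blast
    also have "... = braid_wedge D s n 1 xi1 (J 1 (inc xi2 *. emb KA a))" unfolding 1[OF x(3) a] ..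
    also have "... = J (n + 1) (inc xi1 *. (inc xi2 *. emb KA a))"
     using Suc.IH[OF x(2)] by (intro braid_wedge_J x(2) A.forms_rmult inc_forms x(3) a) auto
    also have "... = J (n + 1) (inc x *. emb KA a)"
     using x a by (simp add: inc_closed inc_mult B.FD(5) A.alg_simps A.embD)
    finally show "s (Suc n) (btens D (Suc n) x a) = J (Suc n) (inc x *. emb KA a)" by simp
   qed
  qed
 qed
 thus ?thesis using a by auto
qed

lemma braids_extends: "extends_braid D (braids D)"
 unfolding braids_def by (rule someI[of _ s0]) (rule s0_extends)

lemma braid_wedge_braids:
 "xi:forms KB m ==> zeta:forms KA k ==> braid_wedge D (braids D) m k xi (J k zeta) = J (m + k) (inc xi *. zeta)"
 by (rule braid_wedge_J) (assumption | rule extends_unique[OF braids_extends])+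

lemma Fl_gens_forms: "p <= n ==> {inc xi *. eta | xi eta. xi:forms KB p & eta:forms KA (n - p)} <= forms KA n"
 using A.forms_mult[OF inc_forms, of _ p _ "n - p"] by auto

lemma Fl_gens_carrier: "{inc xi *. eta | xi eta. xi:forms KB p & eta:forms KA k} <= car KA"
 using A.alg_simps(1) A.FD(5) inc_forms by blast

lemma Fl_subspace: "csubspace (Fl p n) KA"
 by (auto simp: ideal_filt_def csubspace_zero[OF A.V] intro: cspan_sub[OF A.V Fl_gens_carrier])

lemmas FlD = subD[OF A.V Fl_subspace]

lemma Fl_forms: "Fl p n <= forms KA n"
 unfolding ideal_filt_def using cspan_minimal[OF A.V A.forms_subspace Fl_gens_forms] A.FD(2) by auto

lemma Fl_gen: "xi:forms KB p ==> eta:forms KA k ==> inc xi *. eta:Fl p (p + k)"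
 unfolding ideal_filt_def by (auto intro!: cspan_base[OF A.V])

text \<open>Induction over a filtration step for conditions of the form \<open>f x : T\<close>.
  Generators are met only for \<open>p \<le> n\<close>, where the truncated difference
  \<open>n - p\<close> is the true one.\<close>

lemma Fl_induct_map:
 assumes f: "f:lin KA KA" and T: "csubspace T KA"
  and gen: "!!xi eta. p <= n ==> xi:forms KB p ==> eta:forms KA (n - p) ==> f (inc xi *. eta):T"
  and x: "x:Fl p n"
 shows "f x:T"
proof -
 have sp: "csubspace {x:car KA. f x:T} KA" by (rule lin_vimage[OF A.V A.V f T])
 show ?thesis
 proof (cases "p <= n")
  case True
  have "{inc xi *. eta | xi eta. xi:forms KB p & eta:forms KA (n - p)} <= {x:car KA. f x:T}"
   using Fl_gens_carrier[of p "n - p"] gen[OF True] by auto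
  from cspan_minimal[OF A.V sp this] show ?thesis using x True by (auto simp: ideal_filt_def)
 next
  case False
  thus ?thesis using x subD(2)[OF A.V T] lin_zero[OF A.V A.V f] by (auto simp: ideal_filt_def)
 qed
qed

lemma Fl_0: "Fl 0 n = forms KA n"
proof
 show "forms KA n <= Fl 0 n"
 proof
  fix eta assume "eta:forms KA n"
  moreover have "inc (emb KB 1[B]) = 1[KA]"
   using inc_emb[OF calgebraD(2)[OF B.algA]] by (simp add: B_eq(2) A.emb_one)
  ultimately show "eta:Fl 0 n"
   using Fl_gen[OF B.emb_forms[OF calgebraD(2)[OF B.algA]], of eta n]
   by (simp add: calgebraD(5)[OF A.alg] A.FD(5))
 qed
qed (rule Fl_forms)

text \<open>A \<open>(p + 1)\<close>-form of the base is a sum of products of a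
  \<open>p\<close>-form and a 1-form, and the 1-form is absorbed into the right factor.\<close>

lemma Fl_Suc: "Fl (Suc p) n <= Fl p n"
proof
 fix x assume x: "x:Fl (Suc p) n"
 have "(%x. x) x:Fl p n"
 proof (rule Fl_induct_map[OF linear_id Fl_subspace _ x])
  fix xi eta assume p: "Suc p <= n" and xi: "xi:forms KB (Suc p)" and eta: "eta:forms KA (n - Suc p)"
  let ?G = "{xi **[KB] xi' | xi xi'. xi:forms KB p & xi':forms KB 1}"
  have G: "?G <= car KB" using B.alg_simps(1) B.FD(5) by blast
  have lin: "(%xi. inc xi *. eta):lin KB KA"
   by (rule lin_comp[OF inc_linear calgebra_mult_linear(2)[OF A.alg A.FD(5)[OF eta]]])
  have "?G <= {xi:car KB. inc xi *. eta:Fl p n}"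
  proof
   fix x assume "x:?G"
   then obtain xi1 xi2 where *: "x = xi1 **[KB] xi2" "xi1:forms KB p" "xi2:forms KB 1" by auto
   have "inc xi2 *. eta:forms KA (n - p)" using A.forms_mult[OF inc_forms[OF *(3)] eta] p by (simp add: Suc_diff_Suc)
   hence "inc xi1 *. (inc xi2 *. eta):Fl p n" using Fl_gen[OF *(2)] p by force
   thus "x:{xi:car KB. inc xi *. eta:Fl p n}"
    using * eta by (simp add: inc_mult B.FD(5) A.alg_simps A.FD(5) inc_forms B.alg_simps incD)
  qed
  from cspan_minimal[OF B.V lin_vimage[OF B.V A.V lin Fl_subspace] this]
  show "inc xi *. eta:Fl p n" using xi forms_gen by auto
 qed
 thus "x:Fl p n" .
qed

text \<open>In the Leibniz rule the term with the differentiated base form even lies one filtration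
  step higher.\<close>

lemma Fl_diff: "x:Fl p n ==> dA x:Fl p (Suc n)"
proof (rule Fl_induct_map[OF A.diff_linear Fl_subspace])
 fix xi eta assume p: "p <= n" and xi: "xi:forms KB p" and eta: "eta:forms KA (n - p)"
 have "inc (diff KB xi) *. eta:Fl (Suc p) (Suc n)" using Fl_gen[OF B.diff_forms[OF xi] eta] p by simp
 hence "inc (diff KB xi) *. eta:Fl p (Suc n)" using Fl_Suc by blast
 moreover have "inc xi *. dA eta:Fl p (Suc n)" using Fl_gen[OF xi A.diff_forms[OF eta]] p by simp
 ultimately show "dA (inc xi *. eta):Fl p (Suc n)"
  using xi eta FlD(3,4) by (simp add: A.leibniz[OF inc_forms] A.FD(5) inc_diff B.FD(5))
qed

text \<open>By \<open>tensor_linear_image\<close> the step is spanned by the values of the lifted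
  map on pure tensors, and under \<open>J\<close> these are the products that generate
  \<open>Fl\<close>.\<close>

lemma filt_eq: "filt D p n = J n ` Fl p n"
proof (cases "p <= n")
 case False
 thus ?thesis by (simp add: filt_def ideal_filt_def J_zero[simplified])
next
 case True
 let ?h = "braid_wedge D (braids D) p (n - p)" and ?P = "fb KB p"
 have n: "p + (n - p) = n" using True by simp
 have T: "tensorable B ?P (cochains D (n - p))"
  using B.cvs_forms cvs_C B.forms_rmult lin_cl[OF lact_linear[OF BA]] by (auto simp: tensorable_def)
 have bw: "?h xi (J (n - p) zeta) = J n (inc xi *. zeta)" if "xi:forms KB p" "zeta:forms KA (n - p)" for xi zeta
  using braid_wedge_braids[OF that] n by simp
 have fm: "inc xi *. zeta:forms KA n" if "xi:forms KB p" "zeta:forms KA (n - p)" for xi zeta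
  using A.forms_mult[OF inc_forms[OF that(1)] that(2)] n by simp
 note c = bw fm JD(1) JD(2,3)[symmetric] A.FD(3,4) A.FD(5) A.alg_simps incD inc_closed B.FD(5) B.FD(3,4) inc_mult B.embD A.embD
 have h: "balanced B ?P (cochains D (n - p)) (cochains D n) ?h"
 proof (rule balancedI)
  fix xi z assume "xi:car ?P" "z:car (cochains D (n - p))"
  moreover then obtain zeta where "zeta:forms KA (n - p)" "z = J (n - p) zeta" by (metis J_cases)
  ultimately show "?h xi z:car (cochains D n)" by (simp add: c)
 next
  fix xi z z' assume *: "xi:car ?P" "z:car (cochains D (n - p))" "z':car (cochains D (n - p))"
  then obtain zeta zeta' where "zeta:forms KA (n - p)" "z = J (n - p) zeta" "zeta':forms KA (n - p)" "z' = J (n - p) zeta'"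
   by (metis J_cases)
  with * show "?h xi (z +[cochains D (n - p)] z') = ?h xi z +[cochains D n] ?h xi z'" by (simp add: c)
 next
  fix k xi z assume *: "xi:car ?P" "z:car (cochains D (n - p))"
  then obtain zeta where "zeta:forms KA (n - p)" "z = J (n - p) zeta" by (metis J_cases)
  with * show "?h xi (k *[cochains D (n - p)] z) = k *[cochains D n] ?h xi z"
   "?h (k *[?P] xi) z = k *[cochains D n] ?h xi z" by (simp_all add: c)
 next
  fix xi xi' z assume *: "xi:car ?P" "xi':car ?P" "z:car (cochains D (n - p))"
  then obtain zeta where "zeta:forms KA (n - p)" "z = J (n - p) zeta" by (metis J_cases)
  with * show "?h (xi +[?P] xi') z = ?h xi z +[cochains D n] ?h xi' z" by (simp add: c)
 next
  fix xi b z assume *: "xi:car ?P" "b:car B" "z:car (cochains D (n - p))"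
  then obtain zeta where "zeta:forms KA (n - p)" "z = J (n - p) zeta" by (metis J_cases)
  with * show "?h (ract ?P xi b) z = ?h xi (lact (cochains D (n - p)) b z)"
   by (simp add: c lact_J BA A.forms_lmult B.forms_rmult inc_emb)
 qed
 let ?L = "tensor_lift (cochains D n) ?h"
 have Lt: "?L (tens B ?P (cochains D (n - p)) xi z) = ?h xi z" if "xi:forms KB p" "z:car (cochains D (n - p))" for xi z
  using tensor_lift_tens[OF T cvs_C h] that by simp
 have "filt D p n = cspan (cochains D n) {?L (tens B ?P (cochains D (n - p)) xi z) | xi z. xi:forms KB p & z:car (cochains D (n - p))}"
  unfolding filt_def using True
   tensor_linear_image[OF T cvs_C tensor_lift_linear[OF T cvs_C h]]
  by (simp del: cochains_simps)
 also have "{?L (tens B ?P (cochains D (n - p)) xi z) | xi z. xi:forms KB p & z:car (cochains D (n - p))}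
  = {?h xi z | xi z. xi:forms KB p & z:car (cochains D (n - p))}"
  by (rule Collect_cong) (metis Lt)
 also have "{?h xi z | xi z. xi:forms KB p & z:car (cochains D (n - p))}
   = J n ` {inc xi *. eta | xi eta. xi:forms KB p & eta:forms KA (n - p)}"
  by (auto simp: image_iff bw simp del: cochains_simps elim!: J_cases) (metis bw JD(1) cochains_simps(1))+
 also have "cspan (cochains D n) ... = J n ` Fl p n"
  unfolding ideal_filt_def using True linear_image_cspan[OF A.cvs_forms cvs_C J_linear, of _ n] Fl_gens_forms[OF True]
  by (simp add: A.cspan_form_bimod)
 finally show ?thesis .
qed

text \<open>\<open>a \<otimes> d\<eta> + \<nabla>a \<and> \<eta> = 1 \<otimes> (a d\<eta> + da
  \<and> \<eta>)\<close>, and this is \<open>1 \<otimes> d(a \<eta>)\<close> by the Leibniz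
  rule.\<close>

lemma connC_J: "eta:forms KA n ==> connC D n (J n eta) = J (Suc n) (dA eta)"
 and connC_lin: "connC D n:lin (cochains D n) (cochains D (Suc n))"
proof -
 let ?h = "%e eta. ctens D (Suc n) e (dA eta) +[cochains D (Suc n)] cwedge D (Suc n) (nab e) eta"
 have eq: "?h a eta = J (Suc n) (dA (emb KA a *. eta))" if "a:car A" "eta:forms KA n" for a eta
 proof -
  have da: "dA (emb KA a):forms KA 1" using A.diff_forms[OF A.emb_forms[OF that(1)]] by simp
  have "cwedge D (Suc n) (nab a) eta = J (Suc n) (dA (emb KA a) *. eta)"
   using cwedge_J[OF da that(2)] that nab_eq by (simp add: J_def)
  moreover have "dA (emb KA a) *. eta:forms KA (Suc n)" using A.forms_mult[OF da that(2)] by simp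
  moreover have "emb KA a *. dA eta:forms KA (Suc n)" using A.forms_lmult[OF that(1) A.diff_forms[OF that(2)]] .
  ultimately show ?thesis
   using that cvs_add_comm[OF A.V] by (simp add: ctens_eq_J A.diff_forms JD(2)[symmetric] A.diff_mult_emb A.FD(5))
 qed
 show "connC D n:lin (cochains D n) (cochains D (Suc n))"
  unfolding connC_def D_simps by (rule lift_J(1)[OF dA_linear eq])
 show "connC D n (J n eta) = J (Suc n) (dA eta)" if "eta:forms KA n"
  unfolding connC_def D_simps by (rule lift_J(2)[OF dA_linear eq that])
qed

sublocale filtered_complex D
proof (rule filtered_complex.intro)
 fix n p
 show "cvs (cochains D n)" by (rule cvs_C)
 show "connC D n:lin (cochains D n) (cochains D (Suc n))" by (rule connC_lin)
 show "connC D (Suc n) (connC D n x) = 0[cochains D (Suc (Suc n))]" if "x:car (cochains D n)" for x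
  using that by (elim J_cases) (simp add: connC_J A.diff_forms A.diff_diff A.FD(5) J_zero[simplified])
 show "csubspace (filt D p n) (cochains D n)"
  unfolding filt_eq
 proof (rule linear_image_subspace[OF A.cvs_forms cvs_C J_linear])
  have "csubspace (Fl p n) (KA(|carrier := forms KA n|))"
   using csubspace_of_subspace[OF A.V A.forms_subspace Fl_forms] Fl_subspace by blast
  thus "csubspace (Fl p n) (fb KA n)"
   using csubspace_cong[OF sub_cvs[OF A.V A.forms_subspace], where W = "fb KA n"] by simp
 qed
 show "filt D 0 n = car (cochains D n)" unfolding filt_eq Fl_0 using J_bij[of n] by (simp add: bij_betw_def)
 show "filt D (Suc p) n <= filt D p n" unfolding filt_eq using Fl_Suc by blast
 show "filt D p n = {0[cochains D n]}" if "n < p" using that by (simp add: filt_def)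
 show "connC D n x:filt D p (Suc n)" if "x:filt D p n" for x
  using that Fl_diff Fl_forms unfolding filt_eq by (auto simp: connC_J subset_iff)
qed

lemma deRham_iso: "isomorphic (bundle_cohomology D k) (deRham KA k)"
proof -
 have "isomorphic (deRham KA k) (bundle_cohomology D k)"
  unfolding deRham_def bundle_cohomology_def
  by (rule cohomology_iso[where f = J])
   (use J_bij A.FD(5) in "auto simp: A.cvs_forms cvs_C J_linear A.diff_diff connC_J A.diff_forms A.diffD intro!: linI")
 \<comment> \<open>Inverting an isomorphism requires its source to be a vector space.\<close>
 moreover have "cvs (deRham KA k)"
 proof -
  let ?F = "fb KA k"
  have lin: "dA:lin (fb KA n) (fb KA (Suc n))" for n
   by (auto intro!: linI simp: A.diffD A.FD(5) A.diff_forms)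
  have Z: "csubspace (cocycles (fb KA) (%n. dA) k) ?F"
   unfolding cocycles_def by (rule linear_kernel_subspace[OF A.cvs_forms A.cvs_forms lin])
  have B: "csubspace (coboundaries (fb KA) (%n. dA) k) ?F"
  proof (cases k)
   case (Suc m)
   show ?thesis
    using linear_image_subspace[OF A.cvs_forms A.cvs_forms lin csubspace_carrier[OF A.cvs_forms], of m]
    by (simp add: coboundaries_def Suc)
  qed (use csubspace_zero[OF A.cvs_forms, of 0] in "simp add: coboundaries_def")
  have BZ: "coboundaries (fb KA) (%n. dA) k <= cocycles (fb KA) (%n. dA) k"
   by (cases k) (auto simp: coboundaries_def cocycles_def A.diff_diff A.diff_forms A.FD A.diff_zero)
  show ?thesis
   unfolding deRham_def cohomology_def
   by (rule cvs_quot[OF sub_cvs[OF A.cvs_forms Z]])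
    (use csubspace_of_subspace[OF A.cvs_forms Z BZ] B in blast)
 qed
 ultimately show ?thesis by (rule isomorphic_sym[rotated])
qed

lemma bimodule_E: "bimodule B A E"
 unfolding bimodule_def left_module_def
 by (auto simp: cvs_E calgebraD[OF A.algA] BA B_eq intro!: linI)

lemma bimodule_connection_D: "bimodule_connection D"
 unfolding bimodule_connection_def D_simps
proof (intro conjI ballI)
 show "differential_calculus B KB" "differential_calculus A KA" by (rule B.dc, rule A.dc)
 show "bimodule B A E" by (rule bimodule_E)
 show "nab:lin E (cochains D 1)" using nab_linear by (simp add: linear_maps_def)
 have nJ: "nab a = J 1 (dA (emb KA a))" if "a:car A" for a using nab_eq[OF that] by (simp add: J_def)
 have d1: "dA (emb KA a):forms KA 1" if "a:car A" for a using A.diff_forms[OF A.emb_forms[OF that]] by simp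
 note c = calgebraD(3)[OF A.algA] A.emb_mult A.diff_mult_emb A.embD A.FD(5)
 show "nab (ract E e a) = ract (cochains D 1) (nab e) a +[cochains D 1] ctens D 1 e (dA (emb KA a))"
  if "e:car E" "a:car A" for e a
  using that d1 JD(2)[of "dA (emb KA e) *. emb KA a" 1 "emb KA e *. dA (emb KA a)"]
  by (simp add: nJ c ract_J ctens_eq_J A.forms_rmult A.forms_lmult)
 show "sig:bimodule_maps B A (btensor B (fb KB 1) E) (cochains D 1)"
 proof -
  let ?T = "btensor B (fb KB 1) E"
  have "lact ?T b t:car ?T" if "b:car B" "t:car ?T" for b t
   using lin_cl[OF bT_lact(1)[OF that(1), of 1]] that by (simp del: btensor_simps(5))
  moreover have "ract ?T t a:car ?T" if "a:car A" "t:car ?T" for a t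
   using lin_cl[OF bT_ract(1)[OF that(1), of 1]] that by (simp del: btensor_simps(6))
  moreover have "sig:lin ?T (cochains D 1)" using sig_linear by (simp add: linear_maps_def)
  ultimately show ?thesis
   using s0_bimodule[of 1] sig_eq_s0 unfolding bimodule_maps_def left_module_maps_def mem_Collect_eq btensor_simps(1)
   by (simp del: btensor_simps(5,6) cochains_simps)
 qed
 show "nab (lact E b e) = sig (btens D 1 (diff KB (emb KB b)) e) +[cochains D 1] lact (cochains D 1) b (nab e)"
  if "b:car B" "e:car E" for b e
 proof -
  have db: "diff KB (emb KB b):forms KB 1" using B.diff_forms[OF B.emb_forms[OF that(1)]] by simp
  have "sig (btens D 1 (diff KB (emb KB b)) e) = J 1 (dA (emb KA b) *. emb KA e)"
   using that sig_eq[OF db] by (simp add: btens_def J_def inc_diff B.embD inc_emb)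
  thus ?thesis
   using that d1 BA JD(2)[of "dA (emb KA b) *. emb KA e" 1 "emb KA b *. dA (emb KA e)"]
   by (simp add: nJ c lact_J A.forms_rmult A.forms_lmult)
 qed
qed

lemma zero_curvature_D: "zero_curvature D"
 unfolding zero_curvature_def D_simps
proof
 fix e assume "e:car E"
 hence e: "e:car A" by simp
 have d1: "dA (emb KA e):forms KA 1" using A.diff_forms[OF A.emb_forms[OF e]] by simp
 have "nab e = J 1 (dA (emb KA e))" using nab_eq[OF e] by (simp add: J_def)
 hence "connC D 1 (nab e) = J (Suc 1) (dA (dA (emb KA e)))" using connC_J[OF d1] by simp
 thus "connC D 1 (nab e) = 0[cochains D 2]"
  using e J_zero[of 2] by (simp add: A.diff_diff A.embD numeral_2_eq_2)
qed

end

section \<open>Multiplication and the filtration; basis expansions\<close>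

context split_bundle begin

lemma Fl_0': "Fl 0 (0 + q) = forms KA q" by (simp add: Fl_0)

lemma Fl_lmult:
 assumes xi: "xi:forms KB p" and x: "x:Fl r n"
 shows "inc xi *. x:Fl (p + r) (p + n)"
proof (rule Fl_induct_map[OF calgebra_mult_linear(1)[OF A.alg inc_closed[OF xi]] Fl_subspace _ x])
 fix xi' eta assume *: "r <= n" "xi':forms KB r" "eta:forms KA (n - r)"
 have "inc (xi **[KB] xi') *. eta:Fl (p + r) (p + n)" using Fl_gen[OF B.forms_mult[OF xi *(2)] *(3)] *(1) by simp
 thus "inc xi *. (inc xi' *. eta):Fl (p + r) (p + n)"
  using xi * by (simp add: inc_mult B.FD(5) inc_closed A.FD(5) A.alg_simps)
qed

lemma Fl_lact: "b:car B ==> x:Fl p n ==> emb KA b *. x:Fl p n"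
 using Fl_lmult[OF B.emb_forms, of b x p n] by (simp add: inc_emb)

lemma Fl_ract:
 assumes a: "a:car A" and x: "x:Fl p n"
 shows "x *. emb KA a:Fl p n"
proof (rule Fl_induct_map[OF calgebra_mult_linear(2)[OF A.alg A.embD(1)[OF a]] Fl_subspace _ x])
 fix xi' eta assume *: "p <= n" "xi':forms KB p" "eta:forms KA (n - p)"
 have "inc xi' *. (eta *. emb KA a):Fl p n" using Fl_gen[OF *(2) A.forms_rmult[OF a *(3)]] *(1) by simp
 thus "inc xi' *. eta *. emb KA a:Fl p n"
  using * a by (simp add: inc_closed A.FD(5) A.alg_simps A.embD)
qed

lemma basisD: "finite (I p)" "e:I p ==> e:forms KB p"
 using basis[of p] by (auto simp: right_basis_def)

lemma B_closed: "ALL p':car (fb KB p). ALL b:car B. ract (fb KB p) p' b:car (fb KB p)"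
 by (simp add: B.forms_rmult)

lemmas rb = right_basisD[OF B.VA B.cvs_forms B_closed basis, simplified]

text \<open>Expand the base factor in the right basis and let its coordinates, which are elements of
  \<open>B\<close>, act on the second factor.\<close>

lemma Fl_expand:
 assumes x: "x:Fl p (p + k)"
 shows "EX eta. (ALL e:I p. eta e:forms KA k) & x = (finsum KA (%e. inc e *. eta e) (I p))"
proof -
 interpret AA: abelian_group KA by (rule cvs_abelian[OF A.V])
 have cl: "inc e *. y:car KA" if "e:I p" "y:forms KA k" for e y
  using that A.alg_simps(1) inc_closed[OF basisD(2)] A.FD(5) by auto
 have "x:cspan KA {inc xi *. eta | xi eta. xi:forms KB p & eta:forms KA k}"
  using x by (simp add: ideal_filt_def)
 from A.V this Fl_gens_carrier show ?thesis
 proof (induction rule: cspan_induct)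
  case zero
  have "(finsum KA (%e. inc e *. 0[KA]) (I p)) = 0[KA]"
   using lin_zero[OF A.V A.V calgebra_mult_linear(1)[OF A.alg inc_closed[OF basisD(2)]]]
   by (intro AA.add.finprod_one_eqI) auto
  thus ?case using A.FD(2) by (intro exI[of _ "%_. 0[KA]"]) auto
 next
  case (base s)
  then obtain xi eta where s: "s = inc xi *. eta" "xi:forms KB p" "eta:forms KA k" by auto
  have b: "co p e xi:car B" if "e:I p" for e using rb(7)[OF that s(2)] .
  have cl': "e **[KB] emb KB (co p e xi):forms KB p" if "e:I p" for e
   using that b basisD(2) B.forms_rmult by auto
  have "xi = (finsum KB (%e. e **[KB] emb KB (co p e xi)) (I p))"
   using rb(6)[OF s(2)] B.finsum_form_bimod[OF cl', of "I p"] by simp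
  hence "s = inc (finsum KB (%e. e **[KB] emb KB (co p e xi)) (I p)) *. eta" using s by simp
  also have "... = (finsum KA (%e. inc (e **[KB] emb KB (co p e xi)) *. eta) (I p))"
   by (rule lin_finsum[OF B.V A.V lin_comp[OF inc_linear calgebra_mult_linear(2)[OF A.alg A.FD(5)[OF s(3)]]]])
    (use cl' B.FD(5) in auto)
  also have "... = (finsum KA (%e. inc e *. (emb KA (co p e xi) *. eta)) (I p))"
  proof (rule AA.finsum_cong')
   fix e assume e: "e:I p"
   thus "inc (e **[KB] emb KB (co p e xi)) *. eta = inc e *. (emb KA (co p e xi) *. eta)"
    using b[OF e] basisD(2)[OF e] s(3) A.FD(5)[OF s(3)] B.FD(5)[OF basisD(2)[OF e]]
    by (simp add: inc_mult B.embD inc_emb BA inc_closed A.embD A.alg_simps)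
  qed (use cl b BA s A.forms_lmult in auto)
  finally show ?case using b BA s A.forms_lmult by (intro exI[of _ "%e. emb KA (co p e xi) *. eta"]) auto
 next
  case (add x y)
  then obtain eta zeta where *: "ALL e:I p. eta e:forms KA k" "x = (finsum KA (%e. inc e *. eta e) (I p))"
   "ALL e:I p. zeta e:forms KA k" "y = (finsum KA (%e. inc e *. zeta e) (I p))" by auto
  hence fc: "e:I p ==> eta e:car KA" "e:I p ==> zeta e:car KA" for e using A.FD(5) by blast+
  have "x +. y = (finsum KA (%e. inc e *. eta e +. inc e *. zeta e) (I p))"
   unfolding * by (rule AA.finsum_addf[symmetric]) (use * cl in auto)
  also have "... = (finsum KA (%e. inc e *. (eta e +. zeta e)) (I p))"
   by (rule AA.finsum_cong')
    (use * A.FD(3) in "auto simp: A.alg_simps inc_closed[OF basisD(2)] fc intro!: cl")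
  finally show ?case using * A.FD(3) by (intro exI[of _ "%e. eta e +. zeta e"]) auto
 next
  case (smult c x)
  then obtain eta where *: "ALL e:I p. eta e:forms KA k" "x = (finsum KA (%e. inc e *. eta e) (I p))" by auto
  hence fc: "e:I p ==> eta e:car KA" for e using A.FD(5) by blast
  have "c .* x = (finsum KA (%e. c .* (inc e *. eta e)) (I p))"
   unfolding * by (rule lin_finsum[OF A.V A.V linear_scale[OF A.V linear_id]]) (use * cl in auto)
  also have "... = (finsum KA (%e. inc e *. (c .* eta e)) (I p))"
   by (rule AA.finsum_cong')
    (use * A.FD(4) in "auto simp: A.alg_simps inc_closed[OF basisD(2)] fc intro!: cl")
  finally show ?case using * A.FD(4) by (intro exI[of _ "%e. c .* eta e"]) auto
 qed
qed

section \<open>Fibre forms\<close>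

text \<open>The class in \<open>M\<^sub>p\<^sub>,\<^sub>q\<close> of a form. The quotients are
  handled mainly through this surjection from forms, whose kernel is the next filtration step
  (\<open>mcl_zero_iff\<close>).\<close>

definition "mcl p q eta = filt_class D p q (J (p + q) eta)"

abbreviation "FV p n == (cochains D n)(|carrier := filt D p n|)"

lemma FV_cvs: "cvs (FV p n)"
 by (rule sub_cvs[OF cochains_cvs filt_subspace])

lemma FV_sub: "csubspace (filt D (Suc p) n) (FV p n)"
 using csubspace_of_subspace[OF cochains_cvs filt_subspace filt_Suc] filt_subspace by blast

lemma fibre_quot_eq: "fibre_quot D p q = bquot (FV p (p + q)) (filt D (Suc p) (p + q))"
 by (simp add: fibre_quot_def)

lemma cvs_fibre: "cvs (fibre_quot D p q)"
 unfolding fibre_quot_eq by (rule cvs_bquot[OF FV_cvs FV_sub])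

lemma J_mem_filt: "eta:forms KA n ==> J n eta:filt D p n <-> eta:Fl p n"
 unfolding filt_eq using J_inj Fl_forms by (auto simp: image_iff subset_iff) metis

lemma J_Fl: "eta:Fl p n ==> J n eta:filt D p n"
 unfolding filt_eq by auto

lemma carrier_fibre: "car (fibre_quot D p q) = mcl p q ` Fl p (p + q)"
 by (simp add: fibre_quot_eq filt_eq[of p] mcl_def filt_class_def image_image)

lemma J_linear': "J n:lin (KA(|carrier := Fl p n|)) (FV p n)"
 using JD Fl_forms J_Fl by (auto intro!: linI simp: subset_iff)

lemma quot_bquot: "lin V (bquot M S) = lin V (quot M S)"
 by (simp add: linear_maps_def)

lemma mcl_linear: "mcl p q:lin (KA(|carrier := Fl p (p + q)|)) (fibre_quot D p q)"
 using lin_comp[OF J_linear' quot_class_linear[OF FV_cvs FV_sub], of p "p + q"]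
 unfolding fibre_quot_eq quot_bquot by (simp add: mcl_def[abs_def] filt_class_def)

lemmas mclD = linD[OF mcl_linear, simplified]

lemma mcl_zero_iff: "eta:Fl p (p + q) ==> mcl p q eta = 0[fibre_quot D p q] <-> eta:Fl (Suc p) (p + q)"
 using coset_eq_zero_iff[OF FV_cvs FV_sub, of "J (p + q) eta" p "p + q"] J_mem_filt[of eta "p + q" "Suc p"] Fl_forms J_Fl
 by (auto simp: fibre_quot_eq mcl_def filt_class_def subset_iff)

lemma mcl_eqD:
 assumes "mcl p q eta = mcl p q eta'" "eta:Fl p (p + q)" "eta':Fl p (p + q)"
 shows "EX f:Fl (Suc p) (p + q). eta = f +. eta'"
proof -
 note cl = FlD(5)[OF assms(2)] FlD(5)[OF assms(3)]
 have "eta +. (-1) .* eta':Fl p (p + q)" using FlD(3,4) assms by auto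
 moreover have "mcl p q (eta +. (-1) .* eta') = 0[fibre_quot D p q]"
  using assms FlD(4) by (simp add: mclD(2,3) cvs_diff_self[OF cvs_fibre] mclD(1))
 ultimately have "eta +. (-1) .* eta':Fl (Suc p) (p + q)" using mcl_zero_iff by blast
 moreover have "eta = (eta +. (-1) .* eta') +. eta'"
  using cvs_diff_add[OF A.V, of eta' eta] cl cvs_add_comm[OF A.V, of "eta +. (-1) .* eta'" eta']
  by (simp add: add_cl[OF A.V] smult_cl[OF A.V])
 ultimately show ?thesis by blast
qed

lemma FV_lact: "b:car B ==> lact (FV p n) b:lin (FV p n) (FV p n)"
 and FV_lact_stable: "b:car B ==> lact (FV p n) b ` filt D r n <= filt D r n"
proof -
 assume b: "b:car B"
 have st: "lact (cochains D n) b z:filt D r n" if "z:filt D r n" for z r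
  using that Fl_lact[OF b] Fl_forms unfolding filt_eq by (auto simp: lact_J BA b subset_iff)
 show "lact (FV p n) b:lin (FV p n) (FV p n)"
  by simp (rule linear_corestrict[OF linear_restrict[OF lact_linear[OF BA[OF b]] FD(1)]], use st in auto)
 show "lact (FV p n) b ` filt D r n <= filt D r n" using st by auto
qed

lemma FV_ract: "b:car A ==> (%t. ract (FV p n) t b):lin (FV p n) (FV p n)"
 and FV_ract_stable: "b:car A ==> (%t. ract (FV p n) t b) ` filt D r n <= filt D r n"
proof -
 assume b: "b:car A"
 have st: "ract (cochains D n) z b:filt D r n" if "z:filt D r n" for z r
  using that Fl_ract[OF b] Fl_forms unfolding filt_eq by (auto simp: ract_J b subset_iff)
 show "(%t. ract (FV p n) t b):lin (FV p n) (FV p n)"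
  by simp (rule linear_corestrict[OF linear_restrict[OF ract_linear[OF b] FD(1)]], use st in auto)
 show "(%t. ract (FV p n) t b) ` filt D r n <= filt D r n" using st by auto
qed

lemma lact_mcl: "b:car B ==> eta:Fl p (p + q) ==> lact (fibre_quot D p q) b (mcl p q eta) = mcl p q (emb KA b *. eta)"
proof -
 assume *: "b:car B" "eta:Fl p (p + q)"
 hence eta: "eta:forms KA (p + q)" using Fl_forms by auto
 show ?thesis
  using lact_lquot[OF FV_cvs FV_sub FV_lact[OF *(1)] FV_lact_stable[OF *(1)], of "J (p + q) eta" p "p + q"] J_Fl[OF *(2)]
  by (simp add: fibre_quot_eq mcl_def filt_class_def lact_J[OF BA[OF *(1)] eta])
qed

lemma ract_mcl: "b:car A ==> eta:Fl p (p + q) ==> ract (fibre_quot D p q) (mcl p q eta) b = mcl p q (eta *. emb KA b)"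
proof -
 assume *: "b:car A" "eta:Fl p (p + q)"
 hence eta: "eta:forms KA (p + q)" using Fl_forms by auto
 show ?thesis
  using ract_bquot[OF FV_cvs FV_sub FV_ract[OF *(1)] FV_ract_stable[OF *(1)], of "J (p + q) eta" p "p + q"] J_Fl[OF *(2)]
  by (simp add: fibre_quot_eq mcl_def filt_class_def ract_J[OF *(1) eta])
qed

text \<open>Module laws pass along a surjection compatible with the action, and on forms they are
  laws of the algebra. This serves the quotients of the filtration and the fibre cohomology
  alike.\<close>

lemma left_module_by_classes:
 assumes W: "cvs W" "cvs S" and f: "f:lin S W" "car W = f ` car S" and S: "car S <= car KA"
   "add S = add KA" "smult S = smult KA"
  and act: "!!b eta. b:car B ==> eta:car S ==> lact W b (f eta) = f (emb KA b *. eta)"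
  and st: "!!b eta. b:car B ==> eta:car S ==> emb KA b *. eta:car S"
 shows "left_module B W"
proof -
 note fD = linD[OF f(1), unfolded S(2,3)]
 have c: "eta:car KA" if "eta:car S" for eta using S(1) that by auto
 note SC = add_cl[OF W(2), unfolded S(2)] smult_cl[OF W(2), unfolded S(3)]
 note cc = add_cl[OF B.VA] smult_cl[OF B.VA]
 note r = fD(2,3)[symmetric] act st c A.alg_simps A.embD BA SC cc cc[unfolded B_eq] A.emb_mult
 have one: "1[A]:car B" using calgebraD(2)[OF B.algA] B_eq(2) by simp
 have mul: "a **[A] b:car B" if "a:car B" "b:car B" for a b
  using calgebraD(3)[OF B.algA that] B_eq(1) by simp
 show ?thesis
  unfolding left_module_def
 proof (intro conjI ballI)
  fix b assume b: "b:car B"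
  show "lact W b:lin W W"
   using b by (intro linI) (auto simp: f(2) r)
  fix m assume m: "m:car W"
  show "lact W (b **[B] b') m = lact W b (lact W b' m)" if "b':car B" for b'
   using that b m by (auto simp: f(2) r B_eq mul)
 next
  fix m assume m: "m:car W"
  then obtain eta where eta: "eta:car S" "m = f eta" by (auto simp: f(2))
  show "(%b. lact W b m):lin B W"
   using eta by (intro linI) (auto simp: f(2) r B_eq)
  show "lact W 1[B] m = m" using eta one by (simp add: B_eq r A.emb_one calgebraD(5)[OF A.alg])
 qed (rule W)
qed

lemma Fl_cvs: "cvs (KA(|carrier := Fl p n|))"
 by (rule sub_cvs[OF A.V Fl_subspace])

lemma left_module_fibre: "left_module B (fibre_quot D p q)"
 by (rule left_module_by_classes[OF cvs_fibre Fl_cvs mcl_linear])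
  (auto simp: carrier_fibre lact_mcl Fl_lact FlD(5))

lemma diff_mcl: "eta:Fl p (p + q) ==> fibre_quot_diff D p q (mcl p q eta) = mcl p (Suc q) (dA eta)"
proof -
 assume eta: "eta:Fl p (p + q)"
 have "on_coset (%z. filt_class D p (Suc q) (connC D (p + q) z)) (filt D (Suc p) (p + q) +>\<^bsub>FV p (p + q)\<^esub> J (p + q) eta)
   = filt_class D p (Suc q) (connC D (p + q) (J (p + q) eta))"
 proof (rule on_coset_eq[OF FV_cvs FV_sub])
  show "J (p + q) eta:car (FV p (p + q))" using J_Fl[OF eta] by simp
  fix s assume "s:filt D (Suc p) (p + q)"
  hence s: "s:car (cochains D (p + q))" "connC D (p + q) s:filt D (Suc p) (Suc (p + q))" using FD(5) connC_filt by auto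
  have z: "J (p + q) eta:car (cochains D (p + q))" using J_Fl[OF eta] FD(5) by blast
  thus "filt_class D p (Suc q) (connC D (p + q) (s +[FV p (p + q)] J (p + q) eta)) = filt_class D p (Suc q) (connC D (p + q) (J (p + q) eta))"
   using s unfolding filt_class_def
   by (intro coset_eqI[OF cochains_cvs filt_subspace, of "connC D (p + q) s"]) (simp_all add: dD del: cochains_simps)
 qed
 thus ?thesis using eta Fl_forms[of p "p + q"] connC_J[of eta "p + q"]
  by (simp add: fibre_quot_diff_def mcl_def filt_class_def subset_iff)
qed

lemma diff_mcl': "eta:Fl p (p + q) ==> dA eta:Fl p (p + Suc q)"
 using Fl_diff by simp

section \<open>The isomorphisms induced by the braiding\<close>

lemma on_coset_mcl:
 assumes eta: "eta:forms KA q" and f: "!!f. f:Fl 1 q ==> G (J q (f +. eta)) = G (J q eta)"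
 shows "on_coset G (mcl 0 q eta) = G (J q eta)"
proof -
 have "on_coset G (filt D (Suc 0) q +>\<^bsub>FV 0 q\<^esub> J q eta) = G (J q eta)"
 proof (rule on_coset_eq[OF FV_cvs FV_sub])
  show "J q eta:car (FV 0 q)" using eta by (simp add: filt_0 JD(1))
  fix s assume "s:filt D (Suc 0) q"
  then obtain f where "f:Fl 1 q" "s = J q f" by (auto simp: filt_eq)
  moreover from this have "f:forms KA q" using Fl_forms by auto
  ultimately show "G (s +[FV 0 q] J q eta) = G (J q eta)" using f[of f] eta by (simp add: JD(2))
 qed
 thus ?thesis by (simp add: mcl_def filt_class_def)
qed

definition "gh p q xi = on_coset (%z. filt_class D p q (braid_wedge D (braids D) p q xi z))"

lemma mcl_add_Fl: "f:Fl (Suc p) (p + q) ==> eta:Fl p (p + q) ==> mcl p q (f +. eta) = mcl p q eta"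
 using mclD(2)[of f p q eta] mcl_zero_iff[of f p q] Fl_Suc[of p "p + q"] mclD(1)[of eta p q]
 by (auto simp: cvs_l_zero[OF cvs_fibre])

lemma Fl_lmult1: "xi:forms KB p ==> f:Fl 1 q ==> inc xi *. f:Fl (Suc p) (p + q)"
 using Fl_lmult[of xi p f 1 q] by simp

text \<open>Well defined because a \<open>p\<close>-form of the base times filtration step 1 lies in
  step \<open>p + 1\<close> (\<open>Fl_lmult1\<close>).\<close>

lemma gh_mcl:
 assumes xi: "xi:forms KB p" and eta: "eta:forms KA q"
 shows "gh p q xi (mcl 0 q eta) = mcl p q (inc xi *. eta)"
proof -
 have "gh p q xi (mcl 0 q eta) = filt_class D p q (braid_wedge D (braids D) p q xi (J q eta))"
  unfolding gh_def
 proof (rule on_coset_mcl[OF eta])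
  fix f assume f: "f:Fl 1 q"
  hence f': "f:forms KA q" using Fl_forms by auto
  have "mcl p q (inc xi *. (f +. eta)) = mcl p q (inc xi *. f +. inc xi *. eta)"
   using xi eta f' by (simp add: A.alg_simps inc_closed A.FD(5))
  also have "... = mcl p q (inc xi *. eta)" by (rule mcl_add_Fl[OF Fl_lmult1[OF xi f] Fl_gen[OF xi eta]])
  finally show "filt_class D p q (braid_wedge D (braids D) p q xi (J q (f +. eta))) = filt_class D p q (braid_wedge D (braids D) p q xi (J q eta))"
   using xi eta f' A.FD(3) by (simp add: braid_wedge_braids mcl_def)
 qed
 thus ?thesis using xi eta by (simp add: braid_wedge_braids mcl_def)
qed

lemma fibre_cases: assumes "u:car (fibre D q)" obtains eta where "eta:forms KA q" "u = mcl 0 q eta"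
 using assms by (auto simp: carrier_fibre Fl_0)

lemmas mcl0D = mclD[where p = 0, unfolded Fl_0']
lemmas lact_mcl0 = lact_mcl[where p = 0, unfolded Fl_0']

lemma tensorable_fibre: "tensorable B (fb KB p) (fibre_quot D p' q)"
 by (rule B.tensorable_left[OF left_module_fibre])

lemma gh_balanced: "balanced B (fb KB p) (fibre D q) (fibre_quot D p q) (gh p q)"
proof -
 note c = gh_mcl mcl0D(2,3)[symmetric] mclD(2,3)[symmetric] Fl_gen A.FD(3,4) A.alg_simps inc_closed A.FD(5) incD B.FD(5) B.FD(3,4)
  mclD(1) lact_mcl0 B.forms_rmult A.forms_lmult BA inc_mult inc_emb A.embD B.embD
 show ?thesis
 proof (rule balancedI)
  fix xi u assume *: "xi:car (fb KB p)" "u:car (fibre D q)"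
  then obtain eta where eta: "eta:forms KA q" "u = mcl 0 q eta" by (auto elim: fibre_cases)
  show "gh p q xi u:car (fibre_quot D p q)" using eta * by (simp add: c)
  show "gh p q xi (k *[fibre D q] u) = k *[fibre_quot D p q] gh p q xi u" for k using eta * by (simp add: c)
  show "gh p q (k *[fb KB p] xi) u = k *[fibre_quot D p q] gh p q xi u" for k using eta * by (simp add: c)
  show "gh p q xi (u +[fibre D q] u') = gh p q xi u +[fibre_quot D p q] gh p q xi u'" if "u':car (fibre D q)" for u'
   using that eta * by (auto elim!: fibre_cases simp: c)
  show "gh p q (xi +[fb KB p] xi') u = gh p q xi u +[fibre_quot D p q] gh p q xi' u" if "xi':car (fb KB p)" for xi'
   using that eta * by (simp add: c)
  show "gh p q (ract (fb KB p) xi b) u = gh p q xi (lact (fibre D q) b u)" if "b:car B" for b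
   using that eta * by (simp add: c)
 qed
qed

lemma g_map_eq: "g_map D p q = tensor_lift (fibre_quot D p q) (gh p q)"
 by (simp add: g_map_def gh_def[abs_def])

lemma g_map_tens: "xi:forms KB p ==> eta:forms KA q ==>
  g_map D p q (tens B (fb KB p) (fibre D q) xi (mcl 0 q eta)) = mcl p q (inc xi *. eta)"
 unfolding g_map_eq
 by (subst tensor_lift_tens[OF tensorable_fibre cvs_fibre gh_balanced]) (auto simp: gh_mcl mcl0D(1))

lemma sum_forms:
 assumes "!!e. e:I p ==> eta e:forms KA q"
 shows "(finsum KA (%e. inc e *. eta e) (I p)):Fl p (p + q)"
 by (rule csubspace_sum_closed[OF A.V Fl_subspace]) (use assms basisD(2) Fl_gen in auto)

lemma class_sum:
 assumes S: "csubspace S KA" and W: "cvs W" and f: "f:lin (KA(|carrier := S|)) W"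
  and x: "!!i. i:K ==> x i:S"
 shows "f (finsum KA (%i. x i) K) = (finsum W (%i. f (x i)) K)"
proof -
 note SV = sub_cvs[OF A.V S]
 have "(%x. x):lin (KA(|carrier := S|)) KA"
  using subD(5)[OF A.V S] by (auto simp: linear_maps_def)
 from lin_finsum[OF SV A.V this, of K x] x
 have "(finsum (KA(|carrier := S|)) (%i. x i) K) = (finsum KA (%i. x i) K)" by simp
 thus ?thesis using lin_finsum[OF SV W f, of K x] x by simp
qed

text \<open>In basis coordinates an element of the tensor product is a family of classes of forms
  \<open>\<eta>\<^sub>e\<close>, and its image is the class of the sum of the
  \<open>e \<and> \<eta>\<^sub>e\<close>. So \<open>basis_independent\<close> gives injectivity, and
  surjectivity holds since the filtration step is spanned by products.\<close>

lemma g_map_iso: "linear_iso (tensor B (fb KB p) (fibre D q)) (fibre_quot D p q) (g_map D p q)"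
 unfolding linear_iso_def bij_betw_def
proof (intro conjI)
 let ?T = "tensor B (fb KB p) (fibre D q)" and ?t = "tens B (fb KB p) (fibre D q)"
 note T = cvs_tensor[OF tensorable_fibre]
 show lin: "g_map D p q:lin ?T (fibre_quot D p q)"
  unfolding g_map_eq by (rule tensor_lift_linear[OF tensorable_fibre cvs_fibre gh_balanced])
 note te = tensor_expand[OF B.VA B.cvs_forms B_closed basis left_module_fibre]
  and tl = tensor_coord_linear[OF B.VA B.cvs_forms B_closed basis left_module_fibre]
 show "inj_on (g_map D p q) (car ?T)"
 proof (rule linear_injI[OF T cvs_fibre lin])
  fix t assume t: "t:car ?T" "g_map D p q t = 0[fibre_quot D p q]"
  have "EX eta. eta:forms KA q & tensor_coord (co p) (fibre D q) e t = mcl 0 q eta" if "e:I p" for e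
   using lin_cl[OF tl[OF that] t(1)] by (metis fibre_cases)
  then obtain eta where eta: "!!e. e:I p ==> eta e:forms KA q" "!!e. e:I p ==> tensor_coord (co p) (fibre D q) e t = mcl 0 q (eta e)"
   by metis
  interpret TG: abelian_group ?T by (rule cvs_abelian[OF T])
  interpret WG: abelian_group "fibre_quot D p q" by (rule cvs_abelian[OF cvs_fibre])
  have tcl: "?t e (mcl 0 q (eta e)):car ?T" if "e:I p" for e
   using that eta basisD(2) by (auto intro!: tens_closed[OF tensorable_fibre] simp: mcl0D(1))
  have t_eq: "t = (finsum ?T (%e. ?t e (mcl 0 q (eta e))) (I p))"
  proof -
   have "t = (finsum ?T (%e. ?t e (tensor_coord (co p) (fibre D q) e t)) (I p))" by (rule te[OF t(1)])
   also have "... = (finsum ?T (%e. ?t e (mcl 0 q (eta e))) (I p))" by (rule TG.finsum_cong') (use eta tcl in auto)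
   finally show ?thesis .
  qed
  have "g_map D p q t = (finsum (fibre_quot D p q) (%e. g_map D p q (?t e (mcl 0 q (eta e)))) (I p))"
   by (subst t_eq, rule lin_finsum[OF T cvs_fibre lin tcl])
  also have "... = (finsum (fibre_quot D p q) (%e. mcl p q (inc e *. eta e)) (I p))"
   by (rule WG.finsum_cong') (use eta basisD(2) in "auto simp: g_map_tens mclD(1) Fl_gen")
  also have "... = mcl p q (finsum KA (%e. inc e *. eta e) (I p))"
   by (rule class_sum[OF Fl_subspace cvs_fibre mcl_linear, symmetric]) (use eta basisD(2) Fl_gen in auto)
  finally have "(finsum KA (%e. inc e *. eta e) (I p)):Fl (Suc p) (p + q)" using mcl_zero_iff[OF sum_forms, of p eta q] eta(1) t(2) by simp
  hence "eta e:Fl 1 q" if "e:I p" for e using basis_independent[of p eta q e] eta(1) that by blast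
  hence "mcl 0 q (eta e) = 0[fibre D q]" if "e:I p" for e
   using that eta(1) mcl_zero_iff[of "eta e" 0 q] by (simp add: Fl_0)
  hence "?t e (mcl 0 q (eta e)) = 0[?T]" if "e:I p" for e
   using that lin_zero[OF cvs_fibre T balancedD(7)[OF tens_balanced[OF tensorable_fibre]]] basisD(2) by simp
  thus "t = 0[?T]" unfolding t_eq by (intro TG.add.finprod_one_eqI) auto
 qed
 have "g_map D p q ` car ?T = cspan (fibre_quot D p q) {g_map D p q (?t xi u) | xi u. xi:car (fb KB p) & u:car (fibre D q)}"
  by (rule tensor_linear_image[OF tensorable_fibre cvs_fibre lin])
 also have "{g_map D p q (?t xi u) | xi u. xi:car (fb KB p) & u:car (fibre D q)}
   = mcl p q ` {inc xi *. eta | xi eta. xi:forms KB p & eta:forms KA (p + q - p)}" (is "?X = ?Y")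
 proof
  show "?X <= ?Y" by (auto elim!: fibre_cases simp: g_map_tens intro!: imageI) blast
  show "?Y <= ?X" by (auto simp: g_map_tens[symmetric]) (metis mcl0D(1))
 qed
 also have "cspan (fibre_quot D p q) ... = mcl p q ` Fl p (p + q)"
 proof -
  let ?S = "{inc xi *. eta | xi eta. xi:forms KB p & eta:forms KA (p + q - p)}"
  have S: "?S <= Fl p (p + q)" using Fl_gen by auto
  have "mcl p q ` cspan (KA(|carrier := Fl p (p + q)|)) ?S = cspan (fibre_quot D p q) (mcl p q ` ?S)"
   by (rule linear_image_cspan[OF Fl_cvs cvs_fibre mcl_linear]) (use S in simp)
  moreover have "Fl p (p + q) = cspan KA ?S" by (simp add: ideal_filt_def)
  ultimately show ?thesis unfolding cspan_of_subspace[OF A.V Fl_subspace S] by simp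
 qed
 finally show "g_map D p q ` car ?T = car (fibre_quot D p q)" by (simp add: carrier_fibre)
qed

lemma differential_fibre_bundle_D: "differential_fibre_bundle (ty :: ('m \<times> 'n) itself) D"
 unfolding differential_fibre_bundle_def extendable_def D_simps
 using bimodule_connection_D s0_extends zero_curvature_D g_map_iso
  right_basis_flat[OF B.VA B.cvs_forms B_closed basis] by blast

section \<open>Cohomology of the fibres\<close>

abbreviation "Hq p q == cohomology (fibre_quot D p) (fibre_quot_diff D p) q"
definition "kcl p q eta = coh_class (fibre_quot D p) (fibre_quot_diff D p) q (mcl p q eta)"
text \<open>\<open>ZM\<close> and \<open>BM\<close> are the forms that represent cocycles and
  coboundaries of \<open>M\<^sub>p\<close>, everything of filtration \<open>p + 1\<close> counting
  as zero. They are singled out because the same two sets describe page 1 (\<open>Z1_eq\<close>,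
  \<open>J_Bd1\<close>).\<close>

definition "ZM p q = {eta:Fl p (p + q). dA eta:Fl (Suc p) (Suc (p + q))}"
definition "BM p q = (case q of 0 => Fl (Suc p) p
 | Suc m => {dA zeta +. f | zeta f. zeta:Fl p (p + m) & f:Fl (Suc p) (p + q)})"

lemma ZM_subspace: "csubspace (ZM p q) KA"
 by (rule csubspaceI[OF A.V]) (auto simp: ZM_def FlD A.diffD A.diff_zero)

lemmas ZMD = subD[OF A.V ZM_subspace]

lemma ZM_cvs: "cvs (KA(|carrier := ZM p q|))" by (rule sub_cvs[OF A.V ZM_subspace])

lemma ZM_Fl: "eta:ZM p q ==> eta:Fl p (p + q)" by (simp add: ZM_def)

lemma ZM0_iff: "eta:ZM 0 q <-> eta:forms KA q & dA eta:Fl 1 (Suc q)"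
 by (simp add: ZM_def Fl_0)

lemma ZM0_forms: "eta:ZM 0 q ==> eta:forms KA q" by (simp add: ZM0_iff)

abbreviation "cy p q == cocycles (fibre_quot D p) (fibre_quot_diff D p) q"
abbreviation "cb p q == coboundaries (fibre_quot D p) (fibre_quot_diff D p) q"

lemma mcl_cocycle: "eta:Fl p (p + q) ==> mcl p q eta:cy p q <-> eta:ZM p q"
 using mcl_zero_iff[of "dA eta" p "Suc q"] diff_mcl'[of eta p q] mclD(1)[of eta p q]
 by (simp add: cocycles_def diff_mcl ZM_def)

lemma cocycles_eq: "cy p q = mcl p q ` ZM p q"
proof -
 have "cy p q <= mcl p q ` Fl p (p + q)" using carrier_fibre by (auto simp: cocycles_def)
 thus ?thesis using mcl_cocycle ZM_Fl by (auto simp: subset_iff image_iff) metis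
qed

lemma coboundaries_eq:
 "cb p q = (case q of 0 => {0[fibre_quot D p 0]} | Suc m => (%zeta. mcl p q (dA zeta)) ` Fl p (p + m))"
 by (cases q) (auto simp: coboundaries_def carrier_fibre image_image diff_mcl image_iff)

lemma fdiff_linear: "fibre_quot_diff D p q:lin (fibre_quot D p q) (fibre_quot D p (Suc q))"
proof (rule linI)
 note c = diff_mcl mclD(2,3)[symmetric] FlD(3,4) A.diffD FlD(5) diff_mcl' mclD(1)
 show "fibre_quot_diff D p q x:car (fibre_quot D p (Suc q))" if "x:car (fibre_quot D p q)" for x
  using that diff_mcl' by (auto simp: carrier_fibre diff_mcl simp del: add_Suc_right)
 show "fibre_quot_diff D p q (x +[fibre_quot D p q] y) = fibre_quot_diff D p q x +[fibre_quot D p (Suc q)] fibre_quot_diff D p q y"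
  if "x:car (fibre_quot D p q)" "y:car (fibre_quot D p q)" for x y
  using that by (auto simp: carrier_fibre c simp del: add_Suc_right)
 show "fibre_quot_diff D p q (k *[fibre_quot D p q] x) = k *[fibre_quot D p (Suc q)] fibre_quot_diff D p q x"
  if "x:car (fibre_quot D p q)" for k x
  using that by (auto simp: carrier_fibre c simp del: add_Suc_right)
qed

lemma cy_subspace: "csubspace (cy p q) (fibre_quot D p q)"
 unfolding cocycles_def by (rule linear_kernel_subspace[OF cvs_fibre cvs_fibre fdiff_linear])

lemma cy_cvs: "cvs ((fibre_quot D p q)(|carrier := cy p q|))"
 by (rule sub_cvs[OF cvs_fibre cy_subspace])

lemma dA_dA_ZM: "zeta:Fl p (p + m) ==> dA zeta:ZM p (Suc m)"
 using diff_mcl'[of zeta p m] FlD(2) by (simp add: ZM_def A.diff_diff FlD(5))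

lemma cb_sub: "cb p q <= cy p q"
proof (cases q)
 case 0
 thus ?thesis using subD(2)[OF cvs_fibre cy_subspace] by (simp add: coboundaries_eq)
next
 case (Suc m)
 thus ?thesis using dA_dA_ZM by (auto simp: coboundaries_eq cocycles_eq)
qed

lemma cb_subspace: "csubspace (cb p q) ((fibre_quot D p q)(|carrier := cy p q|))"
proof -
 have "csubspace (cb p q) (fibre_quot D p q)"
 proof (cases q)
  case 0
  thus ?thesis using csubspace_zero[OF cvs_fibre] by (simp add: coboundaries_def)
 next
  case (Suc m)
  thus ?thesis using linear_image_subspace[OF cvs_fibre cvs_fibre fdiff_linear csubspace_carrier[OF cvs_fibre]]
   by (simp add: coboundaries_def)
 qed
 thus ?thesis using csubspace_of_subspace[OF cvs_fibre cy_subspace cb_sub] by blast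
qed

lemma cvs_H: "cvs (Hq p q)"
 unfolding cohomology_def by (rule cvs_quot[OF cy_cvs cb_subspace])

lemma carrier_H: "car (Hq p q) = kcl p q ` ZM p q"
 by (simp add: cohomology_def cocycles_eq image_image kcl_def coh_class_def)

lemma kcl_linear: "kcl p q:lin (KA(|carrier := ZM p q|)) (Hq p q)"
proof -
 have "mcl p q:lin (KA(|carrier := ZM p q|)) ((fibre_quot D p q)(|carrier := cy p q|))"
  using mclD ZM_Fl by (auto intro!: linI simp: cocycles_eq)
 from lin_comp[OF this quot_class_linear[OF cy_cvs cb_subspace]]
 show ?thesis by (simp add: cohomology_def kcl_def[abs_def] coh_class_def)
qed

lemmas kclD = linD[OF kcl_linear, simplified]

lemma kcl_zero_iff:
 assumes eta: "eta:ZM p q"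
 shows "kcl p q eta = 0[Hq p q] <-> eta:BM p q"
proof -
 have "kcl p q eta = 0[Hq p q] <-> mcl p q eta:cb p q"
  using coset_eq_zero_iff[OF cy_cvs cb_subspace, of "mcl p q eta" p q] eta
  by (simp add: kcl_def coh_class_def cohomology_def cocycles_eq)
 also have "... <-> eta:BM p q"
 proof (cases q)
  case 0
  thus ?thesis using mcl_zero_iff[OF ZM_Fl[OF eta]] by (simp add: coboundaries_eq BM_def)
 next
  case (Suc m)
  have "mcl p q eta = mcl p q (dA zeta) <-> (EX f:Fl (Suc p) (p + q). eta = dA zeta +. f)" if zeta: "zeta:Fl p (p + m)" for zeta
  proof -
   have d: "dA zeta:Fl p (p + q)" using diff_mcl'[OF zeta] Suc by simp
   have cm: "f +. dA zeta = dA zeta +. f" if "f:Fl (Suc p) (p + q)" for f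
    using cvs_add_comm[OF A.V FlD(5)[OF that] FlD(5)[OF d]] .
   show ?thesis using mcl_eqD[OF _ ZM_Fl[OF eta] d] mcl_add_Fl[OF _ d] cm by metis
  qed
  thus ?thesis unfolding coboundaries_eq BM_def Suc by (auto simp: image_iff simp del: add_Suc_right)
 qed
 finally show ?thesis .
qed

lemma HN_simps [simp]:
 "car (HN D q) = car (Hq 0 q)" "zero (HN D q) = zero (Hq 0 q)" "add (HN D q) = add (Hq 0 q)"
 "smult (HN D q) = smult (Hq 0 q)"
 by (simp_all add: HN_def lcohomology_def cohomology_def)

lemma HN_class_mcl: "HN_class D q (mcl 0 q eta) = kcl 0 q eta"
 by (simp add: HN_class_def kcl_def)

lemma cvs_HN: "cvs (HN D q)"
 by (rule cvs_cong[OF cvs_H]) simp_all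

text \<open>The extra Leibniz term \<open>db \<and> \<eta>\<close> has filtration 1, so in the fibre
  the differential is linear over \<open>B\<close>.\<close>

lemma ZM_lact: "b:car B ==> eta:ZM 0 q ==> emb KA b *. eta:ZM 0 q"
proof -
 assume b: "b:car B" and eta: "eta:ZM 0 q"
 have "inc (diff KB (emb KB b)) *. eta:Fl 1 (Suc q)"
  using Fl_gen[OF B.diff_forms[OF B.emb_forms[OF b]] ZM0_forms[OF eta]] by simp
 moreover have "inc (diff KB (emb KB b)) = dA (emb KA b)" using b by (simp add: inc_diff B.embD inc_emb)
 ultimately show ?thesis
  using b eta FlD(3) Fl_lact A.forms_lmult BA by (simp add: ZM0_iff A.diff_mult_emb A.FD(5)[OF ZM0_forms[OF eta]])
qed

text \<open>The action on cohomology may be read off from representatives: it preserves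
  coboundaries, again because the Leibniz term \<open>db \<and> \<zeta>\<close> has filtration
  1.\<close>

lemma lact_HN: "b:car B ==> eta:ZM 0 q ==> lact (HN D q) b (kcl 0 q eta) = kcl 0 q (emb KA b *. eta)"
proof -
 assume b: "b:car B" and eta: "eta:ZM 0 q"
 let ?M = "(fibre D q)(|carrier := cy 0 q|)"
 note fb = left_moduleD[OF left_module_fibre]
 have lz: "lact (fibre D q) b u:cy 0 q" if "u:cy 0 q" for u
  using that b by (auto simp: cocycles_eq lact_mcl0 ZM0_forms ZM_lact)
 have 1: "lact ?M b:lin ?M ?M"
  using linear_corestrict[OF linear_restrict[OF fb(2)[OF b] subD(1)[OF cvs_fibre cy_subspace]]] lz by auto
 have 2: "lact ?M b ` cb 0 q <= cb 0 q"
 proof (cases q)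
  case 0
  thus ?thesis using lin_zero[OF cvs_fibre cvs_fibre fb(2)[OF b]] by (simp add: coboundaries_eq)
 next
  case (Suc m)
  show ?thesis
  proof
   fix u assume "u:lact ?M b ` cb 0 q"
   then obtain zeta where zeta: "zeta:forms KA m" "u = lact (fibre D q) b (mcl 0 q (dA zeta))"
    by (auto simp: coboundaries_eq Suc Fl_0)
   have d: "dA zeta:forms KA q" using A.diff_forms[OF zeta(1)] Suc by simp
   have u: "u = mcl 0 q (emb KA b *. dA zeta)" using zeta b d by (simp add: lact_mcl0)
   have "inc (diff KB (emb KB b)) *. zeta:Fl 1 q"
    using Fl_gen[OF B.diff_forms[OF B.emb_forms[OF b]] zeta(1)] Suc by simp
   hence f: "dA (emb KA b) *. zeta:Fl (Suc 0) (0 + q)" using b by (simp add: inc_diff B.embD inc_emb)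
   have bzeta: "emb KA b *. zeta:forms KA m" "emb KA b *. dA zeta:forms KA q" using A.forms_lmult BA b zeta(1) d by auto
   have "mcl 0 q (dA (emb KA b *. zeta)) = u"
    using mcl_add_Fl[OF f, of "emb KA b *. dA zeta"] bzeta b zeta BA unfolding u by (simp add: A.diff_mult_emb A.FD(5) Fl_0)
   thus "u:cb 0 q" using bzeta(1) by (auto simp: coboundaries_eq Suc Fl_0)
  qed
 qed
 have m: "mcl 0 q eta:car ?M" using eta by (simp add: cocycles_eq)
 have "lact (HN D q) b (kcl 0 q eta) = cb 0 q +>\<^bsub>?M\<^esub> lact ?M b (mcl 0 q eta)"
  using lact_lquot[OF cy_cvs cb_subspace 1 2 m] by (simp add: HN_def lcohomology_def kcl_def coh_class_def)
 thus ?thesis using b eta by (simp add: kcl_def coh_class_def lact_mcl0 ZM0_forms)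
qed

lemma kcl_linear_HN: "kcl 0 q:lin (KA(|carrier := ZM 0 q|)) (HN D q)"
 using kcl_linear[of 0 q] by (simp add: linear_maps_def)

lemma left_module_HN: "left_module B (HN D q)"
 by (rule left_module_by_classes[OF cvs_HN ZM_cvs kcl_linear_HN])
  (auto simp: carrier_H lact_HN ZM_lact ZMD(5))

lemma tensorable_HN: "tensorable B (fb KB p) (HN D q)"
 by (rule B.tensorable_left[OF left_module_HN])

lemma HN_cases: assumes "h:car (HN D q)" obtains eta where "eta:ZM 0 q" "h = kcl 0 q eta"
 using assms by (auto simp: carrier_H)


section \<open>The first page and the connection on the fibre cohomology\<close>

lemma leibniz_closed:
 assumes "xi:forms KB p" "eta:car KA"
 shows "dA (inc xi *. eta) = inc (diff KB xi) *. eta +. (-1) ^ p .* (inc xi *. dA eta)"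
 using assms by (simp add: A.leibniz[OF inc_forms] inc_diff B.FD(5))

lemma ZM_mult:
 assumes xi: "xi:forms KB p" and eta: "eta:ZM 0 q"
 shows "inc xi *. eta:ZM p q"
proof -
 note f = ZM0_forms[OF eta]
 have "inc (diff KB xi) *. eta:Fl (Suc p) (Suc (p + q))" using Fl_gen[OF B.diff_forms[OF xi] f] by simp
 moreover have "inc xi *. dA eta:Fl (Suc p) (p + Suc q)" using eta by (intro Fl_lmult1[OF xi]) (simp add: ZM0_iff)
 ultimately show ?thesis
  using Fl_gen[OF xi f] FlD(3,4) by (simp add: ZM_def leibniz_closed[OF xi A.FD(5)[OF f]])
qed

text \<open>The basis forms are closed, so only the coefficients are differentiated, each with the
  sign for passing a \<open>p\<close>-form.\<close>

lemma diff_sum: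
 assumes eta: "!!e. e:I p ==> eta e:forms KA q"
 shows "dA (finsum KA (%e. inc e *. eta e) (I p)) = (finsum KA (%e. inc e *. ((-1) ^ p .* dA (eta e))) (I p))"
proof -
 interpret AA: abelian_group KA by (rule cvs_abelian[OF A.V])
 have fc: "eta e:car KA" "inc e:car KA" if "e:I p" for e using eta that A.FD(5) inc_closed basisD(2) by blast+
 have "dA (finsum KA (%e. inc e *. eta e) (I p)) = (finsum KA (%e. dA (inc e *. eta e)) (I p))"
  by (rule lin_finsum[OF A.V A.V A.diff_linear]) (simp add: fc A.alg_simps)
 also have "... = (finsum KA (%e. inc e *. ((-1) ^ p .* dA (eta e))) (I p))"
 proof (rule AA.finsum_cong')
  fix e assume e: "e:I p"
  have z: "inc 0[KB] *. eta e = 0[KA]"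
   using lin_zero[OF A.V A.V calgebra_mult_linear(2)[OF A.alg fc(1)[OF e]]] lin_zero[OF B.V A.V inc_linear] by simp
  show "dA (inc e *. eta e) = inc e *. ((-1) ^ p .* dA (eta e))"
   using leibniz_closed[OF basisD(2)[OF e] fc(1)[OF e]] fc[OF e] basis_closed[OF e] z
   by (simp add: A.alg_simps A.diffD cvs_l_zero[OF A.V] smult_cl[OF A.V])
 qed (use fc in "auto simp: A.alg_simps A.diffD smult_cl[OF A.V]")
 finally show ?thesis .
qed

lemma sign_smult: "x:car KA ==> (-1) ^ p .* ((-1) ^ p .* x) = x"
 by (simp add: cvs_smult_smult[OF A.V] power_mult_distrib[symmetric] cvs_smult_one[OF A.V])

text \<open>Apply \<open>basis_independent\<close> to the differential of the expansion: the
  coefficients of a cocycle of \<open>M\<^sub>p\<close> are cocycles of the fibre.\<close>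

lemma ZM_expand:
 assumes z: "z:ZM p q"
 shows "EX eta. (ALL e:I p. eta e:ZM 0 q) & z = (finsum KA (%e. inc e *. eta e) (I p))"
proof -
 obtain eta where eta: "!!e. e:I p ==> eta e:forms KA q" "z = (finsum KA (%e. inc e *. eta e) (I p))"
  using Fl_expand[OF ZM_Fl[OF z]] by blast
 have "(finsum KA (%e. inc e *. ((-1) ^ p .* dA (eta e))) (I p)):Fl (Suc p) (p + Suc q)"
  using z diff_sum[OF eta(1)] eta(2) by (simp add: ZM_def)
 hence "(-1) ^ p .* dA (eta e):Fl 1 (Suc q)" if "e:I p" for e
  by (rule basis_independent[rotated, OF _ that]) (use eta(1) A.diff_forms A.FD(4) in auto)
 hence "(-1) ^ p .* ((-1) ^ p .* dA (eta e)):Fl 1 (Suc q)" if "e:I p" for e using that FlD(4) by auto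
 hence "eta e:ZM 0 q" if "e:I p" for e
  using that eta(1) by (simp add: ZM0_iff sign_smult A.diffD A.FD(5)[OF eta(1)])
 thus ?thesis using eta(2) by blast
qed

text \<open>From the expansion of a coboundary subtract that of its primitive, differentiated
  coefficientwise. The difference has filtration \<open>p + 1\<close>, so each of its coefficients
  has filtration 1. This is flatness in coordinates: taking coefficients commutes with
  cohomology.\<close>

lemma BM_sum:
 assumes eta: "!!e. e:I p ==> eta e:ZM 0 q" and b: "(finsum KA (%e. inc e *. eta e) (I p)):BM p q" and e: "e:I p"
 shows "eta e:BM 0 q"
proof (cases q)
 case 0
 thus ?thesis using basis_independent[of p eta 0 e] eta ZM0_forms b e by (simp add: BM_def)
next
 case (Suc m)
 obtain zeta f where zeta: "zeta:Fl p (p + m)" "f:Fl (Suc p) (p + q)" "(finsum KA (%e. inc e *. eta e) (I p)) = dA zeta +. f"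
  using b Suc by (auto simp: BM_def)
 obtain \<kappa> where \<kappa>: "!!e. e:I p ==> \<kappa> e:forms KA m" "zeta = (finsum KA (%e. inc e *. \<kappa> e) (I p))"
  using Fl_expand[OF zeta(1)] by blast
 interpret AA: abelian_group KA by (rule cvs_abelian[OF A.V])
 \<comment> \<open>By \<open>diff_sum\<close> these are the coefficients of the differential of the
   primitive.\<close>
 define k where "k e = (-1) ^ p .* dA (\<kappa> e)" for e
 have k: "k e:forms KA q" if "e:I p" for e using \<kappa>(1)[OF that] A.diff_forms A.FD(4) Suc by (auto simp: k_def)
 have eta': "eta e:forms KA q" if "e:I p" for e using eta that ZM0_forms by auto
 have c: "eta e:car KA" "k e:car KA" "(-1) .* k e:car KA" "inc e:car KA" if "e:I p" for e
  using k eta' that A.FD(5) inc_closed basisD(2) smult_cl[OF A.V] by blast+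
 have dzeta: "dA zeta = (finsum KA (%e. inc e *. k e) (I p))" unfolding k_def \<kappa>(2) by (rule diff_sum[OF \<kappa>(1)])
 have "(finsum KA (%e. inc e *. (eta e +. (-1) .* k e)) (I p)) = (finsum KA (%e. inc e *. eta e +. (-1) .* (inc e *. k e)) (I p))"
  by (rule AA.finsum_cong') (auto simp: c A.alg_simps smult_cl[OF A.V])
 also have "... = (finsum KA (%e. inc e *. eta e) (I p)) +. (finsum KA (%e. (-1) .* (inc e *. k e)) (I p))"
  by (rule AA.finsum_addf) (auto simp: c A.alg_simps smult_cl[OF A.V])
 also have "(finsum KA (%e. (-1) .* (inc e *. k e)) (I p)) = (-1) .* dA zeta"
  unfolding dzeta by (rule lin_finsum[OF A.V A.V linear_scale[OF A.V linear_id], symmetric]) (auto simp: c A.alg_simps)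
 also have "(finsum KA (%e. inc e *. eta e) (I p)) +. (-1) .* dA zeta = f"
  unfolding zeta(3) by (rule cvs_add_diff[OF A.V A.diffD(1)[OF FlD(5)[OF zeta(1)]] FlD(5)[OF zeta(2)]])
 finally have "(finsum KA (%e. inc e *. (eta e +. (-1) .* k e)) (I p)):Fl (Suc p) (p + q)" using zeta(2) by simp
 hence f: "eta e +. (-1) .* k e:Fl 1 q"
  by (rule basis_independent[rotated, OF _ e]) (use eta' k A.FD(3,4) in auto)
 have "eta e = k e +. (eta e +. (-1) .* k e)" using c[OF e] by (simp add: cvs_diff_add[OF A.V])
 moreover have "k e = dA ((-1) ^ p .* \<kappa> e)" using A.FD(5)[OF \<kappa>(1)[OF e]] by (simp add: k_def A.diffD)
 moreover have "(-1) ^ p .* \<kappa> e:Fl 0 m" using \<kappa>(1)[OF e] A.FD(4) by (simp add: Fl_0)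
 ultimately show ?thesis using f unfolding BM_def Suc by (auto simp: Suc intro!: exI)
qed

text \<open>Both the first page and the cohomology of \<open>M\<^sub>p\<close> are quotients of \<open>ZM p q\<close> by \<open>BM p q\<close>; the following
 argument identifies any such quotient \<open>W\<close> with \<open>K\<^sup>p \<otimes>\<^sub>B H\<^sup>q(N)\<close>.\<close>

context
 fixes W :: "(complex, 'k, 'zz) module_scheme" and \<rho> and p q :: nat and h
 assumes W: "cvs W" and \<rho>: "\<rho> : lin (KA(|carrier := ZM p q|)) W" "car W = \<rho> ` ZM p q"
  and ker: "!!eta. eta:ZM p q ==> \<rho> eta = 0[W] <-> eta:BM p q"
  and h: "!!xi eta. xi:forms KB p ==> eta:ZM 0 q ==> h xi (kcl 0 q eta) = \<rho> (inc xi *. eta)"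
begin

private lemma \<rho>D: "x:ZM p q ==> \<rho> x:car W" "x:ZM p q ==> y:ZM p q ==> \<rho> (x +. y) = \<rho> x +[W] \<rho> y"
 "x:ZM p q ==> \<rho> (c .* x) = c *[W] \<rho> x"
 using linD[OF \<rho>(1)] by auto

private lemma bal: "balanced B (fb KB p) (HN D q) W h"
proof -
 note c = h kclD(2,3)[symmetric] \<rho>D(2,3)[symmetric] ZM_mult \<rho>D(1) ZMD(3,4) A.alg_simps inc_closed ZMD(5) incD B.FD(5) B.FD(3,4)
  lact_HN ZM_lact B.forms_rmult BA inc_mult inc_emb A.embD B.embD
 show ?thesis
 proof (rule balancedI)
  fix xi u assume *: "xi:car (fb KB p)" "u:car (HN D q)"
  then obtain eta where eta: "eta:ZM 0 q" "u = kcl 0 q eta" using HN_cases by blast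
  show "h xi u:car W" using eta * by (simp add: c)
  show "h xi (k *[HN D q] u) = k *[W] h xi u" for k using eta * by (simp add: c)
  show "h (k *[fb KB p] xi) u = k *[W] h xi u" for k using eta * by (simp add: c)
  show "h xi (u +[HN D q] u') = h xi u +[W] h xi u'" if "u':car (HN D q)" for u'
  proof -
   obtain eta' where eta': "eta':ZM 0 q" "u' = kcl 0 q eta'" using \<open>u':car (HN D q)\<close> HN_cases by blast
   show ?thesis using eta * eta' by (simp add: c)
  qed
  show "h (xi +[fb KB p] xi') u = h xi u +[W] h xi' u" if "xi':car (fb KB p)" for xi'
   using that eta * by (simp add: c)
  show "h (ract (fb KB p) xi b) u = h xi (lact (HN D q) b u)" if "b:car B" for b
   using that eta * by (simp add: c)
 qed
qed

lemma E1_linear: "tensor_lift W h:lin (lforms B KB (HN D q) p) W"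
 unfolding lforms_def by (rule tensor_lift_linear[OF tensorable_HN W bal])

lemma E1_tens: "xi:forms KB p ==> eta:ZM 0 q ==>
  tensor_lift W h (tens B (fb KB p) (HN D q) xi (kcl 0 q eta)) = \<rho> (inc xi *. eta)"
 by (subst tensor_lift_tens[OF tensorable_HN W bal]) (auto simp: kclD(1) h)

text \<open>\<open>BM_sum\<close> makes the kernel trivial, and \<open>ZM_expand\<close> makes the
  map onto.\<close>

lemma E1_bij: "bij_betw (tensor_lift W h) (car (lforms B KB (HN D q) p)) (car W)"
 unfolding bij_betw_def
proof
 let ?T = "lforms B KB (HN D q) p" and ?t = "tens B (fb KB p) (HN D q)"
 have T: "cvs ?T" unfolding lforms_def by (rule cvs_tensor[OF tensorable_HN])
 note te = tensor_expand[OF B.VA B.cvs_forms B_closed basis left_module_HN, folded lforms_def]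
  and tl = tensor_coord_linear[OF B.VA B.cvs_forms B_closed basis left_module_HN, folded lforms_def]
 interpret TG: abelian_group ?T by (rule cvs_abelian[OF T])
 interpret WG: abelian_group W by (rule cvs_abelian[OF W])
 have tcl: "?t e (kcl 0 q (eta e)):car ?T" if "e:I p" "eta e:ZM 0 q" for e eta
  unfolding lforms_def using that basisD(2) by (auto intro!: tens_closed[OF tensorable_HN] simp: kclD(1))
 \<comment> \<open>On a basis expansion with coefficients in the fibre cohomology the map is
   \<open>\<rho>\<close> of the corresponding sum of forms.\<close>
 have val: "tensor_lift W h (finsum ?T (%e. ?t e (kcl 0 q (eta e))) (I p)) = \<rho> (finsum KA (%e. inc e *. eta e) (I p))"
  if eta: "!!e. e:I p ==> eta e:ZM 0 q" for eta
 proof -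
  have "tensor_lift W h (finsum ?T (%e. ?t e (kcl 0 q (eta e))) (I p)) = (finsum W (%e. tensor_lift W h (?t e (kcl 0 q (eta e)))) (I p))"
   by (rule lin_finsum[OF T W E1_linear]) (use eta tcl in auto)
  also have "... = (finsum W (%e. \<rho> (inc e *. eta e)) (I p))"
   by (rule WG.finsum_cong') (use eta basisD(2) in \<open>auto simp: E1_tens intro!: \<rho>D(1) ZM_mult\<close>)
  also have "... = \<rho> (finsum KA (%e. inc e *. eta e) (I p))"
   by (rule class_sum[OF ZM_subspace W \<rho>(1), symmetric]) (use eta basisD(2) ZM_mult in auto)
  finally show ?thesis .
 qed
 show "inj_on (tensor_lift W h) (car ?T)"
 proof (rule linear_injI[OF T W E1_linear])
  fix t assume t: "t:car ?T" "tensor_lift W h t = 0[W]"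
  have "EX eta. eta:ZM 0 q & tensor_coord (co p) (HN D q) e t = kcl 0 q eta" if "e:I p" for e
   using lin_cl[OF tl[OF that] t(1)] by (metis HN_cases)
  then obtain eta where eta: "!!e. e:I p ==> eta e:ZM 0 q" "!!e. e:I p ==> tensor_coord (co p) (HN D q) e t = kcl 0 q (eta e)"
   by metis
  have t_eq: "t = (finsum ?T (%e. ?t e (kcl 0 q (eta e))) (I p))"
  proof -
   have "t = (finsum ?T (%e. ?t e (tensor_coord (co p) (HN D q) e t)) (I p))" by (rule te[OF t(1)])
   also have "... = (finsum ?T (%e. ?t e (kcl 0 q (eta e))) (I p))" by (rule TG.finsum_cong') (use eta tcl in auto)
   finally show ?thesis .
  qed
  have s: "(finsum KA (%e. inc e *. eta e) (I p)):ZM p q"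
   by (rule csubspace_sum_closed[OF A.V ZM_subspace]) (use eta basisD(2) ZM_mult in auto)
  have "\<rho> (finsum KA (%e. inc e *. eta e) (I p)) = 0[W]" using t(2) t_eq val[OF eta(1)] by simp
  hence "eta e:BM 0 q" if "e:I p" for e using BM_sum[OF eta(1) _ that] ker[OF s] by simp
  hence "kcl 0 q (eta e) = 0[HN D q]" if "e:I p" for e using that kcl_zero_iff[OF eta(1)] by simp
  hence "?t e (kcl 0 q (eta e)) = 0[?T]" if "e:I p" for e
   using that lin_zero[OF cvs_HN T balancedD(7)[OF tens_balanced[OF tensorable_HN], folded lforms_def]] basisD(2) by simp
  thus "t = 0[?T]" unfolding t_eq by (intro TG.add.finprod_one_eqI) auto
 qed
 show "tensor_lift W h ` car ?T = car W"
 proof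
  show "car W <= tensor_lift W h ` car ?T"
  proof
   fix w assume "w:car W"
   then obtain z where z: "z:ZM p q" "w = \<rho> z" by (auto simp: \<rho>(2))
   then obtain eta where eta: "!!e. e:I p ==> eta e:ZM 0 q" "z = (finsum KA (%e. inc e *. eta e) (I p))" using ZM_expand by blast
   have "w = tensor_lift W h (finsum ?T (%e. ?t e (kcl 0 q (eta e))) (I p))" using val[OF eta(1)] z eta(2) by simp
   moreover have "(finsum ?T (%e. ?t e (kcl 0 q (eta e))) (I p)):car ?T"
    by (rule cvs_finsum_closed[OF T]) (use eta tcl in auto)
   ultimately show "w:tensor_lift W h ` car ?T" by blast
  qed
 qed (use lin_cl[OF E1_linear] in blast)
qed

end

lemma kcl_add_BM: "f:BM p q ==> f:ZM p q ==> eta:ZM p q ==> kcl p q (f +. eta) = kcl p q eta"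
 using kclD(2)[of f p q eta] kcl_zero_iff[of f p q] kclD(1)[of eta p q] by (simp add: cvs_l_zero[OF cvs_H])

lemma BM_ZM: "BM p q <= ZM p q"
proof
 fix x assume x: "x:BM p q"
 have F: "f:ZM p q" if "f:Fl (Suc p) (p + q)" for f
  using that Fl_Suc Fl_diff by (auto simp: ZM_def)
 show "x:ZM p q"
 proof (cases q)
  case 0
  thus ?thesis using x F by (simp add: BM_def)
 next
  case (Suc m)
  thus ?thesis using x F ZMD(3) dA_dA_ZM by (auto simp: BM_def)
 qed
qed


lemma on_coset_kcl:
 assumes eta: "eta:ZM 0 q" and f: "!!eta'. eta':ZM 0 q ==> kcl 0 q eta' = kcl 0 q eta ==> G (mcl 0 q eta') = v"
 shows "on_coset G (kcl 0 q eta) = v"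
proof (rule on_coset_eqI)
 let ?M = "(fibre D q)(|carrier := cy 0 q|)"
 have m: "mcl 0 q eta:car ?M" using eta by (simp add: cocycles_eq)
 have k: "kcl 0 q eta = cb 0 q +>\<^bsub>?M\<^esub> mcl 0 q eta" for eta by (simp add: kcl_def coh_class_def)
 show "mcl 0 q eta:kcl 0 q eta" unfolding k by (rule mem_own_coset[OF cy_cvs cb_subspace m])
 fix u assume "u:kcl 0 q eta"
 then obtain s where s: "s:cb 0 q" "u = s +[?M] mcl 0 q eta" unfolding k mem_coset_iff by auto
 have "cb 0 q +>\<^bsub>?M\<^esub> u = cb 0 q +>\<^bsub>?M\<^esub> mcl 0 q eta" by (rule coset_eqI[OF cy_cvs cb_subspace s(1) m s(2)])
 moreover have "u:car ?M"
  using s m subD(5)[OF cy_cvs cb_subspace] add_cl[OF cy_cvs, of s 0 q] by auto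
 then obtain eta' where "eta':ZM 0 q" "u = mcl 0 q eta'" by (auto simp: cocycles_eq)
 ultimately show "G u = v" using f[of eta'] by (simp add: k)
qed

lemma kcl_eqD:
 assumes "kcl p q eta = kcl p q eta'" "eta:ZM p q" "eta':ZM p q"
 shows "EX f:BM p q. eta = f +. eta'"
proof -
 note cl = ZMD(5)[OF assms(2)] ZMD(5)[OF assms(3)]
 have "eta +. (-1) .* eta':ZM p q" using ZMD(3,4) assms by auto
 moreover have "kcl p q (eta +. (-1) .* eta') = 0[Hq p q]"
  using assms ZMD(4) by (simp add: kclD(2,3) cvs_diff_self[OF cvs_H] kclD(1))
 ultimately have "eta +. (-1) .* eta':BM p q" using kcl_zero_iff by blast
 moreover have "eta = (eta +. (-1) .* eta') +. eta'"
  using cvs_diff_add[OF A.V, of eta' eta] cl cvs_add_comm[OF A.V, of "eta +. (-1) .* eta'" eta']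
  by (simp add: add_cl[OF A.V] smult_cl[OF A.V])
 ultimately show ?thesis by blast
qed

text \<open>With \<open>s = (-1)^p\<close> one has \<open>\<xi> \<and> d\<zeta> = d(s \<xi> \<and>
  \<zeta>) - s d\<xi> \<and> \<zeta>\<close>, and the last term has filtration
  \<open>p + 1\<close>.\<close>

lemma BM_mult:
 assumes xi: "xi:forms KB p" and f: "f:BM 0 q"
 shows "inc xi *. f:BM p q"
proof (cases q)
 case 0
 thus ?thesis using f Fl_lmult1[OF xi, of f 0] by (simp add: BM_def)
next
 case (Suc m)
 then obtain zeta g where *: "zeta:forms KA m" "g:Fl 1 q" "f = dA zeta +. g" using f by (auto simp: BM_def Fl_0)
 note c = A.FD(5)[OF *(1)] A.diffD(1)[OF A.FD(5)[OF *(1)]] inc_closed[OF xi] FlD(5)[OF *(2)] inc_closed[OF B.diff_forms[OF xi]]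
 have d: "dA (inc xi *. zeta) = inc (diff KB xi) *. zeta +. (-1) ^ p .* (inc xi *. dA zeta)"
  by (rule leibniz_closed[OF xi c(1)])
 have cl: "inc xi *. dA zeta:car KA" "inc (diff KB xi) *. zeta:car KA" "inc xi *. g:car KA" "inc xi *. zeta:car KA"
  using c by (simp_all add: A.alg_simps)
 define s :: complex where "s = (-1) ^ p"
 have ss: "s * s = 1" by (simp add: s_def power_mult_distrib[symmetric])
 interpret AA: abelian_group KA by (rule cvs_abelian[OF A.V])
 have "inc xi *. f = dA (s .* (inc xi *. zeta)) +. ((- s) .* (inc (diff KB xi) *. zeta) +. inc xi *. g)"
 proof (rule cvs_eqI[OF A.V])
  fix phi assume phi: "phi:lin KA complex_vs"
  have ss': "s * (s * z) = z" for z using ss by (simp add: mult.assoc[symmetric])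
  show "phi (inc xi *. f) = phi (dA (s .* (inc xi *. zeta)) +. ((- s) .* (inc (diff KB xi) *. zeta) +. inc xi *. g))"
   using c cl unfolding *(3)
   by (simp add: A.diffD d func_simps[OF phi] A.alg_simps(6) add_cl[OF A.V] smult_cl[OF A.V]
     s_def[symmetric] algebra_simps ss')
 qed (use c cl *(3) in "auto simp: A.alg_simps A.diffD add_cl[OF A.V] smult_cl[OF A.V]")
 moreover have "(- s) .* (inc (diff KB xi) *. zeta) +. inc xi *. g:Fl (Suc p) (p + q)"
  using Fl_gen[OF B.diff_forms[OF xi] *(1)] Fl_lmult1[OF xi *(2)] Suc FlD(3,4) by simp
 moreover have "s .* (inc xi *. zeta):Fl p (p + m)" using Fl_gen[OF xi *(1)] FlD(4) by simp
 ultimately show ?thesis by (auto simp: BM_def Suc)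
qed

lemma class_mult_cong:
 assumes \<rho>: "\<rho> : lin (KA(|carrier := ZM p q|)) W" "cvs W" "!!eta. eta:ZM p q ==> \<rho> eta = 0[W] <-> eta:BM p q"
  and xi: "xi:forms KB p" and eta: "eta:ZM 0 q" "eta':ZM 0 q" "kcl 0 q eta = kcl 0 q eta'"
 shows "\<rho> (inc xi *. eta) = \<rho> (inc xi *. eta')"
proof -
 obtain f where f: "f:BM 0 q" "eta = f +. eta'" using kcl_eqD[OF eta(3,1,2)] by blast
 hence "f:ZM 0 q" using BM_ZM by auto
 hence "inc xi *. eta = inc xi *. f +. inc xi *. eta'"
  unfolding f(2) using eta(2) xi by (simp add: A.alg_simps inc_closed ZMD(5))
 moreover have "\<rho> (inc xi *. f) = 0[W]" "inc xi *. f:ZM p q" using \<rho>(3) BM_mult[OF xi f(1)] BM_ZM by auto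
 ultimately show ?thesis
  using linD[OF \<rho>(1), simplified] ZM_mult[OF xi eta(2)] by (simp add: cvs_l_zero[OF \<rho>(2)])
qed

definition "gch q xi = on_coset (%u. coh_class (fibre_quot D 1) (fibre_quot_diff D 1) q
    (g_map D 1 q (tens B (fb KB 1) (fibre D q) xi u)))"

lemma gch_kcl:
 assumes xi: "xi:forms KB 1" and eta: "eta:ZM 0 q"
 shows "gch q xi (kcl 0 q eta) = kcl 1 q (inc xi *. eta)"
 unfolding gch_def
proof (rule on_coset_kcl[OF eta])
 fix eta' assume eta': "eta':ZM 0 q" "kcl 0 q eta' = kcl 0 q eta"
 have "kcl 1 q (inc xi *. eta') = kcl 1 q (inc xi *. eta)"
  by (rule class_mult_cong[OF kcl_linear cvs_H kcl_zero_iff xi eta'(1) eta eta'(2)])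
 thus "coh_class (fibre_quot D 1) (fibre_quot_diff D 1) q
    (g_map D 1 q (tens B (fb KB 1) (fibre D q) xi (mcl 0 q eta'))) = kcl 1 q (inc xi *. eta)"
  using g_map_tens[OF xi ZM0_forms[OF eta'(1)]] by (simp add: kcl_def)
qed

lemma g_coh_eq: "g_coh D q = tensor_lift (Hq 1 q) (gch q)"
 by (simp add: g_coh_def gch_def[abs_def])

abbreviation "LF q p == lforms B KB (HN D q) p"
abbreviation "ten q p == tens B (fb KB p) (HN D q)"

lemma cvs_LF: "cvs (LF q p)" unfolding lforms_def by (rule cvs_tensor[OF tensorable_HN])

lemmas ten_bal = balancedD[OF tens_balanced[OF tensorable_HN], folded lforms_def, simplified]

text \<open>The comparison above for \<open>p = 1\<close>, with the cohomology of
  \<open>M\<^sub>1\<close> in the role of \<open>W\<close>.\<close>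

lemma g_coh_linear: "g_coh D q:lin (LF q 1) (Hq 1 q)"
 and g_coh_bij: "bij_betw (g_coh D q) (car (LF q 1)) (car (Hq 1 q))"
 unfolding g_coh_eq
 by (rule E1_linear[OF cvs_H kcl_linear carrier_H kcl_zero_iff gch_kcl] E1_bij[OF cvs_H kcl_linear carrier_H kcl_zero_iff gch_kcl]; assumption)+

lemma g_coh_tens: "xi:forms KB 1 ==> eta:ZM 0 q ==> g_coh D q (ten q 1 xi (kcl 0 q eta)) = kcl 1 q (inc xi *. eta)"
 unfolding g_coh_eq by (rule E1_tens[OF cvs_H kcl_linear carrier_H kcl_zero_iff gch_kcl]; assumption)

lemma dA_ZM1: "eta:ZM 0 q ==> dA eta:ZM 1 q"
proof -
 assume eta: "eta:ZM 0 q"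
 have "dA (dA eta) = 0[KA]" by (rule A.diff_diff[OF ZMD(5)[OF eta]])
 thus ?thesis using eta FlD(2) by (simp add: ZM_def)
qed

text \<open>The definition ranges over all cochains that represent a class. Two representatives
  differ by some \<open>d\<zeta> + f\<close> with \<open>f\<close> of filtration 1, so their
  differentials differ by \<open>df\<close>, a coboundary of \<open>M\<^sub>1\<close>.\<close>

lemma fibre_conn_kcl:
 assumes eta: "eta:ZM 0 q"
 shows "fibre_conn D q (kcl 0 q eta) = inv_into (car (LF q 1)) (g_coh D q) (kcl 1 q (dA eta))"
proof -
 let ?G = "%z. inv_into (car (LF q 1)) (g_coh D q)
    (coh_class (fibre_quot D 1) (fibre_quot_diff D 1) q (filt_class D 1 q (connC D q z)))"
 have val: "?G (J q eta') = inv_into (car (LF q 1)) (g_coh D q) (kcl 1 q (dA eta'))" if "eta':ZM 0 q" for eta'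
  using connC_J[OF ZM0_forms[OF that]] by (simp add: kcl_def mcl_def)
 have cong: "kcl 1 q (dA eta') = kcl 1 q (dA eta)" if eta': "eta':ZM 0 q" "kcl 0 q eta' = kcl 0 q eta" for eta'
 proof -
  obtain f where f: "f:BM 0 q" "eta' = f +. eta" using kcl_eqD[OF eta'(2,1) eta] by blast
  have fZ: "f:ZM 0 q" using f BM_ZM by auto
  have "dA f:BM 1 q"
  proof (cases q)
   case 0
   \<comment> \<open>In degree 0 filtration step 1 is zero.\<close>
   hence "f = 0[KA]" using f(1) by (simp add: BM_def ideal_filt_def)
   thus ?thesis using FlD(2) 0 by (simp add: BM_def A.diff_zero)
  next
   case (Suc m)
   then obtain zeta g where *: "zeta:forms KA m" "g:Fl 1 (1 + m)" "f = dA zeta +. g" using f(1) by (auto simp: BM_def Fl_0)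
   have "dA f = dA g +. 0[KA]"
    using *(1,3) FlD(5)[OF *(2)] A.FD(5)[OF *(1)] by (simp add: A.diffD A.diff_diff cvs_l_zero[OF A.V] cvs_r_zero[OF A.V])
   thus ?thesis using *(2) FlD(2) unfolding BM_def Suc by auto
  qed
  moreover have "dA eta' = dA f +. dA eta" using f(2) ZMD(5) fZ eta by (simp add: A.diffD)
  ultimately show ?thesis using kcl_add_BM[OF _ dA_ZM1[OF fZ] dA_ZM1[OF eta]] by simp
 qed
 let ?M = "(fibre D q)(|carrier := cy 0 q|)"
 have m: "mcl 0 q eta:car ?M" using eta by (simp add: cocycles_eq)
 have k: "kcl 0 q eta = cb 0 q +>\<^bsub>?M\<^esub> mcl 0 q eta" for eta by (simp add: kcl_def coh_class_def)
 \<comment> \<open>As a set of cochains, a class of the fibre consists of the images under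
   \<open>J\<close> of one form plus all forms of filtration 1. This describes the union over a
   cohomology class.\<close>
 have mJ: "z:mcl 0 q eta' <-> (EX f:Fl 1 q. z = J q (f +. eta'))" if "eta':forms KA q" for z eta'
 proof -
  have "J q f +[cochains D q] J q eta' = J q (f +. eta')" if "f:Fl 1 q" for f
   using that Fl_forms \<open>eta':forms KA q\<close> JD(2) by (simp add: subset_iff)
  thus ?thesis by (auto simp: mcl_def filt_class_def mem_coset_iff filt_eq simp del: cochains_simps)
 qed
 show ?thesis
  unfolding fibre_conn_def D_simps
 proof (rule on_coset_eqI)
  have "mcl 0 q eta:kcl 0 q eta" unfolding k by (rule mem_own_coset[OF cy_cvs cb_subspace m])
  moreover have "J q eta:mcl 0 q eta"
   using FlD(2) eta cvs_l_zero[OF A.V, of eta] ZMD(5) by (force simp: mJ ZM0_forms)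
  ultimately show "J q eta : \<Union> (kcl 0 q eta)" by blast
  fix z assume "z : \<Union> (kcl 0 q eta)"
  then obtain u where u: "z:u" "u:kcl 0 q eta" by auto
  obtain s where s: "s:cb 0 q" "u = s +[?M] mcl 0 q eta" using u(2) unfolding k mem_coset_iff by auto
  have "cb 0 q +>\<^bsub>?M\<^esub> u = cb 0 q +>\<^bsub>?M\<^esub> mcl 0 q eta" by (rule coset_eqI[OF cy_cvs cb_subspace s(1) m s(2)])
  moreover have "u:car ?M"
   using s m subD(5)[OF cy_cvs cb_subspace] add_cl[OF cy_cvs, of s 0 q] by auto
  then obtain eta' where eta': "eta':ZM 0 q" "u = mcl 0 q eta'" by (auto simp: cocycles_eq)
  ultimately have ke: "kcl 0 q eta' = kcl 0 q eta" by (simp add: k)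
  obtain f where f: "f:Fl 1 q" "z = J q (f +. eta')" using u(1) mJ[OF ZM0_forms[OF eta'(1)]] eta'(2) by auto
  have fZ: "f +. eta':ZM 0 q"
   using f(1) eta'(1) Fl_forms[of 1 q] Fl_diff[OF f(1)] A.FD(3) FlD(3) FlD(5)[OF f(1)] ZMD(5)[OF eta'(1)]
   by (auto simp: ZM0_iff A.diffD)
  have "mcl 0 q (f +. eta') = mcl 0 q eta'" using mcl_add_Fl[of f 0 q eta'] f(1) ZM_Fl[OF eta'(1)] by simp
  hence "kcl 0 q (f +. eta') = kcl 0 q eta" using ke by (simp add: kcl_def)
  thus "?G z = inv_into (car (LF q 1)) (g_coh D q) (kcl 1 q (dA eta))"
   unfolding f(2) using val[OF fZ] cong[OF fZ] by simp
 qed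
qed

text \<open>\<open>g_coh\<close> is injective, so a value of the connection may be guessed and then
  verified after applying \<open>g_coh\<close>, where it is the differential of forms.\<close>

lemma fibre_conn_eqI:
 assumes eta: "eta:ZM 0 q" and t: "t:car (LF q 1)" "g_coh D q t = kcl 1 q (dA eta)"
 shows "fibre_conn D q (kcl 0 q eta) = t"
 unfolding fibre_conn_kcl[OF eta] t(2)[symmetric]
 using g_coh_bij t(1) by (simp add: bij_betw_def)

lemma g_coh_fibre_conn:
 assumes eta: "eta:ZM 0 q"
 shows "fibre_conn D q (kcl 0 q eta):car (LF q 1)" "g_coh D q (fibre_conn D q (kcl 0 q eta)) = kcl 1 q (dA eta)"
proof -
 have k: "kcl 1 q (dA eta):g_coh D q ` car (LF q 1)"
  using kclD(1)[OF dA_ZM1[OF eta]] g_coh_bij[of q] by (simp add: bij_betw_def)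
 show "fibre_conn D q (kcl 0 q eta):car (LF q 1)" "g_coh D q (fibre_conn D q (kcl 0 q eta)) = kcl 1 q (dA eta)"
  unfolding fibre_conn_kcl[OF eta] using inv_into_into[OF k] f_inv_into_f[OF k] by auto
qed

lemma ten_closed: "xi:forms KB p ==> eta:ZM 0 q ==> ten q p xi (kcl 0 q eta):car (LF q p)"
 by (rule ten_bal(1)) (auto simp: kclD(1))

text \<open>The explicit form of \<open>\<nabla>\<^sub>q\<close>: by \<open>ZM_expand\<close> the
  coefficients of \<open>d\<eta>\<close> in the basis of 1-forms are fibre cocycles.\<close>

lemma fibre_conn_expand:
 assumes eta: "eta:ZM 0 q"
 shows "EX \<kappa>. (ALL e:I 1. \<kappa> e:ZM 0 q) & dA eta = (finsum KA (%e. inc e *. \<kappa> e) (I 1)) &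
  fibre_conn D q (kcl 0 q eta) = (finsum (LF q 1) (%e. ten q 1 e (kcl 0 q (\<kappa> e))) (I 1))"
proof -
 obtain \<kappa> where \<kappa>: "!!e. e:I 1 ==> \<kappa> e:ZM 0 q" "dA eta = (finsum KA (%e. inc e *. \<kappa> e) (I 1))"
  using ZM_expand[OF dA_ZM1[OF eta]] by blast
 interpret WG: abelian_group "Hq 1 q" by (rule cvs_abelian[OF cvs_H])
 have cl: "ten q 1 e (kcl 0 q (\<kappa> e)):car (LF q 1)" if "e:I 1" for e using that \<kappa>(1) basisD(2) ten_closed by blast
 have "g_coh D q (finsum (LF q 1) (%e. ten q 1 e (kcl 0 q (\<kappa> e))) (I 1)) = (finsum (Hq 1 q) (%e. g_coh D q (ten q 1 e (kcl 0 q (\<kappa> e)))) (I 1))"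
  by (rule lin_finsum[OF cvs_LF cvs_H g_coh_linear cl])
 also have "... = (finsum (Hq 1 q) (%e. kcl 1 q (inc e *. \<kappa> e)) (I 1))"
  by (rule WG.finsum_cong', rule refl) (use \<kappa>(1) basisD(2) ZM_mult g_coh_tens kclD(1) in "blast+")
 also have "... = kcl 1 q (dA eta)"
  unfolding \<kappa>(2) by (rule class_sum[OF ZM_subspace cvs_H kcl_linear, symmetric]) (use \<kappa>(1) basisD(2) ZM_mult in blast)
 finally have "fibre_conn D q (kcl 0 q eta) = (finsum (LF q 1) (%e. ten q 1 e (kcl 0 q (\<kappa> e))) (I 1))"
  by (intro fibre_conn_eqI eta) (use cl in "auto intro: cvs_finsum_closed[OF cvs_LF]")
 thus ?thesis using \<kappa> by blast
qed

lemma wedge_linear: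
 assumes xi: "xi:forms KB p"
 shows "lforms_wedge B KB (HN D q) (p + j) xi:lin (LF q j) (LF q (p + j))"
  and "xi':forms KB j ==> h:car (HN D q) ==>
   lforms_wedge B KB (HN D q) (p + j) xi (ten q j xi' h) = ten q (p + j) (xi **[KB] xi') h"
proof -
 have b: "balanced B (fb KB j) (HN D q) (LF q (p + j)) (%eta x. ten q (p + j) (xi **[KB] eta) x)"
 proof (rule balancedI)
  fix eta b x assume *: "eta:car (fb KB j)" "b:car B" "x:car (HN D q)"
  have "xi **[KB] (eta **[KB] emb KB b) = (xi **[KB] eta) **[KB] emb KB b"
   using * xi by (simp add: B.alg_simps B.FD(5)[OF xi] B.FD(5) B.embD)
  thus "ten q (p + j) (xi **[KB] ract (fb KB j) eta b) x = ten q (p + j) (xi **[KB] eta) (lact (HN D q) b x)"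
   using * ten_bal(6)[OF B.forms_mult[OF xi]] by simp
 qed (simp_all add: ten_bal(1-5) B.forms_mult[OF xi] B.alg_simps B.FD(5)[OF xi] B.FD(5))
 show "lforms_wedge B KB (HN D q) (p + j) xi:lin (LF q j) (LF q (p + j))"
  unfolding lforms_wedge_def lforms_def[of _ _ _ j] by (rule tensor_lift_linear[OF tensorable_HN cvs_LF b])
 show "xi':forms KB j ==> h:car (HN D q) ==>
   lforms_wedge B KB (HN D q) (p + j) xi (ten q j xi' h) = ten q (p + j) (xi **[KB] xi') h"
  unfolding lforms_wedge_def by (subst tensor_lift_tens[OF tensorable_HN cvs_LF b]) auto
qed

lemma fibre_conn_linear: "fibre_conn D q:lin (HN D q) (LF q 1)"
proof (rule linI)
 note cl = add_cl[OF cvs_LF] smult_cl[OF cvs_LF] and g = g_coh_fibre_conn and gl = linD[OF g_coh_linear]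
 fix x assume "x:car (HN D q)"
 then obtain eta where eta: "eta:ZM 0 q" "x = kcl 0 q eta" using HN_cases by blast
 show "fibre_conn D q x:car (LF q 1)" using eta g(1) by simp
 show "fibre_conn D q (c *[HN D q] x) = c *[LF q 1] fibre_conn D q x" for c
 proof -
  have "fibre_conn D q (kcl 0 q (c .* eta)) = c *[LF q 1] fibre_conn D q x"
   by (rule fibre_conn_eqI) (use eta ZMD(4,5) dA_ZM1 in "auto simp del: One_nat_def simp: g gl cl kclD(3) A.diffD")
  thus ?thesis using eta by (simp add: kclD(3))
 qed
 fix y assume "y:car (HN D q)"
 then obtain zeta where zeta: "zeta:ZM 0 q" "y = kcl 0 q zeta" using HN_cases by blast
 have "fibre_conn D q (kcl 0 q (eta +. zeta)) = fibre_conn D q x +[LF q 1] fibre_conn D q y"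
  by (rule fibre_conn_eqI) (use eta zeta ZMD(3,5) dA_ZM1 in "auto simp del: One_nat_def simp: g gl cl kclD(2) A.diffD")
 thus "fibre_conn D q (x +[HN D q] y) = fibre_conn D q x +[LF q 1] fibre_conn D q y"
  using eta zeta by (simp add: kclD(2))
qed

text \<open>Kept general in \<open>F\<close> and \<open>\<rho>\<close>: with \<open>g_coh\<close> it
  yields the Leibniz rule of the connection, and with \<open>Psi\<close> the differential of page
  1.\<close>

lemma lift_wedge_conn:
 assumes xi: "xi:forms KB p" and eta: "eta:ZM 0 q" and W: "cvs W"
  and \<rho>: "\<rho> : lin (KA(|carrier := ZM (p + 1) q|)) W"
  and F: "F:lin (LF q (p + 1)) W" "!!xi eta. xi:forms KB (p + 1) ==> eta:ZM 0 q ==> F (ten q (p + 1) xi (kcl 0 q eta)) = \<rho> (inc xi *. eta)"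
 shows "inc xi *. dA eta:ZM (p + 1) q"
  "F (lforms_wedge B KB (HN D q) (p + 1) xi (fibre_conn D q (kcl 0 q eta))) = \<rho> (inc xi *. dA eta)"
proof -
 obtain \<kappa> where \<kappa>: "!!e. e:I 1 ==> \<kappa> e:ZM 0 q" "dA eta = (finsum KA (%e. inc e *. \<kappa> e) (I 1))"
  "fibre_conn D q (kcl 0 q eta) = (finsum (LF q 1) (%e. ten q 1 e (kcl 0 q (\<kappa> e))) (I 1))"
  using fibre_conn_expand[OF eta] by blast
 note cl = ten_closed[OF basisD(2) \<kappa>(1)]
 interpret WG: abelian_group W by (rule cvs_abelian[OF W])
 interpret AA: abelian_group KA by (rule cvs_abelian[OF A.V])
 have pr: "xi **[KB] e:forms KB (p + 1)" if "e:I 1" for e using B.forms_mult[OF xi basisD(2)[OF that]] .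
 have mem: "inc (xi **[KB] e) *. \<kappa> e:ZM (p + 1) q" if "e:I 1" for e by (rule ZM_mult[OF pr[OF that] \<kappa>(1)[OF that]])
 have sum: "inc xi *. dA eta = (finsum KA (%e. inc (xi **[KB] e) *. \<kappa> e) (I 1))"
 proof -
  have "inc xi *. dA eta = (finsum KA (%e. inc xi *. (inc e *. \<kappa> e)) (I 1))"
   unfolding \<kappa>(2) by (rule lin_finsum[OF A.V A.V calgebra_mult_linear(1)[OF A.alg inc_closed[OF xi]]])
    (use \<kappa>(1) basisD(2) ZM_mult ZMD(5) in blast)
  also have "... = (finsum KA (%e. inc (xi **[KB] e) *. \<kappa> e) (I 1))"
  proof (rule AA.finsum_cong')
   fix e assume e: "e:I 1"
   show "inc xi *. (inc e *. \<kappa> e) = inc (xi **[KB] e) *. \<kappa> e"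
    using xi basisD(2)[OF e] ZMD(5)[OF \<kappa>(1)[OF e]] by (simp add: inc_mult B.FD(5)[OF xi] B.FD(5) inc_closed A.alg_simps)
  qed (use mem ZMD(5) in auto)
  finally show ?thesis .
 qed
 show "inc xi *. dA eta:ZM (p + 1) q" unfolding sum by (rule csubspace_sum_closed[OF A.V ZM_subspace mem])
 have "F (lforms_wedge B KB (HN D q) (p + 1) xi (fibre_conn D q (kcl 0 q eta)))
   = (finsum W (%e. F (lforms_wedge B KB (HN D q) (p + 1) xi (ten q 1 e (kcl 0 q (\<kappa> e))))) (I 1))"
  unfolding \<kappa>(3) by (rule lin_finsum[OF cvs_LF W lin_comp[OF wedge_linear(1)[OF xi] F(1)] cl])
 also have "... = (finsum W (%e. \<rho> (inc (xi **[KB] e) *. \<kappa> e)) (I 1))"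
 proof (rule WG.finsum_cong')
  fix e assume e: "e:I 1"
  show "F (lforms_wedge B KB (HN D q) (p + 1) xi (ten q 1 e (kcl 0 q (\<kappa> e)))) = \<rho> (inc (xi **[KB] e) *. \<kappa> e)"
   using wedge_linear(2)[OF xi basisD(2)[OF e]] kclD(1)[OF \<kappa>(1)[OF e]] F(2)[OF pr[OF e] \<kappa>(1)[OF e]] by simp
 qed (use mem lin_cl[OF \<rho>] in auto)
 also have "... = \<rho> (inc xi *. dA eta)" unfolding sum by (rule class_sum[OF ZM_subspace W \<rho> mem, symmetric])
 finally show "F (lforms_wedge B KB (HN D q) (p + 1) xi (fibre_conn D q (kcl 0 q eta))) = \<rho> (inc xi *. dA eta)" .
qed

text \<open>After applying \<open>g_coh\<close>, the Leibniz rule of the connection is that of the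
  differential of forms, \<open>d(b \<eta>) = db \<and> \<eta> + b d\<eta>\<close>.\<close>

lemma left_connection_D: "left_connection B KB (HN D q) (fibre_conn D q)"
 unfolding left_connection_def
proof (intro conjI ballI)
 fix b x assume b: "b:car B" and "x:car (HN D q)"
 then obtain eta where eta: "eta:ZM 0 q" "x = kcl 0 q eta" using HN_cases by blast
 \<comment> \<open>Elements of \<open>B\<close> are treated as forms of degree 0, so that
   \<open>lift_wedge_conn\<close> applies with \<open>p = 0\<close>.\<close>
 have e0: "emb KB b:forms KB 0" by (rule B.emb_forms[OF b])
 have db: "diff KB (emb KB b):forms KB 1" using B.diff_forms[OF e0] by simp
 have gt: "g_coh D q (ten q (0 + 1) xi (kcl 0 q eta)) = kcl 1 q (inc xi *. eta)" if "xi:forms KB (0 + 1)" "eta:ZM 0 q" for xi eta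
  using g_coh_tens that by simp
 note lw = lift_wedge_conn[OF e0 eta(1) cvs_H, of "kcl 1 q" 1 q "g_coh D q", OF _ _ gt, simplified, OF kcl_linear[of 1 q, simplified] g_coh_linear[of q, simplified]]
 have wc: "lforms_wedge B KB (HN D q) 1 (emb KB b) (fibre_conn D q x):car (LF q 1)"
  using lin_cl[OF wedge_linear(1)[OF e0, of q 1]] g_coh_fibre_conn(1)[OF eta(1)] eta(2) by simp
 have tc: "ten q 1 (diff KB (emb KB b)) x:car (LF q 1)" using ten_closed[OF db eta(1)] eta(2) by simp
 have dz: "dA (emb KA b *. eta) = inc (diff KB (emb KB b)) *. eta +. inc (emb KB b) *. dA eta"
  using b eta BA by (simp add: A.diff_mult_emb ZMD(5) inc_diff B.embD inc_emb)
 have "fibre_conn D q (kcl 0 q (emb KA b *. eta)) =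
   ten q 1 (diff KB (emb KB b)) x +[LF q 1] lforms_wedge B KB (HN D q) 1 (emb KB b) (fibre_conn D q x)"
 proof (rule fibre_conn_eqI[OF ZM_lact[OF b eta(1)] add_cl[OF cvs_LF tc wc]])
  show "g_coh D q (ten q 1 (diff KB (emb KB b)) x +[LF q 1] lforms_wedge B KB (HN D q) 1 (emb KB b) (fibre_conn D q x))
   = kcl 1 q (dA (emb KA b *. eta))"
   unfolding dz linear_add[OF g_coh_linear tc wc]
   using lw kclD(2)[of _ 1 q] ZM_mult[OF db eta(1)] g_coh_tens[OF db eta(1)] eta(2) by simp
 qed
 thus "fibre_conn D q (lact (HN D q) b x) =
   ten q 1 (diff KB (emb KB b)) x +[LF q 1] lforms_wedge B KB (HN D q) 1 (emb KB b) (fibre_conn D q x)"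
  using b eta by (simp add: lact_HN)
qed (rule fibre_conn_linear)

end

section \<open>The first and the second page\<close>

context split_bundle begin

text \<open>The class on page 1 of a form in \<open>ZM\<close>; this is the surjection to which the
  comparison of \<open>E1_bij\<close> is applied.\<close>

definition "rho p q eta = pcl (Suc 0) (int p) (p + q) (J (p + q) eta)"

definition "PG p q = Pg (Suc 0) (int p) (p + q)"

lemma one_le: "1 <= Suc 0" by simp

lemma cvs_PG: "cvs (PG p q)"
 unfolding PG_def by (rule cvs_Pg[OF one_le])

lemma Z1_eq: "Z (Suc 0) (int p) (p + q) = J (p + q) ` ZM p q"
proof -
 have "nat (int p + int (Suc 0)) = Suc p" by simp
 hence *: "z:Z (Suc 0) (int p) (p + q) <-> z:filt D p (p + q) & d (p + q) z:filt D (Suc p) (Suc (p + q))" for z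
  by (simp add: Z_iff)
 have "J (p + q) eta:Z (Suc 0) (int p) (p + q) <-> eta:ZM p q" if "eta:Fl p (p + q)" for eta
  using that Fl_forms[of p "p + q"] A.diff_forms unfolding *
  by (auto simp: connC_J J_mem_filt ZM_def subset_iff)
 thus ?thesis using ZM_Fl * unfolding filt_eq[of p] by (auto simp: image_iff) blast+
qed

lemma Z0_eq: "Z 0 p n = Fi p n"
 using connC_filt by (auto simp: Z_iff)

text \<open>On page 1 both summands of \<open>Bpage\<close> involve \<open>Z 0\<close>, which is a
  full filtration step. So they are filtration step \<open>p + 1\<close> and the boundaries of step
  \<open>p\<close>.\<close>

lemma J_Bd1: "eta:ZM p q ==> J (p + q) eta:Bd (Suc 0) (int p) (p + q) <-> eta:BM p q"
proof -
 assume eta: "eta:ZM p q"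
 have etaf: "eta:forms KA (p + q)" using ZM_Fl[OF eta] Fl_forms by blast
 have n: "nat (int p + 1) = Suc p" by simp
 have *: "z:Bd (Suc 0) (int p) (p + q) <-> (EX u:filt D (Suc p) (p + q). EX v:bdry (Suc 0) (int p) (p + q). z = u +[C (p + q)] v)" for z
  by (simp add: Bd_iff Z0_eq n)
 have b: "bdry (Suc 0) (int p) (p + q) = (case q of 0 => {0[C p]} | Suc m => (%zeta. J (p + q) (dA zeta)) ` Fl p (p + m))"
 proof (cases q)
  case 0
  show ?thesis
  proof (cases p)
   case (Suc p')
   \<comment> \<open>For \<open>q = 0\<close> a primitive would have degree \<open>p - 1\<close> and
     filtration \<open>p\<close>, hence is zero.\<close>
   have "Fi (int p) p' = {0[C p']}" using filt_above[of p' p] Suc by (simp del: of_nat_Suc)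
   hence "bdry (Suc 0) (int p) p = {0[C p]}" using d_zero[of p'] by (simp add: bdry_def Suc Z0_eq add.commute)
   thus ?thesis using 0 by simp
  qed (simp add: bdry_def 0)
 next
  case (Suc m)
  have "d (p + m) (J (p + m) zeta) = J (Suc (p + m)) (dA zeta)" if "zeta:Fl p (p + m)" for zeta
   using that Fl_forms connC_J by blast
  thus ?thesis by (auto simp: bdry_def Suc Z0_eq filt_eq image_image)
 qed
 have add: "J (p + q) f +[C (p + q)] J (p + q) x = J (p + q) (f +. x)" if "f:forms KA (p + q)" "x:forms KA (p + q)" for f x
  using JD(2)[OF that] by simp
 have inj: "J (p + q) eta = J (p + q) x <-> eta = x" if "x:forms KA (p + q)" for x
  using J_inj[OF _ etaf that] by blast
 show ?thesis
 proof (cases q)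
  case 0
  have "J p f +[C p] 0[C p] = J p f" if "f:forms KA p" for f
   using cvs_r_zero[OF cvs_C, of "J p f" p] JD(1)[OF that] by simp
  thus ?thesis
   using inj Fl_forms[of "Suc p" p] unfolding * b BM_def using 0 by (auto simp: filt_eq subset_iff simp del: cochains_simps)
 next
  case (Suc m)
  have d: "dA zeta:forms KA (p + q)" if "zeta:Fl p (p + m)" for zeta
   using that Fl_forms[of p "p + m"] A.diff_forms[of zeta "p + m"] Suc by auto
  have f: "f:forms KA (p + q)" if "f:Fl (Suc p) (p + q)" for f using that Fl_forms by blast
  have "J (p + q) eta:Bd (Suc 0) (int p) (p + q) <-> (EX f:Fl (Suc p) (p + q). EX zeta:Fl p (p + m). J (p + q) eta = J (p + q) f +[C (p + q)] J (p + q) (dA zeta))"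
   unfolding * b filt_eq by (simp add: Suc del: cochains_simps add_Suc_right)
  also have "... <-> (EX f:Fl (Suc p) (p + q). EX zeta:Fl p (p + m). eta = f +. dA zeta)"
   using f d inj add A.FD(3) by (metis (no_types, lifting))
  also have "... <-> (EX f:Fl (Suc p) (p + q). EX zeta:Fl p (p + m). eta = dA zeta +. f)"
   using cvs_add_comm[OF A.V] f d A.FD(5) by (metis (no_types, lifting))
  also have "... <-> eta:BM p q" by (auto simp: BM_def Suc)
  finally show ?thesis .
 qed
qed

lemma rho_carrier: "car (PG p q) = rho p q ` ZM p q"
 unfolding PG_def carrier_Pg Z1_eq rho_def[abs_def] by (simp add: image_image)

lemma rho_linear: "rho p q:lin (KA(|carrier := ZM p q|)) (PG p q)"
proof -
 have "ZM p q <= forms KA (p + q)" using ZM_Fl Fl_forms by blast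
 hence "J (p + q):lin (KA(|carrier := ZM p q|)) (ZV (Suc 0) (int p) (p + q))"
  using JD by (auto intro!: linI simp: Z1_eq subset_iff)
 from lin_comp[OF this pcl_linear[OF one_le]] show ?thesis by (simp add: rho_def[abs_def] PG_def)
qed

lemma rho_zero_iff: "eta:ZM p q ==> rho p q eta = 0[PG p q] <-> eta:BM p q"
 using pcl_zero_iff[OF one_le, of "J (p + q) eta" "int p" "p + q"] J_Bd1[of eta p q] Z1_eq[of p q] by (auto simp: rho_def PG_def)

lemmas rhoD = linD[OF rho_linear, simplified]

text \<open>An arbitrary representative of the class is taken; \<open>class_mult_cong\<close> makes
  the choice irrelevant (\<open>rh_kcl\<close>).\<close>

definition "rh p q xi x = rho p q (inc xi *. inv_into (ZM 0 q) (kcl 0 q) x)"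

lemma rh_kcl: "xi:forms KB p ==> eta:ZM 0 q ==> rh p q xi (kcl 0 q eta) = rho p q (inc xi *. eta)"
 unfolding rh_def
proof (rule class_mult_cong[OF rho_linear cvs_PG rho_zero_iff])
 assume "eta:ZM 0 q"
 hence i: "kcl 0 q eta:kcl 0 q ` ZM 0 q" by auto
 show "inv_into (ZM 0 q) (kcl 0 q) (kcl 0 q eta):ZM 0 q" by (rule inv_into_into[OF i])
 show "kcl 0 q (inv_into (ZM 0 q) (kcl 0 q) (kcl 0 q eta)) = kcl 0 q eta" by (rule f_inv_into_f[OF i])
qed

text \<open>The isomorphism from
  \<open>\<Omega>\<^sub>B\<^sup>p \<otimes>\<^sub>B H\<^sup>q(N)\<close> to page 1 at
  \<open>(p, q)\<close>.\<close>

definition "Psi p q = tensor_lift (PG p q) (rh p q)"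

lemma Psi_linear: "Psi p q:lin (LF q p) (PG p q)"
 and Psi_bij: "bij_betw (Psi p q) (car (LF q p)) (car (PG p q))"
 and Psi_tens: "xi:forms KB p ==> eta:ZM 0 q ==> Psi p q (ten q p xi (kcl 0 q eta)) = rho p q (inc xi *. eta)"
 unfolding Psi_def
 using E1_linear[OF cvs_PG rho_linear rho_carrier rho_zero_iff rh_kcl, of p q]
  E1_bij[OF cvs_PG rho_linear rho_carrier rho_zero_iff rh_kcl, of p q]
  E1_tens[OF cvs_PG rho_linear rho_carrier rho_zero_iff rh_kcl, where xi = xi and p = p and eta = eta and q = q] by auto

lemma Psi_inj: "Psi p q s = Psi p q t ==> s:car (LF q p) ==> t:car (LF q p) ==> s = t"
 using Psi_bij[of p q] by (auto simp: bij_betw_def inj_on_def)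

abbreviation "ldiff q p == lforms_diff B KB (HN D q) (fibre_conn D q) p"

definition "lh q p \<omega> x = ten q (Suc p) (diff KB \<omega>) x +[LF q (Suc p)]
    ((-1) ^ p *[LF q (Suc p)] lforms_wedge B KB (HN D q) (Suc p) \<omega> (fibre_conn D q x))"

text \<open>Seen through \<open>Psi\<close>, the two terms of the connection differential are the
  two terms of the Leibniz rule for \<open>\<xi> \<and> \<eta>\<close>.\<close>

lemma Psi_lh:
 assumes xi: "xi:forms KB p" and eta: "eta:ZM 0 q"
 shows "lh q p xi (kcl 0 q eta):car (LF q (Suc p))"
  and "Psi (Suc p) q (lh q p xi (kcl 0 q eta)) = rho (Suc p) q (dA (inc xi *. eta))"
proof -
 have t: "ten q (Suc p) (diff KB xi) (kcl 0 q eta):car (LF q (Suc p))"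
  by (rule ten_closed[OF B.diff_forms[OF xi] eta])
 have w: "lforms_wedge B KB (HN D q) (Suc p) xi (fibre_conn D q (kcl 0 q eta)):car (LF q (Suc p))"
  using lin_cl[OF wedge_linear(1)[OF xi, of q 1] g_coh_fibre_conn(1)[OF eta]] by simp
 note sw = smult_cl[OF cvs_LF w, of "(-1) ^ p"]
 show "lh q p xi (kcl 0 q eta):car (LF q (Suc p))"
  unfolding lh_def by (rule add_cl[OF cvs_LF t sw])
 have rl: "rho (p + 1) q:lin (KA(|carrier := ZM (p + 1) q|)) (PG (p + 1) q)" by (rule rho_linear)
 note lw = lift_wedge_conn[OF xi eta cvs_PG rho_linear[of "p + 1" q] Psi_linear[of "p + 1" q] Psi_tens[of _ "p + 1" _ q]]
 have 1: "inc xi *. dA eta:ZM (Suc p) q" using lw(1) by simp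
 have 2: "Psi (Suc p) q (lforms_wedge B KB (HN D q) (Suc p) xi (fibre_conn D q (kcl 0 q eta))) = rho (Suc p) q (inc xi *. dA eta)"
  using lw(2) by simp
 note 3 = ZM_mult[OF B.diff_forms[OF xi] eta]
 have "Psi (Suc p) q (lh q p xi (kcl 0 q eta)) = rho (Suc p) q (inc (diff KB xi) *. eta) +[PG (Suc p) q] (-1) ^ p *[PG (Suc p) q] rho (Suc p) q (inc xi *. dA eta)"
  unfolding lh_def linear_add[OF Psi_linear t sw] linear_smult[OF Psi_linear w] Psi_tens[OF B.diff_forms[OF xi] eta] 2 ..
 also have "... = rho (Suc p) q (inc (diff KB xi) *. eta +. (-1) ^ p .* (inc xi *. dA eta))"
  unfolding rhoD(2)[OF 3 ZMD(4)[OF 1]] rhoD(3)[OF 1] ..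
 finally show "Psi (Suc p) q (lh q p xi (kcl 0 q eta)) = rho (Suc p) q (dA (inc xi *. eta))"
  unfolding leibniz_closed[OF xi ZMD(5)[OF eta]] .
qed

lemma ZM_diff: "z:ZM p q ==> dA z:ZM (Suc p) q"
proof -
 assume z: "z:ZM p q"
 have "dA (dA z) = 0[KA]" by (rule A.diff_diff[OF ZMD(5)[OF z]])
 thus ?thesis using z FlD(2) by (simp add: ZM_def)
qed

text \<open>Composing with the injective map \<open>Psi\<close> turns the formula into \<open>xi \<otimes> [eta] \<mapsto> [d (xi eta)]\<close>,
 which is visibly balanced.\<close>

lemma lh_balanced: "balanced B (fb KB p) (HN D q) (LF q (Suc p)) (lh q p)"
proof -
 note cl = Psi_lh(1) add_cl[OF cvs_LF] smult_cl[OF cvs_LF]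
 note r = Psi_lh(2) linD(2,3)[OF Psi_linear] rhoD(2,3)[symmetric] ZM_mult ZM_diff kclD(2,3)[symmetric] ZMD(3,4)
  B.FD(3,4) incD B.FD(5) A.alg_simps inc_closed ZMD(5) A.diffD lact_HN ZM_lact B.forms_rmult inc_mult inc_emb B.embD A.embD BA
 show ?thesis
 proof (rule balancedI)
  fix xi u assume *: "xi:car (fb KB p)" "u:car (HN D q)"
  then obtain eta where eta: "eta:ZM 0 q" "u = kcl 0 q eta" using HN_cases by blast
  show "lh q p xi u:car (LF q (Suc p))" using * eta cl by simp
  show "lh q p xi (c *[HN D q] u) = c *[LF q (Suc p)] lh q p xi u" for c
   by (rule Psi_inj[where p = "Suc p" and q = q]) (use * eta in "simp_all add: r cl")
  show "lh q p (c *[fb KB p] xi) u = c *[LF q (Suc p)] lh q p xi u" for c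
   by (rule Psi_inj[where p = "Suc p" and q = q]) (use * eta in "simp_all add: r cl")
  show "lh q p (xi +[fb KB p] xi') u = lh q p xi u +[LF q (Suc p)] lh q p xi' u" if "xi':car (fb KB p)" for xi'
   by (rule Psi_inj[where p = "Suc p" and q = q]) (use * eta that in "simp_all add: r cl")
  show "lh q p (ract (fb KB p) xi b) u = lh q p xi (lact (HN D q) b u)" if "b:car B" for b
   by (rule Psi_inj[where p = "Suc p" and q = q]) (use * eta that in "simp_all add: r cl")
  show "lh q p xi (u +[HN D q] u') = lh q p xi u +[LF q (Suc p)] lh q p xi u'" if "u':car (HN D q)" for u'
  proof -
   obtain eta' where eta': "eta':ZM 0 q" "u' = kcl 0 q eta'" using \<open>u':car (HN D q)\<close> HN_cases by blast
   show ?thesis by (rule Psi_inj[where p = "Suc p" and q = q]) (use * eta eta' in "simp_all add: r cl")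
  qed
 qed
qed

lemma ldiff_eq: "ldiff q p = tensor_lift (LF q (Suc p)) (lh q p)"
 by (simp add: lforms_diff_def lh_def[abs_def])

lemma ldiff_linear: "ldiff q p:lin (LF q p) (LF q (Suc p))"
 unfolding ldiff_eq lforms_def[of _ _ _ p] by (rule tensor_lift_linear[OF tensorable_HN cvs_LF lh_balanced])

lemma page1_eq: "page D (Suc 0) (int p) (int q) = PG p q"
 using page_eq_Pg[of "int p" "int q" "Suc 0"] by (simp add: nat_int_add PG_def)

lemma page1_diff: "eta:ZM p q ==> page_diff D (Suc 0) (int p) (int q) (rho p q eta) = rho (Suc p) q (dA eta)"
proof -
 assume eta: "eta:ZM p q"
 have f: "eta:forms KA (p + q)" using ZM_Fl[OF eta] Fl_forms by blast
 have "J (p + q) eta:Z (Suc 0) (int p) (nat (int p + int q))" using eta by (simp add: nat_int_add Z1_eq[simplified])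
 from page_diff_class[OF one_le _ this]
 have "page_diff D (Suc 0) (int p) (int q) (pcl (Suc 0) (int p) (p + q) (J (p + q) eta)) = pcl (Suc 0) (int p + int (Suc 0)) (Suc (p + q)) (d (p + q) (J (p + q) eta))"
  by (simp add: nat_int_add)
 thus ?thesis using connC_J[OF f] by (simp add: rho_def add.commute)
qed

lemma Psi_ldiff: "t:car (LF q p) ==> page_diff D (Suc 0) (int p) (int q) (Psi p q t) = Psi (Suc p) q (ldiff q p t)"
proof -
 assume t: "t:car (LF q p)"
 have e: "int p + int (Suc 0) = int (Suc p)" "int q - int (Suc 0) + 1 = int q" by auto
 have pl: "page_diff D (Suc 0) (int p) (int q):lin (PG p q) (PG (Suc p) q)"
  using page_diff_linear[OF one_le, of "int p" "int q"] unfolding e page1_eq .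
 show ?thesis
 proof (rule tensor_linear_eqI[OF tensorable_HN cvs_PG _ _ _ t[unfolded lforms_def]])
  show "(%t. page_diff D (Suc 0) (int p) (int q) (Psi p q t)):lin (tensor B (fb KB p) (HN D q)) (PG (Suc p) q)"
   using lin_comp[OF Psi_linear pl] by (simp add: lforms_def)
  show "(%t. Psi (Suc p) q (ldiff q p t)):lin (tensor B (fb KB p) (HN D q)) (PG (Suc p) q)"
   using lin_comp[OF ldiff_linear Psi_linear] by (simp add: lforms_def)
  fix xi x assume *: "xi:car (fb KB p)" "x:car (HN D q)"
  then obtain eta where eta: "eta:ZM 0 q" "x = kcl 0 q eta" using HN_cases by blast
  have xi: "xi:forms KB p" using * by simp
  have "ldiff q p (ten q p xi x) = lh q p xi x"
   unfolding ldiff_eq by (rule tensor_lift_tens[OF tensorable_HN cvs_LF lh_balanced *])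
  thus "page_diff D (Suc 0) (int p) (int q) (Psi p q (ten q p xi x)) = Psi (Suc p) q (ldiff q p (ten q p xi x))"
   using Psi_lh(2)[OF xi eta(1)] page1_diff[OF ZM_mult[OF xi eta(1)]] Psi_tens[OF xi eta(1)] eta(2) by simp
 qed
qed

text \<open>By \<open>Psi\<close> each row of page 1 is the complex of the fibre connection. The
  cohomology of a row, indexed by natural numbers, has then to be matched with page 2, indexed by
  integers.\<close>

lemma page2_iso: "isomorphic (page D 2 (int p) (int q)) (left_connection_cohomology B KB (HN D q) (fibre_conn D q) p)"
proof -
 let ?P = "%p. page D (Suc 0) (int p) (int q)" and ?d = "%p. page_diff D (Suc 0) (int p) (int q)"
 have e: "int p + int (Suc 0) = int (Suc p)" "int q - int (Suc 0) + 1 = int q" for p by auto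
 have pl: "?d p:lin (?P p) (?P (Suc p))" for p
  using page_diff_linear[OF one_le, of "int p" "int q"] unfolding e .
 have sq: "?d (Suc p) (?d p x) = 0[?P (Suc (Suc p))]" if "x:car (?P p)" for p x
  using page_diff_square[OF one_le that] unfolding e .
 have inv: "inv_into (car (LF q p)) (Psi p q):lin (?P p) (LF q p)"
  "bij_betw (inv_into (car (LF q p)) (Psi p q)) (car (?P p)) (car (LF q p))" for p
  unfolding page1_eq by (rule linear_inv[OF cvs_LF Psi_linear Psi_bij], rule bij_betw_inv_into[OF Psi_bij])
 have comm: "ldiff q p (inv_into (car (LF q p)) (Psi p q) x) = inv_into (car (LF q (Suc p))) (Psi (Suc p) q) (?d p x)"
  if x: "x:car (?P p)" for p x
 proof -
  let ?t = "inv_into (car (LF q p)) (Psi p q) x"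
  have im: "x:Psi p q ` car (LF q p)" using x Psi_bij[of p q] unfolding page1_eq by (simp add: bij_betw_def)
  have t: "?t:car (LF q p)" "Psi p q ?t = x" using inv_into_into[OF im] f_inv_into_f[OF im] by auto
  have "?d p x = Psi (Suc p) q (ldiff q p ?t)" using Psi_ldiff[OF t(1)] t(2) by simp
  thus ?thesis
   using Psi_bij[of "Suc p" q] lin_cl[OF ldiff_linear t(1)] by (simp add: bij_betw_def)
 qed
 have 1: "isomorphic (cohomology ?P ?d p) (left_connection_cohomology B KB (HN D q) (fibre_conn D q) p)"
  unfolding left_connection_cohomology_def
  by (rule cohomology_iso[where C = ?P and d = ?d and C' = "lforms B KB (HN D q)"
    and d' = "ldiff q" and f = "%p. inv_into (car (LF q p)) (Psi p q)"])
   (use cvs_page[OF one_le] pl sq cvs_LF inv comm in auto)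
 have s: "Suc (Suc 0) = (2::nat)" by simp
 have "isomorphic (page D 2 (int p) (int q)) (cohomology ?P ?d p)"
 proof -
  have "coboundaries ?P ?d p = page_diff D (Suc 0) (int p - int (Suc 0)) (int q + int (Suc 0) - 1) ` car (page D (Suc 0) (int p - int (Suc 0)) (int q + int (Suc 0) - 1))"
  proof (cases p)
   case 0
   \<comment> \<open>In column 0 the incoming differential starts at negative filtration degree,
     where the page vanishes; this agrees with the convention that only 0 is a coboundary in degree
     0.\<close>
   have "car (page D (Suc 0) (int p - int (Suc 0)) (int q + int (Suc 0) - 1)) = {0[page D (Suc 0) (int p - int (Suc 0)) (int q + int (Suc 0) - 1)]}"
    by (rule page_vanishes[OF one_le]) (simp add: 0)
   moreover have "page_diff D (Suc 0) (int p - int (Suc 0)) (int q + int (Suc 0) - 1) 0[page D (Suc 0) (int p - int (Suc 0)) (int q + int (Suc 0) - 1)] = 0[?P 0]"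
    using lin_zero[OF cvs_page[OF one_le] cvs_page[OF one_le] page_diff_linear[OF one_le], of "int p - int (Suc 0)" "int q + int (Suc 0) - 1"] 0
    by simp
   ultimately show ?thesis unfolding coboundaries_def 0 by simp
  next
   case (Suc m)
   have "int p - int (Suc 0) = int m" "int q + int (Suc 0) - 1 = int q" using Suc by auto
   thus ?thesis unfolding coboundaries_def Suc by simp
  qed
  moreover have "cocycles ?P ?d p = {x:car (?P p). ?d p x = 0[page D (Suc 0) (int p + int (Suc 0)) (int q - int (Suc 0) + 1)]}"
   unfolding cocycles_def e ..
  ultimately show ?thesis
   unfolding cohomology_def using page_step[OF one_le, of "int p" "int q"] unfolding s by simp
 qed
 thus ?thesis using 1 by (rule isomorphic_trans)
qed

end

section \<open>Exterior algebras\<close>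

text \<open>Functions on words of all lengths at once, multilinear in the letters and zero on words
  with two equal neighbours: those whose linear extension kills \<open>ext_rels\<close>.\<close>

definition alternating ::
 "(complex, 'v) module => (complex, 'w, 'z) module_scheme => ('v list => 'w) => bool" where
 "alternating V W h <-> (ALL ws:lists (car V). h ws:car W) &
  (ALL us:lists (car V). ALL u:car V. ALL v:car V. ALL vs:lists (car V).
    h (us @ [u +[V] v] @ vs) = h (us @ [u] @ vs) +[W] h (us @ [v] @ vs)) &
  (ALL c. ALL us:lists (car V). ALL u:car V. ALL vs:lists (car V).
    h (us @ [c *[V] u] @ vs) = c *[W] h (us @ [u] @ vs)) &
  (ALL us:lists (car V). ALL u:car V. ALL vs:lists (car V). h (us @ [u, u] @ vs) = 0[W])"

lemma alternatingI:
 assumes "!!ws. ws:lists (car V) ==> h ws:car W"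
  "!!us u v vs. us:lists (car V) ==> u:car V ==> v:car V ==> vs:lists (car V) ==>
    h (us @ [u +[V] v] @ vs) = h (us @ [u] @ vs) +[W] h (us @ [v] @ vs)"
  "!!c us u vs. us:lists (car V) ==> u:car V ==> vs:lists (car V) ==>
    h (us @ [c *[V] u] @ vs) = c *[W] h (us @ [u] @ vs)"
  "!!us u vs. us:lists (car V) ==> u:car V ==> vs:lists (car V) ==> h (us @ [u, u] @ vs) = 0[W]"
 shows "alternating V W h"
 unfolding alternating_def by (intro conjI ballI allI) (simp_all only: assms)

lemma alternatingD:
 assumes "alternating V W h"
 shows "!!ws. ws:lists (car V) ==> h ws:car W"
  "!!us u v vs. us:lists (car V) ==> u:car V ==> v:car V ==> vs:lists (car V) ==>
    h (us @ [u +[V] v] @ vs) = h (us @ [u] @ vs) +[W] h (us @ [v] @ vs)"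
  "!!c us u vs. us:lists (car V) ==> u:car V ==> vs:lists (car V) ==>
    h (us @ [c *[V] u] @ vs) = c *[W] h (us @ [u] @ vs)"
  "!!us u vs. us:lists (car V) ==> u:car V ==> vs:lists (car V) ==> h (us @ [u, u] @ vs) = 0[W]"
 using assms unfolding alternating_def by blast+

definition ext_lift :: "(complex, 'w, 'z) module_scheme => ('v list => 'w) => ('v list \<Rightarrow>\<^sub>0 complex) set => 'w" where
 "ext_lift W h = on_coset (lin_ext W h)"

lemma ext_alg_simps [simp]:
 "car (ext_alg V) = car (quot (free_cvs (lists (car V))) (ext_ideal V))"
 "zero (ext_alg V) = zero (quot (free_cvs (lists (car V))) (ext_ideal V))"
 "add (ext_alg V) = add (quot (free_cvs (lists (car V))) (ext_ideal V))"
 "smult (ext_alg V) = smult (quot (free_cvs (lists (car V))) (ext_ideal V))"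
 "one (ext_alg V) = wg V []"
 by (simp_all add: ext_alg_def Let_def)

context
 fixes V :: "(complex, 'v) module"
 assumes V: "cvs V"
begin

lemma ext_rels_subset: "ext_rels V <= car (free_cvs (lists (car V)))"
proof
 have k: "keys (single ws c) <= lists (car V)"
  if "ws:lists (car V)" for ws and c :: complex using that by auto
 fix r assume "r:ext_rels V"
 thus "r:car (free_cvs (lists (car V)))"
  unfolding ext_rels_def free_cvs_simps mem_Collect_eq
  by (elim UnE CollectE exE conjE; hypsubst; intro keys_diff_subset k)
   (auto intro: add_cl[OF V] smult_cl[OF V])
qed

lemma ext_ideal_subspace: "csubspace (ext_ideal V) (free_cvs (lists (car V)))"
 unfolding ext_ideal_def by (rule cspan_sub[OF cvs_free_cvs ext_rels_subset])

lemma cvs_ext_alg: "cvs (ext_alg V)"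
 by (rule cvs_cong[OF cvs_quot[OF cvs_free_cvs ext_ideal_subspace]]) simp_all

lemma wedge_list_closed: "ws:lists (car V) ==> wg V ws:car (ext_alg V)"
 by (auto simp: wedge_list_def)

lemma lin_ext_ext_ideal:
 assumes W: "cvs W" and h: "alternating V W h" and t: "t:ext_ideal V"
 shows "lin_ext W h t = 0[W]"
proof -
 let ?S = "lists (car V)"
 note H = alternatingD[OF h]
 have cl: "h:?S \<rightarrow> car W" using H(1) by auto
 note L = lin_ext_linear[OF W cl] and g = lin_ext_gen[OF W cl] and d = lin_ext_diff[OF W cl] and si = lin_ext_single[OF W cl]
 have mem: "us @ [u] @ vs:?S" if "us:?S" "u:car V" "vs:?S" for us u vs using that by auto
 have k: "keys (single ws c) <= ?S" if "ws:?S" for ws and c :: complex using that by auto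
 have base: "lin_ext W h r = 0[W]" if "r:ext_rels V" for r
  using that unfolding ext_rels_def
 proof (elim UnE CollectE exE conjE)
  fix us u v vs assume r: "r = gen (us @ [u +[V] v] @ vs) - gen (us @ [u] @ vs) - gen (us @ [v] @ vs)"
   and *: "us:?S" "u:car V" "v:car V" "vs:?S"
  note m = mem[OF *(1) _ *(4)]
  note m' = m[OF add_cl[OF V *(2,3)]] m[OF *(2)] m[OF *(3)]
  show ?thesis
   unfolding r d[OF keys_diff_subset[OF k[OF m'(1)] k[OF m'(2)]] k[OF m'(3)]] d[OF k[OF m'(1)] k[OF m'(2)]]
    g[OF m'(1)] g[OF m'(2)] g[OF m'(3)] H(2)[OF *] cvs_add_diff[OF W H(1)[OF m'(2)] H(1)[OF m'(3)]]
   by (rule cvs_diff_self[OF W H(1)[OF m'(3)]])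
 next
  fix c us u vs assume r: "r = gen (us @ [c *[V] u] @ vs) - single (us @ [u] @ vs) c"
   and *: "us:?S" "u:car V" "vs:?S"
  note m = mem[OF *(1) _ *(3)]
  note m' = m[OF smult_cl[OF V *(2)]] m[OF *(2)]
  show ?thesis
   unfolding r d[OF k[OF m'(1)] k[OF m'(2)]] g[OF m'(1)] si[OF m'(2)] H(3)[OF *]
   by (rule cvs_diff_self[OF W smult_cl[OF W H(1)[OF m'(2)]]])
 next
  fix us u vs assume r: "r = gen (us @ [u, u] @ vs)" and *: "us:?S" "u:car V" "vs:?S"
  hence "us @ [u, u] @ vs:?S" by auto
  thus ?thesis unfolding r using g H(4)[OF *] by metis
 qed
 show ?thesis
  by (rule lin_eq_cspan[OF cvs_free_cvs W L linear_zero_map[OF W] ext_rels_subset])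
   (use base t in "auto simp: ext_ideal_def")
qed

lemma
 assumes W: "cvs W" and h: "alternating V W h"
 shows ext_lift_linear: "ext_lift W h:lin (ext_alg V) W"
  and ext_lift_wedge: "ws:lists (car V) ==> ext_lift W h (wg V ws) = h ws"
proof -
 have cl: "h:lists (car V) \<rightarrow> car W" using alternatingD(1)[OF h] by auto
 note O = on_coset_linear[OF cvs_free_cvs ext_ideal_subspace W lin_ext_linear[OF W cl] lin_ext_ext_ideal[OF W h]]
 show "ext_lift W h:lin (ext_alg V) W"
  using O(1) by (simp add: ext_lift_def linear_maps_def)
 show "ws:lists (car V) ==> ext_lift W h (wg V ws) = h ws"
  unfolding ext_lift_def wedge_list_def by (subst O(2)) (simp_all add: lin_ext_gen[OF W cl])
qed

lemma wedge_alternating: "alternating V (ext_alg V) (wg V)"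
proof -
 let ?F = "free_cvs (lists (car V))" and ?S = "lists (car V)"
 note F = cvs_free_cvs[of ?S] and I = ext_ideal_subspace
 have rel: "r:ext_rels V ==> r:ext_ideal V" for r unfolding ext_ideal_def by (rule cspan_base[OF F])
 have ad: "(ext_ideal V +>\<^bsub>?F\<^esub> gen p) <+>\<^bsub>?F\<^esub> (ext_ideal V +>\<^bsub>?F\<^esub> gen q) = ext_ideal V +>\<^bsub>?F\<^esub> (gen p + gen q)"
  if "p:?S" "q:?S" for p q
  using coset_add[OF F I, of "gen p" "gen q"] that by simp
 have sm: "c *[quot ?F (ext_ideal V)] (ext_ideal V +>\<^bsub>?F\<^esub> gen p) = ext_ideal V +>\<^bsub>?F\<^esub> (single p c)"
  if "p:?S" for p c
  using quot_smult[OF F I, of "gen p" c] that unfolding single_eq_scale_gen[of p c] by simp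
 have eq: "ext_ideal V +>\<^bsub>?F\<^esub> x = ext_ideal V +>\<^bsub>?F\<^esub> y"
  if "y:car ?F" "x - y:ext_rels V" for x y
  by (rule coset_eqI[OF F I rel[OF that(2)] that(1)]) simp
 show ?thesis
 proof (rule alternatingI)
  fix us u v vs assume *: "us:?S" "u:car V" "v:car V" "vs:?S"
  have r: "gen (us @ [u +[V] v] @ vs) - (gen (us @ [u] @ vs) + gen (us @ [v] @ vs)):ext_rels V"
   unfolding diff_diff_add[symmetric] ext_rels_def using * by blast
  have m: "us @ [u] @ vs:?S" "us @ [v] @ vs:?S" using * by auto
  hence "gen (us @ [u] @ vs) + gen (us @ [v] @ vs):car ?F" using add_cl[OF F, of "gen (us @ [u] @ vs)" "gen (us @ [v] @ vs)"] by simp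
  from eq[OF this r] show "wg V (us @ [u +[V] v] @ vs) = wg V (us @ [u] @ vs) +[ext_alg V] wg V (us @ [v] @ vs)"
   unfolding wedge_list_def ext_alg_simps quot_simps ad[OF m] .
 next
  fix c us u vs assume *: "us:?S" "u:car V" "vs:?S"
  have r: "gen (us @ [c *[V] u] @ vs) - single (us @ [u] @ vs) c:ext_rels V"
   unfolding ext_rels_def using * by blast
  have m: "us @ [u] @ vs:?S" using * by auto
  hence "single (us @ [u] @ vs) c:car ?F" by auto
  from eq[OF this r] show "wg V (us @ [c *[V] u] @ vs) = c *[ext_alg V] wg V (us @ [u] @ vs)"
   unfolding wedge_list_def ext_alg_simps sm[OF m] .
 next
  fix us u vs assume *: "us:?S" "u:car V" "vs:?S"
  have r: "gen (us @ [u, u] @ vs) - 0:ext_rels V" unfolding ext_rels_def diff_zero using * by blast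
  have "0:car ?F" by simp
  from eq[OF this r] show "wg V (us @ [u, u] @ vs) = 0[ext_alg V]"
   using coset_zero[OF F I] by (simp add: wedge_list_def)
 qed (rule wedge_list_closed)
qed

lemma ext_alg_span: "car (ext_alg V) = cspan (ext_alg V) (wg V ` lists (car V))"
proof -
 let ?F = "free_cvs (lists (car V))"
 have "car (ext_alg V) = (%x. ext_ideal V +>\<^bsub>?F\<^esub> x) ` cspan ?F (gen ` lists (car V))"
  unfolding ext_alg_simps quot_simps carrier_free_cvs_span ..
 also have "... = cspan (quot ?F (ext_ideal V)) ((%x. ext_ideal V +>\<^bsub>?F\<^esub> x) ` gen ` lists (car V))"
  by (rule linear_image_cspan[OF cvs_free_cvs cvs_quot[OF cvs_free_cvs ext_ideal_subspace]
    quot_class_linear[OF cvs_free_cvs ext_ideal_subspace]]) auto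
 also have "(%x. ext_ideal V +>\<^bsub>?F\<^esub> x) ` gen ` lists (car V) = wg V ` lists (car V)"
  by (auto simp: wedge_list_def)
 also have "cspan (quot ?F (ext_ideal V)) ... = cspan (ext_alg V) (wg V ` lists (car V))"
  by (rule cspan_cong[OF cvs_quot[OF cvs_free_cvs ext_ideal_subspace], symmetric]) simp_all
 finally show ?thesis .
qed

lemma ext_linear_eqI:
 assumes "cvs W" "f:lin (ext_alg V) W" "g:lin (ext_alg V) W"
  and "!!ws. ws:lists (car V) ==> f (wg V ws) = g (wg V ws)"
  and "x:car (ext_alg V)"
 shows "f x = g x"
 by (rule lin_eq_cspan[OF cvs_ext_alg assms(1-3), of "wg V ` lists (car V)"])
  (use assms(4,5) wedge_list_closed ext_alg_span in auto)

lemma alternating_prefix: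
 assumes h: "alternating V W h" and us: "us:lists (car V)"
 shows "alternating V W (%vs. h (us @ vs))" "alternating V W (%vs. h (vs @ us))"
proof -
 note H = alternatingD[OF h]
 have a: "us @ vs:lists (car V)" "vs @ us:lists (car V)" if "vs:lists (car V)" for vs using us that by auto
 show "alternating V W (%vs. h (us @ vs))"
 proof (rule alternatingI)
  fix c us' u vs assume *: "us':lists (car V)" "u:car V" "vs:lists (car V)"
  show "h (us @ us' @ [c *[V] u] @ vs) = c *[W] h (us @ us' @ [u] @ vs)"
   using H(3)[OF a(1)[OF *(1)] *(2,3)] by simp
  show "h (us @ us' @ [u, u] @ vs) = 0[W]" using H(4)[OF a(1)[OF *(1)] *(2,3)] by simp
  fix v assume "v:car V"
  thus "h (us @ us' @ [u +[V] v] @ vs) = h (us @ us' @ [u] @ vs) +[W] h (us @ us' @ [v] @ vs)"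
   using H(2)[OF a(1)[OF *(1)] *(2) _ *(3)] by simp
 qed (rule H(1)[OF a(1)])
 show "alternating V W (%vs. h (vs @ us))"
 proof (rule alternatingI)
  fix c us' u vs assume *: "us':lists (car V)" "u:car V" "vs:lists (car V)"
  show "h ((us' @ [c *[V] u] @ vs) @ us) = c *[W] h ((us' @ [u] @ vs) @ us)"
   using H(3)[OF *(1,2) a(2)[OF *(3)]] by simp
  show "h ((us' @ [u, u] @ vs) @ us) = 0[W]" using H(4)[OF *(1,2) a(2)[OF *(3)]] by simp
  fix v assume "v:car V"
  thus "h ((us' @ [u +[V] v] @ vs) @ us) = h ((us' @ [u] @ vs) @ us) +[W] h ((us' @ [v] @ vs) @ us)"
   using H(2)[OF *(1,2) _ a(2)[OF *(3)]] by simp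
 qed (rule H(1)[OF a(2)])
qed

lemma lin_ext_eqI:
 assumes W: "cvs W" and f: "f:lin (free_cvs S) W" and g: "g:lin (free_cvs S) W"
  and "!!s. s:S ==> f (gen s) = g (gen s)" and t: "t:car (free_cvs S)"
 shows "f t = g t"
 by (rule lin_eq_cspan[OF cvs_free_cvs W f g, of "gen ` S"])
  (use assms(4) t carrier_free_cvs_span[of S] in auto)

private abbreviation "LL == ext_alg V"
private abbreviation "QQ == quot (free_cvs (lists (car V))) (ext_ideal V)"
text \<open>Right multiplication by the class of \<open>t\<close>, with \<open>t\<close> still in
  the free space: the product of \<open>ext_alg\<close> is a nested lift, and its inner part is
  studied before \<open>t\<close> is replaced by its class. \<open>QQ\<close> is the quotient
  without product and unit, as it occurs in the definition of the product.\<close>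

private definition "RR t = ext_lift QQ (%us. lin_ext QQ (%vs. wg V (us @ vs)) t)"

private lemma QQ: "cvs QQ" by (rule cvs_quot[OF cvs_free_cvs ext_ideal_subspace])

private lemma wQ: "alternating V QQ (wg V)"
 using wedge_alternating by (simp add: alternating_def)

private lemma pre_lin: "us:lists (car V) ==> lin_ext QQ (%vs. wg V (us @ vs)):lin (free_cvs (lists (car V))) QQ"
 by (rule lin_ext_linear[OF QQ]) (use alternatingD(1)[OF alternating_prefix(1)[OF wQ]] in auto)

private lemma pre_gen: "us:lists (car V) ==> vs:lists (car V) ==> lin_ext QQ (%vs. wg V (us @ vs)) (gen vs) = wg V (us @ vs)"
 by (rule lin_ext_gen[OF QQ]) (use alternatingD(1)[OF alternating_prefix(1)[OF wQ]] in auto)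

private lemma RR_alt:
 assumes t: "t:car (free_cvs (lists (car V)))"
 shows "alternating V QQ (%us. lin_ext QQ (%vs. wg V (us @ vs)) t)"
proof (rule alternatingI)
 have W: "alternating V QQ (%us. wg V (us @ s))" if "s:lists (car V)" for s
  by (rule alternating_prefix(2)[OF wQ that])
 note W = alternatingD[OF W]
 show "lin_ext QQ (%vs. wg V (us @ vs)) t:car QQ" if "us:lists (car V)" for us
  by (rule lin_cl[OF pre_lin[OF that] t])
 fix us vs u assume *: "us:lists (car V)" "u:car V" "vs:lists (car V)"
 have m: "us @ [u] @ vs:lists (car V)" "us @ [u, u] @ vs:lists (car V)" using * by auto
 show "lin_ext QQ (%vsa. wg V ((us @ [c *[V] u] @ vs) @ vsa)) t = c *[QQ] lin_ext QQ (%vsa. wg V ((us @ [u] @ vs) @ vsa)) t" for c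
 proof -
  have m': "us @ [c *[V] u] @ vs:lists (car V)" using * smult_cl[OF V] by auto
  show ?thesis
   by (rule lin_ext_eqI[OF QQ pre_lin[OF m'] linear_scale[OF QQ pre_lin[OF m(1)]] _ t])
    (simp only: pre_gen[OF m'] pre_gen[OF m(1)] W(3)[OF _ *])
 qed
 show "lin_ext QQ (%vsa. wg V ((us @ [u, u] @ vs) @ vsa)) t = 0[QQ]"
  by (rule lin_ext_eqI[OF QQ pre_lin[OF m(2)] linear_zero_map[OF QQ] _ t])
   (simp only: pre_gen[OF m(2)] W(4)[OF _ *])
 fix v assume v: "v:car V"
 have m': "us @ [u +[V] v] @ vs:lists (car V)" "us @ [v] @ vs:lists (car V)" using * v add_cl[OF V] by auto
 show "lin_ext QQ (%vsa. wg V ((us @ [u +[V] v] @ vs) @ vsa)) t =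
   lin_ext QQ (%vsa. wg V ((us @ [u] @ vs) @ vsa)) t +[QQ] lin_ext QQ (%vsa. wg V ((us @ [v] @ vs) @ vsa)) t"
  by (rule lin_ext_eqI[OF QQ pre_lin[OF m'(1)] linear_plus[OF QQ pre_lin[OF m(1)] pre_lin[OF m'(2)]] _ t])
   (simp only: pre_gen[OF m'(1)] pre_gen[OF m'(2)] pre_gen[OF m(1)] W(2)[OF _ *(1,2) v *(3)])
qed

private lemma RR_linear: "t:car (free_cvs (lists (car V))) ==> RR t:lin LL QQ"
 unfolding RR_def by (rule ext_lift_linear[OF QQ RR_alt])

private lemma RR_wedge: "t:car (free_cvs (lists (car V))) ==> us:lists (car V) ==>
  RR t (wg V us) = lin_ext QQ (%vs. wg V (us @ vs)) t"
 unfolding RR_def by (rule ext_lift_wedge[OF QQ RR_alt])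

private lemma RR_linear2:
 assumes x: "x:car LL"
 shows "(%t. RR t x):lin (free_cvs (lists (car V))) QQ"
proof (rule linI)
 fix s t assume st: "s:car (free_cvs (lists (car V)))" "t:car (free_cvs (lists (car V)))"
 note c = add_cl[OF cvs_free_cvs st]
 show "RR (s +[free_cvs (lists (car V))] t) x = RR s x +[QQ] RR t x"
  by (rule ext_linear_eqI[OF QQ RR_linear[OF c] linear_plus[OF QQ RR_linear[OF st(1)] RR_linear[OF st(2)]] _ x])
   (simp only: RR_wedge[OF c] RR_wedge[OF st(1)] RR_wedge[OF st(2)] linear_add[OF pre_lin st])
next
 fix a t assume t: "t:car (free_cvs (lists (car V)))"
 note c = smult_cl[OF cvs_free_cvs t]
 show "RR (a *[free_cvs (lists (car V))] t) x = a *[QQ] RR t x"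
  by (rule ext_linear_eqI[OF QQ RR_linear[OF c] linear_scale[OF QQ RR_linear[OF t]] _ x])
   (simp only: RR_wedge[OF c] RR_wedge[OF t] linear_smult[OF pre_lin t])
qed (rule lin_cl[OF RR_linear x])

private lemma RR_ideal: "t:ext_ideal V ==> x:car LL ==> RR t x = 0[QQ]"
proof -
 assume t: "t:ext_ideal V" and x: "x:car LL"
 have t': "t:car (free_cvs (lists (car V)))" using t subD(5)[OF cvs_free_cvs ext_ideal_subspace] by blast
 show ?thesis
  by (rule ext_linear_eqI[OF QQ RR_linear[OF t'] linear_zero_map[OF QQ] _ x])
   (simp only: RR_wedge[OF t'] lin_ext_ext_ideal[OF QQ alternating_prefix(1)[OF wQ] t])
qed

private lemma mult_eq: "x **[LL] y = on_coset (%t. RR t x) y"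
 by (simp add: ext_alg_def Let_def RR_def ext_lift_def)

private lemma mult_on:
 assumes x: "x:car LL"
 shows "on_coset (%t. RR t x):lin QQ QQ"
  "t:car (free_cvs (lists (car V))) ==> on_coset (%t. RR t x) (ext_ideal V +>\<^bsub>free_cvs (lists (car V))\<^esub> t) = RR t x"
 using on_coset_linear[OF cvs_free_cvs ext_ideal_subspace QQ RR_linear2[OF x] RR_ideal[OF _ x]] by blast+

lemma ext_mulR: "x:car (ext_alg V) ==> (%y. x **[ext_alg V] y):lin (ext_alg V) (ext_alg V)"
 unfolding mult_eq using mult_on(1)[of x] by (simp add: linear_maps_def)

lemma ext_mulL: "y:car (ext_alg V) ==> (%x. x **[ext_alg V] y):lin (ext_alg V) (ext_alg V)"
proof -
 assume "y:car (ext_alg V)"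
 then obtain t where t: "t:car (free_cvs (lists (car V)))" "y = ext_ideal V +>\<^bsub>free_cvs (lists (car V))\<^esub> t" by auto
 have "x **[ext_alg V] y = RR t x" if "x:car LL" for x
  unfolding mult_eq t(2) by (rule mult_on(2)[OF that t(1)])
 moreover have "RR t:lin LL LL" using RR_linear[OF t(1)] by (simp add: linear_maps_def)
 ultimately show ?thesis by (simp add: linear_maps_def Pi_iff add_cl[OF cvs_ext_alg] smult_cl[OF cvs_ext_alg] del: ext_alg_simps)
qed

lemma wedge_mult:
 assumes "us:lists (car V)" "vs:lists (car V)"
 shows "wg V us **[ext_alg V] wg V vs = wg V (us @ vs)"
proof -
 have g: "gen vs:car (free_cvs (lists (car V)))" using assms by (intro gen_closed)
 note u = wedge_list_closed[OF assms(1)]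
 have "wg V us **[ext_alg V] wg V vs = RR (gen vs) (wg V us)"
  unfolding mult_eq wedge_list_def[of V vs] by (rule mult_on(2)[OF u g])
 thus ?thesis using RR_wedge[OF g assms(1)] pre_gen[OF assms] by simp
qed

lemmas ext_multD = linD[OF ext_mulR] linD(2,3)[OF ext_mulL]

lemma ext_assoc:
 assumes x: "x:car LL" and y: "y:car LL" and z: "z:car LL"
 shows "x **[LL] y **[LL] z = x **[LL] (y **[LL] z)"
proof -
 note C = cvs_ext_alg and R = ext_mulR and L = ext_mulL and w = wedge_list_closed
 have 1: "wg V us **[LL] wg V vs **[LL] z = wg V us **[LL] (wg V vs **[LL] z)"
  if "us:lists (car V)" "vs:lists (car V)" for us vs
  by (rule ext_linear_eqI[OF C R[OF lin_cl[OF R[OF w[OF that(1)]] w[OF that(2)]]] lin_comp[OF R[OF w[OF that(2)]] R[OF w[OF that(1)]]] _ z])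
   (use that in "simp add: wedge_mult del: ext_alg_simps")
 have 2: "wg V us **[LL] y **[LL] z = wg V us **[LL] (y **[LL] z)" if "us:lists (car V)" for us
  by (rule ext_linear_eqI[OF C lin_comp[OF R[OF w[OF that]] L[OF z]] lin_comp[OF L[OF z] R[OF w[OF that]]] 1[OF that] y])
 show ?thesis
  by (rule ext_linear_eqI[OF C lin_comp[OF L[OF y] L[OF z]] L[OF lin_cl[OF L[OF z] y]] 2 x])
qed

lemma calgebra_ext_alg: "calgebra (ext_alg V)"
proof -
 note C = cvs_ext_alg
 have one: "1[LL]:car LL" unfolding ext_alg_simps(5) by (rule wedge_list_closed) simp
 have l1: "1[LL] **[LL] x = x" if "x:car LL" for x
  by (rule ext_linear_eqI[OF C ext_mulR[OF one] linear_id _ that]) (simp add: wedge_mult)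
 have r1: "x **[LL] 1[LL] = x" if "x:car LL" for x
  by (rule ext_linear_eqI[OF C ext_mulL[OF one] linear_id _ that]) (simp add: wedge_mult)
 have "Group.monoid LL"
  by (rule monoidI; (rule lin_cl[OF ext_mulR] one l1 r1 ext_assoc)?; assumption)
 hence "ring LL"
  by (intro ringI cvs_abelian[OF C])
   (simp_all add: ext_multD(2) ext_multD(4) del: ext_alg_simps)
 thus ?thesis
  unfolding calgebra_def using C ext_multD(3,5) by blast
qed

lemma wedge_Cons: "v:car V ==> vs:lists (car V) ==> wg V (v # vs) = wg V [v] **[LL] wg V vs"
 by (subst wedge_mult) auto

lemma wedge1_linear: "(%v. wg V [v]):lin V LL"
proof (rule linI)
 note W = alternatingD[OF wedge_alternating]
 show "wg V [x]:car LL" if "x:car V" for x using that by (intro wedge_list_closed) auto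
 show "wg V [x +[V] y] = wg V [x] +[LL] wg V [y]" if "x:car V" "y:car V" for x y
  using W(2)[of "[]" x y "[]"] that by (simp del: ext_alg_simps)
 show "wg V [c *[V] x] = c *[LL] wg V [x]" if "x:car V" for c x
  using W(3)[of "[]" x "[]"] that by (simp del: ext_alg_simps)
qed

lemma wedge_square: "v:car V ==> wg V [v] **[LL] wg V [v] = 0[LL]"
 using alternatingD(4)[OF wedge_alternating, of "[]" v "[]"] by (simp add: wedge_mult del: ext_alg_simps)

text \<open>Expand \<open>(u + v) \<and> (u + v) = 0\<close>.\<close>

lemma wedge_anticomm:
 assumes "u:car V" "v:car V"
 shows "wg V [u] **[LL] wg V [v] = (-1) *[LL] (wg V [v] **[LL] wg V [u])"
proof -
 let ?w = "%v. wg V [v]"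
 note C = cvs_ext_alg and D = linD[OF wedge1_linear]
 have cl: "?w u:car LL" "?w v:car LL" using assms D(1) by auto
 note cl2 = ext_multD(1)[OF cl(1) cl(2)] ext_multD(1)[OF cl(2) cl(1)] ext_multD(1)[OF cl(1) cl(1)] ext_multD(1)[OF cl(2) cl(2)]
 have "0[LL] = ?w (u +[V] v) **[LL] ?w (u +[V] v)"
  using wedge_square[OF add_cl[OF V assms]] by simp
 also have "... = ?w u **[LL] ?w u +[LL] ?w v **[LL] ?w u +[LL] (?w u **[LL] ?w v +[LL] ?w v **[LL] ?w v)"
  unfolding D(2)[OF assms] using cl by (simp add: ext_multD(2)[OF add_cl[OF C]] ext_multD(4) del: ext_alg_simps)
 also have "... = ?w v **[LL] ?w u +[LL] ?w u **[LL] ?w v"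
  using cl2 by (simp add: wedge_square assms cvs_l_zero[OF C] cvs_r_zero[OF C] del: ext_alg_simps)
 finally have "0[LL] = ?w v **[LL] ?w u +[LL] ?w u **[LL] ?w v" .
 from cvs_add_left_imp_diff[OF C cl2(2,1) this] show ?thesis
  using cl2 by (simp add: cvs_l_zero[OF C] smult_cl[OF C] del: ext_alg_simps)
qed

lemma ext_power_gens: "U <= car V ==> {wg V vs | vs. vs:lists U & length vs = n} <= car LL"
 using lists_mono[of U "car V"] by (auto intro!: wedge_list_closed simp del: ext_alg_simps)

lemma ext_power_subspace: "U <= car V ==> csubspace (ext_power V U n) LL"
 unfolding ext_power_def by (rule cspan_sub[OF cvs_ext_alg ext_power_gens])

lemma ext_power_wedge: "vs:lists U ==> wg V vs:ext_power V U (length vs)"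
 unfolding ext_power_def by (rule cspan_base[OF cvs_ext_alg]) auto

lemma ext_power_eqI:
 assumes U: "U <= car V" and W: "cvs W" and f: "f:lin LL W" and g: "g:lin LL W"
  and eq: "!!vs. vs:lists U ==> length vs = n ==> f (wg V vs) = g (wg V vs)" and x: "x:ext_power V U n"
 shows "f x = g x"
 by (rule lin_eq_cspan[OF cvs_ext_alg W f g ext_power_gens[OF U] _ x[unfolded ext_power_def]]) (use eq in auto)

lemma ext_power_mapI:
 assumes U: "U <= car V" and W: "cvs W" and f: "f:lin LL W" and T: "csubspace T W"
  and "!!vs. vs:lists U ==> length vs = n ==> f (wg V vs):T" and x: "x:ext_power V U n"
 shows "f x:T"
proof -
 have "{wg V vs | vs. vs:lists U & length vs = n} <= {x:car LL. f x:T}"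
  using assms(5) ext_power_gens[OF U] by blast
 from cspan_minimal[OF cvs_ext_alg lin_vimage[OF cvs_ext_alg W f T] this]
 show ?thesis using x by (auto simp: ext_power_def)
qed

lemma ext_power_mono: "U <= U' ==> ext_power V U n <= ext_power V U' n"
 unfolding ext_power_def by (rule cspan_mono[OF cvs_ext_alg]) (auto dest: lists_mono)

lemma ext_power_mult:
 assumes U: "U <= car V" and x: "x:ext_power V U m" and y: "y:ext_power V U n"
 shows "x **[LL] y:ext_power V U (m + n)"
proof -
 note T = ext_power_subspace[OF U, of "m + n"]
 have U': "vs:lists (car V)" if "vs:lists U" for vs using that U by auto
 have y': "y:car LL" using y subD(5)[OF cvs_ext_alg ext_power_subspace[OF U]] by blast
 show ?thesis
 proof (rule ext_power_mapI[OF U cvs_ext_alg ext_mulL[OF y'] T _ x])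
  fix us assume us: "us:lists U" "length us = m"
  show "wg V us **[LL] y:ext_power V U (m + n)"
  proof (rule ext_power_mapI[OF U cvs_ext_alg ext_mulR[OF wedge_list_closed[OF U'[OF us(1)]]] T _ y])
   fix vs assume vs: "vs:lists U" "length vs = n"
   show "wg V us **[LL] wg V vs:ext_power V U (m + n)"
    using ext_power_wedge[of "us @ vs" U] us vs U' by (simp add: wedge_mult)
  qed
 qed
qed

text \<open>Each of the \<open>n\<close> letters that \<open>v\<close> passes contributes a
  sign.\<close>

lemma ext_power_comm:
 assumes v: "v:car V" and x: "x:ext_power V (car V) n"
 shows "wg V [v] **[LL] x = (-1) ^ n *[LL] (x **[LL] wg V [v])"
proof -
 note C = cvs_ext_alg and A = calgebraD[OF calgebra_ext_alg]
 have v': "wg V [v]:car LL" using v by (intro wedge_list_closed) auto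
 have "wg V [v] **[LL] wg V vs = (-1) ^ length vs *[LL] (wg V vs **[LL] wg V [v])"
  if "vs:lists (car V)" for vs
  using that
 proof (induction vs)
  case Nil
  thus ?case using v' A(5,6)[OF v'] by (simp add: cvs_smult_one[OF C] del: ext_alg_simps(1-4))
 next
  case (Cons u us)
  hence u: "u:car V" "us:lists (car V)" by auto
  have cl: "wg V [u]:car LL" "wg V us:car LL" using u by (auto intro!: wedge_list_closed simp del: ext_alg_simps)
  have "wg V [v] **[LL] wg V (u # us) = (wg V [v] **[LL] wg V [u]) **[LL] wg V us"
   unfolding wedge_Cons[OF u] using v' cl by (simp add: A(4) del: ext_alg_simps)
  also have "... = (-1) *[LL] (wg V [u] **[LL] (wg V [v] **[LL] wg V us))"
   unfolding wedge_anticomm[OF v u(1)] using v' cl by (simp add: A(3,4,9) del: ext_alg_simps)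
  also have "... = (-1) ^ length (u # us) *[LL] (wg V [u] **[LL] (wg V us **[LL] wg V [v]))"
   unfolding Cons.IH[simplified u(2) HOL.simp_thms, rule_format] using v' cl by (simp add: A(3,10) cvs_smult_smult[OF C] del: ext_alg_simps)
  also have "... = (-1) ^ length (u # us) *[LL] (wg V (u # us) **[LL] wg V [v])"
   unfolding wedge_Cons[OF u] using v' cl by (simp add: A(4) del: ext_alg_simps)
  finally show ?case .
 qed
 thus ?thesis
  by (intro ext_power_eqI[OF order_refl C ext_mulR[OF v'] linear_scale[OF C ext_mulL[OF v']] _ x]) auto
qed

text \<open>The relations preserve the length of words, hence selecting the words of one length is well defined.\<close>

definition "ext_proj n = ext_lift LL (%ws. if length ws = n then wg V ws else 0[LL])"

lemma length_alternating:
 assumes W: "cvs W" and h: "alternating V W h"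
 shows "alternating V W (%ws. if P (length ws) then h ws else 0[W])"
 using alternatingD[OF h] by (intro alternatingI) (auto simp: zero_cl[OF W] cvs_l_zero[OF W] cvs_smult_zero[OF W])

lemma ext_proj_linear: "ext_proj n:lin LL LL"
 unfolding ext_proj_def by (rule ext_lift_linear[OF cvs_ext_alg length_alternating[OF cvs_ext_alg wedge_alternating]])

lemma ext_proj_wedge: "ws:lists (car V) ==> ext_proj n (wg V ws) = (if length ws = n then wg V ws else 0[LL])"
 unfolding ext_proj_def by (rule ext_lift_wedge[OF cvs_ext_alg length_alternating[OF cvs_ext_alg wedge_alternating]])

lemma ext_proj_power: "x:ext_power V (car V) n ==> ext_proj m x = (if m = n then x else 0[LL])"
proof -
 assume x: "x:ext_power V (car V) n"
 have "(%x. if m = n then x else 0[LL]):lin LL LL"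
  using linear_id linear_zero_map[OF cvs_ext_alg] by (cases "m = n") (auto simp del: ext_alg_simps)
 from ext_power_eqI[OF order_refl cvs_ext_alg ext_proj_linear this _ x] show ?thesis
  by (auto simp: ext_proj_wedge simp del: ext_alg_simps)
qed

lemma ext_proj_mem: "x:car LL ==> ext_proj n x:ext_power V (car V) n"
proof -
 assume x: "x:car LL"
 note T = ext_power_subspace[OF order_refl, of n]
 have "wg V ` lists (car V) <= {x:car LL. ext_proj n x:ext_power V (car V) n}"
 proof (intro subsetI CollectI conjI; elim imageE; hypsubst)
  fix ws assume ws: "ws:lists (car V)"
  show "wg V ws:car LL" by (rule wedge_list_closed[OF ws])
  show "ext_proj n (wg V ws):ext_power V (car V) n"
   unfolding ext_proj_wedge[OF ws] using ext_power_wedge[OF ws] subD(2)[OF cvs_ext_alg T] by auto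
 qed
 from cspan_minimal[OF cvs_ext_alg lin_vimage[OF cvs_ext_alg cvs_ext_alg ext_proj_linear T] this]
 show ?thesis using x ext_alg_span by auto
qed

text \<open>The bound \<open>N\<close> depends on \<open>x\<close>; the claim for all
  \<open>M \<ge> N\<close> lets the bounds of two summands be merged.\<close>

lemma ext_proj_expand:
 assumes x: "x:car LL"
 shows "EX N. ALL M>=N. x = (finsum LL (%n. ext_proj n x) {..<M}) & ext_proj M x = 0[LL]"
proof -
 note C = cvs_ext_alg and P = linD[OF ext_proj_linear]
 interpret AG: abelian_group LL by (rule cvs_abelian[OF C])
 have x': "x:cspan LL (wg V ` lists (car V))" using x ext_alg_span by simp
 have sub: "wg V ` lists (car V) <= car LL" using wedge_list_closed by auto
 have lin: "(%x. \<Oplus>\<^bsub>LL\<^esub>n\<in>{..<M}. ext_proj n x):lin LL LL" for M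
  by (rule linear_finsum_maps[OF C C ext_proj_linear])
 note S = linD[OF lin]
 from C x' sub show ?thesis
 proof (induction rule: cspan_induct)
  case zero
  thus ?case using lin_zero[OF C C lin] lin_zero[OF C C ext_proj_linear] by auto
 next
  case (base s)
  then obtain ws where ws: "ws:lists (car V)" "s = wg V ws" by auto
  have "s = (finsum LL (%n. ext_proj n s) {..<M})" "ext_proj M s = 0[LL]" if "M >= Suc (length ws)" for M
  proof -
   have "(finsum LL (%n. ext_proj n s) {..<M}) = ext_proj (length ws) s"
    using that ws wedge_list_closed by (intro cvs_finsum_single[OF C]) (auto simp: ext_proj_wedge simp del: ext_alg_simps)
   thus "s = (finsum LL (%n. ext_proj n s) {..<M})" using ws by (simp add: ext_proj_wedge del: ext_alg_simps)
   show "ext_proj M s = 0[LL]" using that ws by (auto simp add: ext_proj_wedge simp del: ext_alg_simps)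
  qed
  thus ?case by blast
 next
  case (add x y)
  then obtain N N' where *: "ALL M>=N. x = (finsum LL (%n. ext_proj n x) {..<M}) & ext_proj M x = 0[LL]"
   "ALL M>=N'. y = (finsum LL (%n. ext_proj n y) {..<M}) & ext_proj M y = 0[LL]" by auto
  have cl: "x:car LL" "y:car LL" using add ext_alg_span by auto
  show ?case
  proof (intro exI[of _ "max N N'"] allI impI conjI)
   fix M assume "max N N' <= M"
   hence a: "(finsum LL (%n. ext_proj n x) {..<M}) = x" "(finsum LL (%n. ext_proj n y) {..<M}) = y"
    "ext_proj M x = 0[LL]" "ext_proj M y = 0[LL]" using * by (auto simp del: ext_alg_simps)
   show "x +[LL] y = (finsum LL (%n. ext_proj n (x +[LL] y)) {..<M})" unfolding S(2)[OF cl] a ..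
   show "ext_proj M (x +[LL] y) = 0[LL]" unfolding P(2)[OF cl] a by (rule AG.l_zero[OF AG.zero_closed])
  qed
 next
  case (smult c x)
  then obtain N where *: "ALL M>=N. x = (finsum LL (%n. ext_proj n x) {..<M}) & ext_proj M x = 0[LL]" by auto
  have cl: "x:car LL" using smult ext_alg_span by auto
  show ?case
  proof (intro exI[of _ N] allI impI conjI)
   fix M assume "N <= M"
   hence a: "(finsum LL (%n. ext_proj n x) {..<M}) = x" "ext_proj M x = 0[LL]" using * by (auto simp del: ext_alg_simps)
   show "c *[LL] x = (finsum LL (%n. ext_proj n (c *[LL] x)) {..<M})" unfolding S(3)[OF cl] a ..
   show "ext_proj M (c *[LL] x) = 0[LL]" unfolding P(3)[OF cl] a by (rule cvs_smult_zero[OF C])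
  qed
 qed
qed

lemma counit_alternating: "alternating V complex_vs (%ws. if ws = [] then 1 else 0)"
 by (rule alternatingI) auto

text \<open>The augmentation of the exterior algebra. It identifies degree 0 with the scalars and
  shows that the unit is not zero.\<close>

definition "ext_counit = ext_lift complex_vs (%ws :: 'v list. if ws = [] then 1 else 0)"

lemma ext_counit_linear: "ext_counit:lin LL complex_vs"
 unfolding ext_counit_def by (rule ext_lift_linear[OF cvs_complex_vs counit_alternating])

lemma ext_counit_one: "ext_counit 1[LL] = 1"
 unfolding ext_counit_def using ext_lift_wedge[OF cvs_complex_vs counit_alternating, of "[]"] by simp

lemma ext_power_0: "x:ext_power V U 0 ==> x = ext_counit x *[LL] 1[LL]"
proof -
 assume x: "x:ext_power V U 0"
 have g: "{wg V vs | vs. vs:lists U & length vs = 0} = {1[LL]}" by auto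
 have one: "1[LL]:car LL" by (rule calgebraD(2)[OF calgebra_ext_alg])
 obtain c where "x = c *[LL] 1[LL]"
  using x cspan_singleton[OF cvs_ext_alg one] unfolding ext_power_def g by auto
 thus ?thesis using func_simps(2)[OF ext_counit_linear one] ext_counit_one by simp
qed

end

declare ext_alg_simps [simp del]

section \<open>Functoriality of the exterior algebra\<close>

definition ext_map :: "(complex, 'v) module => (complex, 'u) module => ('v => 'u) =>
  ('v list \<Rightarrow>\<^sub>0 complex) set => ('u list \<Rightarrow>\<^sub>0 complex) set" where
 "ext_map V U phi = ext_lift (ext_alg U) (%vs. wg U (map phi vs))"

lemma ext_act_eq: "ext_act V act xi x = ext_map V V (%v. act v x) xi"
 by (simp add: ext_act_def ext_map_def ext_lift_def)

context
 fixes V :: "(complex, 'v) module" and U :: "(complex, 'u) module" and phi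
 assumes V: "cvs V" and U: "cvs U" and phi: "phi:lin V U"
begin

lemma map_lists_linear: "vs:lists (car V) ==> map phi vs:lists (car U)"
 using lin_cl[OF phi] by auto

lemma alternating_map: "alternating U W h ==> alternating V W (%vs. h (map phi vs))"
proof -
 assume "alternating U W h"
 note H = alternatingD[OF this] and m = map_lists_linear and p = lin_cl[OF phi]
 show ?thesis
  by (rule alternatingI) (simp_all only: map_append list.map linear_add[OF phi] linear_smult[OF phi] H m p)
qed

lemma ext_map_linear: "ext_map V U phi:lin (ext_alg V) (ext_alg U)"
 unfolding ext_map_def by (rule ext_lift_linear[OF V cvs_ext_alg[OF U] alternating_map[OF wedge_alternating[OF U]]])

lemma ext_map_wedge: "vs:lists (car V) ==> ext_map V U phi (wg V vs) = wg U (map phi vs)"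
 unfolding ext_map_def by (rule ext_lift_wedge[OF V cvs_ext_alg[OF U] alternating_map[OF wedge_alternating[OF U]]])

lemma ext_map_one: "ext_map V U phi 1[ext_alg V] = 1[ext_alg U]"
 using ext_map_wedge[of "[]"] by (simp add: ext_alg_simps(5))

lemma ext_map_mult:
 assumes x: "x:car (ext_alg V)" and y: "y:car (ext_alg V)"
 shows "ext_map V U phi (x **[ext_alg V] y) = ext_map V U phi x **[ext_alg U] ext_map V U phi y"
proof -
 note C = cvs_ext_alg[OF U] and w = wedge_list_closed[OF V] and f = ext_map_linear and fc = lin_cl[OF ext_map_linear]
 have 1: "ext_map V U phi (wg V us **[ext_alg V] y) = ext_map V U phi (wg V us) **[ext_alg U] ext_map V U phi y"
  if "us:lists (car V)" for us
  by (rule ext_linear_eqI[OF V C lin_comp[OF ext_mulR[OF V w[OF that]] f]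
     lin_comp[OF f ext_mulR[OF U fc[OF w[OF that]]]] _ y])
   (use that in "simp add: ext_map_wedge map_lists_linear wedge_mult[OF V] wedge_mult[OF U]")
 show ?thesis
  by (rule ext_linear_eqI[OF V C lin_comp[OF ext_mulL[OF V y] f]
     lin_comp[OF f ext_mulL[OF U fc[OF y]]] 1 x])
qed

lemma ext_map_power:
 assumes S: "S <= car V" "T <= car U" "phi ` S <= T" and x: "x:ext_power V S n"
 shows "ext_map V U phi x:ext_power U T n"
proof (rule ext_power_mapI[OF V S(1) cvs_ext_alg[OF U] ext_map_linear ext_power_subspace[OF U S(2)] _ x])
 fix vs assume vs: "vs:lists S" "length vs = n"
 hence "vs:lists (car V)" "map phi vs:lists T" using S by (auto simp: subset_iff image_subset_iff)
 thus "ext_map V U phi (wg V vs):ext_power U T n"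
  using ext_power_wedge[OF U, of "map phi vs" T] vs by (simp add: ext_map_wedge)
qed

end

lemma ext_map_compose:
 assumes V: "cvs V" and U: "cvs U" and W: "cvs W" and phi: "phi:lin V U" and \<psi>: "\<psi> : lin U W"
  and x: "x:car (ext_alg V)"
 shows "ext_map U W \<psi> (ext_map V U phi x) = ext_map V W (%v. \<psi> (phi v)) x"
 by (rule ext_linear_eqI[OF V cvs_ext_alg[OF W] lin_comp[OF ext_map_linear[OF V U phi] ext_map_linear[OF U W \<psi>]]
    ext_map_linear[OF V W lin_comp[OF phi \<psi>]] _ x])
  (simp add: ext_map_wedge[OF V U phi] ext_map_wedge[OF U W \<psi>] ext_map_wedge[OF V W lin_comp[OF phi \<psi>]]
   map_lists_linear[OF V U phi] comp_def)

lemma ext_map_id_on: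
 assumes V: "cvs V" and phi: "phi:lin V V" and S: "S <= car V" "!!v. v:S ==> phi v = v" and x: "x:ext_power V S n"
 shows "ext_map V V phi x = x"
proof (rule ext_power_eqI[OF V S(1) cvs_ext_alg[OF V] ext_map_linear[OF V V phi] linear_id _ x])
 fix vs assume vs: "vs:lists S"
 hence "map phi vs = vs" using S(2) by (auto intro: map_idI)
 thus "ext_map V V phi (wg V vs) = wg V vs"
  using ext_map_wedge[OF V V phi, of vs] vs lists_mono[OF S(1)] by auto
qed

lemma ext_map_id:
 assumes V: "cvs V" and phi: "phi:lin V V" "!!v. v:car V ==> phi v = v" and x: "x:car (ext_alg V)"
 shows "ext_map V V phi x = x"
proof (rule ext_linear_eqI[OF V cvs_ext_alg[OF V] ext_map_linear[OF V V phi(1)] linear_id _ x])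
 fix vs assume vs: "vs:lists (car V)"
 hence "map phi vs = vs" using phi(2) by (auto intro: map_idI)
 thus "ext_map V V phi (wg V vs) = wg V vs" by (simp add: ext_map_wedge[OF V V phi(1) vs])
qed

text \<open>Letters from the span are replaced by letters from \<open>S\<close> one at a time, from
  left to right; \<open>us\<close> is the part already replaced. For finite \<open>S\<close> this
  gives a finite spanning set.\<close>

lemma ext_power_span:
 assumes V: "cvs V" and S: "S <= car V"
 shows "ext_power V (cspan V S) n = cspan (ext_alg V) (wg V ` {vs:lists S. length vs = n})" (is "_ = ?T")
proof
 note C = cvs_ext_alg[OF V]
 have sub: "wg V ` {vs:lists S. length vs = n} <= car (ext_alg V)"
  using wedge_list_closed[OF V] lists_mono[OF S] by auto
 note T = cspan_sub[OF C sub]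
 have SV: "cspan V S <= car V" by (rule cspan_minimal[OF V csubspace_carrier[OF V] S])
 have "wg V (us @ ws):?T" if "us:lists S" "ws:lists (cspan V S)" "length us + length ws = n" for us ws
  using that
 proof (induction ws arbitrary: us)
  case Nil
  thus ?case by (auto intro!: cspan_base[OF C])
 next
  case (Cons w ws)
  have us: "us:lists (car V)" "ws:lists (car V)" using Cons.prems S SV by auto
  have lin: "(%v. wg V (us @ [v] @ ws)):lin V (ext_alg V)"
   by (rule linI) (use alternatingD[OF wedge_alternating[OF V]] us in auto)
  have "wg V (us @ [s] @ ws):?T" if "s:S" for s
   using Cons.IH[of "us @ [s]"] Cons.prems that by simp
  hence "S <= {x:car V. wg V (us @ [x] @ ws):?T}" using S by auto
  from cspan_minimal[OF V lin_vimage[OF V C lin T] this] show ?case using Cons.prems by auto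
 qed
 from this[of "[]"] show "ext_power V (cspan V S) n <= ?T"
  unfolding ext_power_def by (intro cspan_minimal[OF C T]) auto
 show "?T <= ext_power V (cspan V S) n"
  unfolding ext_power_def using cspan_superset[OF V, of S] by (intro cspan_mono[OF C]) auto
qed

section \<open>The filtration of an exterior algebra by a subspace, and contraction\<close>

definition "wedge_filt V W p n = cspan (ext_alg V) {wg V ws **[ext_alg V] u | ws u.
  ws:lists W & length ws = p & u:ext_power V (car V) (n - p) & p <= n}"

text \<open>\<open>contr lam\<close> is the composition of \<open>\<Lambda>V \<rightarrow> \<Lambda>V \<otimes> \<Lambda>V\<close>, the algebra map
 extending \<open>v \<mapsto> \<pi> v \<otimes> 1 + 1 \<otimes> \<pi>' v\<close> into the graded tensor product, with \<open>lam \<otimes> id\<close>.\<close>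

fun contr where
 "contr V \<pi> \<pi>' lam [] = lam 1[ext_alg V] *[ext_alg V] 1[ext_alg V]"
| "contr V \<pi> \<pi>' lam (v # vs) = contr V \<pi> \<pi>' (%xi. lam (wg V [\<pi> v] **[ext_alg V] xi)) vs +[ext_alg V]
  wg V [\<pi>' v] **[ext_alg V] contr V \<pi> \<pi>' (%xi. lam (ext_map V V (%v. (-1) *[V] v) xi)) vs"

context
 fixes V :: "(complex, 'v) module" and W \<pi> \<pi>'
 assumes V: "cvs V" and W: "csubspace W V" and \<pi>: "\<pi> : lin V V" and \<pi>': "\<pi>':lin V V"
  and \<pi>_W: "!!w. w:W ==> \<pi> w = w" and \<pi>_mem: "!!v. v:car V ==> \<pi> v:W"
  and \<pi>'_W: "!!w. w:W ==> \<pi>' w = 0[V]"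
  and split: "!!v. v:car V ==> v = \<pi> v +[V] \<pi>' v"
begin

private abbreviation "L == ext_alg V"
private abbreviation "w1 v == wg V [v]"
private abbreviation "wl == wg V"
text \<open>The grading involution, \<open>(-1)^n\<close> in degree \<open>n\<close>; it provides
  the signs of the graded tensor product.\<close>

private abbreviation "sg == ext_map V V (%v. (-1) *[V] v)"
private abbreviation "ctr == contr V \<pi> \<pi>'"
private abbreviation mulL (infixl \<open>**\<close> 70) where "x ** y == x **[L] y"
private abbreviation addL (infixl \<open>++\<close> 65) where "x ++ y == x +[L] y"
private abbreviation smulL (infixr \<open>\<cdot>\<close> 72) where "c \<cdot> y == c *[L] y"

private lemmas C = cvs_ext_alg[OF V]
private lemmas Alg = calgebraD[OF calgebra_ext_alg[OF V]]
private lemmas w1D = linD[OF wedge1_linear[OF V]]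
private lemmas piD = linD[OF \<pi>] linD[OF \<pi>']
private lemma neg: "(%v. (-1) *[V] v):lin V V" by (rule linear_scale[OF V linear_id])
private lemmas sgD = linD[OF ext_map_linear[OF V V neg]]
private lemmas cl = w1D(1)[OF piD(1)] w1D(1)[OF piD(4)]

private lemma sg_mult: "v:car V ==> x:car L ==> sg (w1 v ** x) = (-1) \<cdot> (w1 v ** sg x)"
 by (simp add: ext_map_mult[OF V V neg] w1D ext_map_wedge[OF V V neg] sgD Alg)

private lemma wl_nil: "wl [] = 1[L]" by (simp add: ext_alg_simps)

private lemma ctr_closed: "ws:lists (car V) ==> ctr lam ws:car L"
proof (induction ws arbitrary: lam)
 case Nil
 show ?case by (simp add: smult_cl[OF C Alg(2)])
next
 case (Cons a ws)
 thus ?case by (simp add: add_cl[OF C] Alg(3) cl)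
qed

private lemma ctr_cong: "ws:lists (car V) ==> (!!x. x:car L ==> lam x = mu x) ==> ctr lam ws = ctr mu ws"
proof (induction ws arbitrary: lam mu)
 case Nil
 thus ?case by (simp add: Alg(2))
next
 case (Cons a ws)
 have "ctr (%xi. lam (w1 (\<pi> a) ** xi)) ws = ctr (%xi. mu (w1 (\<pi> a) ** xi)) ws"
  "ctr (%xi. lam (sg xi)) ws = ctr (%xi. mu (sg xi)) ws"
  by (rule Cons.IH; use Cons.prems in "simp add: Alg(3) cl sgD")+
 thus ?case by simp
qed

private lemma ctr_add: "ws:lists (car V) ==> ctr (%xi. lam xi + mu xi) ws = ctr lam ws ++ ctr mu ws"
proof (induction ws arbitrary: lam mu)
 case Nil
 show ?case by (simp add: cvs_add_smult[OF C Alg(2)])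
next
 case (Cons a ws)
 interpret AG: abelian_group L by (rule cvs_abelian[OF C])
 show ?case using Cons by (simp add: Alg(3,8) cl ctr_closed AG.a_ac)
qed

private lemma ctr_scale: "ws:lists (car V) ==> ctr (%xi. c * lam xi) ws = c \<cdot> ctr lam ws"
proof (induction ws arbitrary: lam)
 case Nil
 show ?case by (simp add: cvs_smult_smult[OF C Alg(2)])
next
 case (Cons a ws)
 thus ?case by (simp add: Alg(3,10) cl ctr_closed cvs_smult_add[OF C])
qed

private lemma lin1: "lam:lin L complex_vs ==> v:car V ==> (%xi. lam (w1 v ** xi)):lin L complex_vs"
 by (rule lin_comp[OF ext_mulR[OF V w1D(1)]])

private lemma lin2: "lam:lin L complex_vs ==> (%xi. lam (sg xi)):lin L complex_vs"
 by (rule lin_comp[OF ext_map_linear[OF V V neg]])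

text \<open>This makes the contraction well defined on the exterior algebra. For a doubled letter
  the squares vanish, and the two mixed terms cancel by the sign that \<open>sg\<close> produces.
  The functional must vary in the inductions, since the recursion composes it with multiplications
  and with \<open>sg\<close>.\<close>

private lemma ctr_alternating: "lam:lin L complex_vs ==> alternating V L (ctr lam)"
proof (rule alternatingI)
 fix us u vs assume us: "us:lists (car V)" and u: "u:car V" and vs: "vs:lists (car V)"
 interpret AG: abelian_group L by (rule cvs_abelian[OF C])
 have cs: "vs:lists (car V) ==> ctr l vs:car L" for l vs by (rule ctr_closed)
 show "ctr lam (us @ [c *[V] u] @ vs) = c \<cdot> ctr lam (us @ [u] @ vs)" if "lam:lin L complex_vs" for c
  using that us
 proof (induction us arbitrary: lam)
  case Nil
  have "ctr (%xi. lam (w1 (\<pi> (c *[V] u)) ** xi)) vs = ctr (%xi. c * lam (w1 (\<pi> u) ** xi)) vs"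
   by (rule ctr_cong[OF vs]) (simp add: piD w1D u Alg(3,9) func_simps[OF Nil(1)])
  thus ?case by (simp add: ctr_scale vs piD w1D u Alg(3,9) cs cvs_smult_add[OF C])
 next
  case (Cons a us)
  thus ?case using u vs
   by (simp add: lin1 lin2 piD Alg(3,10) w1D cs cvs_smult_add[OF C] smult_cl[OF V])
 qed
 show "ctr lam (us @ [u, u] @ vs) = 0[L]" if "lam:lin L complex_vs"
  using that us
 proof (induction us arbitrary: lam)
  case Nil
  have sq: "w1 x ** (w1 x ** y) = 0[L]" if "x:car V" "y:car L" for x y
   using that by (simp add: Alg(4)[symmetric] w1D wedge_square[OF V] lin_zero[OF C C ext_mulL[OF V]])
  have 1: "ctr (%xi. lam (w1 (\<pi> u) ** (w1 (\<pi> u) ** xi))) vs = ctr (%xi. 0 * lam xi) vs"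
   by (rule ctr_cong[OF vs]) (use lin_zero[OF C cvs_complex_vs Nil(1)] in "simp add: sq piD u")
  have 2: "ctr (%xi. lam (sg (w1 (\<pi> u) ** xi))) vs = ctr (%xi. (-1) * lam (w1 (\<pi> u) ** sg xi)) vs"
   by (rule ctr_cong[OF vs]) (use func_simps(2)[OF Nil(1), of _ "-1"] in "simp add: sg_mult piD u Alg(3) w1D sgD")
  have cX: "ctr l vs:car L" for l by (rule ctr_closed[OF vs])
  note b = w1D(1)[OF piD(4)[OF u]]
  have "ctr lam ([] @ [u, u] @ vs) = w1 (\<pi>' u) ** ctr (%xi. lam (w1 (\<pi> u) ** sg xi)) vs ++ (-1) \<cdot> (w1 (\<pi>' u) ** ctr (%xi. lam (w1 (\<pi> u) ** sg xi)) vs)"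
   unfolding append_Nil append_Cons contr.simps 1 2 ctr_scale[OF vs]
   by (simp add: Alg(3,8,10) b cX sq piD u smult_cl[OF C] cvs_zero_smult[OF C] zero_cl[OF C] cvs_l_zero[OF C] cvs_r_zero[OF C])
  thus ?case by (simp add: cvs_diff_self[OF C] Alg(3) b cX)
 next
  case (Cons a us)
  have "0[L] ++ w1 (\<pi>' a) ** 0[L] = 0[L]"
   using Cons.prems(2) by (simp add: lin_zero[OF C C ext_mulR[OF V]] cl cvs_l_zero[OF C] zero_cl[OF C])
  thus ?case using Cons by (simp add: lin1 lin2 piD)
 qed
 fix v assume v: "v:car V"
 show "ctr lam (us @ [u +[V] v] @ vs) = ctr lam (us @ [u] @ vs) ++ ctr lam (us @ [v] @ vs)" if "lam:lin L complex_vs"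
  using that us
 proof (induction us arbitrary: lam)
  case Nil
  have "ctr (%xi. lam (w1 (\<pi> (u +[V] v)) ** xi)) vs = ctr (%xi. lam (w1 (\<pi> u) ** xi) + lam (w1 (\<pi> v) ** xi)) vs"
   by (rule ctr_cong[OF vs]) (simp add: piD w1D u v Alg(3,7) func_simps[OF Nil(1)])
  thus ?case by (simp add: ctr_add vs piD w1D u v Alg(3,7) cs AG.a_ac)
 next
  case (Cons a us)
  thus ?case using u v vs
   by (simp add: lin1 lin2 piD Alg(3,8) w1D cs add_cl[OF V] AG.a_ac)
 qed
qed (rule ctr_closed)

text \<open>Letters from \<open>W\<close> are killed by \<open>\<pi>'\<close>, so all of them go
  into the functional.\<close>

private lemma ctr_prefix:
 assumes us: "us:lists (car V)"
 shows "ws:lists W ==> ctr lam (ws @ us) = ctr (%xi. lam (wl ws ** xi)) us"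
proof (induction ws arbitrary: lam)
 case Nil
 show ?case by (simp, rule ctr_cong[OF us]) (simp add: wl_nil Alg(5))
next
 case (Cons w ws)
 hence w: "w:W" "w:car V" "ws:lists W" "ws:lists (car V)" using subD(1)[OF V W] by auto
 have "ctr lam ((w # ws) @ us) = ctr (%xi. lam (w1 w ** (wl ws ** xi))) us"
  using w us Cons.IH[OF w(3)] lin_zero[OF V C wedge1_linear[OF V]]
  by (simp add: \<pi>_W \<pi>'_W lin_zero[OF C C ext_mulL[OF V]] ctr_closed cvs_r_zero[OF C])
 also have "... = ctr (%xi. lam (wl (w # ws) ** xi)) us"
  by (rule ctr_cong[OF us]) (simp add: wedge_Cons[OF V w(2,4)] Alg(4) w1D(1)[OF w(2)] wedge_list_closed[OF V w(4)])
 finally show ?case .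
qed

text \<open>A functional that vanishes on multiples of vectors of \<open>W\<close> sees nothing as
  soon as one letter goes through \<open>\<pi>\<close>. Only the term with all letters going through
  \<open>\<pi>'\<close> is left, and there the sign automorphism acts on the unit, which it
  fixes.\<close>

private lemma ctr_killed:
 assumes us: "us:lists (car V)" and mu: "mu:lin L complex_vs"
  "!!w x. w:W ==> x:car L ==> mu (w1 w ** x) = 0"
 shows "ctr mu us = mu 1[L] \<cdot> wl (map \<pi>' us)"
 using us mu
proof (induction us arbitrary: mu)
 case Nil
 thus ?case by (simp add: wl_nil)
next
 case (Cons u us)
 have u: "u:car V" "us:lists (car V)" using Cons.hyps by auto
 have Wc: "w:W ==> w:car V" for w using subD(1)[OF V W] by auto
 have 1: "ctr (%xi. mu (w1 (\<pi> u) ** xi)) us = ctr (%xi. 0 * mu xi) us"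
  by (rule ctr_cong[OF u(2)]) (simp add: Cons.prems \<pi>_mem u)
 have 2: "ctr (%xi. mu (sg xi)) us = mu (sg 1[L]) \<cdot> wl (map \<pi>' us)"
  by (rule Cons.IH[OF lin2[OF Cons.prems(1)]])
   (use func_simps(2)[OF Cons.prems(1), of _ "-1"] in "simp add: sg_mult Wc Cons.prems(2) Alg(3) w1D sgD")
 have m: "map \<pi>' us:lists (car V)" by (rule map_lists_linear[OF V V \<pi>' u(2)])
 show ?case
  unfolding contr.simps 1 2 ctr_scale[OF u(2)] ext_map_one[OF V V neg] list.map
  using wedge_Cons[OF V piD(4)[OF u(1)] m]
  by (simp add: cvs_zero_smult[OF C] ctr_closed[OF u(2)] cl u(1) wedge_list_closed[OF V m] Alg(3,10) smult_cl[OF C] cvs_l_zero[OF C])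
qed

private abbreviation "VW == V(|carrier := W|)"

private lemma VW: "cvs VW" by (rule sub_cvs[OF V W])

lemma incl_linear: "(%v. v):lin VW V"
 by (rule linI) (use subD(1)[OF V W] in auto)

lemma proj_linear: "\<pi> : lin V VW"
 by (rule linI) (simp_all add: \<pi>_mem piD)

private abbreviation "jj == ext_map VW V (%v. v)"
private abbreviation "PP == ext_map V VW \<pi>"

lemma wedge_filt_subspace: "csubspace (wedge_filt V W p n) (ext_alg V)"
 unfolding wedge_filt_def
proof (rule cspan_sub[OF C])
 have "wg V ws ** u:car L" if "ws:lists W" "u:ext_power V (car V) m" for ws u m
  using that lists_mono[OF subD(1)[OF V W]] subD(5)[OF C ext_power_subspace[OF V order_refl]]
  by (intro Alg(3) wedge_list_closed[OF V]) auto
 thus "{wg V ws ** u | ws u. ws:lists W & length ws = p & u:ext_power V (car V) (n - p) & p <= n} <= car L"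
  by blast
qed

lemma wedge_filt_base: "ws:lists W ==> length ws = p ==> u:ext_power V (car V) (n - p) ==> p <= n ==>
  wg V ws **[ext_alg V] u:wedge_filt V W p n"
 unfolding wedge_filt_def by (rule cspan_base[OF C]) auto

lemma wedge_filt_incl:
 assumes k: "k:ext_power VW W p" and u: "u:ext_power V (car V) (n - p)" and n: "p <= n"
 shows "ext_map VW V (%v. v) k **[ext_alg V] u:wedge_filt V W p n"
proof -
 have u': "u:car L" by (rule subD(5)[OF C ext_power_subspace[OF V order_refl] u])
 show ?thesis
  by (rule ext_power_mapI[OF VW _ C lin_comp[OF ext_map_linear[OF VW V incl_linear] ext_mulL[OF V u']] wedge_filt_subspace _ k])
   (use wedge_filt_base[OF _ _ u n] in "auto simp: ext_map_wedge[OF VW V incl_linear]")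
qed

lemma wedge_filt_kernel:
 assumes f: "cvs U" "f:lin (ext_alg V) U"
  and 0: "!!ws u. ws:lists W ==> length ws = p ==> u:car (ext_alg V) ==> f (wg V ws **[ext_alg V] u) = 0[U]"
  and x: "x:wedge_filt V W p n"
 shows "f x = 0[U]"
proof (rule lin_eq_cspan[OF C f(1,2) linear_zero_map[OF f(1)] _ _ x[unfolded wedge_filt_def]])
 show sub: "{wl ws ** u |ws u. ws:lists W & length ws = p & u:ext_power V (car V) (n - p) & p <= n} <= car L"
  using subD(1)[OF C wedge_filt_subspace[of p n]] wedge_filt_base by blast
qed (use 0 subD(5)[OF C ext_power_subspace[OF V order_refl]] in blast)

text \<open>In positive filtration degree every generator begins with a letter of \<open>W\<close>,
  and \<open>\<pi>'\<close> kills it.\<close>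

lemma wedge_filt_projection:
 assumes x: "x:wedge_filt V W (Suc p) n"
 shows "ext_map V V \<pi>' x = 0[ext_alg V]"
proof (rule wedge_filt_kernel[OF C ext_map_linear[OF V V \<pi>'] _ x])
 fix ws u assume ws: "ws:lists W" "length ws = Suc p" and u: "u:car L"
 then obtain a as where a: "ws = a # as" "a:W" "as:lists W" by (cases ws) auto
 have c: "a:car V" "as:lists (car V)" using a subD(1)[OF V W] by auto
 have "ext_map V V \<pi>' (w1 a) = 0[L]"
  using c a lin_zero[OF V C wedge1_linear[OF V]] by (simp add: ext_map_wedge[OF V V \<pi>'] \<pi>'_W)
 thus "ext_map V V \<pi>' (wl ws ** u) = 0[L]"
  unfolding a(1) wedge_Cons[OF V c]
  using lin_zero[OF C C ext_mulL[OF V]] lin_cl[OF ext_map_linear[OF V V \<pi>']] u w1D(1)[OF c(1)] wedge_list_closed[OF V c(2)]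
  by (simp add: ext_map_mult[OF V V \<pi>'] Alg(3))
qed

text \<open>By induction on words, \<open>v \<and> x - \<pi>'v \<and> \<Lambda>\<pi>'x = \<pi>v
  \<and> x + \<pi>'v \<and> (x - \<Lambda>\<pi>'x)\<close>, where \<open>\<Lambda>\<pi>'\<close> is
  the induced map. Together with \<open>wedge_filt_projection\<close> this identifies filtration
  step 1 with the kernel of \<open>\<Lambda>\<pi>'\<close>.\<close>

lemma wedge_filt_complement:
 assumes x: "x:ext_power V (car V) q"
 shows "x +[ext_alg V] (-1) *[ext_alg V] ext_map V V \<pi>' x:wedge_filt V W 1 q"
proof (rule ext_power_mapI[OF V order_refl C _ wedge_filt_subspace _ x])
 show "(%x. x ++ (-1) \<cdot> ext_map V V \<pi>' x):lin L L"
  by (intro linear_plus linear_scale linear_id C ext_map_linear[OF V V \<pi>'])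
 fix vs assume "vs:lists (car V)" "length vs = q"
 thus "wl vs ++ (-1) \<cdot> ext_map V V \<pi>' (wl vs):wedge_filt V W 1 q"
 proof (induction vs arbitrary: q)
  case Nil
  thus ?case using subD(2)[OF C wedge_filt_subspace]
   by (simp add: wl_nil ext_map_one[OF V V \<pi>'] cvs_diff_self[OF C Alg(2)])
 next
  case (Cons v vs)
  hence v: "v:car V" "vs:lists (car V)" by auto
  interpret AG: abelian_group L by (rule cvs_abelian[OF C])
  let ?y = "wl vs ++ (-1) \<cdot> ext_map V V \<pi>' (wl vs)"
  note S = subD[OF C wedge_filt_subspace[of 1 q]]
  note m = wedge_list_closed[OF V map_lists_linear[OF V V \<pi>' v(2)]] and wv = wedge_list_closed[OF V v(2)] and a = cl[OF v(1)]
  have y: "?y:wedge_filt V W 1 (length vs)" by (rule Cons.IH[OF refl])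
  \<comment> \<open>Multiplication by \<open>\<pi>' v\<close> from the left preserves the
    filtration: it is moved behind the leading letter of \<open>W\<close> at the cost of a
    sign.\<close>
  have "w1 (\<pi>' v) ** ?y:wedge_filt V W 1 q"
  proof -
   have "w1 (\<pi>' v) ** (wl ws ** u):wedge_filt V W 1 q"
    if ws: "ws:lists W" "length ws = 1" and u: "u:ext_power V (car V) (length vs - 1)" and q: "1 <= length vs" for ws u
   proof -
    have u': "u:car L" by (rule subD(5)[OF C ext_power_subspace[OF V order_refl] u])
    obtain w where w: "ws = [w]" "w:W" using ws by (auto simp: length_Suc_conv)
    have wc: "w:car V" "w1 w:car L" using w subD(1)[OF V W] w1D(1) by auto
    have "w1 (\<pi>' v):ext_power V (car V) 1" using ext_power_wedge[OF V, of "[\<pi>' v]" "car V"] piD(4)[OF v(1)] by simp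
    from ext_power_mult[OF V order_refl this u] have f: "w1 w ** (w1 (\<pi>' v) ** u):wedge_filt V W 1 q"
     using wedge_filt_base[of "[w]" 1 _ q] w q Cons.prems by (cases "length vs") auto
    have "w1 (\<pi>' v) ** (w1 w ** u) = (-1) \<cdot> (w1 w ** (w1 (\<pi>' v) ** u))"
     unfolding Alg(4)[OF a(2) wc(2) u', symmetric] Alg(4)[OF wc(2) a(2) u', symmetric] wedge_anticomm[OF V piD(4)[OF v(1)] wc(1)]
     by (rule Alg(9)[OF Alg(3)[OF wc(2) a(2)] u'])
    thus ?thesis using S(4)[OF f] w by simp
   qed
   moreover have "wl ws ** u:car L" if "ws:lists W" "u:ext_power V (car V) m" for ws u m
    using that lists_mono[OF subD(1)[OF V W]] subD(5)[OF C ext_power_subspace[OF V order_refl]]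
    by (intro Alg(3) wedge_list_closed[OF V]) auto
   ultimately have "wedge_filt V W 1 (length vs) <= {x:car L. w1 (\<pi>' v) ** x:wedge_filt V W 1 q}"
    unfolding wedge_filt_def[of V W 1 "length vs"]
    by (intro cspan_minimal[OF C] lin_vimage[OF C C ext_mulR[OF V a(2)] wedge_filt_subspace]) blast
   thus ?thesis using y by blast
  qed
  moreover have "w1 (\<pi> v) ** wl vs:wedge_filt V W 1 q"
   using wedge_filt_base[of "[\<pi> v]" 1 "wl vs" q] \<pi>_mem[OF v(1)] ext_power_wedge[OF V v(2)] Cons.prems by auto
  moreover have "wl (v # vs) ++ (-1) \<cdot> ext_map V V \<pi>' (wl (v # vs)) = w1 (\<pi> v) ** wl vs ++ w1 (\<pi>' v) ** ?y"
  proof -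
   have e: "w1 v = w1 (\<pi> v) ++ w1 (\<pi>' v)" using w1D(2)[OF piD(1)[OF v(1)] piD(4)[OF v(1)]] split[OF v(1)] by simp
   have "ext_map V V \<pi>' (wl (v # vs)) = w1 (\<pi>' v) ** wl (map \<pi>' vs)"
    using wedge_Cons[OF V piD(4)[OF v(1)] map_lists_linear[OF V V \<pi>' v(2)]] ext_map_wedge[OF V V \<pi>', of "v # vs"] v by simp
   thus ?thesis
    unfolding wedge_Cons[OF V v] e ext_map_wedge[OF V V \<pi>' v(2)]
    using a m wv by (simp add: Alg(3,7,8,10) smult_cl[OF C] AG.a_ac)
  qed
  ultimately show ?case using S(3) by simp
 qed
qed

text \<open>Contract with the coordinate functional of index \<open>i\<close>, composed with the
  projection of \<Lambda>V onto \<Lambda>W. The contraction vanishes on filtration step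
  \<open>p + 1\<close> and turns \<open>k \<and> x\<close>, with \<open>k\<close> of degree
  \<open>p\<close> in \<Lambda>W, into the multiple by \<open>phi k\<close> of the projected
  \<open>x\<close>. In the sum only the term of index \<open>i\<close> remains.\<close>

lemma wedge_independent:
 assumes I: "finite I" "I <= ext_power VW W p"
  and co: "!!i. i:I ==> co i:lin ((ext_alg VW)(|carrier := ext_power VW W p|)) complex_vs"
   "!!i k. i:I ==> k:I ==> co i k = (if k = i then 1 else 0)"
  and u: "!!i. i:I ==> u i:car (ext_alg V)"
  and mem: "(finsum (ext_alg V) (%i. ext_map VW V (%v. v) i **[ext_alg V] u i) I):wedge_filt V W (Suc p) n" and i: "i:I"
 shows "ext_map V V \<pi>' (u i) = 0[ext_alg V]"
proof -
 note CW = cvs_ext_alg[OF VW] and AlgW = calgebraD[OF calgebra_ext_alg[OF VW]]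
 note j = ext_map_linear[OF VW V incl_linear] and P = ext_map_linear[OF V VW proj_linear]
 note PD = linD[OF P] and wW = wedge_list_closed[OF VW]
 have pw: "ext_power VW W m = ext_power VW (car VW) m" for m by simp
 \<comment> \<open>The coordinate functional is given on degree \<open>p\<close> only; it is
   extended by zero to the other degrees.\<close>
 define phi where "phi x = co i (ext_proj VW p x)" for x
 have phi: "phi:lin (ext_alg VW) complex_vs"
  unfolding phi_def
  by (rule lin_comp[OF linear_corestrict[OF ext_proj_linear[OF VW]] co(1)[OF i]])
   (unfold pw image_subset_iff, intro ballI ext_proj_mem[OF VW])
 define lam where "lam x = phi (PP x)" for x
 have lam: "lam:lin L complex_vs" unfolding lam_def by (rule lin_comp[OF P phi])
 have P_wl: "PP (wl ws ** x) = wg VW ws **[ext_alg VW] PP x" if "ws:lists W" "x:car L" for ws x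
 proof -
  have ws: "ws:lists (car V)" "map \<pi> ws = ws"
   using that(1) subD(1)[OF V W] by (auto intro!: map_idI simp: \<pi>_W)
  show ?thesis
   unfolding ext_map_mult[OF V VW proj_linear wedge_list_closed[OF V ws(1)] that(2)] ext_map_wedge[OF V VW proj_linear ws(1)] ws(2) ..
 qed
 \<comment> \<open>All components of such a product have degree at least \<open>p + 1\<close>, while
   \<open>phi\<close> sees degree \<open>p\<close> only.\<close>
 have vanish: "phi (wg VW ws **[ext_alg VW] x) = 0" if ws: "ws:lists W" "length ws = Suc p" and x: "x:car (ext_alg VW)" for ws x
 proof -
  have wsl: "ws:lists (car VW)" using ws by simp
  have "ext_proj VW p (wg VW ws **[ext_alg VW] x) = 0[ext_alg VW]"
   by (rule ext_linear_eqI[OF VW CW lin_comp[OF ext_mulR[OF VW wW[OF wsl]] ext_proj_linear[OF VW]] linear_zero_map[OF CW] _ x])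
    (use ws in "auto simp: wedge_mult[OF VW] ext_proj_wedge[OF VW]")
  thus ?thesis unfolding phi_def
   using lin_zero[OF sub_cvs[OF CW ext_power_subspace[OF VW]] cvs_complex_vs co(1)[OF i]] by simp
 qed
 let ?c = "ext_lift L (ctr lam)"
 note c = ext_lift_linear[OF V C ctr_alternating[OF lam]] and cw = ext_lift_wedge[OF V C ctr_alternating[OF lam]]
 have Wl: "ws:lists W ==> ws:lists (car V)" for ws using subD(1)[OF V W] by auto
 have c0: "?c (wl ws ** x) = 0[L]" if ws: "ws:lists W" "length ws = Suc p" and x: "x:car L" for ws x
 proof (rule ext_linear_eqI[OF V C lin_comp[OF ext_mulR[OF V wedge_list_closed[OF V Wl[OF ws(1)]]] c] linear_zero_map[OF C] _ x])
  fix us assume us: "us:lists (car V)"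
  have "ctr lam (ws @ us) = ctr (%xi. 0 * lam xi) us"
   unfolding ctr_prefix[OF us ws(1)] by (rule ctr_cong[OF us]) (simp add: lam_def P_wl ws vanish PD)
  thus "?c (wl ws ** wl us) = 0[L]"
   using us Wl[OF ws(1)] cvs_zero_smult[OF C ctr_closed[OF us]] ctr_scale[OF us, of 0 lam] by (simp add: wedge_mult[OF V] cw)
 qed
 have cj: "?c (jj k ** x) = phi k \<cdot> ext_map V V \<pi>' x" if k: "k:ext_power VW W p" and x: "x:car L" for k x
 proof (rule ext_power_eqI[OF VW _ C lin_comp[OF lin_comp[OF j ext_mulL[OF V x]] c] _ _ k])
  show "(%k. phi k \<cdot> ext_map V V \<pi>' x):lin (ext_alg VW) L"
   using lin_cl[OF ext_map_linear[OF V V \<pi>'] x]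
   by (intro linI) (simp_all add: func_simps[OF phi] smult_cl[OF C] cvs_add_smult[OF C] cvs_smult_smult[OF C])
  fix ws assume ws: "ws:lists W" "length ws = p"
  have wsl: "ws:lists (car VW)" using ws by simp
  have "?c (wl ws ** x) = phi (wg VW ws) \<cdot> ext_map V V \<pi>' x"
  proof (rule ext_linear_eqI[OF V C lin_comp[OF ext_mulR[OF V wedge_list_closed[OF V Wl[OF ws(1)]]] c]
     linear_scale[OF C ext_map_linear[OF V V \<pi>']] _ x])
   fix us assume us: "us:lists (car V)"
   let ?mu = "%xi. lam (wl ws ** xi)"
   have mu: "?mu:lin L complex_vs"
    by (rule lin_comp[OF ext_mulR[OF V wedge_list_closed[OF V Wl[OF ws(1)]]] lam])
   \<comment> \<open>After \<open>p\<close> letters of \<open>W\<close> one more makes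
     \<open>p + 1\<close>, so the functional satisfies the assumption of
     \<open>ctr_killed\<close>.\<close>
   have "?mu (w1 w ** y) = 0" if w: "w:W" and y: "y:car L" for w y
   proof -
    have wv: "[w]:lists (car V)" "ws @ [w]:lists W" using w ws subD(1)[OF V W] by auto
    have "wl ws ** (w1 w ** y) = wl (ws @ [w]) ** y"
     using Alg(4)[OF wedge_list_closed[OF V Wl[OF ws(1)]] wedge_list_closed[OF V wv(1)] y] wedge_mult[OF V Wl[OF ws(1)] wv(1)] by simp
    thus ?thesis by (simp add: lam_def P_wl[OF wv(2) y] vanish[OF wv(2)] ws PD(1)[OF y])
   qed
   from ctr_killed[OF us mu this] have "ctr lam (ws @ us) = ?mu 1[L] \<cdot> wl (map \<pi>' us)" using ctr_prefix[OF us ws(1)] by simp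
   moreover have "?mu 1[L] = phi (wg VW ws)"
    unfolding lam_def P_wl[OF ws(1) Alg(2)] ext_map_one[OF V VW proj_linear] by (simp add: AlgW(6)[OF wW[OF wsl]])
   ultimately show "?c (wl ws ** wl us) = phi (wg VW ws) \<cdot> ext_map V V \<pi>' (wl us)"
    using us Wl[OF ws(1)] by (simp add: wedge_mult[OF V] cw ext_map_wedge[OF V V \<pi>'])
  qed
  thus "?c (jj (wg VW ws) ** x) = phi (wg VW ws) \<cdot> ext_map V V \<pi>' x"
   by (simp add: ext_map_wedge[OF VW V incl_linear wsl])
 qed simp
 have jk: "k:I ==> jj k ** u k:car L" for k
  using I(2) u subD(5)[OF CW ext_power_subspace[OF VW, of W]] lin_cl[OF j] by (intro Alg(3)) auto
 have "0[L] = ?c (finsum L (%k. jj k ** u k) I)"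
  by (rule wedge_filt_kernel[OF C c c0 mem, symmetric])
 also have "... = (finsum L (%k. ?c (jj k ** u k)) I)" by (rule lin_finsum[OF C C c jk])
 also have "... = ?c (jj i ** u i)"
 proof (rule cvs_finsum_single[OF C I(1) i])
  show "?c (jj i ** u i):car L" by (rule lin_cl[OF c jk[OF i]])
  fix k assume k: "k:I" "k ~= i"
  have "phi k = 0" unfolding phi_def using ext_proj_power[OF VW, of k p p] co(2)[OF i k(1)] k I(2) by auto
  thus "?c (jj k ** u k) = 0[L]"
   using cj[of k "u k"] k I(2) u by (auto simp: cvs_zero_smult[OF C] lin_cl[OF ext_map_linear[OF V V \<pi>']])
 qed
 also have "... = ext_map V V \<pi>' (u i)"
 proof -
  have "phi i = 1" unfolding phi_def using ext_proj_power[OF VW, of i p p] co(2)[OF i i] i I(2) by auto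
  thus ?thesis using cj[of i "u i"] i I(2) u[OF i]
   by (auto simp: cvs_smult_one[OF C] lin_cl[OF ext_map_linear[OF V V \<pi>']])
 qed
 finally show ?thesis ..
qed

end

section \<open>The calculus of a group representation\<close>

locale group_calc =
 fixes X :: "('x, 'z) monoid_scheme" and V :: "(complex, 'v) module" and act \<omega>
 assumes X: "group X" and rep: "right_representation X V act" and coc: "cocycle X V act \<omega>"
  and span: "car V = cspan V (\<omega> ` car X)"
begin

sublocale X: group X by (rule X)

abbreviation L where "L == ext_alg V"
abbreviation K where "K == group_calculus X V act \<omega>"
abbreviation Pw where "Pw == ext_power V (car V)"
abbreviation w1 where "w1 v == wg V [v]"
abbreviation mn where "mn == left_mono V"
abbreviation mulL (infixl \<open>**\<close> 70) where "x ** y == x **[L] y"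
abbreviation addL (infixl \<open>++\<close> 65) where "x ++ y == x +[L] y"
abbreviation smulL (infixr \<open>\<cdot>\<close> 72) where "c \<cdot> y == c *[L] y"
abbreviation mulK (infixl \<open>\<star>\<close> 70) where "f \<star> g == f **[K] g"
abbreviation actL (infixl \<open>\<lhd>\<close> 75) where "xi \<lhd> x == ext_act V act xi x"
abbreviation mulX (infixl \<open>*X\<close> 70) where "x *X y == x **[X] y"
abbreviation zeroL (\<open>0L\<close>) where "0L == 0[L]"
abbreviation supp where "supp f == {x. f x ~= 0L}"

lemma V: "cvs V" using rep by (simp add: right_representation_def)

lemma act: "x:car X ==> (%v. act v x):lin V V"
 "x:car X ==> y:car X ==> v:car V ==> act v (x *X y) = act (act v x) y"
 "v:car V ==> act v 1[X] = v"
 using rep by (auto simp: right_representation_def)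

lemma \<omega>: "x:car X ==> \<omega> x:car V"
 "x:car X ==> y:car X ==> \<omega> (x *X y) = act (\<omega> x) y +[V] \<omega> y"
 using coc by (auto simp: cocycle_def)

lemmas C = cvs_ext_alg[OF V] and Alg = calgebraD[OF calgebra_ext_alg[OF V]]
lemmas Cs = add_cl[OF C] smult_cl[OF C] zero_cl[OF C]
lemmas w1D = linD[OF wedge1_linear[OF V]]
lemmas Pw = subD[OF C ext_power_subspace[OF V order_refl]]
lemmas mulR = ext_mulR[OF V] and mulL = ext_mulL[OF V]
lemmas mul0 = lin_zero[OF C C mulR] lin_zero[OF C C mulL]

lemma act_linear: "x:car X ==> (%xi. xi \<lhd> x):lin L L"
 unfolding ext_act_eq by (rule ext_map_linear[OF V V act(1)])

lemmas actD = linD[OF act_linear] and act0 = lin_zero[OF C C act_linear]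

lemma act_mult: "x:car X ==> xi:car L ==> eta:car L ==> (xi ** eta) \<lhd> x = xi \<lhd> x ** eta \<lhd> x"
 unfolding ext_act_eq by (rule ext_map_mult[OF V V act(1)])

lemma act_one: "x:car X ==> 1[L] \<lhd> x = 1[L]"
 unfolding ext_act_eq by (rule ext_map_one[OF V V act(1)])

lemma act_w1: "x:car X ==> v:car V ==> w1 v \<lhd> x = w1 (act v x)"
 unfolding ext_act_eq by (simp add: ext_map_wedge[OF V V act(1)])

lemma act_power: "x:car X ==> xi:Pw n ==> xi \<lhd> x:Pw n"
 unfolding ext_act_eq using lin_cl[OF act(1)] by (intro ext_map_power[OF V V act(1)]) auto

lemma act_act: "x:car X ==> y:car X ==> xi:car L ==> xi \<lhd> (x *X y) = (xi \<lhd> x) \<lhd> y"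
 by (rule ext_linear_eqI[OF V C act_linear lin_comp[OF act_linear act_linear]])
  (auto simp: ext_act_eq ext_map_wedge[OF V V act(1)] map_lists_linear[OF V V act(1)] comp_def act(2)
   cong: map_cong intro!: arg_cong[of _ _ "wg V"])

lemma act_one_right: "xi:car L ==> xi \<lhd> 1[X] = xi"
 unfolding ext_act_eq by (rule ext_map_id[OF V act(1)]) (simp_all add: act(3))

lemma K_simps:
 "car K = {f. (ALL x. f x:car L) & finite (supp f) & supp f <= car X}"
 "zero K = (%x. 0L)" "add K = (%f g x. f x ++ g x)" "smult K = (%c f x. c \<cdot> f x)"
 "one K = mn 1[X] 1[L]"
 "forms K n = {f. (ALL x. f x:Pw n) & finite (supp f) & supp f <= car X}"
 "emb K = (%a x. lookup a x \<cdot> 1[L])"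
 "diff K = (%f x. if x:car X then w1 (\<omega> x) ** f x else 0L)"
 by (simp_all add: group_calculus_def Let_def)

lemma K_app: "(f +[K] g) x = f x ++ g x" "(c *[K] f) x = c \<cdot> f x"
 by (simp_all add: K_simps)

lemma K_D: "f:car K ==> f x:car L" "f:car K ==> finite (supp f)"
 "f:car K ==> f x ~= 0L ==> x:car X" "f:car K ==> x \<notin> car X ==> f x = 0L"
 by (auto simp: K_simps)

lemma K_I: "(!!x. f x:car L) ==> finite S ==> S <= car X ==> (!!x. x \<notin> S ==> f x = 0L) ==> f:car K"
 unfolding K_simps by (auto intro: finite_subset[of "supp f" S])

lemma cvs_K: "cvs K"
proof (rule cvsI)
 show "0[K]:car K" by (rule K_I[of _ "{}"]) (simp_all add: K_simps Cs)
 show "f +[K] g:car K" if "f:car K" "g:car K" for f g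
 proof (rule K_I[of _ "supp f \<union> supp g"])
  show "supp f \<union> supp g <= car X" using K_D(3)[OF that(1)] K_D(3)[OF that(2)] by blast
 qed (use K_D(1,2)[OF that(1)] K_D(1,2)[OF that(2)] in "auto simp: Cs K_simps(3) cvs_l_zero[OF C]")
 show "c *[K] f:car K" if "f:car K" for c f
  by (rule K_I[of _ "supp f"]) (use K_D(1-3)[OF that] in "auto simp: Cs K_simps(4) cvs_smult_zero[OF C]")
qed (simp_all add: K_simps fun_eq_iff cvs_l_zero[OF C] cvs_add_assoc[OF C] cvs_add_smult[OF C] cvs_smult_add[OF C]
  cvs_smult_smult[OF C] cvs_smult_one[OF C] cvs_zero_smult[OF C] cvs_add_comm[OF C])

lemma eval_linear: "(%f. f x):lin K L"
 by (rule linI) (rule K_D(1), simp_all add: K_simps(3,4))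

lemma finsum_eval: "(!!i. i:I ==> F i:car K) ==> (finsum K (%i. F i) I) x = (finsum L (%i. F i x) I)"
 using lin_finsum[OF cvs_K C eval_linear, of I F x] by simp

lemma mn_linear: "x:car X ==> mn x:lin L K"
proof -
 assume x: "x:car X"
 show "mn x:lin L K"
 proof (rule linI)
  show "mn x xi:car K" if "xi:car L" for xi
   by (rule K_I[of _ "{x}"]) (use that x in "auto simp: left_mono_def Cs")
 qed (auto simp: left_mono_def K_simps fun_eq_iff cvs_l_zero[OF C] Cs cvs_smult_zero[OF C])
qed

lemma K_expand:
 assumes f: "f:car K" and F: "finite F" "supp f <= F" "F <= car X"
 shows "f = (finsum K (%x. mn x (f x)) F)"
proof (rule ext)
 fix z
 have m: "x:F ==> mn x (f x):car K" for x using F lin_cl[OF mn_linear K_D(1)[OF f]] by auto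
 have cl: "x:F ==> mn x (f x) z:car L" for x by (rule K_D(1)[OF m])
 have ev: "(finsum K (%x. mn x (f x)) F) z = (finsum L (%x. mn x (f x) z) F)" by (rule finsum_eval[OF m])
 show "f z = (finsum K (%x. mn x (f x)) F) z"
  unfolding ev
 proof (rule cvs_eqI[OF C K_D(1)[OF f]])
  show "(finsum L (%x. mn x (f x) z) F):car L" by (rule cvs_finsum_closed[OF C]) (use cl in auto)
  fix phi assume phi: "phi:lin L complex_vs"
  have "phi (mn x (f x) z) = (if z = x then phi (f x) else 0)" for x
   using lin_zero[OF C cvs_complex_vs phi] by (simp add: left_mono_def)
  hence "(\<Sum>x\<in>F. phi (mn x (f x) z)) = (if z:F then phi (f z) else 0)" using F(1) by simp
  also have "... = phi (f z)" using F(2) lin_zero[OF C cvs_complex_vs phi] by (cases "f z = 0L") auto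
  finally show "phi (f z) = phi (finsum L (%x. mn x (f x) z) F)" by (simp only: functional_finsum[OF C phi cl])
 qed
qed

text \<open>With an exterior power for \<open>S\<close> this describes the forms of one degree, and
  with everything the whole algebra; linear statements are thereby reduced to monomials.\<close>

lemma K_span:
 assumes S: "csubspace S L"
 shows "{f:car K. ALL x. f x:S} = cspan K {mn x xi | x xi. x:car X & xi:S}" (is "?A = cspan K ?B")
proof
 note D = subD[OF C S]
 have B: "?B <= car K" using lin_cl[OF mn_linear] D(1) by auto
 show "?A <= cspan K ?B"
 proof
  fix f assume f: "f:?A"
  hence k: "f:car K" by auto
  have F: "supp f <= car X" using K_D(3)[OF k] by auto
  have "mn x (f x):cspan K ?B" if "x:supp f" for x using that F f by (intro cspan_base[OF cvs_K]) auto
  thus "f:cspan K ?B"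
   by (subst K_expand[OF k K_D(2)[OF k] order_refl F], intro csubspace_sum_closed[OF cvs_K cspan_sub[OF cvs_K B]])
 qed
 have "csubspace ?A K"
  using D zero_cl[OF cvs_K] add_cl[OF cvs_K] smult_cl[OF cvs_K]
  by (intro csubspaceI[OF cvs_K]) (auto simp: K_simps(2-4))
 moreover have "?B <= ?A" using B D(2) by (auto simp: left_mono_def)
 ultimately show "cspan K ?B <= ?A" by (rule cspan_minimal[OF cvs_K])
qed

lemma forms_eq: "forms K n = {f:car K. ALL x. f x:Pw n}"
 using Pw(5) by (auto simp: K_simps(1,6))

lemma forms_span: "forms K n = cspan K {mn x xi | x xi. x:car X & xi:Pw n}"
 unfolding forms_eq by (rule K_span[OF ext_power_subspace[OF V order_refl]])

lemma mn_closed: "x:car X ==> xi:car L ==> mn x xi:car K"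
 by (rule lin_cl[OF mn_linear])

lemma mn_forms: "x:car X ==> xi:Pw n ==> mn x xi:forms K n"
 unfolding forms_span by (rule cspan_base[OF cvs_K]) auto

lemma K_linear_eqI:
 assumes "cvs W" "f:lin K W" "g:lin K W"
  and "!!x xi. x:car X ==> xi:car L ==> f (mn x xi) = g (mn x xi)" and k: "k:car K"
 shows "f k = g k"
proof (rule lin_eq_cspan[OF cvs_K assms(1-3)])
 show "k:cspan K {mn x xi | x xi. x:car X & xi:car L}"
  using k K_D(1)[OF k] unfolding K_span[OF csubspace_carrier[OF C], symmetric] by simp
qed (use assms(4) mn_closed in auto)

lemma form_linear_eqI:
 assumes "cvs W" "f:lin K W" "g:lin K W"
  and "!!x xi. x:car X ==> xi:Pw n ==> f (mn x xi) = g (mn x xi)" and k: "k:forms K n"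
 shows "f k = g k"
 by (rule lin_eq_cspan[OF cvs_K assms(1-3) _ _ k[unfolded forms_span]]) (use assms(4) mn_closed Pw(5) in auto)

lemma form_linear_memI:
 assumes W: "cvs W" "f:lin K W" "csubspace T W"
  and "!!x xi. x:car X ==> xi:Pw n ==> f (mn x xi):T" and k: "k:forms K n"
 shows "f k:T"
 using cspan_minimal[OF cvs_K lin_vimage[OF cvs_K W], of "{mn x xi | x xi. x:car X & xi:Pw n}"]
  assms(4) mn_closed Pw(5) k unfolding forms_span by blast

lemma mult_term_linear:
 assumes "y:car X" "f:car K" "g:car K"
 shows "(%g. (f x \<lhd> y) ** g y):lin K L" "(%f. (f x \<lhd> y) ** g y):lin K L"
 using lin_comp[OF eval_linear[of y] mulR[OF actD(1)[OF assms(1) K_D(1)[OF assms(2)]]]]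
  lin_comp[OF lin_comp[OF eval_linear[of x] act_linear[OF assms(1)]] mulL[OF K_D(1)[OF assms(3)]]] by auto

text \<open>The product as a convolution. Its definition sums over pairs of support points, a set
  that varies with the factors; a fixed finite \<open>F\<close> around the support of
  \<open>f\<close> makes the bilinearity visible.\<close>

lemma mult_eq:
 assumes f: "f:car K" and g: "g:car K" and z: "z:car X" and F: "finite F" "supp f <= F" "F <= car X"
 shows "(f \<star> g) z = (finsum L (%x. (f x \<lhd> (inv[X] x *X z)) ** g (inv[X] x *X z)) F)"
proof -
 let ?P = "{(x, y). x:supp f & y:supp g & x *X y = z}"
 let ?t = "%x. (f x \<lhd> (inv[X] x *X z)) ** g (inv[X] x *X z)"
 have sX: "x:supp f ==> x:car X" "y:supp g ==> y:car X" for x y using K_D(3)[OF f] K_D(3)[OF g] by auto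
 have t: "x:F ==> ?t x:car L" for x
  using F z by (intro lin_cl[OF mult_term_linear(1)[OF _ f g] g]) auto
 have s: "p:?P ==> (f (fst p) \<lhd> snd p) ** g (snd p):car L" for p
 proof -
  assume "p:?P"
  hence "snd p:car X" by (intro sX(2)) (simp add: case_prod_beta)
  from lin_cl[OF mult_term_linear(1)[OF this f g] g] show ?thesis .
 qed
 have "(finsum L (%p. (f (fst p) \<lhd> snd p) ** g (snd p)) ?P) = (finsum L (%x. ?t x) F)"
 proof (rule cvs_eqI[OF C])
  fix phi assume phi: "phi:lin L complex_vs"
  have phi0: "phi 0L = 0" using lin_zero[OF C cvs_complex_vs phi] by simp
  have "(\<Sum>x\<in>F. phi (?t x)) = (\<Sum>x\<in>{x:F. f x ~= 0L & g (inv[X] x *X z) ~= 0L}. phi (?t x))"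
  proof (intro sum.mono_neutral_right[OF F(1)] ballI)
   fix x assume x: "x:F - {x:F. f x ~= 0L & g (inv[X] x *X z) ~= 0L}"
   hence "inv[X] x *X z:car X" using F z by auto
   thus "phi (?t x) = 0"
    using x mul0(1)[OF actD(1)[OF _ K_D(1)[OF f]]] mul0(2)[OF K_D(1)[OF g]] act0 by (auto simp: phi0)
  qed blast
  also have "... = (\<Sum>p\<in>?P. phi ((f (fst p) \<lhd> snd p) ** g (snd p)))"
   by (rule sum.reindex_bij_witness[where i = fst and j = "%x. (x, inv[X] x *X z)"])
    (use F sX z in "auto simp: X.m_assoc[symmetric] simp del: X.m_assoc del: equalityI")
  finally show "phi (finsum L (%p. (f (fst p) \<lhd> snd p) ** g (snd p)) ?P) = phi (finsum L (%x. ?t x) F)"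
   by (simp only: functional_finsum[OF C phi t] functional_finsum[OF C phi s])
 qed (rule cvs_finsum_closed[OF C], use t s in blast)+
 thus ?thesis by (simp add: group_calculus_def Let_def)
qed

lemma mult_closed:
 assumes f: "f:car K" and g: "g:car K"
 shows "f \<star> g:car K"
proof (rule K_I[of _ "(%(x, y). x *X y) ` (supp f \<times> supp g)"])
 have sX: "x:supp f ==> x:car X" "y:supp g ==> y:car X" for x y using K_D(3)[OF f] K_D(3)[OF g] by auto
 show "!!z. z \<notin> (%(x, y). x *X y) ` (supp f \<times> supp g) ==> (f \<star> g) z = 0L"
 proof -
  fix z assume that: "z \<notin> (%(x, y). x *X y) ` (supp f \<times> supp g)"
  have "{(x, y). x:supp f & y:supp g & x *X y = z} = {}" using that by auto
  thus "(f \<star> g) z = 0L" unfolding group_calculus_def Let_def calculus.simps ring.simps monoid.simps by (simp only: abelian_monoid.finsum_empty[OF abelian_group.axioms(1)[OF cvs_abelian[OF C]]])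
 qed
 show "(f \<star> g) z:car L" for z
  unfolding group_calculus_def Let_def calculus.simps ring.simps monoid.simps
 proof (rule cvs_finsum_closed[OF C], rule Pi_I)
  fix p assume "p:{(x, y). x:supp f & y:supp g & x *X y = z}"
  hence "snd p:car X" by (intro sX(2)) (simp add: case_prod_beta)
  from lin_cl[OF mult_term_linear(1)[OF this f g] g] show "(f (fst p) \<lhd> snd p) ** g (snd p):car L" .
 qed
qed (use K_D(2)[OF f] K_D(2)[OF g] K_D(3)[OF f] K_D(3)[OF g] in auto)

lemma mult_outside: "f:car K ==> g:car K ==> z \<notin> car X ==> (f \<star> g) z = 0L"
 using K_D(4)[OF mult_closed] .

lemma K_mult_linear:
 assumes f: "f:car K"
 shows K_mulR: "(%g. f \<star> g):lin K K" and K_mulL: "(%g. g \<star> f):lin K K"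
proof -
 have s: "g:car K ==> supp g <= car X" for g using K_D(3) by auto
 define T where "T z F g h = (finsum L (%x. (g x \<lhd> (inv[X] x *X z)) ** h (inv[X] x *X z)) F)" for z F g h
 have T: "T z F g:lin K L" "(%g. T z F g h):lin K L"
  if "F <= car X" "z:car X" "g:car K" "h:car K" for z F g h
  unfolding T_def using that by (intro linear_finsum_maps[OF cvs_K C] mult_term_linear[OF _ that(3,4)]; auto)+
 have eq: "(g \<star> h) z = (if z:car X then T z F g h else 0L)"
  if "g:car K" "h:car K" "finite F" "supp g <= F" "F <= car X" for g h z F
  using mult_eq[OF that(1,2) _ that(3-5)] mult_outside[OF that(1,2)] by (simp add: T_def)
 show "(%g. f \<star> g):lin K K"
 proof (rule linI[OF mult_closed[OF f]])
  note e = eq[OF f _ K_D(2)[OF f] order_refl s[OF f]]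
  fix g h assume gh: "g:car K" "h:car K"
  show "f \<star> (g +[K] h) = f \<star> g +[K] f \<star> h"
   by (rule ext) (simp add: e gh add_cl[OF cvs_K gh] linear_add[OF T(1)[OF s[OF f] _ f f] gh] K_app cvs_l_zero[OF C] Cs)
  show "f \<star> (c *[K] g) = c *[K] (f \<star> g)" for c
   by (rule ext) (simp add: e gh smult_cl[OF cvs_K gh(1)] linear_smult[OF T(1)[OF s[OF f] _ f f] gh(1)] K_app cvs_smult_zero[OF C])
 qed
 show "(%g. g \<star> f):lin K K"
 proof (rule linI[OF mult_closed[OF _ f]])
  fix g h assume gh: "g:car K" "h:car K"
  \<comment> \<open>One index set that covers the supports of both forms, of their sum and of their
    multiples.\<close>
  let ?F = "supp g \<union> supp h"
  have F: "finite ?F" "?F <= car X" using K_D(2) s gh by auto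
  have sub: "supp (g +[K] h) <= ?F" "supp (c *[K] g) <= ?F" for c
   by (auto simp: K_app cvs_l_zero[OF C] cvs_smult_zero[OF C] Cs)
  note e = eq[OF _ f F(1) _ F(2)]
  show "(g +[K] h) \<star> f = g \<star> f +[K] h \<star> f"
   by (rule ext) (simp add: e[OF add_cl[OF cvs_K gh] sub(1)] e[OF gh(1)] e[OF gh(2)] linear_add[OF T(2)[OF F(2) _ f f] gh] K_app(1)[where f = "g \<star> f"] cvs_l_zero[OF C] Cs)
  show "(c *[K] g) \<star> f = c *[K] (g \<star> f)" for c
   by (rule ext) (simp add: e[OF smult_cl[OF cvs_K gh(1)] sub(2)] e[OF gh(1)] linear_smult[OF T(2)[OF F(2) _ f f] gh(1)] K_app(2)[where f = "g \<star> f"] cvs_smult_zero[OF C])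
 qed
qed

lemma mn_mult:
 assumes x: "x:car X" "y:car X" and xi: "xi:car L" "eta:car L"
 shows "mn x xi \<star> mn y eta = mn (x *X y) ((xi \<lhd> y) ** eta)"
proof (rule ext)
 fix z
 note m = mn_closed[OF x(1) xi(1)] mn_closed[OF x(2) xi(2)]
 show "(mn x xi \<star> mn y eta) z = mn (x *X y) ((xi \<lhd> y) ** eta) z"
 proof (cases "z:car X")
  case True
  have iff: "inv[X] x *X z = y <-> z = x *X y" using X.inv_solve_left'[OF _ x(1) True, of y] x True by auto
  have i: "inv[X] x *X z:car X" using x True by simp
  have "(mn x xi \<star> mn y eta) z = (finsum L (%k. (mn x xi k \<lhd> (inv[X] k *X z)) ** mn y eta (inv[X] k *X z)) {x})"
   by (rule mult_eq[OF m True]) (use x in "auto simp: left_mono_def")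
  also have "... = (mn x xi x \<lhd> (inv[X] x *X z)) ** mn y eta (inv[X] x *X z)"
   by (rule cvs_finsum_single[OF C]) (use i m lin_cl[OF mult_term_linear(1)[OF i m] m(2)] in auto)
  finally show ?thesis using mul0(1)[OF actD(1)[OF i xi(1)]] iff by (auto simp: left_mono_def)
 next
  case False
  thus ?thesis using mult_outside[OF m] x by (auto simp: left_mono_def)
 qed
qed

end

text \<open>The group algebra will inherit its laws from the forms of degree 0, so that
  associativity is proved once, for forms.\<close>

lemma calgebra_pullback:
 assumes K: "calgebra K" and A: "cvs A" and e: "e:lin A K" "inj_on e (car A)"
  and cl: "1[A]:car A" "!!x y. x:car A ==> y:car A ==> x **[A] y:car A"
  and h: "e 1[A] = 1[K]" "!!x y. x:car A ==> y:car A ==> e (x **[A] y) = e x **[K] e y"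
 shows "calgebra A"
proof -
 note D = calgebraD[OF K] and eD = linD[OF e(1)] and c = add_cl[OF A] smult_cl[OF A] cl
 have eq: "x = y" if "e x = e y" "x:car A" "y:car A" for x y using that e(2) by (auto simp: inj_on_def)
 have "Group.monoid A" by (rule monoidI; (rule eq)?) (simp_all add: c h D(3-6) eD)
 have "ring A"
  by (rule ringI[OF cvs_abelian[OF A] \<open>Group.monoid A\<close>]; rule eq) (simp_all add: c h D(3,7,8) eD)
 moreover have "(c *[A] x) **[A] y = c *[A] (x **[A] y)" "x **[A] (c *[A] y) = c *[A] (x **[A] y)"
  if "x:car A" "y:car A" for c x y
  by (rule eq; simp add: that c h D(3,9,10) eD)+
 ultimately show ?thesis unfolding calgebra_def using A by blast
qed

context group_calc begin

lemma K_mult_assoc: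
 assumes f: "f:car K" and g: "g:car K" and h: "h:car K"
 shows "f \<star> g \<star> h = f \<star> (g \<star> h)"
proof -
 note m = mn_closed and c = mult_closed and lc = lin_comp
 have 1: "mn x xi \<star> mn y eta \<star> h = mn x xi \<star> (mn y eta \<star> h)"
  if "x:car X" "xi:car L" "y:car X" "eta:car L" for x y xi eta
  by (rule K_linear_eqI[OF cvs_K K_mulR[OF c[OF m[OF that(1,2)] m[OF that(3,4)]]] lc[OF K_mulR[OF m[OF that(3,4)]] K_mulR[OF m[OF that(1,2)]]] _ h])
   (use that in "simp add: mn_mult actD Alg(3,4) act_mult act_act X.m_assoc")
 have 2: "mn x xi \<star> g \<star> h = mn x xi \<star> (g \<star> h)" if "x:car X" "xi:car L" for x xi
  by (rule K_linear_eqI[OF cvs_K lc[OF K_mulR[OF m[OF that]] K_mulL[OF h]] lc[OF K_mulL[OF h] K_mulR[OF m[OF that]]] 1[OF that] g])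
 show ?thesis
  by (rule K_linear_eqI[OF cvs_K lc[OF K_mulL[OF g] K_mulL[OF h]] K_mulL[OF c[OF g h]] 2 f])
qed

lemma calgebra_K: "calgebra K"
proof -
 have one: "1[K]:car K" unfolding K_simps(5) by (rule mn_closed[OF X.one_closed Alg(2)])
 have l1: "1[K] \<star> f = f" if "f:car K" for f
  by (rule K_linear_eqI[OF cvs_K K_mulR[OF one] linear_id _ that]) (simp add: K_simps(5) mn_mult Alg(2,5) act_one)
 have r1: "f \<star> 1[K] = f" if "f:car K" for f
  by (rule K_linear_eqI[OF cvs_K K_mulL[OF one] linear_id _ that]) (simp add: K_simps(5) mn_mult Alg(2,6) act_one_right)
 have "Group.monoid K"
  by (rule monoidI; (rule mult_closed one l1 r1 K_mult_assoc)?; assumption)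
 hence "ring K"
  by (intro ringI cvs_abelian[OF cvs_K]; simp only: linear_add[OF K_mulR] linear_add[OF K_mulL])
 thus ?thesis
  unfolding calgebra_def using cvs_K linear_smult[OF K_mulR] linear_smult[OF K_mulL] by blast
qed

lemmas KA = calgebraD[OF calgebra_K]

abbreviation A where "A == group_alg X"

lemma A_simps:
 "car A = {a. keys a <= car X}" "one A = gen 1[X]" "zero A = 0" "add A = (+)"
 "smult A = (%c. Poly_Mapping.map ((*) c))"
 "mult A = (%a b. \<Sum>x\<in>keys a. \<Sum>y\<in>keys b.
  single (x *X y) (lookup a x * lookup b y))"
 by (simp_all add: group_alg_def)

lemma cvs_A: "cvs A"
 by (rule cvs_cong[OF cvs_free_cvs[of "car X"]]) (simp_all add: A_simps)

lemma one_nonzero: "c \<cdot> 1[L] = 0L <-> c = 0"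
proof
 assume "c \<cdot> 1[L] = 0L"
 hence "ext_counit (c \<cdot> 1[L]) = 0" using lin_zero[OF C cvs_complex_vs ext_counit_linear[OF V]] by simp
 thus "c = 0" by (simp add: func_simps[OF ext_counit_linear[OF V]] Alg(2) ext_counit_one[OF V])
qed (simp add: cvs_zero_smult[OF C Alg(2)])

lemma emb_app: "emb K a x = lookup a x \<cdot> 1[L]" by (simp add: K_simps)

lemma supp_emb: "supp (emb K a) = keys a"
 by (auto simp: emb_app one_nonzero in_keys_iff)

lemma one_power: "1[L]:Pw 0"
 using ext_power_wedge[OF V, of "[]" "car V"] by (simp add: ext_alg_simps(5))

lemma emb_forms: "a:car A ==> emb K a:forms K 0"
 using supp_emb[of a] Pw(4)[OF one_power] by (simp add: K_simps(6) emb_app A_simps)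

lemma forms_K: "xi:forms K n ==> xi:car K" by (simp add: forms_eq)

lemma emb_linear: "emb K:lin A K"
 by (rule linI)
  (rule forms_K[OF emb_forms], assumption, auto simp: K_simps(3,4,7) A_simps(4,5) lookup_add cvs_add_smult[OF C Alg(2)] cvs_smult_smult[OF C Alg(2)] del: equalityI)

lemma emb_inj: "inj_on (emb K) (car A)"
proof (rule inj_onI, rule poly_mapping_eqI)
 fix a b x assume "emb K a = emb K b"
 hence "ext_counit (emb K a x) = ext_counit (emb K b x)" by simp
 thus "lookup a x = lookup b x"
  by (simp add: emb_app func_simps[OF ext_counit_linear[OF V]] Alg(2) ext_counit_one[OF V])
qed

text \<open>The coefficients of a form of degree 0 are multiples of the unit, recovered by
  \<open>ext_counit\<close>, and finite support makes them an element of the group algebra.\<close>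

lemma emb_bij: "bij_betw (emb K) (car A) (forms K 0)"
 unfolding bij_betw_def
proof (intro conjI emb_inj subset_antisym subsetI)
 fix f assume f: "f:forms K 0"
 have fx: "f x = ext_counit (f x) \<cdot> 1[L]" for x using ext_power_0[OF V, of "f x" "car V"] f by (simp add: K_simps)
 hence "f x = 0L <-> ext_counit (f x) = 0" for x using one_nonzero by metis
 moreover have "finite (supp f)" "supp f <= car X" using f by (auto simp: K_simps del: equalityI)
 ultimately have fin: "finite {x. ext_counit (f x) ~= 0}" "{x. ext_counit (f x) ~= 0} <= car X" by auto
 let ?a = "Abs_poly_mapping (%x. ext_counit (f x))"
 have l: "lookup ?a = (%x. ext_counit (f x))" using fin(1) by simp
 have "?a:car A" using fin(2) by (auto simp: A_simps in_keys_iff l)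
 moreover have "f = emb K ?a" using fx by (auto simp: emb_app l fun_eq_iff)
 ultimately show "f:emb K ` car A" by blast
qed (use emb_forms in auto)

lemma gen_A: "x:car X ==> gen x:car A" by (simp add: A_simps)

lemma emb_gen: "emb K (gen x) = mn x 1[L]"
 by (rule ext) (simp add: emb_app left_mono_def lookup_single when_def cvs_smult_one[OF C Alg(2)] cvs_zero_smult[OF C Alg(2)])

lemma A_span: "car A = cspan A (gen ` car X)"
 using carrier_free_cvs_span[of "car X"] cspan_cong[OF cvs_free_cvs[of "car X"], of A "gen ` car X"] by (simp add: A_simps)

lemma A_mult_closed: "a:car A ==> b:car A ==> a **[A] b:car A"
proof -
 assume ab: "a:car A" "b:car A"
 have *: "keys (\<Sum>i\<in>I. f i) <= car X" if "!!i. i:I ==> keys (f i) <= car X"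
  for I and f :: "'x => 'x \<Rightarrow>\<^sub>0 complex"
  using that keys_sum[of f I] by blast
 show ?thesis
  unfolding A_simps mem_Collect_eq by (rule *, rule *) (use ab in "auto simp: A_simps split: if_splits")
qed

lemma emb_mult: "a:car A ==> b:car A ==> emb K (a **[A] b) = emb K a \<star> emb K b"
proof (rule ext)
 assume ab: "a:car A" "b:car A"
 fix z
 let ?P = "{(x, y). x:keys a & y:keys b & x *X y = z}"
 have lin: "(%c. c \<cdot> 1[L]):lin complex_vs L"
  by (rule linI) (simp_all add: Cs Alg(2) cvs_add_smult[OF C] cvs_smult_smult[OF C])
 have "?P = {p:keys a \<times> keys b. fst p *X snd p = z}" by auto
 hence "lookup (a **[A] b) z = (\<Sum>p\<in>?P. lookup a (fst p) * lookup b (snd p))"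
  by (simp add: A_simps lookup_sum lookup_single when_def sum.cartesian_product sum.inter_filter case_prod_beta)
 hence "emb K (a **[A] b) z = (finsum L (%p. (lookup a (fst p) * lookup b (snd p)) \<cdot> 1[L]) ?P)"
  using lin_finsum[OF cvs_complex_vs C lin, of ?P] by (simp add: emb_app finsum_complex_vs)
 also have "... = (finsum L (%p. (emb K a (fst p) \<lhd> snd p) ** emb K b (snd p)) ?P)"
 proof (rule cvs_finsum_cong[OF C])
  fix p assume "p:?P"
  hence "snd p:car X" using ab by (auto simp: A_simps)
  thus "(lookup a (fst p) * lookup b (snd p)) \<cdot> 1[L] = (emb K a (fst p) \<lhd> snd p) ** emb K b (snd p)"
   by (simp add: emb_app actD act_one Alg Cs cvs_smult_smult[OF C] mult.commute)
 next
  show "(%p. (emb K a (fst p) \<lhd> snd p) ** emb K b (snd p)):?P \<rightarrow> car L"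
   using ab by (auto simp: A_simps emb_app actD act_one Alg(2,3) Cs subset_iff)
 qed
 also have "... = (emb K a \<star> emb K b) z"
  by (simp add: group_calculus_def Let_def one_nonzero in_keys_iff)
 finally show "emb K (a **[A] b) z = (emb K a \<star> emb K b) z" .
qed

lemma emb_one: "emb K 1[A] = 1[K]" by (simp add: A_simps emb_gen K_simps(5))

lemma calgebra_A: "calgebra A"
 by (rule calgebra_pullback[OF calgebra_K cvs_A emb_linear emb_inj _ A_mult_closed emb_one emb_mult])
  (simp_all add: A_simps)

lemma diff_linear: "diff K:lin K K"
proof -
 have l: "x:car X ==> (%xi. w1 (\<omega> x) ** xi):lin L L" for x by (rule mulR[OF w1D(1)[OF \<omega>(1)]])
 show ?thesis
 proof (rule linI)
  fix f assume f: "f:car K"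
  show "diff K f:car K"
   by (rule K_I[of _ "supp f"])
    (use K_D(1-3)[OF f] lin_cl[OF l] in \<open>auto simp: K_simps(8) Cs mul0(1)[OF w1D(1)[OF \<omega>(1)]] del: equalityI\<close>)
  show "diff K (c *[K] f) = c *[K] diff K f" for c
   using K_D(1)[OF f] linear_smult[OF l] by (auto simp: K_simps(4,8) fun_eq_iff cvs_smult_zero[OF C] del: equalityI)
  fix g assume g: "g:car K"
  show "diff K (f +[K] g) = diff K f +[K] diff K g"
   using K_D(1)[OF f] K_D(1)[OF g] linear_add[OF l] by (auto simp: K_simps(3,8) fun_eq_iff cvs_l_zero[OF C] Cs del: equalityI)
 qed
qed

lemma diff_mn: "x:car X ==> xi:car L ==> diff K (mn x xi) = mn x (w1 (\<omega> x) ** xi)"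
 by (rule ext) (auto simp: K_simps(8) left_mono_def mul0(1)[OF w1D(1)[OF \<omega>(1)]] del: equalityI)

lemma w1_power: "v:car V ==> w1 v:Pw 1"
 using ext_power_wedge[OF V, of "[v]" "car V"] by simp

lemmas Pw_mult = ext_power_mult[OF V order_refl]

lemma forms_mult: "xi:forms K m ==> eta:forms K n ==> xi \<star> eta:forms K (m + n)"
proof -
 assume xi: "xi:forms K m" and eta: "eta:forms K n"
 have T: "csubspace (forms K (m + n)) K"
  unfolding forms_span by (rule cspan_sub[OF cvs_K]) (use mn_closed Pw(5) in auto)
 show ?thesis
 proof (rule form_linear_memI[OF cvs_K K_mulL[OF forms_K[OF eta]] T _ xi])
  fix x zeta assume x: "x:car X" "zeta:Pw m"
  show "mn x zeta \<star> eta:forms K (m + n)"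
   by (rule form_linear_memI[OF cvs_K K_mulR[OF mn_closed[OF x(1) Pw(5)[OF x(2)]]] T _ eta])
    (use x in "simp add: mn_mult Pw(5) mn_forms Pw_mult act_power")
 qed
qed

lemma forms_subspace: "csubspace (forms K n) K"
 unfolding forms_span by (rule cspan_sub[OF cvs_K]) (use mn_closed Pw(5) in auto)

lemma diff_forms: "xi:forms K n ==> diff K xi:forms K (Suc n)"
 by (rule form_linear_memI[OF cvs_K diff_linear forms_subspace])
  (use Pw_mult[OF w1_power[OF \<omega>(1)]] in "simp_all add: diff_mn Pw(5) mn_forms")

text \<open>Differentiating leaves the group element \<open>x\<close> unchanged, and
  \<open>\<omega>(x) \<and> \<omega>(x) = 0\<close>.\<close>

lemma diff_diff: "xi:car K ==> diff K (diff K xi) = 0[K]"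
proof (rule K_linear_eqI[OF cvs_K lin_comp[OF diff_linear diff_linear] linear_zero_map[OF cvs_K]])
 fix x xi assume x: "x:car X" "xi:car L"
 have "w1 (\<omega> x) ** (w1 (\<omega> x) ** xi) = 0L"
  using x by (simp add: Alg(4)[symmetric] w1D \<omega> wedge_square[OF V] mul0)
 thus "diff K (diff K (mn x xi)) = 0[K]"
  using x by (simp add: diff_mn Alg(3) w1D \<omega>) (simp add: left_mono_def K_simps)
qed

text \<open>On monomials the cocycle law
  \<open>\<omega>(xy) = \<omega>(x) \<lhd> y + \<omega>(y)\<close> gives the two terms; the sign
  arises when \<open>\<omega>(y)\<close> passes a form of degree \<open>n\<close>.\<close>

lemma diff_mult:
 assumes xi: "xi:forms K n" and eta: "eta:car K"
 shows "diff K (xi \<star> eta) = (diff K xi \<star> eta) +[K] ((-1) ^ n *[K] (xi \<star> diff K eta))"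
proof -
 note lc = lin_comp and d = diff_linear and dc = lin_cl[OF diff_linear]
 have 1: "diff K (mn x zeta \<star> eta) = (diff K (mn x zeta) \<star> eta) +[K] ((-1) ^ n *[K] (mn x zeta \<star> diff K eta))"
  if x: "x:car X" "zeta:Pw n" for x zeta
 proof -
  have z: "zeta:car L" by (rule Pw(5)[OF x(2)])
  note m = mn_closed[OF x(1) z]
  show ?thesis
  proof (rule K_linear_eqI[OF cvs_K lc[OF K_mulR[OF m] d] linear_plus[OF cvs_K K_mulR[OF dc[OF m]] linear_scale[OF cvs_K lc[OF d K_mulR[OF m]]]] _ eta])
   fix y \<theta> assume y: "y:car X" "\<theta> : car L"
   note cl = actD(1)[OF y(1) z] w1D(1)[OF \<omega>(1)[OF x(1)]] w1D(1)[OF \<omega>(1)[OF y(1)]] w1D(1)[OF lin_cl[OF act(1)[OF y(1)] \<omega>(1)[OF x(1)]]] y(2)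
   have "w1 (\<omega> (x *X y)) ** (zeta \<lhd> y ** \<theta>) = (w1 (\<omega> x) ** zeta) \<lhd> y ** \<theta> ++ (-1) ^ n \<cdot> (zeta \<lhd> y ** (w1 (\<omega> y) ** \<theta>))"
    using x y z cl ext_power_comm[OF V \<omega>(1)[OF y(1)] act_power[OF y(1) x(2)]]
    by (simp add: \<omega>(2) w1D(2) lin_cl[OF act(1)] \<omega>(1) Alg(3,7,9) Alg(4)[symmetric] act_mult act_w1)
   thus "diff K (mn x zeta \<star> mn y \<theta>) = (diff K (mn x zeta) \<star> mn y \<theta>) +[K] ((-1) ^ n *[K] (mn x zeta \<star> diff K (mn y \<theta>)))"
    using x y z cl by (simp add: mn_mult diff_mn Alg(3) actD linear_add[OF mn_linear] linear_smult[OF mn_linear] Cs)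
  qed
 qed
 show ?thesis
  by (rule form_linear_eqI[OF cvs_K lc[OF K_mulL[OF eta] d] linear_plus[OF cvs_K lc[OF d K_mulL[OF eta]] linear_scale[OF cvs_K K_mulL[OF dc[OF eta]]]] 1 xi])
qed

definition proj where "proj n f = (%x. ext_proj V n (f x))"

lemma proj_linear: "proj n:lin K K"
proof (rule linI)
 note P = linD[OF ext_proj_linear[OF V]] and P0 = lin_zero[OF C C ext_proj_linear[OF V]]
 fix f assume f: "f:car K"
 show "proj n f:car K"
  by (rule K_I[of _ "supp f"]) (use K_D(1-3)[OF f] in "auto simp: proj_def P P0")
 show "proj n (c *[K] f) = c *[K] proj n f" for c by (simp add: proj_def K_simps(4) P K_D(1)[OF f])
 fix g assume g: "g:car K"
 show "proj n (f +[K] g) = proj n f +[K] proj n g" by (simp add: proj_def K_simps(3) P K_D(1)[OF f] K_D(1)[OF g])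
qed

lemma proj_mem: "f:car K ==> proj n f:forms K n"
 using lin_cl[OF proj_linear] ext_proj_mem[OF V] K_D(1) unfolding forms_eq by (simp add: proj_def)

lemma proj_forms: "f:forms K m ==> proj n f = (if n = m then f else 0[K])"
 using ext_proj_power[OF V, of "f _" m n] by (auto simp: proj_def forms_eq K_simps(2) fun_eq_iff del: equalityI)

text \<open>Existence comes from the finite expansion of each coefficient; uniqueness holds because
  \<open>proj m\<close> picks the component of degree \<open>m\<close> out of any
  decomposition.\<close>

lemma grading:
 assumes w: "w:car K"
 shows "EX! f. (ALL n. f n:forms K n) & finite {n. f n ~= 0[K]} & w = (finsum K (%n. f n) {n. f n ~= 0[K]})"
proof (rule ex1I[of _ "%n. proj n w"])
 note pK = forms_K[OF proj_mem[OF w]]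
 have "EX N. ALL M>=N. w x = (finsum L (%n. ext_proj V n (w x)) {..<M}) & ext_proj V M (w x) = 0L" for x
  by (rule ext_proj_expand[OF V K_D(1)[OF w]])
 then obtain N where N: "!!x M. N x <= M ==> w x = (finsum L (%n. ext_proj V n (w x)) {..<M}) & ext_proj V M (w x) = 0L"
  by metis
 \<comment> \<open>The support is finite, so the bounds for the coefficients have a maximum; the
   inserted 0 covers the empty support.\<close>
 define M where "M = Max (insert 0 (N ` supp w))"
 have M: "x:supp w ==> N x <= M" for x unfolding M_def using K_D(2)[OF w] by (intro Max_ge) auto
 have big: "proj n w = 0[K]" if n: "M <= n" for n
 proof (rule ext)
  fix x
  show "proj n w x = 0[K] x"
   using N[of x n] M[of x] n lin_zero[OF C C ext_proj_linear[OF V]]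
   by (cases "w x = 0L") (auto simp: proj_def K_simps(2) del: equalityI)
 qed
 have sub: "{n. proj n w ~= 0[K]} <= {..<M}" using big by (force simp: not_le[symmetric])
 have fin: "finite {n. proj n w ~= 0[K]}" by (rule finite_subset[OF sub]) simp
 have "w = (finsum K (%n. proj n w) {..<M})"
 proof (rule ext)
  fix x
  have e: "(finsum K (%n. proj n w) {..<M}) x = (finsum L (%n. proj n w x) {..<M})" by (rule finsum_eval[OF pK])
  have "w x = (finsum L (%n. ext_proj V n (w x)) {..<M})"
  proof (cases "w x = 0L")
   case True
   have "(finsum L (%n. ext_proj V n (w x)) {..<M}) = (finsum L (%n. 0L) {..<M})"
    unfolding True lin_zero[OF C C ext_proj_linear[OF V]] ..
   also have "... = 0L" by (rule cvs_finsum_zero[OF C])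
   finally show ?thesis using True by simp
  qed (use N M in auto)
  thus "w x = (finsum K (%n. proj n w) {..<M}) x" unfolding e by (simp add: proj_def)
 qed
 also have "... = (finsum K (%n. proj n w) {n. proj n w ~= 0[K]})"
 proof (rule cvs_eqI[OF cvs_K])
  fix phi assume phi: "phi:lin K complex_vs"
  have "(\<Sum>n\<in>{..<M}. phi (proj n w)) = (\<Sum>n\<in>{n. proj n w ~= 0[K]}. phi (proj n w))"
   using sub lin_zero[OF cvs_K cvs_complex_vs phi] by (intro sum.mono_neutral_right) auto
  thus "phi (finsum K (%n. proj n w) {..<M}) = phi (finsum K (%n. proj n w) {n. proj n w ~= 0[K]})"
   by (simp only: functional_finsum[OF cvs_K phi pK])
 qed (rule cvs_finsum_closed[OF cvs_K], use pK in blast)+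
 finally show "(ALL n. proj n w:forms K n) & finite {n. proj n w ~= 0[K]} & w = (finsum K (%n. proj n w) {n. proj n w ~= 0[K]})"
  using fin proj_mem[OF w] by blast
next
 fix f assume "(ALL n. f n:forms K n) & finite {n. f n ~= 0[K]} & w = (finsum K (%n. f n) {n. f n ~= 0[K]})"
 hence f: "!!n. f n:forms K n" "finite {n. f n ~= 0[K]}" and we: "w = (finsum K (%n. f n) {n. f n ~= 0[K]})" by auto
 have sum: "proj m w = (finsum K (%n. proj m (f n)) {n. f n ~= 0[K]})" for m
  by (subst we, rule lin_finsum[OF cvs_K cvs_K proj_linear forms_K[OF f(1)]])
 show "f = (%n. proj n w)"
 proof (rule ext)
  fix m
  have p: "proj m (f n) = (if m = n then f n else 0[K])" for n by (rule proj_forms[OF f(1)])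
  show "f m = proj m w"
  proof (cases "f m = 0[K]")
   case True
   have z: "proj m (f n) = 0[K]" for n using p True by auto
   show ?thesis
    unfolding sum z True by (rule cvs_finsum_zero[OF cvs_K, symmetric])
  next
   case False
   have "(finsum K (%n. proj m (f n)) {n. f n ~= 0[K]}) = proj m (f m)"
    by (rule cvs_finsum_single[OF cvs_K f(2)]) (use False p forms_K[OF f(1)] in auto)
   thus ?thesis unfolding sum using p by simp
  qed
 qed
qed

lemma mn_factor:
 assumes x: "x:car X" and xi: "xi:car L"
 shows "emb K (gen x) \<star> mn 1[X] xi = mn x xi"
 using x xi by (simp add: emb_gen mn_mult Alg(2) act_one Alg(5))

lemma emb_diff: "x:car X ==> y:car X ==> emb K (gen (x *X inv[X] y)) \<star> diff K (emb K (gen y)) = mn x (w1 (\<omega> y))"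
 by (simp add: emb_gen diff_mn mn_mult Alg(2,3,5,6) act_one w1D \<omega> X.m_assoc)

text \<open>The forms \<open>x.\<omega>(y) = (x y^{-1}) dy\<close> of \<open>emb_diff\<close> span
  all 1-forms, because the values of \<open>\<omega>\<close> span \<open>V\<close>.\<close>

lemma forms_1: "forms K 1 = cspan K {emb K a' \<star> diff K (emb K a) | a a'. a:car A & a':car A}" (is "_ = cspan K ?S")
proof
 have S: "?S <= forms K 1" using forms_mult[OF emb_forms diff_forms[OF emb_forms]] by auto
 thus "cspan K ?S <= forms K 1" by (rule cspan_minimal[OF cvs_K forms_subspace])
 have T: "csubspace (cspan K ?S) K" by (rule cspan_sub[OF cvs_K]) (use S forms_K in blast)
 show "forms K 1 <= cspan K ?S"
 proof
  fix f assume f: "f:forms K 1"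
  show "f:cspan K ?S"
  proof (rule form_linear_memI[OF cvs_K linear_id T _ f])
   fix x xi assume x: "x:car X" and xi: "xi:Pw 1"
   have sub: "\<omega> ` car X <= car V" using \<omega>(1) by auto
   have "xi:cspan L (wg V ` {vs:lists (\<omega> ` car X). length vs = 1})"
    using xi ext_power_span[OF V sub, of 1] span by simp
   moreover have "wg V ` {vs:lists (\<omega> ` car X). length vs = 1} <= {xi:car L. mn x xi:cspan K ?S}"
   proof (rule image_subsetI, elim CollectE conjE)
    fix vs assume "vs:lists (\<omega> ` car X)" "length vs = 1"
    then obtain y where y: "vs = [\<omega> y]" "y:car X" by (auto simp: length_Suc_conv)
    have "mn x (w1 (\<omega> y)):cspan K ?S"
     unfolding emb_diff[OF x y(2), symmetric] using x y gen_A by (intro cspan_base[OF cvs_K]) blast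
    thus "wg V vs:{xi:car L. mn x xi:cspan K ?S}" using y w1D \<omega> by simp
   qed
   ultimately show "mn x xi:cspan K ?S"
    using cspan_minimal[OF C lin_vimage[OF C cvs_K mn_linear[OF x] T]] by blast
  qed
 qed
qed

text \<open>Words are built letter by letter from 1-forms \<open>1.v\<close> and then multiplied by
  a group element, which has degree 0.\<close>

lemma generated:
 assumes S: "csubspace S K" "forms K 0 \<union> forms K 1 <= S" "!!xi eta. xi:S ==> eta:S ==> xi \<star> eta:S"
 shows "car K <= S"
proof
 have 1: "mn 1[X] (wg V vs):S" if "vs:lists (car V)" for vs
  using that
 proof (induction vs)
  case Nil
  have "mn 1[X] (wg V []):forms K 0" using mn_forms[OF X.one_closed one_power] by (simp add: ext_alg_simps(5))
  thus ?case using S(2) by auto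
 next
  case (Cons v vs)
  hence v: "v:car V" "vs:lists (car V)" by auto
  have "mn 1[X] (w1 v):S" using mn_forms[OF X.one_closed w1_power[OF v(1)]] S(2) by auto
  from S(3)[OF this Cons.IH] show ?case
   using v wedge_list_closed[OF V v(2)] w1D(1)[OF v(1)] by (simp add: mn_mult act_one_right wedge_Cons[OF V v])
 qed
 fix k assume k: "k:car K"
 show "k:S"
 proof -
  have "mn x xi:S" if x: "x:car X" and xi: "xi:car L" for x xi
  proof -
   have "wg V ` lists (car V) <= {xi:car L. mn x xi:S}"
   proof (rule image_subsetI)
    fix vs assume vs: "vs:lists (car V)"
    have "emb K (gen x):S" using emb_forms[OF gen_A[OF x]] S(2) by auto
    from S(3)[OF this 1[OF vs]] show "wg V vs:{xi:car L. mn x xi:S}"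
     using mn_factor[OF x wedge_list_closed[OF V vs]] wedge_list_closed[OF V vs] by simp
   qed
   from cspan_minimal[OF C lin_vimage[OF C cvs_K mn_linear[OF x] S(1)] this] show ?thesis
    using xi ext_alg_span[OF V] by auto
  qed
  moreover have "k:cspan K {mn x xi | x xi. x:car X & xi:car L}"
   using k K_D(1)[OF k] unfolding K_span[OF csubspace_carrier[OF C], symmetric] by simp
  ultimately show ?thesis
   using cspan_minimal[OF cvs_K S(1), of "{mn x xi | x xi. x:car X & xi:car L}"] by blast
 qed
qed

theorem calculus: "differential_calculus A K"
 unfolding differential_calculus_def
 by (intro conjI allI ballI impI; (elim conjE)?;
   (rule calgebra_A calgebra_K forms_subspace grading forms_mult emb_linear emb_bij emb_one emb_mult diff_linear
    diff_forms diff_diff diff_mult forms_1 generated; (assumption | blast)))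

text \<open>Split off the last letter of each word.\<close>

lemma forms_generated:
 "forms K (Suc n) <= cspan K {xi \<star> xi' | xi xi'. xi:forms K n & xi':forms K 1}" (is "_ <= cspan K ?S")
proof
 have S: "?S <= car K" using forms_K[OF forms_mult] by blast
 note T = cspan_sub[OF cvs_K S]
 fix f assume f: "f:forms K (Suc n)"
 show "f:cspan K ?S"
 proof (rule form_linear_memI[OF cvs_K linear_id T _ f])
  fix x xi assume x: "x:car X" and xi: "xi:Pw (Suc n)"
  show "mn x xi:cspan K ?S"
  proof (rule ext_power_mapI[OF V order_refl cvs_K mn_linear[OF x] T _ xi])
   fix vs assume "vs:lists (car V)" "length vs = Suc n"
   then obtain us v where vs: "vs = us @ [v]" "us:lists (car V)" "v:car V" "length us = n"
    by (cases vs rule: rev_cases) auto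
   have w: "wg V us:Pw n" using ext_power_wedge[OF V vs(2)] vs by simp
   have "mn x (wg V vs) = mn x (wg V us) \<star> mn 1[X] (w1 v)"
    using x vs Pw(5)[OF w] wedge_mult[OF V vs(2), of "[v]"] w1D(1)[OF vs(3)] by (simp add: mn_mult act_one_right)
   thus "mn x (wg V vs):cspan K ?S"
    using mn_forms[OF x w] mn_forms[OF X.one_closed w1_power[OF vs(3)]] by (intro cspan_base[OF cvs_K]) blast
  qed
 qed
qed

lemma right_mono_eq: "x:car X ==> xi:car L ==> right_mono X V act \<omega> xi x = mn x (xi \<lhd> x)"
 by (simp add: right_mono_def emb_gen mn_mult Alg(2,6) actD)

text \<open>The reason why the forms \<open>1.\<xi>\<close> are closed.\<close>

lemma \<omega>_one: "\<omega> 1[X] = 0[V]"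
proof -
 have "\<omega> 1[X] = \<omega> 1[X] +[V] \<omega> 1[X]" using \<omega>(2)[OF X.one_closed X.one_closed] by (simp add: act(3) \<omega>(1))
 from cvs_add_left_imp_diff[OF V \<omega>(1)[OF X.one_closed] \<omega>(1)[OF X.one_closed] this] show ?thesis
  using cvs_diff_self[OF V \<omega>(1)[OF X.one_closed]] by simp
qed

end

section \<open>Projections\<close>

context
 fixes V :: "(complex, 'v) module" and ip :: "'v => 'v => complex"
 assumes V: "cvs V"
  and ip_add: "ALL u:car V. ALL u':car V. ALL v:car V. ip (u +[V] u') v = ip u v + ip u' v"
  and ip_smult: "ALL c. ALL u:car V. ALL v:car V. ip (c *[V] u) v = c * ip u v"
  and ip_cnj: "ALL u:car V. ALL v:car V. ip v u = cnj (ip u v)"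
  and ip_pos: "ALL u:car V. u ~= 0[V] --> Re (ip u u) > 0"
begin

private lemma ip_lin: "v:car V ==> (%u. ip u v):lin V complex_vs"
 by (rule linI) (use ip_add ip_smult in auto)

private lemma ip_swap: "u:car V ==> v:car V ==> ip u v = 0 ==> ip v u = 0"
 by (metis ip_cnj complex_cnj_zero)

text \<open>Gram-Schmidt, by induction on a finite spanning set. \<open>V\<close> itself may have
  infinite dimension; the finiteness of the spanning set of the subspace yields the
  decomposition.\<close>

lemma orthogonal_decomposition:
 assumes "finite S" "S <= car V" "v:car V"
 shows "EX w:cspan V S. EX t:car V. v = w +[V] t & (ALL u:cspan V S. ip t u = 0)"
 using assms
proof (induction S arbitrary: v rule: finite_induct)
 case empty
 have "csubspace {0[V]} V" by (rule csubspace_zero[OF V])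
 from cspan_minimal[OF V this, of "{}"] have "cspan V {} <= {0[V]}" by simp
 moreover have "0[V]:cspan V {}" using subD(2)[OF V cspan_sub[OF V]] by simp
 moreover have "ip v 0[V] = 0"
  using lin_zero[OF V cvs_complex_vs ip_lin[OF empty(2)]] by (intro ip_swap[OF zero_cl[OF V] empty(2)]) simp
 ultimately show ?case using empty by (intro bexI[of _ "0[V]"] bexI[of _ v]) (auto simp: cvs_l_zero[OF V])
next
 case (insert s S)
 have S: "S <= car V" "s:car V" using insert by auto
 interpret AG: abelian_group V by (rule cvs_abelian[OF V])
 note D = subD[OF V cspan_sub[OF V S(1)]] and DI = subD[OF V cspan_sub[OF V insert.prems(1)]]
 have sub: "cspan V S <= cspan V (insert s S)" by (rule cspan_mono[OF V]) auto
 obtain s0 s' where s: "s0:cspan V S" "s':car V" "s = s0 +[V] s'" "ALL u:cspan V S. ip s' u = 0"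
  using insert.IH[OF S] by blast
 obtain w t where w: "w:cspan V S" "t:car V" "v = w +[V] t" "ALL u:cspan V S. ip t u = 0"
  using insert.IH[OF S(1) insert.prems(2)] by blast
 have s0: "s0:car V" "w:car V" using D(5) s(1) w(1) by auto
 \<comment> \<open>The Gram-Schmidt coefficient that makes \<open>t - c s'\<close> orthogonal to
   \<open>s'\<close>. For \<open>s' = 0\<close> it is a division by zero, and the orthogonality is
   proved separately.\<close>
 define c where "c = ip t s' / ip s' s'"
 note cs = smult_cl[OF V s(2), of c] and cm = smult_cl[OF V s(2), of "- c"]
 have s'_mem: "s':cspan V (insert s S)"
 proof -
  have "s' = s +[V] (-1) *[V] s0" using cvs_add_diff[OF V s0(1) s(2)] s(3) by simp
  moreover have "s:cspan V (insert s S)" by (rule cspan_base[OF V]) simp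
  ultimately show ?thesis using DI(3,4) sub s(1) by auto
 qed
 define t' where "t' = t +[V] (- c) *[V] s'"
 have t': "t':car V" unfolding t'_def using w cm by simp
 have ipt: "ip t' u = ip t u - c * ip s' u" if "u:car V" for u
  unfolding t'_def using linear_add[OF ip_lin[OF that] w(2) cm] linear_smult[OF ip_lin[OF that] s(2)] by simp
 have z: "ip t' s' = 0"
 proof (cases "s' = 0[V]")
  case True
  show ?thesis unfolding True
   using lin_zero[OF V cvs_complex_vs ip_lin[OF t']] by (intro ip_swap[OF zero_cl[OF V] t']) simp
 next
  case False
  hence "ip s' s' ~= 0" using ip_pos s(2) by force
  thus ?thesis by (simp add: ipt s c_def)
 qed
 have o: "ip t' u = 0" if "u:cspan V S" for u using ipt[OF D(5)[OF that]] s(4) w(4) that by simp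
 have "insert s S <= {u:car V. ip u t':{0}}"
 proof
  fix x assume x: "x:insert s S"
  have "ip s t' = 0"
   unfolding s(3) using linear_add[OF ip_lin[OF t'] s0(1) s(2)] ip_swap[OF t' s0(1) o[OF s(1)]] ip_swap[OF t' s(2) z] by simp
  thus "x:{u:car V. ip u t':{0}}"
   using x S ip_swap[OF t' _ o[OF cspan_base[OF V]]] by auto
 qed
 moreover have "csubspace {u:car V. ip u t':{0}} V"
  using linear_kernel_subspace[OF V cvs_complex_vs ip_lin[OF t']] by simp
 ultimately have "cspan V (insert s S) <= {u:car V. ip u t':{0}}" by (intro cspan_minimal[OF V])
 hence "ALL u:cspan V (insert s S). ip t' u = 0" using ip_swap[OF _ t'] by auto
 moreover have "w +[V] c *[V] s':cspan V (insert s S)" using DI(3,4) s'_mem sub w(1) by auto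
 moreover have "v = (w +[V] c *[V] s') +[V] t'"
 proof -
  have "c *[V] s' +[V] (- c) *[V] s' = 0[V]"
   using cvs_add_smult[OF V s(2), of c "- c"] cvs_zero_smult[OF V s(2)] by simp
  hence "t +[V] (c *[V] s' +[V] (- c) *[V] s') = t" using w by simp
  thus ?thesis unfolding t'_def w(3) using s0 w cs cm by (simp add: AG.a_ac)
 qed
 ultimately show ?case using t' by blast
qed

lemma orthogonal_projections:
 assumes S: "finite S" "S <= car V" and W: "W = cspan V S" and Wp: "Wp = {v:car V. ALL w:W. ip v w = 0}"
 shows "csubspace Wp V" "W \<inter> Wp <= {0[V]}" "!!v. v:car V ==> EX w:W. EX t:Wp. v = w +[V] t"
proof -
 have WV: "w:W ==> w:car V" for w using subD(5)[OF V cspan_sub[OF V S(2)]] W by simp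
 show "csubspace Wp V"
  by (rule csubspaceI[OF V])
   (use ip_add ip_smult WV lin_zero[OF V cvs_complex_vs ip_lin] in
    \<open>auto simp: Wp zero_cl[OF V] add_cl[OF V] smult_cl[OF V]\<close>)
 show "W \<inter> Wp <= {0[V]}" using ip_pos by (force simp: Wp)
 show "EX w:W. EX t:Wp. v = w +[V] t" if "v:car V" for v
  using orthogonal_decomposition[OF S that] by (auto simp: W Wp)
qed

end

section \<open>The inclusion of a subgroup\<close>

text \<open>The inner product is represented by the two complementary projections that it
  yields.\<close>

locale subgroup_bundle = group_calc X V act \<omega>
 for X :: "('x, 'z) monoid_scheme" and V :: "(complex, 'v) module" and act \<omega> +
 fixes G and W Wp :: "'v set" and \<pi> \<pi>p
 assumes G: "subgroup G X" and fin: "finite G" and W_eq: "W = cspan V (\<omega> ` G)" and Wp: "csubspace Wp V"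
  and \<pi>: "\<pi> : lin V V" "!!v. v:car V ==> \<pi> v:W" "!!v. v:W ==> \<pi> v = v"
  and \<pi>p: "\<pi>p:lin V V" "!!v. v:car V ==> \<pi>p v:Wp" "!!v. v:Wp ==> \<pi>p v = v" "!!v. v:W ==> \<pi>p v = 0[V]"
  and split: "!!v. v:car V ==> v = \<pi> v +[V] \<pi>p v"
begin

abbreviation XG where "XG == X(|carrier := G|)"
abbreviation VW where "VW == V(|carrier := W|)"
abbreviation LW where "LW == ext_alg VW"
abbreviation B where "B == group_alg XG"
abbreviation KB where "KB == group_calculus XG VW act \<omega>"
abbreviation PwW where "PwW == ext_power VW W"
abbreviation mnW where "mnW == left_mono VW"
abbreviation jj where "jj == ext_map VW V (%v. v)"

lemma GX: "g:G ==> g:car X" using subgroup.subset[OF G] by auto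

lemma \<omega>GV: "\<omega> ` G <= car V" using GX \<omega>(1) by auto

lemma W: "csubspace W V" unfolding W_eq by (rule cspan_sub[OF V \<omega>GV])

lemmas WD = subD[OF V W] and WpD = subD[OF V Wp]

lemma VW: "cvs VW" by (rule sub_cvs[OF V W])

text \<open>\<open>\<omega>(h) \<lhd> g = \<omega>(hg) - \<omega>(g)\<close> by the cocycle
  law.\<close>

lemma W_stable: "g:G ==> v:W ==> act v g:W"
proof -
 assume g: "g:G" and v: "v:W"
 have "act (\<omega> h) g:W" if h: "h:G" for h
 proof -
  have m: "\<omega> (h *X g):W" "\<omega> g:W"
   using subgroup.m_closed[OF G h g] g unfolding W_eq by (auto intro!: cspan_base[OF V])
  have a: "act (\<omega> h) g:car V" by (rule lin_cl[OF act(1)[OF GX[OF g]] \<omega>(1)[OF GX[OF h]]])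
  have "act (\<omega> h) g = \<omega> (h *X g) +[V] (-1) *[V] \<omega> g"
   using cvs_add_diff[OF V WD(5)[OF m(2)] a] \<omega>(2)[OF GX[OF h] GX[OF g]] cvs_add_comm[OF V a WD(5)[OF m(2)]] by simp
  thus ?thesis using WD(3,4) m by auto
 qed
 hence "\<omega> ` G <= {v:car V. act v g:W}" using \<omega>GV by auto
 from cspan_minimal[OF V lin_vimage[OF V V act(1)[OF GX[OF g]] W] this] show ?thesis
  using v unfolding W_eq by blast
qed

text \<open>Makes the results on \<open>group_calc\<close> available for the calculus of
  \<open>G\<close>; stability of \<open>W\<close> turns it into a representation, and it is spanned
  by the values of \<open>\<omega>\<close> by its definition.\<close>

lemma G_data: "group_calc XG VW act \<omega>"
proof (rule group_calc.intro)
 show "group XG" by (rule subgroup.subgroup_is_group[OF G X])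
 show "right_representation XG VW act"
  unfolding right_representation_def using VW W_stable act WD(5) GX
  by (auto intro!: linI simp: linD[OF act(1)])
 show "cocycle XG VW act \<omega>"
  using \<omega>(2) GX by (auto simp: cocycle_def W_eq intro: cspan_base[OF V])
 have "\<omega> ` G <= W" unfolding W_eq by (rule cspan_superset[OF V])
 from cspan_of_subspace[OF V W this] show "car VW = cspan VW (\<omega> ` car XG)" by (simp add: W_eq)
qed

end

section \<open>The inclusion of the calculi, and coefficients to the left of group elements\<close>

context subgroup_bundle begin

lemmas GK = group_calc.K_simps[OF G_data, simplified]
lemmas GK_D = group_calc.K_D[OF G_data, simplified]
lemmas GK_app = group_calc.K_app[OF G_data]
lemmas cvs_KB = group_calc.cvs_K[OF G_data]
lemmas Gforms_eq = group_calc.forms_eq[OF G_data, simplified]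
lemmas GmnD = group_calc.mn_closed[OF G_data, simplified] group_calc.mn_forms[OF G_data, simplified]
lemmas Gmn_linear = group_calc.mn_linear[OF G_data, simplified]
lemmas Gmn_mult = group_calc.mn_mult[OF G_data, simplified]
lemmas GK_eqI = group_calc.K_linear_eqI[OF G_data, simplified]
lemmas Gforms_eqI = group_calc.form_linear_eqI[OF G_data, simplified]
lemmas Gforms_memI = group_calc.form_linear_memI[OF G_data, simplified]
lemmas GactD = group_calc.actD[OF G_data, simplified]
lemmas Gact_linear = group_calc.act_linear[OF G_data, simplified]
lemmas Gmul_linear = group_calc.K_mulR[OF G_data] group_calc.K_mulL[OF G_data]
lemmas Gact = group_calc.act_act[OF G_data, simplified] group_calc.act_power[OF G_data, simplified]
 group_calc.act_one_right[OF G_data, simplified]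
lemmas CW = cvs_ext_alg[OF VW] and AlgW = calgebraD[OF calgebra_ext_alg[OF VW]]

lemma incl: "(%v. v):lin VW V" by (rule linI) (simp_all add: WD(5))

lemmas jj_linear = ext_map_linear[OF VW V incl]
lemmas jjD = linD[OF jj_linear] and jj0 = lin_zero[OF CW C jj_linear]
lemmas jj_mult = ext_map_mult[OF VW V incl] and jj_one = ext_map_one[OF VW V incl]

lemma jj_act: "g:G ==> xi:car LW ==> jj (ext_act VW act xi g) = jj xi \<lhd> g"
 unfolding ext_act_eq
 using ext_map_compose[OF VW VW V _ incl, of "%v. act v g"] ext_map_compose[OF VW V V incl act(1)[OF GX]]
  group_calc.act(1)[OF G_data, simplified] by simp

lemma jj_power: "xi:PwW n ==> jj xi:Pw n"
 by (rule ext_map_power[OF VW V incl]) (use WD(1) in auto)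

lemma PwW: "xi:PwW n ==> xi:car LW"
 by (rule subD(5)[OF CW ext_power_subspace[OF VW]]) auto

definition inc where "inc f = (%x. jj (f x))"

lemma inc_mn: "inc (mnW x xi) = mn x (jj xi)"
 by (rule ext) (auto simp: inc_def left_mono_def jj0 del: equalityI)

lemma inc_linear: "inc:lin KB K"
proof (rule linI)
 fix f assume f: "f:car KB"
 show "inc f:car K"
  by (rule K_I[of _ "{x. f x ~= 0[LW]}"]) (use GK_D(1-3)[OF f] GX in "auto simp: inc_def jjD jj0 del: equalityI")
 show "inc (c *[KB] f) = c *[K] inc f" for c by (rule ext) (simp add: inc_def K_app GK_app jjD GK_D(1)[OF f])
 fix g assume g: "g:car KB"
 show "inc (f +[KB] g) = inc f +[K] inc g" by (rule ext) (simp add: inc_def K_app GK_app jjD GK_D(1)[OF f] GK_D(1)[OF g])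
qed

lemmas incD = linD[OF inc_linear]

lemma inc_mult:
 assumes f: "f:car KB" and g: "g:car KB"
 shows "inc (f **[KB] g) = inc f \<star> inc g"
proof -
 note lc = lin_comp
 have 1: "inc (mnW x xi **[KB] g) = inc (mnW x xi) \<star> inc g" if x: "x:G" "xi:car LW" for x xi
  by (rule GK_eqI[OF cvs_K lc[OF Gmul_linear(1)[OF GmnD(1)[OF x]] inc_linear] lc[OF inc_linear K_mulR[OF incD(1)[OF GmnD(1)[OF x]]]] _ g])
   (use x in "simp add: Gmn_mult inc_mn mn_mult GX jjD jj_mult jj_act GactD")
 show ?thesis
  by (rule GK_eqI[OF cvs_K lc[OF Gmul_linear(2)[OF g] inc_linear] lc[OF inc_linear K_mulL[OF incD(1)[OF g]]] 1 f])
qed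

lemma inc_forms: "f:forms KB n ==> inc f:forms K n"
 using incD(1) jj_power by (auto simp: forms_eq Gforms_eq) (simp add: inc_def jj_power)

lemma inc_emb: "inc (emb KB b) = emb K b"
 by (rule ext) (simp add: inc_def GK(7) K_simps(7) jjD AlgW(2) jj_one)

lemma inc_diff:
 assumes f: "f:car KB"
 shows "inc (diff KB f) = diff K (inc f)"
proof (rule GK_eqI[OF cvs_K lin_comp[OF group_calc.diff_linear[OF G_data] inc_linear] lin_comp[OF inc_linear diff_linear] _ f])
 fix x xi assume x: "x:G" "xi:car LW"
 have \<omega>W: "\<omega> x:W" using group_calc.\<omega>(1)[OF G_data, of x] x by simp
 have w: "wg VW [\<omega> x]:car LW" using wedge_list_closed[OF VW, of "[\<omega> x]"] \<omega>W by simp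
 have "jj (wg VW [\<omega> x]) = w1 (\<omega> x)" using ext_map_wedge[OF VW V incl, of "[\<omega> x]"] \<omega>W by simp
 thus "inc (diff KB (mnW x xi)) = diff K (inc (mnW x xi))"
  using group_calc.diff_mn[OF G_data, of x xi] x w by (simp add: inc_mn diff_mn GX jjD jj_mult)
qed

text \<open>The coefficient \<open>\<xi>\<close> of \<open>\<xi>.z\<close> when \<open>f\<close> is
  written with group elements on the right. For these coefficients multiplication by
  \<open>1.\<xi>\<close> from the left is the plain wedge product, without a twist
  (\<open>R_mult_one\<close>).\<close>

definition "R z f = f z \<lhd> inv[X] z"

lemma R_linear: "z:car X ==> R z:lin K L"
 unfolding R_def using lin_comp[OF eval_linear[of z] act_linear[OF X.inv_closed]] .

lemma R_mn: "z:car X ==> R z (mn x xi) = (if z = x then xi \<lhd> inv[X] z else 0L)"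
 by (simp add: R_def left_mono_def act0)

lemma R_right_mono: "x:car X ==> z:car X ==> xi:car L ==> R z (right_mono X V act \<omega> xi x) = (if z = x then xi else 0L)"
 using act_act[of x "inv[X] x" xi] by (auto simp: right_mono_eq R_mn act_one_right del: equalityI)

lemma R_expand:
 assumes f: "f:car K" and F: "finite F" "supp f <= F" "F <= car X"
 shows "f = (finsum K (%x. right_mono X V act \<omega> (R x f) x) F)"
proof -
 have e: "right_mono X V act \<omega> (R x f) x = mn x (f x)" if "x:F" for x
  using that F act_act[of "inv[X] x" x "f x"] K_D(1)[OF f] lin_cl[OF R_linear f, of x]
  by (simp add: right_mono_eq subset_iff) (simp add: R_def act_one_right)
 have "(finsum K (%x. right_mono X V act \<omega> (R x f) x) F) = (finsum K (%x. mn x (f x)) F)"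
  by (rule cvs_finsum_cong[OF cvs_K])
   (rule Pi_I, rule mn_closed[OF _ K_D(1)[OF f]], use F in blast, rule e)
 from trans[OF K_expand[OF f F] this[symmetric]] show ?thesis .
qed

lemma right_mono_linear: "x:car X ==> (%xi. right_mono X V act \<omega> xi x):lin L K"
 by (rule linear_cong[OF lin_comp[OF act_linear mn_linear] C]) (simp_all add: right_mono_eq)

abbreviation "Fl == ideal_filt K KB inc"
abbreviation "WF == wedge_filt V W"

lemma split_prems: "csubspace W V" "\<pi> : lin V V" "\<pi>p:lin V V" "!!w. w:W ==> \<pi> w = w"
 "!!v. v:car V ==> \<pi> v:W" "!!w. w:W ==> \<pi>p w = 0[V]" "!!v. v:car V ==> v = \<pi> v +[V] \<pi>p v"
 by (rule W \<pi> \<pi>p split; assumption)+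

lemmas WF_subspace = wedge_filt_subspace[OF V split_prems]

lemma Fl_gens: "{inc xi \<star> eta | xi eta. xi:forms KB p & eta:forms K n} <= car K"
 using mult_closed forms_K inc_forms by blast

lemma Fl_subspace: "csubspace (Fl p n) K"
 unfolding ideal_filt_def using cspan_sub[OF cvs_K Fl_gens] csubspace_zero[OF cvs_K] by auto

text \<open>Coefficientwise the filtration of forms becomes \<open>wedge_filt\<close>: the factor
  from the powers of \<open>W\<close> is twisted only by an element of \<open>G\<close>, under which
  \<open>W\<close> is stable.\<close>

lemma R_Fl:
 assumes f: "f:Fl p n" and z: "z:car X"
 shows "R z f:WF p n"
proof (cases "p <= n")
 case False
 hence "f = 0[K]" using f by (simp add: ideal_filt_def)
 thus ?thesis using lin_zero[OF cvs_K C R_linear[OF z]] subD(2)[OF C WF_subspace] by simp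
next
 case True
 have "R z (inc xi \<star> eta):WF p n" if xi: "xi:forms KB p" and eta: "eta:forms K (n - p)" for xi eta
 proof (rule Gforms_memI[OF C lin_comp[OF lin_comp[OF inc_linear K_mulL[OF forms_K[OF eta]]] R_linear[OF z]] WF_subspace _ xi])
  fix g k assume g: "g:G" and k: "k:PwW p"
  note k' = PwW[OF k] and gX = GX[OF g]
  note jk = jjD(1)[OF k']
  show "R z (inc (mnW g k) \<star> eta):WF p n"
   unfolding inc_mn
  proof (rule form_linear_memI[OF C lin_comp[OF K_mulR[OF mn_closed[OF gX jk]] R_linear[OF z]] WF_subspace _ eta])
   fix y u assume y: "y:car X" and u: "u:Pw (n - p)"
   have gi: "inv[X] g:G" by (rule subgroup.m_inv_closed[OF G g])
   have i: "inv[X] (g *X y):car X" using gX y by simp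
   \<comment> \<open>The coefficient of \<open>gy\<close> in \<open>g.k \<and> y.u\<close> involves
     \<open>k\<close> twisted by \<open>y\<close> and then by \<open>(gy)^{-1}\<close>, together by
     \<open>g^{-1}\<close>, which belongs to \<open>G\<close>.\<close>
   have "y *X inv[X] (g *X y) = inv[X] g" using gX y by (simp add: X.inv_mult_group X.m_assoc[symmetric])
   hence "((jj k \<lhd> y) ** u) \<lhd> inv[X] (g *X y) = jj (ext_act VW act k (inv[X] g)) ** u \<lhd> inv[X] (g *X y)"
    using act_act[OF y i jk] y i jk Pw(5)[OF u] jj_act[OF gi k'] by (simp add: act_mult actD)
   moreover have "... : WF p n"
    by (rule wedge_filt_incl[OF V split_prems Gact(2)[OF gi] act_power[OF i u] True]; (assumption | rule k))
   ultimately show "R z (mn g (jj k) \<star> mn y u):WF p n"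
    using subD(2)[OF C WF_subspace] gX y jk Pw(5)[OF u] z by (simp add: mn_mult R_mn)
  qed
 qed
 hence "{inc xi \<star> eta | xi eta. xi:forms KB p & eta:forms K (n - p)} <= {f:car K. R z f:WF p n}"
  using Fl_gens by blast
 from cspan_minimal[OF cvs_K lin_vimage[OF cvs_K C R_linear[OF z] WF_subspace] this]
 show ?thesis using f True by (auto simp: ideal_filt_def)
qed

lemma w1W: "w:W ==> wg VW [w]:PwW 1" "w:W ==> jj (wg VW [w]) = w1 w"
 using ext_power_wedge[OF VW, of "[w]" W] ext_map_wedge[OF VW V incl, of "[w]"] by auto

text \<open>The converse for filtration step 1: a leading letter \<open>w\<close> of
  \<open>W\<close> splits off on the left as the base form \<open>1.w\<close>, unaffected by the
  group element on the right.\<close>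

lemma R_Fl_conv:
 assumes eta: "eta:forms K q" and R: "!!z. z:car X ==> R z eta:WF 1 q"
 shows "eta:Fl 1 q"
proof -
 note k = forms_K[OF eta]
 have F: "supp eta <= car X" using K_D(3)[OF k] by auto
 have "right_mono X V act \<omega> (R x eta) x:Fl 1 q" if x: "x:car X" for x
 proof -
  note S = lin_vimage[OF C cvs_K right_mono_linear[OF x] Fl_subspace[of 1 q]]
  have "{wg V ws ** u | ws u. ws:lists W & length ws = 1 & u:Pw (q - 1) & 1 <= q}
    <= {xi:car L. right_mono X V act \<omega> xi x:Fl 1 q}"
  proof (rule subsetI, elim CollectE exE conjE)
   fix xi ws u assume xi: "xi = wg V ws ** u" and ws: "ws:lists W" "length ws = 1" and u: "u:Pw (q - 1)" and q: "1 <= q"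
   obtain w where w: "ws = [w]" "w:W" using ws by (auto simp: length_Suc_conv)
   note c = w1D(1)[OF WD(5)[OF w(2)]] Pw(5)[OF u]
   have "right_mono X V act \<omega> xi x = inc (mnW 1[X] (wg VW [w])) \<star> right_mono X V act \<omega> u x"
    using c x by (simp add: xi w(1) right_mono_eq Alg(3) act_mult inc_mn w1W[OF w(2)] mn_mult actD)
   moreover have "mnW 1[X] (wg VW [w]):forms KB 1"
    by (rule GmnD(2)[OF subgroup.one_closed[OF G] w1W(1)[OF w(2)]])
   moreover have "right_mono X V act \<omega> u x:forms K (q - 1)"
    using c x mn_forms[OF x act_power[OF x u]] by (simp add: right_mono_eq)
   ultimately have "right_mono X V act \<omega> xi x:Fl 1 q"
    unfolding ideal_filt_def if_P[OF q] by (intro cspan_base[OF cvs_K]) blast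
   thus "xi:{xi:car L. right_mono X V act \<omega> xi x:Fl 1 q}" using c by (simp add: xi w(1) Alg(3))
  qed
  from cspan_minimal[OF C S this] show ?thesis using R[OF x] unfolding wedge_filt_def by auto
 qed
 thus ?thesis
  by (subst R_expand[OF k K_D(2)[OF k] order_refl F]) (use F in "blast intro: csubspace_sum_closed[OF cvs_K Fl_subspace]")
qed

end

lemma (in group_calc) emb_single: "emb K (single x c) = mn x (c \<cdot> 1[L])"
 by (rule ext) (simp add: emb_app left_mono_def lookup_single when_def cvs_zero_smult[OF C Alg(2)])

section \<open>Bases of the exterior powers of W, and the maps prescribed on generators\<close>

context subgroup_bundle begin

text \<open>The coordinate functionals are defined on all of \<Lambda>W, so that they can be
  composed with linear maps of the whole algebra.\<close>

definition is_basis where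
 "is_basis p I co <-> finite I & I <= PwW p & (ALL i:I. co i:lin LW complex_vs) &
  (ALL i:I. ALL k:I. co i k = (if k = i then 1 else 0)) & (ALL x:PwW p. x = (finsum LW (%i. co i x *[LW] i) I))"

text \<open>As \<open>G\<close> is finite, the words of length \<open>p\<close> in the values of
  \<open>\<omega>\<close> on \<open>G\<close> give a finite spanning set. The coordinates on degree
  \<open>p\<close> are extended to the whole algebra through \<open>ext_proj\<close>.\<close>

lemma ex_basis: "EX I co. is_basis p I co"
proof -
 note T = ext_power_subspace[OF VW, of W p, simplified]
 have WW: "cspan VW (\<omega> ` G) = W" "\<omega> ` G <= car VW"
  using group_calc.span[OF G_data] group_calc.\<omega>(1)[OF G_data] by auto
 let ?S = "wg VW ` {vs:lists (\<omega> ` G). length vs = p}"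
 have e: "PwW p = cspan LW ?S" using ext_power_span[OF VW WW(2), of p] by (simp only: WW(1))
 have S: "?S <= PwW p" unfolding e by (rule cspan_superset[OF CW])
 have "finite {vs. set vs <= \<omega> ` G & length vs = p}" using fin by (intro finite_lists_length_eq) simp
 hence fS: "finite ?S" by (rule finite_imageI[OF finite_subset[rotated]]) auto
 let ?P = "LW(|carrier := PwW p|)"
 have cs: "?S <= car ?P" "car ?P = cspan ?P ?S" using cspan_of_subspace[OF CW T S] e S by simp_all
 obtain I co where "finite I & I <= ?S & (ALL i:I. co i:lin ?P complex_vs) &
   (ALL i:I. ALL k:I. co i k = (if k = i then 1 else 0)) & (ALL x:car ?P. x = (finsum ?P (%i. co i x *[?P] i) I))"
  using finite_basis[OF sub_cvs[OF CW T] fS cs] by (elim exE) (rule that)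
 hence I: "finite I" "I <= ?S" "ALL i:I. co i:lin ?P complex_vs"
   "ALL i:I. ALL k:I. co i k = (if k = i then 1 else 0)"
   "ALL x:PwW p. x = (finsum ?P (%i. co i x *[LW] i) I)" by simp_all
 have IP: "I <= PwW p" using I(2) S by blast
 have pr: "ext_proj VW p x = x" if "x:PwW p" for x using ext_proj_power[OF VW, of x p p] that by simp
 have pl: "ext_proj VW p:lin LW (LW(|carrier := PwW p|))"
  by (rule linear_corestrict[OF ext_proj_linear[OF VW]]) (use ext_proj_mem[OF VW, of _ p] in auto)
 have "x = (finsum LW (%i. co i x *[LW] i) I)" if x: "x:PwW p" for x
 proof -
  have inc: "(%x. x):lin (LW(|carrier := PwW p|)) LW" by (rule linI) (simp_all add: PwW)
  have "(finsum (LW(|carrier := PwW p|)) (%i. co i x *[LW] i) I) = (finsum LW (%i. co i x *[LW] i) I)"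
   by (rule lin_finsum[OF sub_cvs[OF CW T] CW inc]) (use IP subD(4)[OF CW T] in auto)
  thus ?thesis using I(5) x by auto
 qed
 moreover have "ALL i:I. (%x. co i (ext_proj VW p x)):lin LW complex_vs"
  using I(3) by (blast intro: lin_comp[OF pl])
 ultimately have "is_basis p I (%i x. co i (ext_proj VW p x))"
  unfolding is_basis_def using I(1,4) IP pr by (auto simp: subset_iff)
 thus ?thesis by blast
qed

abbreviation E where "E == mult_bimod A"
abbreviation J1 where "J1 == tens A E (fb K 1) 1[A]"
abbreviation T1 where "T1 == tensor A E (fb K 1)"

lemma A_calculus: "diff_calculus A K" and B_calculus: "diff_calculus B KB"
 by (unfold_locales, rule calculus, unfold_locales, rule group_calc.calculus[OF G_data])

lemmas B_simps = group_calc.A_simps[OF G_data, simplified]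

lemma BA: "b:car B ==> b:car A" using GX by (auto simp: A_simps B_simps)

lemma B_ops: "mult B = mult A" "one B = one A" "zero B = zero A" "add B = add A" "smult B = smult A"
 by (simp_all add: A_simps B_simps)

lemma cvs_E: "cvs E" by (rule cvs_cong[OF cvs_A]) simp_all

lemma tens_able: "tensorable A E (fb K n)"
 using cvs_E diff_calculus.cvs_forms[OF A_calculus] diff_calculus.forms_lmult[OF A_calculus] A_mult_closed by (auto simp: tensorable_def)

lemma btens_able: "tensorable B (fb KB n) E"
 using cvs_E diff_calculus.cvs_forms[OF B_calculus] diff_calculus.forms_rmult[OF B_calculus] A_mult_closed BA
 by (auto simp: tensorable_def B_ops)

lemmas cvs_T1 = cvs_tensor[OF tens_able[of 1]]

lemma J1_linear: "J1:lin (fb K 1) T1"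
 by (rule balancedD(7)[OF tens_balanced[OF tens_able]]) (simp add: A_simps)

lemmas J1D = linD[OF J1_linear, simplified form_bimod_simps]

lemma de_forms: "a:car A ==> diff K (emb K a):forms K 1"
 using diff_forms[OF emb_forms] by simp

lemma nab_linear: "(%a. J1 (diff K (emb K a))):lin A T1"
 using linD[OF lin_comp[OF emb_linear diff_linear]]
 by (intro linI) (simp_all only: J1D de_forms)

lemma sig_balanced: "balanced B (fb KB 1) E T1 (%xi a. J1 (inc xi \<star> emb K a))"
proof -
 note f = diff_calculus.forms_rmult[OF A_calculus] and fc = forms_K
 note F = subD(3,4)[OF cvs_K forms_subspace] and eD = linD[OF emb_linear]
  and GF = subD(5)[OF cvs_KB group_calc.forms_subspace[OF G_data]]
 note eB = lin_cl[OF group_calc.emb_linear[OF G_data]]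
 show ?thesis
  by (rule balancedI)
   (simp_all add: f fc J1D eD inc_forms F KA(7-10) GF incD inc_mult eB inc_emb emb_mult BA K_mult_assoc del: One_nat_def)
qed

text \<open>The prescription of the theorem, on generators only; \<open>nab_eq\<close> and
  \<open>sig_eq\<close> show that linearity determines both maps.\<close>

definition "conn_braid nab sig <-> nab:lin E T1 &
 (ALL x:car X. nab (gen x) = J1 (diff K (emb K (gen x)))) &
 sig:lin (tensor B (fb KB 1) E) T1 &
 (ALL g:G. ALL x:car X. sig (tens B (fb KB 1) E (diff KB (emb KB (gen g))) (gen x)) =
  J1 (diff K (emb K (gen g)) \<star> emb K (gen x)))"

lemma Gde: "b:car B ==> diff KB (emb KB b):forms KB 1" "b:car B ==> inc (diff KB (emb KB b)) = diff K (emb K b)"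
 using group_calc.diff_forms[OF G_data group_calc.emb_forms[OF G_data]]
  inc_diff[OF lin_cl[OF group_calc.emb_linear[OF G_data]]] by (simp_all add: inc_emb)

lemma conn_braid_exists: "EX nab sig. conn_braid nab sig"
proof (intro exI)
 note L = tensor_lift_linear[OF btens_able cvs_T1 sig_balanced]
 have "tensor_lift T1 (%xi a. J1 (inc xi \<star> emb K a)) (tens B (fb KB 1) E xi a) = J1 (inc xi \<star> emb K a)"
  if "xi:forms KB 1" "a:car A" for xi a
  using tensor_lift_tens[OF btens_able cvs_T1 sig_balanced, where e = xi and f = a] that by simp
 moreover have "gen g:car B" if "g:G" for g using that by (simp add: B_simps)
 moreover have "(%a. J1 (diff K (emb K a))):lin E T1" using nab_linear by (simp add: linear_maps_def)
 ultimately show "conn_braid (%a. J1 (diff K (emb K a))) (tensor_lift T1 (%xi a. J1 (inc xi \<star> emb K a)))"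
  unfolding conn_braid_def using L Gde gen_A by auto
qed

context
 fixes nab sig
 assumes cb: "conn_braid nab sig"
begin

private lemma nl: "nab:lin A T1" and sl: "sig:lin (tensor B (fb KB 1) E) T1"
 using cb by (auto simp: conn_braid_def linear_maps_def)

lemma nab_eq: "a:car A ==> nab a = J1 (diff K (emb K a))"
 by (rule lin_eq_cspan[OF cvs_A cvs_T1 nl nab_linear, of "gen ` car X"])
  (use cb gen_A A_span in "auto simp: conn_braid_def")

private lemmas bt = balancedD[OF tens_balanced[OF btens_able]]

text \<open>Linearity in \<open>a\<close> extends the prescribed values from group elements to the
  group algebra, and linearity in \<open>b\<close> then extends them from \<open>G\<close> to
  \<open>B\<close>.\<close>

private lemma sig_d:
 assumes a: "a:car A" and b: "b:car B"
 shows "sig (tens B (fb KB 1) E (diff KB (emb KB b)) a) = J1 (diff K (emb K b) \<star> emb K a)"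
proof -
 note G = group_calc.A_span[OF G_data, simplified] group_calc.cvs_A[OF G_data]
  group_calc.emb_linear[OF G_data] group_calc.diff_linear[OF G_data]
 have E1: "(%b. diff KB (emb KB b)):lin B (fb KB 1)"
  using linD[OF lin_comp[OF G(3,4)]] Gde(1) by (intro linI) simp_all
 have D1: "(%b. diff K (emb K b)):lin B K"
  using linD[OF lin_comp[OF emb_linear diff_linear]] BA by (intro linI) (simp_all add: B_ops)
 have J: "(%x. J1 (f x)):lin U T1" if "f:lin U K" "!!x. x:car U ==> f x:forms K 1" for f and U :: "(complex, 'y, 'k) module_scheme"
  using linD[OF that(1)] that(2) by (intro linI) (simp_all only: J1D)
 note rm = diff_calculus.forms_rmult[OF A_calculus]
 have t1: "tens B (fb KB 1) E xi:lin A (tensor B (fb KB 1) E)" if "xi:forms KB 1" for xi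
  using bt(7)[of xi] that by (simp add: linear_maps_def)
 have 1: "sig (tens B (fb KB 1) E (diff KB (emb KB (gen g))) a) = J1 (diff K (emb K (gen g)) \<star> emb K a)" if g: "g:G" for g
 proof (rule lin_eq_cspan[OF cvs_A cvs_T1 lin_comp[OF t1 sl] J[OF lin_comp[OF emb_linear K_mulR]], of _ _ "gen ` car X"])
  show "diff KB (emb KB (gen g)):forms KB 1" using g by (intro Gde) (simp add: B_simps)
  have d: "diff K (emb K (gen g)):forms K 1" by (rule de_forms[OF gen_A[OF GX[OF g]]])
  show "diff K (emb K (gen g)):car K" by (rule forms_K[OF d])
  show "diff K (emb K (gen g)) \<star> emb K x:forms K 1" if "x:car A" for x by (rule rm[OF that d])
 qed (use a g cb gen_A A_span in "auto simp: conn_braid_def")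
 have t2: "(%xi. tens B (fb KB 1) E xi a):lin (fb KB 1) (tensor B (fb KB 1) E)"
  using bt(8)[of a] a by simp
 show ?thesis
 proof (rule lin_eq_cspan[OF G(2) cvs_T1 lin_comp[OF lin_comp[OF E1 t2] sl] J[OF lin_comp[OF D1 K_mulL]], of _ "gen ` G"])
  show "emb K a:car K" by (rule lin_cl[OF emb_linear a])
  show "diff K (emb K x) \<star> emb K a:forms K 1" if "x:car B" for x by (rule rm[OF a de_forms[OF BA[OF that]]])
 qed (use b 1 G(1) in "auto simp: B_simps")
qed

text \<open>\<open>sig\<close> is given as a linear map, without compatibility with the left action,
  so a form \<open>b' db\<close> is rewritten as \<open>d(b'b) - (db') b\<close>. The first term is
  exact, and in the second \<open>b\<close> moves across the tensor sign.\<close>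

lemma sig_eq:
 assumes xi: "xi:forms KB 1" and a: "a:car A"
 shows "sig (tens B (fb KB 1) E xi a) = J1 (inc xi \<star> emb K a)"
proof -
 note G = group_calc.forms_1[OF G_data] group_calc.A_mult_closed[OF G_data] group_calc.emb_mult[OF G_data]
  linD[OF group_calc.emb_linear[OF G_data]]
 let ?S = "{emb KB b' **[KB] diff KB (emb KB b) | b b'. b:car B & b':car B}"
 have S: "?S <= forms KB 1" using G(1) cspan_superset[OF cvs_KB, of ?S] by simp
 have xi': "xi:cspan (fb KB 1) ?S" using xi G(1) diff_calculus.cspan_form_bimod[OF B_calculus S] by simp
 note s = lin_comp[OF bt(8) sl, of a]
 show ?thesis
 proof (rule lin_eq_cspan[OF diff_calculus.cvs_forms[OF B_calculus] cvs_T1 _ balancedD(8)[OF sig_balanced] _ _ xi'])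
  show "(%xi. sig (tens B (fb KB 1) E xi a)):lin (fb KB 1) T1" using s a by simp
  show "a:car E" using a by simp
  show "?S <= car (fb KB 1)" using S by simp
  fix zeta assume "zeta:?S"
  then obtain b b' where b: "zeta = emb KB b' **[KB] diff KB (emb KB b)" "b:car B" "b':car B" by blast
  note c = Gde(1)[OF b(2)] Gde(1)[OF b(3)] G(2)[OF b(3,2)] lin_cl[OF group_calc.emb_linear[OF G_data] b(3)]
  note fK = subD(5)[OF cvs_KB group_calc.forms_subspace[OF G_data]]
  note rB = diff_calculus.forms_rmult[OF B_calculus b(2) c(2)]
  have zeta: "zeta:forms KB 1" unfolding b(1) by (rule diff_calculus.forms_lmult[OF B_calculus b(3) c(1)])
  have dd: "diff KB (emb KB (b' **[B] b)) = (diff KB (emb KB b') **[KB] emb KB b) +[KB] zeta"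
   unfolding b(1) using diff_calculus.diff_mult_emb[OF B_calculus b(3) G(4)[OF b(2)]] G(3)[OF b(3,2)] by simp
  let ?f = "%xi. sig (tens B (fb KB 1) E xi a)" and ?g = "%xi. J1 (inc xi \<star> emb K a)"
  let ?e = "diff KB (emb KB b') **[KB] emb KB b"
  have f: "?f:lin (fb KB 1) T1" using s a by simp
  have g: "?g:lin (fb KB 1) T1" by (rule balancedD(8)[OF sig_balanced]) (use a in simp)
  have "?f ?e = sig (tens B (fb KB 1) E (diff KB (emb KB b')) (b **[A] a))"
   using bt(6)[where e = "diff KB (emb KB b')" and a = b and f = a] a b c by simp
  also have "... = ?g ?e"
   unfolding sig_d[OF A_mult_closed[OF BA[OF b(2)] a] b(3)]
   using lin_cl[OF emb_linear] a BA[OF b(2)] Gde(2)[OF b(3)] forms_K[OF de_forms[OF BA[OF b(3)]]]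
    inc_mult[OF fK[OF c(2)] G(4)[OF b(2)]] by (simp add: emb_mult inc_emb K_mult_assoc)
  finally have e: "?f ?e = ?g ?e" .
  have t: "?f (diff KB (emb KB (b' **[B] b))) = ?g (diff KB (emb KB (b' **[B] b)))"
   using sig_d[OF a c(3)] Gde(2)[OF c(3)] by simp
  note fl = linear_add[OF f, of ?e zeta, simplified form_bimod_simps, OF rB zeta] and gl = linear_add[OF g, of ?e zeta, simplified form_bimod_simps, OF rB zeta]
  note fc = lin_cl[OF f, simplified form_bimod_simps] and gc = lin_cl[OF g, simplified form_bimod_simps]
  show "?f zeta = ?g zeta"
   using cvs_add_left_imp_diff[OF cvs_T1 fc[OF rB] fc[OF zeta] fl] cvs_add_left_imp_diff[OF cvs_T1 gc[OF rB] gc[OF zeta] gl] e t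
   unfolding dd[symmetric] by simp
 qed
qed

end

context
 fixes BI bco
 assumes bas: "!!p. is_basis p (BI p) (bco p)"
begin

private lemma bD: "finite (BI p)" "i:BI p ==> i:PwW p" "i:BI p ==> bco p i:lin LW complex_vs"
 "i:BI p ==> k:BI p ==> bco p i k = (if k = i then 1 else 0)"
 "x:PwW p ==> x = (finsum LW (%i. bco p i x *[LW] i) (BI p))"
 using bas[of p] unfolding is_basis_def by blast+

definition "form_basis p = mnW 1[X] ` BI p"

text \<open>Move each group element of \<open>f = \<Sum> g.(f g)\<close> to the right by
  \<open>g.\<xi> = (\<xi> \<lhd> g^{-1}).g\<close> and take the coordinate of what then stands in
  front of \<open>g\<close>. The argument \<open>e\<close> is a basis form \<open>1.i\<close>, whose
  value at the unit recovers \<open>i\<close>.\<close>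

definition "form_coord p e f = (\<Sum>g\<in>G. single g (bco p (e 1[X]) (ext_act VW act (f g) (inv[X] g))))"

private lemma lookup_coord: "lookup (form_coord p e f) g =
  (if g:G then bco p (e 1[X]) (ext_act VW act (f g) (inv[X] g)) else 0)"
 using fin by (simp add: form_coord_def lookup_sum lookup_single when_def)

private lemma mn1: "mnW 1[X] i 1[X] = i" by (simp add: left_mono_def)

private lemma iG: "g:G ==> inv[X] g:G" "1[X]:G"
 using subgroup.m_inv_closed[OF G] subgroup.one_closed[OF G] by auto

private lemma coord_linear: "i:BI p ==> form_coord p (mnW 1[X] i):lin KB B"
proof (rule linI)
 assume i: "i:BI p"
 note l = lin_comp[OF lin_comp[OF group_calc.eval_linear[OF G_data] Gact_linear[OF iG(1)]] bD(3)[OF i]]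
 fix f assume f: "f:car KB"
 show "form_coord p (mnW 1[X] i) f:car B" by (auto simp: B_simps in_keys_iff lookup_coord split: if_splits)
 show "form_coord p (mnW 1[X] i) (c *[KB] f) = c *[B] form_coord p (mnW 1[X] i) f" for c
  by (rule poly_mapping_eqI) (simp add: B_simps lookup_coord mn1 func_simps(2)[OF l f])
 fix g assume g: "g:car KB"
 show "form_coord p (mnW 1[X] i) (f +[KB] g) = form_coord p (mnW 1[X] i) f +[B] form_coord p (mnW 1[X] i) g"
  by (rule poly_mapping_eqI) (simp add: B_simps lookup_add lookup_coord mn1 func_simps(1)[OF l f g])
qed

private lemma coord_mn:
 assumes i: "i:BI p" and x: "x:G"
 shows "form_coord p (mnW 1[X] i) (mnW x xi) = single x (bco p i (ext_act VW act xi (inv[X] x)))"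
proof (rule poly_mapping_eqI)
 fix g
 have "bco p i (ext_act VW act 0[LW] (inv[X] g)) = 0" if "g:G"
  using lin_zero[OF CW CW Gact_linear[OF iG(1)[OF that]]] lin_zero[OF CW cvs_complex_vs bD(3)[OF i]] by simp
 thus "lookup (form_coord p (mnW 1[X] i) (mnW x xi)) g = lookup (single x (bco p i (ext_act VW act xi (inv[X] x)))) g"
  using x by (auto simp: lookup_coord mn1 lookup_single when_def left_mono_def)
qed

private lemma act_cancel: "x:G ==> y:G ==> xi:car LW ==> ext_act VW act (ext_act VW act xi y) (inv[X] (x *X y)) = ext_act VW act xi (inv[X] x)"
 "x:G ==> xi:car LW ==> ext_act VW act (ext_act VW act xi (inv[X] x)) x = xi"
proof -
 assume x: "x:G" and xi: "xi:car LW"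
 show "ext_act VW act (ext_act VW act xi (inv[X] x)) x = xi"
  using Gact(1)[OF iG(1)[OF x] x xi] Gact(3)[OF xi] GX[OF x] by simp
 assume y: "y:G"
 have "inv[X] (x *X y):G" by (intro iG subgroup.m_closed[OF G x y])
 from Gact(1)[OF y this xi] show "ext_act VW act (ext_act VW act xi y) (inv[X] (x *X y)) = ext_act VW act xi (inv[X] x)"
  using GX[OF x] GX[OF y] by (simp add: X.inv_mult_group X.m_assoc[symmetric])
qed

text \<open>Multiplication by \<open>h\<close> on the right moves the coefficient of
  \<open>x\<close> to \<open>xh\<close> without changing it, because the twists by \<open>h\<close>
  and \<open>h^{-1}\<close> cancel.\<close>

private lemma coord_mult:
 assumes i: "i:BI p" and f: "f:car KB" and b: "b:car B"
 shows "form_coord p (mnW 1[X] i) (f **[KB] emb KB b) = form_coord p (mnW 1[X] i) f **[B] b"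
proof -
 note cl = coord_linear[OF i] and cB = group_calc.calgebra_A[OF G_data] and Gs = group_calc.A_span[OF G_data, simplified]
  and cvB = group_calc.cvs_A[OF G_data] and el = group_calc.emb_linear[OF G_data]
 have 1: "form_coord p (mnW 1[X] i) (f **[KB] emb KB (gen h)) = form_coord p (mnW 1[X] i) f **[B] gen h" if h: "h:G" for h
 proof -
  have hB: "gen h:car B" using h by (simp add: B_simps)
  show ?thesis
  proof (rule GK_eqI[OF cvB lin_comp[OF Gmul_linear(2)[OF lin_cl[OF el hB]] cl] lin_comp[OF cl calgebra_mult_linear(2)[OF cB hB]] _ f])
   fix x xi assume x: "x:G" "xi:car LW"
   note xh = subgroup.m_closed[OF G x(1) h]
   show "form_coord p (mnW 1[X] i) (mnW x xi **[KB] emb KB (gen h)) = form_coord p (mnW 1[X] i) (mnW x xi) **[B] gen h"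
    using x h xh Gmn_mult[OF x(1) h x(2) AlgW(2)] AlgW(6)[OF GactD(1)[OF h x(2)]]
    by (simp add: group_calc.emb_gen[OF G_data] coord_mn[OF i] act_cancel(1)) (simp add: B_simps A_simps)
  qed
 qed
 show ?thesis
  by (rule lin_eq_cspan[OF cvB cvB lin_comp[OF lin_comp[OF el Gmul_linear(1)[OF f]] cl] calgebra_mult_linear(1)[OF cB lin_cl[OF cl f]], of "gen ` G"])
   (use 1 b Gs in "auto simp: B_simps")
qed

lemma form_right_basis: "right_basis B (fb KB p) (form_basis p) (form_coord p)"
proof -
 note Gf = GmnD(2)[OF iG(2)] and cB = lin_cl[OF coord_linear]
 have fKB: "f:forms KB p ==> f:car KB" for f by (simp add: Gforms_eq)
 have inj: "inj_on (mnW 1[X]) (BI p)" using mn1 by (metis inj_onI)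
 have basis: "e:form_basis p <-> (EX i:BI p. e = mnW 1[X] i)" for e by (auto simp: form_basis_def)
 have tm: "mnW 1[X] i **[KB] emb KB (form_coord p (mnW 1[X] i) f):forms KB p" if "i:BI p" "f:forms KB p" for i f
  by (rule diff_calculus.forms_rmult[OF B_calculus cB[OF that(1) fKB[OF that(2)]] Gf[OF bD(2)[OF that(1)]]])
 have expand: "f = (finsum KB (%i. mnW 1[X] i **[KB] emb KB (form_coord p (mnW 1[X] i) f)) (BI p))" (is "f = ?S f") if f: "f:forms KB p" for f
 proof (rule Gforms_eqI[OF cvs_KB linear_id _ _ f])
  show "?S:lin KB KB"
   by (intro linear_finsum_maps[OF cvs_KB cvs_KB] lin_comp[OF lin_comp[OF coord_linear group_calc.emb_linear[OF G_data]] Gmul_linear(1)])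
    (use fKB[OF Gf[OF bD(2)]] in auto)
  fix x xi assume x: "x:G" and xi: "xi:PwW p"
  note xi' = PwW[OF xi]
  \<comment> \<open>\<open>x.\<xi> = \<zeta>.x\<close> for this \<open>\<zeta>\<close>, so the
    expansion of \<open>\<zeta>\<close> in the basis of the exterior power gives that of the
    form.\<close>
  let ?zeta = "ext_act VW act xi (inv[X] x)"
  have zeta: "?zeta:PwW p" using Gact(2)[OF iG(1)[OF x], of xi p] xi by simp
  have "mnW 1[X] i **[KB] emb KB (form_coord p (mnW 1[X] i) (mnW x xi)) = mnW x (ext_act VW act (bco p i ?zeta *[LW] i) x)" if i: "i:BI p" for i
   using x PwW[OF bD(2)[OF i]] GX[OF x] Gmn_mult[OF iG(2) x PwW[OF bD(2)[OF i]] smult_cl[OF CW AlgW(2)]]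
   by (simp add: coord_mn[OF i x] group_calc.emb_single[OF G_data] GactD AlgW(2,6,10))
  hence "?S (mnW x xi) = (finsum KB (%i. mnW x (ext_act VW act (bco p i ?zeta *[LW] i) x)) (BI p))"
   using GmnD(1)[OF x GactD(1)[OF x smult_cl[OF CW PwW[OF bD(2)]]]]
   by (intro cvs_finsum_cong[OF cvs_KB]) auto
  also have "... = mnW x (ext_act VW act (finsum LW (%i. bco p i ?zeta *[LW] i) (BI p)) x)"
   by (rule lin_finsum[OF CW cvs_KB lin_comp[OF Gact_linear[OF x] Gmn_linear[OF x]], symmetric])
    (rule smult_cl[OF CW PwW[OF bD(2)]])
  also have "... = mnW x xi" unfolding bD(5)[OF zeta, symmetric] act_cancel(2)[OF x xi'] ..
  finally show "mnW x xi = ?S (mnW x xi)" ..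
 qed
 have "f = (finsum (fb KB p) (%e. e **[KB] emb KB (form_coord p e f)) (form_basis p))" if f: "f:forms KB p" for f
 proof -
  have "(finsum (fb KB p) (%e. e **[KB] emb KB (form_coord p e f)) (form_basis p)) = (finsum KB (%e. e **[KB] emb KB (form_coord p e f)) (form_basis p))"
   by (rule diff_calculus.finsum_form_bimod[OF B_calculus]) (use tm f in "auto simp: basis")
  also have "... = (finsum KB (%i. mnW 1[X] i **[KB] emb KB (form_coord p (mnW 1[X] i) f)) (BI p))"
   unfolding form_basis_def
   by (rule cvs_finsum_reindex[OF cvs_KB _ inj]) (use tm f fKB in auto)
  also have "... = f" by (rule expand[OF f, symmetric])
  finally show ?thesis ..
 qed
 moreover have "form_coord p (mnW 1[X] i) (mnW 1[X] k) = (if mnW 1[X] k = mnW 1[X] i then 1[B] else 0[B])"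
  if "i:BI p" "k:BI p" for i k
 proof -
  have "mnW 1[X] k = mnW 1[X] i <-> k = i" using mn1 by metis
  thus ?thesis
   using that bD(4)[OF that] Gact(3)[OF PwW[OF bD(2)[OF that(2)]]] by (simp add: coord_mn[OF that(1) iG(2)] B_simps)
 qed
 ultimately show ?thesis
  unfolding right_basis_def form_bimod_simps
  using bD(1) Gf[OF bD(2)] coord_linear coord_mult fKB diff_calculus.linear_form_restrict[OF B_calculus coord_linear]
  by (auto simp: basis form_basis_def)
qed

end

end

section \<open>Closedness and independence of the basis forms\<close>

context subgroup_bundle begin

lemma basis_closed:
 assumes i: "i:PwW p"
 shows "diff KB (mnW 1[X] i) = 0[KB]"
proof -
 have "wg VW [\<omega> 1[X]] = 0[LW]"
  using group_calc.\<omega>_one[OF G_data] lin_zero[OF VW CW wedge1_linear[OF VW]] by simp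
 thus ?thesis
  using group_calc.diff_mn[OF G_data, of "1[X]" i] subgroup.one_closed[OF G] PwW[OF i]
   lin_zero[OF CW CW ext_mulL[OF VW]] lin_zero[OF CW cvs_KB Gmn_linear] by simp
qed

lemma R_mult_one: "z:car X ==> xi:car L ==> eta:car K ==> R z (mn 1[X] xi \<star> eta) = xi ** R z eta"
proof (rule K_linear_eqI[OF C lin_comp[OF K_mulR R_linear] lin_comp[OF R_linear mulR]])
 fix y \<theta> assume *: "z:car X" "xi:car L" "y:car X" "\<theta> : car L"
 show "R z (mn 1[X] xi \<star> mn y \<theta>) = xi ** R z (mn y \<theta>)"
  using * act_act[of y "inv[X] y" xi] mul0(1)[of xi]
  by (auto simp: mn_mult R_mn act_mult actD act_one_right del: equalityI)
qed (auto intro: mn_closed)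

lemma R_mem: "eta:forms K q ==> z:car X ==> R z eta:Pw q"
 unfolding R_def using act_power by (simp add: forms_eq)

abbreviation "Lp == ext_map V V \<pi>p"

lemmas WF_projection = wedge_filt_projection[OF V split_prems] and WF_complement = wedge_filt_complement[OF V split_prems]

lemma proj_zero_WF:
 assumes u: "u:Pw q" and 0: "Lp u = 0L"
 shows "u:WF 1 q"
proof -
 have "u ++ (-1) \<cdot> Lp u:WF 1 q" by (rule WF_complement; (assumption | rule u))
 thus ?thesis unfolding 0 by (simp add: cvs_smult_zero[OF C] cvs_r_zero[OF C Pw(5)[OF u]])
qed

text \<open>Taking the coefficient \<open>R z\<close> turns the relation into one in \<Lambda>V for
  each \<open>z\<close>, to which \<open>wedge_independent\<close> applies; \<open>R_Fl_conv\<close>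
  reassembles the coefficients.\<close>

lemma basis_independent:
 assumes bas: "is_basis p I co" and eta: "!!e. e:mnW 1[X] ` I ==> eta e:forms K q"
  and mem: "(finsum K (%e. inc e \<star> eta e) (mnW 1[X] ` I)):Fl (Suc p) (p + q)" and i: "i:I"
 shows "eta (mnW 1[X] i):Fl 1 q"
proof -
 have b: "finite I" "I <= PwW p" "!!i k. i:I ==> k:I ==> co i k = (if k = i then 1 else 0)"
  "!!i. i:I ==> co i:lin (LW(|carrier := PwW p|)) complex_vs"
  using bas PwW by (auto simp: is_basis_def intro!: linear_restrict)
 have inj: "inj_on (mnW 1[X]) I" by (rule inj_onI) (metis left_mono_def)
 let ?eta = "%i. eta (mnW 1[X] i)"
 have eta': "k:I ==> ?eta k:car K" for k using forms_K[OF eta] by auto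
 have kL: "k:I ==> jj k:car L" for k using b(2) PwW jjD(1) by blast
 have cl: "k:I ==> mn 1[X] (jj k) \<star> ?eta k:car K" for k by (rule mult_closed[OF mn_closed[OF X.one_closed kL] eta'])
 have re: "(finsum K (%e. inc e \<star> eta e) (mnW 1[X] ` I)) = (finsum K (%k. mn 1[X] (jj k) \<star> ?eta k) I)"
  using cvs_finsum_reindex[OF cvs_K _ inj, of "%e. inc e \<star> eta e"] cl
  by (simp add: inc_mn Pi_iff)
 have "R z (?eta i):WF 1 q" if z: "z:car X" for z
 proof (rule proj_zero_WF[OF R_mem[OF eta z]])
  have "(finsum L (%k. jj k ** R z (?eta k)) I) = (finsum L (%k. R z (mn 1[X] (jj k) \<star> ?eta k)) I)"
   by (rule cvs_finsum_cong[OF C])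
    (use lin_cl[OF R_linear[OF z]] cl R_mult_one[OF z kL eta'] in auto)
  also have "... = R z (finsum K (%k. mn 1[X] (jj k) \<star> ?eta k) I)"
   by (rule lin_finsum[OF cvs_K C R_linear[OF z] cl, symmetric])
  finally have "(finsum L (%k. jj k ** R z (?eta k)) I):WF (Suc p) (p + q)"
   using R_Fl[OF mem z] unfolding re by simp
  from wedge_independent[OF V split_prems b(1,2,4,3) lin_cl[OF R_linear[OF z] eta'] this i]
  show "Lp (R z (?eta i)) = 0L" by blast
  show "mnW 1[X] i:mnW 1[X] ` I" using i by blast
 qed
 thus ?thesis using eta i by (intro R_Fl_conv) auto
qed

lemma split_bundle:
 assumes cb: "conn_braid nab sig" and bas: "!!p. is_basis p (BI p) (bco p)"
 shows "split_bundle A B K KB inc (form_basis BI) (form_coord bco) nab sig"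
proof (intro split_bundle.intro split_bundle_axioms.intro A_calculus B_calculus)
 show "car B <= car A" using BA by auto
 show "forms KB (Suc n) <= cspan KB {xi **[KB] xi' |xi xi'. xi:forms KB n & xi':forms KB 1}" for n
  by (rule group_calc.forms_generated[OF G_data])
 show "right_basis B (fb KB p) (form_basis BI p) (form_coord bco p)" for p
  by (rule form_right_basis[OF bas])
 show "diff KB e = 0[KB]" if "e:form_basis BI p" for e p
  using that basis_closed[of _ p] bas[of p] by (auto simp: form_basis_def[OF bas] is_basis_def)
 show "eta e:Fl 1 q" if "!!e. e:form_basis BI p ==> eta e:forms K q"
   "(finsum K (%e. inc e \<star> eta e) (form_basis BI p)):Fl (Suc p) (p + q)" "e:form_basis BI p" for p eta q e
  using that(3) basis_independent[OF bas that(1,2)[unfolded form_basis_def[OF bas]]] by (auto simp: form_basis_def[OF bas])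
qed (use cb nab_eq[OF cb] sig_eq[OF cb] inc_linear inc_mult inc_forms inc_emb inc_diff B_ops in
  \<open>auto simp: conn_braid_def simp del: One_nat_def\<close>)

section \<open>The fibre forms and the differential on them\<close>

abbreviation "PF q == power_forms X V act \<omega> Wp q"
abbreviation "Pp == ext_power V Wp"
abbreviation "rm == right_mono X V act \<omega>"

lemma Pp: "xi:Pp q ==> xi:Pw q" "xi:Pp q ==> xi:car L" "xi:Pp q ==> Lp xi = xi"
 "xi:Pw q ==> Lp xi:Pp q"
proof -
 show "xi:Pp q ==> xi:Pw q" using ext_power_mono[OF V WpD(1)] by blast
 thus "xi:Pp q ==> xi:car L" using Pw(5) by blast
 show "xi:Pp q ==> Lp xi = xi" by (rule ext_map_id_on[OF V \<pi>p(1) WpD(1) \<pi>p(3)])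
 show "xi:Pw q ==> Lp xi:Pp q" by (rule ext_map_power[OF V V \<pi>p(1) order_refl WpD(1)]) (use \<pi>p(2) in auto)
qed

lemma rm_forms: "xi:Pw q ==> x:car X ==> rm xi x:forms K q"
 by (simp add: right_mono_eq Pw(5) mn_forms act_power)

lemma PF_D:
 assumes "f:car (PF q)"
 shows "f:forms K q" "x:car X ==> R x f:Pp q"
proof -
 let ?S = "{rm xi x | xi x. xi:Pp q & x:car X}"
 have f: "f:cspan K ?S" using assms by (simp add: power_forms_def)
 have "?S <= forms K q" using rm_forms Pp(1) by blast
 from cspan_minimal[OF cvs_K forms_subspace this] f show "f:forms K q" by blast
 show "R x f:Pp q" if x: "x:car X"
 proof -
  note T = ext_power_subspace[OF V WpD(1), of q]
  have "?S <= {f:car K. R x f:Pp q}"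
   using forms_K[OF rm_forms[OF Pp(1)]] R_right_mono[OF _ x Pp(2)] subD(2)[OF C T] by auto
  from cspan_minimal[OF cvs_K lin_vimage[OF cvs_K C R_linear[OF x] T] this] f show ?thesis by blast
 qed
qed

lemma PF_I: "xi:Pp q ==> x:car X ==> rm xi x:car (PF q)"
 unfolding power_forms_def by (auto intro!: cspan_base[OF cvs_K])

lemma PF_simps: "zero (PF q) = zero K" "add (PF q) = add K" "smult (PF q) = smult K"
 "lact (PF q) = (%a xi. emb K a \<star> xi)" "ract (PF q) = (%xi a. xi \<star> emb K a)"
 by (simp_all add: power_forms_def)

lemma PF_subspace: "csubspace (car (PF q)) K"
 unfolding power_forms_def using forms_K[OF rm_forms[OF Pp(1)]] by (auto intro!: cspan_sub[OF cvs_K])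

text \<open>On the coefficients the map induced by \<open>\<pi>p\<close> is the identity, since they
  lie in the powers of \<open>Wp\<close>, and zero, since they lie in filtration step 1.\<close>

lemma PF_Fl_zero:
 assumes f: "f:car (PF q)" "f:Fl 1 q"
 shows "f = 0[K]"
proof (rule ext)
 note k = forms_K[OF PF_D(1)[OF f(1)]]
 fix x
 show "f x = 0[K] x"
 proof (cases "x:car X")
  case True
  have "Lp (R x f) = 0L" using R_Fl[OF f(2) True] WF_projection[of "R x f" 0 q] by simp
  hence z: "R x f = 0L" using Pp(3)[OF PF_D(2)[OF f(1) True]] by simp
  have "f x = R x f \<lhd> x"
   using act_act[of "inv[X] x" x "f x"] True K_D(1)[OF k] by (simp add: R_def act_one_right)
  thus ?thesis using z act0[OF True] by (simp add: K_simps(2))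
 qed (use K_D(4)[OF k] in "simp add: K_simps(2)")
qed

text \<open>Replace each coefficient by its image under the map induced by \<open>\<pi>p\<close>;
  the error has filtration 1. With \<open>PF_Fl_zero\<close> the fibre forms are a complement of
  filtration step 1, hence a model of \<open>N\<^sub>q\<close>.\<close>

lemma PF_complement:
 assumes eta: "eta:forms K q"
 shows "EX f:car (PF q). eta +[K] (-1) *[K] f:Fl 1 q"
proof -
 note k = forms_K[OF eta]
 let ?F = "supp eta"
 have F: "?F <= car X" using K_D(3)[OF k] by auto
 let ?f = "\<Oplus>\<^bsub>K\<^esub>x\<in>?F. rm (Lp (R x eta)) x"
 have P: "x:?F ==> Lp (R x eta):Pp q" for x using F by (intro Pp(4) R_mem[OF eta]) auto
 have t: "x:?F ==> rm (Lp (R x eta)) x:car (PF q)" for x using F P by (intro PF_I) auto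
 have f: "?f:car (PF q)" by (rule csubspace_sum_closed[OF cvs_K PF_subspace t])
 note fk = subD(5)[OF cvs_K PF_subspace]
 have "R z (eta +[K] (-1) *[K] ?f):WF 1 q" if z: "z:car X" for z
 proof -
  have Rf: "R z ?f = Lp (R z eta)"
  proof (cases "z:?F")
   case True
   have "R z ?f = (finsum L (%x. R z (rm (Lp (R x eta)) x)) ?F)"
    by (rule lin_finsum[OF cvs_K C R_linear[OF z] fk[OF t]])
   also have "... = R z (rm (Lp (R z eta)) z)"
   proof (rule cvs_finsum_single[OF C K_D(2)[OF k] True])
    show "R z (rm (Lp (R z eta)) z):car L" by (rule lin_cl[OF R_linear[OF z] fk[OF t[OF True]]])
    show "R z (rm (Lp (R x eta)) x) = 0L" if "x:?F" "x ~= z" for x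
     using R_right_mono[OF _ z Pp(2)[OF P[OF that(1)]], of x] F that by auto
   qed
   also have "... = Lp (R z eta)" using R_right_mono[OF z z Pp(2)[OF P[OF True]]] by simp
   finally show ?thesis .
  next
   case False
   have "R z ?f = (finsum L (%x. R z (rm (Lp (R x eta)) x)) ?F)"
    by (rule lin_finsum[OF cvs_K C R_linear[OF z] fk[OF t]])
   also have "... = (finsum L (%x. 0L) ?F)"
   proof (rule cvs_finsum_cong[OF C])
    show "R z (rm (Lp (R x eta)) x) = 0L" if "x:?F" for x
     using R_right_mono[OF _ z Pp(2)[OF P[OF that]], of x] F that False by (auto del: equalityI)
   qed (use Cs in simp)
   also have "... = 0L" by (rule cvs_finsum_zero[OF C])
   also have "0L = Lp (R z eta)"
    using False act0[of "inv[X] z"] z lin_zero[OF C C ext_map_linear[OF V V \<pi>p(1)]] by (simp add: R_def)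
   finally show ?thesis .
  qed
  note fK = fk[OF f]
  have "R z eta ++ (-1) \<cdot> Lp (R z eta):WF 1 q" by (rule WF_complement; (assumption | rule R_mem[OF eta z]))
  thus ?thesis
   using linear_add[OF R_linear[OF z] k smult_cl[OF cvs_K fK]] linear_smult[OF R_linear[OF z] fK] Rf by simp
 qed
 moreover have "eta +[K] (-1) *[K] ?f:forms K q"
  using subD(3,4)[OF cvs_K forms_subspace] eta PF_D(1)[OF f] by auto
 ultimately have "eta +[K] (-1) *[K] ?f:Fl 1 q" by (intro R_Fl_conv)
 thus ?thesis using f by blast
qed

text \<open>\<open>d(\<xi>.x) = (\<theta> \<and> \<xi>).x\<close> with
  \<open>\<theta> = \<omega>(x) \<lhd> x^{-1}\<close>. The part of \<open>\<theta>\<close> in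
  \<open>W\<close> splits off as a base form on the left; the part in \<open>Wp\<close> is moved
  past \<open>\<xi>\<close>, whence the sign.\<close>

lemma diff_rm:
 assumes xi: "xi:Pw q" and x: "x:car X"
 defines "\<theta> == act (\<omega> x) (inv[X] x)"
 shows "diff K (rm xi x) = (inc (mnW 1[X] (wg VW [\<pi> \<theta>])) \<star> rm xi x) +[K] rm ((-1) ^ q \<cdot> (xi ** w1 (\<pi>p \<theta>))) x"
  "\<theta> : car V"
proof -
 show \<theta>: "\<theta> : car V" unfolding \<theta>_def using x \<omega>(1) lin_cl[OF act(1)] by simp
 note p = lin_cl[OF \<pi>(1) \<theta>] lin_cl[OF \<pi>p(1) \<theta>]
 note c = Pw(5)[OF xi] w1D(1)[OF \<theta>] w1D(1)[OF p(1)] w1D(1)[OF p(2)]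
 have \<omega>x: "act \<theta> x = \<omega> x"
  unfolding \<theta>_def using act(2)[of "inv[X] x" x "\<omega> x"] x \<omega>(1) by (simp add: act(3))
 have "diff K (rm xi x) = rm (w1 \<theta> ** xi) x"
  using x c by (simp add: right_mono_eq diff_mn actD act_mult act_w1 \<theta> \<omega>x Alg(3))
 also have "w1 \<theta> ** xi = w1 (\<pi> \<theta>) ** xi ++ (-1) ^ q \<cdot> (xi ** w1 (\<pi>p \<theta>))"
  using w1D(2)[OF p] split[OF \<theta>] c Alg(7) ext_power_comm[OF V p(2) xi] by simp
 also have "rm ... x = rm (w1 (\<pi> \<theta>) ** xi) x +[K] rm ((-1) ^ q \<cdot> (xi ** w1 (\<pi>p \<theta>))) x"
  by (rule linear_add[OF right_mono_linear[OF x]]) (use c in "simp_all add: Alg(3) Cs")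
 also have "rm (w1 (\<pi> \<theta>) ** xi) x = inc (mnW 1[X] (wg VW [\<pi> \<theta>])) \<star> rm xi x"
  using x c by (simp add: right_mono_eq inc_mn w1W(2)[OF \<pi>(2)[OF \<theta>]] mn_mult act_mult actD Alg(3))
 finally show "diff K (rm xi x) = (inc (mnW 1[X] (wg VW [\<pi> \<theta>])) \<star> rm xi x) +[K] rm ((-1) ^ q \<cdot> (xi ** w1 (\<pi>p \<theta>))) x" .
qed

theorem bundle_properties:
 assumes cb: "conn_braid nab sig"
  and D: "D = (|base_alg = B, base_calc = KB, tot_alg = A, tot_calc = K, bim = E, conn = nab, braid = sig|)"
  and \<Phi>: "\<Phi> = (%q eta. filt_class D 0 q (ctens D q 1[A] eta))"
 shows "differential_fibre_bundle (ty :: ('m \<times> 'n) itself) D" (is ?bundle)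
  "bimodule_iso B A (PF q) (fibre D q) (\<Phi> q)"
  "xi:Pp q ==> x:car X ==> fibre_diff D q (\<Phi> q (rm xi x)) =
   \<Phi> (Suc q) (rm ((-1) ^ q \<cdot> (xi ** w1 (\<pi>p (act (\<omega> x) (inv[X] x))))) x)"
  "left_connection B KB (HN D q) (fibre_conn D q)"
  "xi:Pp q ==> x:car X ==> \<Phi> q (rm xi x):cocycles (fibre D) (fibre_diff D) q ==>
   fibre_conn D q (HN_class D q (\<Phi> q (rm xi x))) =
   tens B (fb KB 1) (HN D q) (mnW 1[X] (wg VW [\<pi> (act (\<omega> x) (inv[X] x))])) (HN_class D q (\<Phi> q (rm xi x)))"
  "spectral_sequence (page D) (page_diff D)" "converges_to (page D) (page_diff D) (bundle_cohomology D)"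
  "isomorphic (bundle_cohomology D k) (deRham K k)"
  "isomorphic (page D 2 (int p) (int q)) (left_connection_cohomology B KB (HN D q) (fibre_conn D q) p)"
  "r < 0 \<or> s < 0 ==> car (page D 2 r s) = {0[page D 2 r s]}"
proof -
 obtain BI bco where bas: "!!p. is_basis p (BI p) (bco p)" using ex_basis by metis
 interpret S: split_bundle A B K KB inc "form_basis BI" "form_coord bco" nab sig
  by (rule split_bundle[OF cb bas])
 have DS: "D = S.D" by (simp add: D S.D_def)
 have \<Phi>_eq: "\<Phi> q eta = S.mcl 0 q eta" for q eta
  by (simp add: \<Phi> DS S.mcl_def S.J_def ctens_def)
 show ?bundle unfolding DS by (rule S.differential_fibre_bundle_D)
 show "left_connection B KB (HN D q) (fibre_conn D q)" unfolding DS by (rule S.left_connection_D)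
 show "spectral_sequence (page D) (page_diff D)" unfolding DS by (rule S.spectral_sequence_pages)
 show "converges_to (page D) (page_diff D) (bundle_cohomology D)" unfolding DS by (rule S.pages_converge)
 show "isomorphic (bundle_cohomology D k) (deRham K k)" unfolding DS by (rule S.deRham_iso)
 show "isomorphic (page D 2 (int p) (int q)) (left_connection_cohomology B KB (HN D q) (fibre_conn D q) p)"
  unfolding DS by (rule S.page2_iso)
 show "r < 0 \<or> s < 0 ==> car (page D 2 r s) = {0[page D 2 r s]}" unfolding DS by (rule S.page_vanishes) simp_all
 note mcl = S.mcl0D[of _ q]
 have zero: "S.mcl 0 q f = 0[fibre S.D q] <-> f:Fl 1 q" if "f:forms K q" for f
  using S.mcl_zero_iff[of f 0 q] that by (simp add: S.Fl_0)
 have cf: "car (fibre S.D q) = S.mcl 0 q ` forms K q" using S.carrier_fibre[of 0 q] by (simp add: S.Fl_0)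
 note P = PF_D(1) and fs = subD[OF cvs_K forms_subspace]
 have lin: "S.mcl 0 q:lin (PF q) (fibre S.D q)"
  using mcl P by (intro linI) (simp_all add: PF_simps)
 have "S.mcl 0 q:bimodule_maps B A (PF q) (fibre S.D q)"
  unfolding bimodule_maps_def left_module_maps_def
  using lin S.lact_mcl0[of _ _ q] S.ract_mcl[of _ _ 0 q] P by (simp add: PF_simps S.Fl_0)
 moreover have "inj_on (S.mcl 0 q) (car (PF q))"
 proof (rule inj_onI)
  fix f g assume f: "f:car (PF q)" and g: "g:car (PF q)" and e: "S.mcl 0 q f = S.mcl 0 q g"
  let ?d = "f +[K] (-1) *[K] g"
  have d: "?d:car (PF q)" using subD(3,4)[OF cvs_K PF_subspace] f g by simp
  have "S.mcl 0 q ?d = 0[fibre S.D q]"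
   using mcl P[OF f] P[OF g] fs(4) e cvs_diff_self[OF S.cvs_fibre mcl(1)[OF P[OF g]]] by simp
  hence "?d = 0[K]" using PF_Fl_zero[OF d] zero[OF P[OF d]] by simp
  thus "f = g" using cvs_diff_eq_zero[OF cvs_K forms_K[OF P[OF f]] forms_K[OF P[OF g]]] by simp
 qed
 moreover have "S.mcl 0 q ` car (PF q) = car (fibre S.D q)"
 proof
  show "S.mcl 0 q ` car (PF q) <= car (fibre S.D q)" using lin_cl[OF lin] by blast
  show "car (fibre S.D q) <= S.mcl 0 q ` car (PF q)"
   unfolding cf
  proof (rule image_subsetI)
   fix eta assume eta: "eta:forms K q"
   obtain f where f: "f:car (PF q)" "eta +[K] (-1) *[K] f:Fl 1 q" using PF_complement[OF eta] by blast
   have d: "eta +[K] (-1) *[K] f:forms K q" using fs(3,4) eta P[OF f(1)] by simp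
   have "S.mcl 0 q eta +[fibre S.D q] (-1) *[fibre S.D q] S.mcl 0 q f = 0[fibre S.D q]"
    using zero[OF d] f(2) mcl eta P[OF f(1)] fs(4) by simp
   hence "S.mcl 0 q eta = S.mcl 0 q f"
    using cvs_diff_eq_zero[OF S.cvs_fibre mcl(1)[OF eta] mcl(1)[OF P[OF f(1)]]] by simp
   thus "S.mcl 0 q eta:S.mcl 0 q ` car (PF q)" using f(1) by blast
  qed
 qed
 ultimately show "bimodule_iso B A (PF q) (fibre D q) (\<Phi> q)"
  unfolding bimodule_iso_def bij_betw_def DS \<Phi>_eq[abs_def] by simp
 assume xi: "xi:Pp q" and x: "x:car X"
 let ?\<theta> = "act (\<omega> x) (inv[X] x)" and ?eta = "rm xi x"
 let ?w = "mnW 1[X] (wg VW [\<pi> ?\<theta>])" and ?zeta = "rm ((-1) ^ q \<cdot> (xi ** w1 (\<pi>p ?\<theta>))) x"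
 note xiw = Pp(1)[OF xi] and d = diff_rm(1)[OF Pp(1)[OF xi] x] and \<theta> = diff_rm(2)[OF Pp(1)[OF xi] x]
 have eta: "?eta:forms K q" by (rule rm_forms[OF xiw x])
 have w: "?w:forms KB 1"
  by (rule GmnD(2)[OF subgroup.one_closed[OF G] w1W(1)[OF \<pi>(2)[OF \<theta>]]])
 have wp: "w1 (\<pi>p ?\<theta>):Pp 1" using ext_power_wedge[OF V, of "[\<pi>p ?\<theta>]" Wp] \<pi>p(2)[OF \<theta>] by simp
 have c: "(-1) ^ q \<cdot> (xi ** w1 (\<pi>p ?\<theta>)):Pp (Suc q)"
  using subD(4)[OF C ext_power_subspace[OF V WpD(1)] ext_power_mult[OF V WpD(1) xi wp]] by simp
 have zeta: "?zeta:car (PF (Suc q))" by (rule PF_I[OF c x])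
 have F: "inc ?w \<star> ?eta:Fl 1 (Suc q)" using S.Fl_gen[OF w eta] by simp
 show "fibre_diff D q (\<Phi> q ?eta) = \<Phi> (Suc q) ?zeta"
  using S.diff_mcl[of ?eta 0 q] S.mcl_add_Fl[of "inc ?w \<star> ?eta" 0 "Suc q" ?zeta] eta F PF_D(1)[OF zeta] d
  by (simp add: DS \<Phi>_eq S.Fl_0)
 assume "\<Phi> q ?eta:cocycles (fibre D) (fibre_diff D) q"
 hence Z: "?eta:S.ZM 0 q" using S.mcl_cocycle[of ?eta 0 q] eta by (simp add: DS \<Phi>_eq S.Fl_0)
 \<comment> \<open>For a fibre cocycle \<open>d\<eta>\<close> has filtration 1, so its part in the
   fibre forms is zero. Then \<open>d\<eta>\<close> equals the base form times \<open>\<eta>\<close>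
   exactly, and the value of the connection can be read off.\<close>
 have "?zeta = 0[K]"
 proof (rule PF_Fl_zero[OF _ ])
  show "?zeta:car (PF (Suc q))" by (rule zeta)
  have "diff K ?eta:Fl 1 (Suc q)" using Z by (simp add: S.ZM0_iff)
  moreover have "?zeta = diff K ?eta +[K] (-1) *[K] (inc ?w \<star> ?eta)"
   by (rule cvs_add_left_imp_diff[OF cvs_K subD(5)[OF cvs_K Fl_subspace F] forms_K[OF PF_D(1)[OF zeta]] d])
  ultimately show "?zeta:Fl 1 (Suc q)" using subD(3,4)[OF cvs_K Fl_subspace] F by auto
 qed
 hence "diff K ?eta = inc ?w \<star> ?eta"
  using d cvs_r_zero[OF cvs_K subD(5)[OF cvs_K Fl_subspace F]] by simp
 hence "fibre_conn S.D q (S.kcl 0 q ?eta) = tens B (fb KB 1) (HN S.D q) ?w (S.kcl 0 q ?eta)"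
  by (intro S.fibre_conn_eqI[OF Z S.ten_closed[OF w Z]]) (simp only: S.g_coh_tens[OF w Z])
 thus "fibre_conn D q (HN_class D q (\<Phi> q ?eta)) = tens B (fb KB 1) (HN D q) ?w (HN_class D q (\<Phi> q ?eta))"
  by (simp add: DS \<Phi>_eq S.HN_class_mcl)
qed

end

text \<open>The first conjunct shows that the maps prescribed on generators exist, so the second is
  not vacuous. Flatness is tested on modules over two types, which are left free here and hence
  arbitrary. \<open>\<Phi>\<close> sends a form to its class in the fibre.\<close>

theorem proposition5p5:
  fixes X :: "('x, 'z) monoid_scheme" and G :: "'x set"
    and V :: "(complex, 'v) module" and act :: "'v \<Rightarrow> 'x \<Rightarrow> 'v" and \<omega> :: "'x \<Rightarrow> 'v"
    and ip :: "'v \<Rightarrow> 'v \<Rightarrow> complex"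
  assumes X: "group X" and G: "subgroup G X" "finite G"
    and V: "right_representation X V act"
    and \<omega>: "cocycle X V act \<omega>" "carrier V = cspan V (\<omega> ` carrier X)"
    and ip: "invariant_inner_product G V act ip"
    and W: "W = cspan V (\<omega> ` G)"
    and Wp: "Wp = {v \<in> carrier V. \<forall>w\<in>W. ip v w = 0}"
    and \<pi>: "\<pi> = projection V W Wp" and \<pi>p: "\<pi>p = projection V Wp W"
    and A: "A = group_alg X" "\<Omega>A = group_calculus X V act \<omega>"
    and B: "B = group_alg (X\<lparr>carrier := G\<rparr>)"
      "\<Omega>B = group_calculus (X\<lparr>carrier := G\<rparr>) (V\<lparr>carrier := W\<rparr>) act \<omega>"
    and E: "E = mult_bimod A"
    and conn_braid: "conn_braid = (\<lambda>nab sig.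
      nab \<in> linear_maps E (tensor A E (form_bimod \<Omega>A 1)) \<and>
      (\<forall>x\<in>carrier X. nab (gen x) = tens A E (form_bimod \<Omega>A 1) \<one>\<^bsub>A\<^esub> (diff \<Omega>A (emb \<Omega>A (gen x)))) \<and>
      sig \<in> linear_maps (tensor B (form_bimod \<Omega>B 1) E) (tensor A E (form_bimod \<Omega>A 1)) \<and>
      (\<forall>g\<in>G. \<forall>x\<in>carrier X.
         sig (tens B (form_bimod \<Omega>B 1) E (diff \<Omega>B (emb \<Omega>B (gen g))) (gen x)) =
         tens A E (form_bimod \<Omega>A 1) \<one>\<^bsub>A\<^esub> (diff \<Omega>A (emb \<Omega>A (gen g)) \<otimes>\<^bsub>\<Omega>A\<^esub> emb \<Omega>A (gen x))))"
  shows "(\<exists>nab sig. conn_braid nab sig) \<and>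
    (\<forall>nab sig D \<Phi>. conn_braid nab sig \<and>
      D = \<lparr>base_alg = B, base_calc = \<Omega>B, tot_alg = A, tot_calc = \<Omega>A, bim = E, conn = nab, braid = sig\<rparr> \<and>
      \<Phi> = (\<lambda>q \<eta>. filt_class D 0 q (ctens D q \<one>\<^bsub>A\<^esub> \<eta>)) \<longrightarrow>
      differential_fibre_bundle TYPE('m \<times> 'n) D \<and>
      (\<forall>q. bimodule_iso B A (power_forms X V act \<omega> Wp q) (fibre D q) (\<Phi> q)) \<and>
      (\<forall>q. \<forall>\<xi>\<in>ext_power V Wp q. \<forall>x\<in>carrier X.
         fibre_diff D q (\<Phi> q (right_mono X V act \<omega> \<xi> x)) =
         \<Phi> (Suc q) (right_mono X V act \<omega>
           ((-1) ^ q \<odot>\<^bsub>ext_alg V\<^esub> (\<xi> \<otimes>\<^bsub>ext_alg V\<^esub> wedge_list V [\<pi>p (act (\<omega> x) (inv\<^bsub>X\<^esub> x))])) x)) \<and>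
      (\<forall>q. left_connection B \<Omega>B (HN D q) (fibre_conn D q)) \<and>
      (\<forall>q. \<forall>\<xi>\<in>ext_power V Wp q. \<forall>x\<in>carrier X.
         \<Phi> q (right_mono X V act \<omega> \<xi> x) \<in> cocycles (fibre D) (fibre_diff D) q \<longrightarrow>
         fibre_conn D q (HN_class D q (\<Phi> q (right_mono X V act \<omega> \<xi> x))) =
         tens B (form_bimod \<Omega>B 1) (HN D q)
           (left_mono (V\<lparr>carrier := W\<rparr>) \<one>\<^bsub>X\<^esub> (wedge_list (V\<lparr>carrier := W\<rparr>) [\<pi> (act (\<omega> x) (inv\<^bsub>X\<^esub> x))]))
           (HN_class D q (\<Phi> q (right_mono X V act \<omega> \<xi> x)))) \<and>
      spectral_sequence (page D) (page_diff D) \<and>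
      converges_to (page D) (page_diff D) (bundle_cohomology D) \<and>
      (\<forall>k. isomorphic (bundle_cohomology D k) (deRham \<Omega>A k)) \<and>
      (\<forall>p q. isomorphic (page D 2 (int p) (int q))
         (left_connection_cohomology B \<Omega>B (HN D q) (fibre_conn D q) p)) \<and>
      (\<forall>p q. p < 0 \<or> q < 0 \<longrightarrow> carrier (page D 2 p q) = {\<zero>\<^bsub>page D 2 p q\<^esub>}))"
proof -
 have cvsV: "cvs V" and fV: "\<omega> ` G \<subseteq> car V"
  using V \<omega>(1) subgroup.subset[OF G(1)] by (auto simp: right_representation_def cocycle_def)
 have Ws: "csubspace W V" unfolding W by (rule cspan_sub[OF cvsV fV])
 have ips: "ALL u:car V. ALL u':car V. ALL v:car V. ip (u +[V] u') v = ip u v + ip u' v"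
  "ALL c. ALL u:car V. ALL v:car V. ip (c *[V] u) v = c * ip u v"
  "ALL u:car V. ALL v:car V. ip v u = cnj (ip u v)" "ALL u:car V. u ~= 0[V] --> Re (ip u u) > 0"
  using ip unfolding invariant_inner_product_def by blast+
 note O = orthogonal_projections[OF cvsV ips finite_imageI[OF G(2)] fV W Wp]
 \<comment> \<open>The decomposition with the summands exchanged, so that one lemma yields both
   projections.\<close>
 have O3: "EX s:Wp. EX t:W. v = s +[V] t" if v: "v:car V" for v
  using O(3)[OF v] subD(5)[OF cvsV Ws] subD(5)[OF cvsV O(1)] cvs_add_comm[OF cvsV] by metis
 have I2: "Wp \<inter> W \<subseteq> {0[V]}" using O(2) by blast
 have p: "\<pi> : lin V V" "!!v. v:car V ==> \<pi> v:W" "!!s t. s:W ==> t:Wp ==> \<pi> (s +[V] t) = s"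
  unfolding \<pi> by (rule complementary_projection[OF cvsV Ws O(1,2) projection_def]; (rule O(3))?; assumption)+
 have pp: "\<pi>p:lin V V" "!!v. v:car V ==> \<pi>p v:Wp" "!!s t. s:Wp ==> t:W ==> \<pi>p (s +[V] t) = s"
  unfolding \<pi>p by (rule complementary_projection[OF cvsV O(1) Ws I2 projection_def]; (rule O3)?; assumption)+
 have z: "0[V]:W" "0[V]:Wp" using subD(2)[OF cvsV Ws] subD(2)[OF cvsV O(1)] by auto
 interpret SB: subgroup_bundle X V act \<omega> G W Wp \<pi> \<pi>p
 proof (intro subgroup_bundle.intro group_calc.intro subgroup_bundle_axioms.intro)
  show "\<pi> v = v" if "v:W" for v using p(3)[OF that z(2)] cvs_r_zero[OF cvsV subD(5)[OF cvsV Ws that]] by simp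
  show "\<pi>p v = v" if "v:Wp" for v using pp(3)[OF that z(1)] cvs_r_zero[OF cvsV subD(5)[OF cvsV O(1) that]] by simp
  show "\<pi>p v = 0[V]" if "v:W" for v using pp(3)[OF z(2) that] cvs_l_zero[OF cvsV subD(5)[OF cvsV Ws that]] by simp
  show "v = \<pi> v +[V] \<pi>p v" if v: "v:car V" for v
  proof -
   obtain w t where w: "w:W" "t:Wp" "v = w +[V] t" using O(3)[OF v] by blast
   hence "v = t +[V] w"
    using cvs_add_comm[OF cvsV subD(5)[OF cvsV Ws w(1)] subD(5)[OF cvsV O(1) w(2)]] by simp
   thus ?thesis using p(3)[OF w(1,2)] pp(3)[OF w(2,1)] w(3) by simp
  qed
 qed (use X V \<omega> G W O(1) p(1,2) pp(1,2) in auto)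
 have cb: "conn_braid nab sig \<longleftrightarrow> SB.conn_braid nab sig" for nab sig
  unfolding conn_braid A B E SB.conn_braid_def ..
 show ?thesis
  unfolding cb A B E
  by (intro conjI allI impI ballI SB.conn_braid_exists; (elim conjE)?; rule SB.bundle_properties; assumption)
qed

end
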